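(* Let $k$ be a positive integer and let $f:\mathbb{N}\to(0,\infty)$ be a positive multiplicative function such that $\sum_{p}|f(p)-1|=\infty$ (sum over all primes $p$) and $f(p)\to 1$ as $p\to\infty$. Then there exists a real number $c>0$ such that the set of $k$-tuples $\{(f(p+1),\ldots,f(p+k)) : p \text{ prime}\}$ is dense either in $[0,c]^k$ or in $[c,+\infty)^k$.
   Context: A multiplicative function satisfies $f(1)=1$ and $f(mn)=f(m)f(n)$ whenever $\gcd(m,n)=1$. "Dense in $A$" means every point of $A$ is a limit of tuples from the set. *)

theory Defs
  imports "HOL-Analysis.Analysis" "HOL-Computational_Algebra.Primes"
begin

definition multiplicative_fun :: "(nat \<Rightarrow> real) \<Rightarrow> bool" where
  "multiplicative_fun f \<longleftrightarrow> f 1 = 1 \<and> (\<forall>m n. coprime m n \<longrightarrow> f (m * n) = f m * f n)"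

definition tuples_dense_in_cube :: "nat \<Rightarrow> (nat \<Rightarrow> real) set \<Rightarrow> real set \<Rightarrow> bool" where
  "tuples_dense_in_cube k T A \<longleftrightarrow>
     (\<forall>x. (\<forall>i\<in>{1..k}. x i \<in> A) \<longrightarrow>
        (\<forall>\<epsilon>>0. \<exists>t\<in>T. \<forall>i\<in>{1..k}. \<bar>t i - x i\<bar> < \<epsilon>))"

end

theory Submission
  imports Defs "HOL-Number_Theory.Number_Theory" "HOL-Real_Asymp.Real_Asymp"
    "HOL-Computational_Algebra.Squarefree"
begin

text \<open>
  Only one fact about primes is needed: for some \<open>R\<close> and \<open>w\<close>, every reduced residue class modulo an
  \<open>M\<close> divisible by all primes up to \<open>w\<close> contains a prime \<open>p\<close> such that each \<open>p + i\<close>, \<open>1 \<le> i \<le> k\<close>, has at most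
  \<open>R\<close> prime factors not dividing \<open>M\<close>, all of them simple. Indeed, suppose
  \<open>\<Sum> max 0 (f p - 1) = \<infinity>\<close> (otherwise pass to \<open>1 / f\<close>). Greedily chosen products of values \<open>f q\<close> over
  large primes approximate any number above \<open>1\<close>, so disjoint sets \<open>S i\<close> of primes can be chosen with
  \<open>f (1 + i) * (\<Prod>q\<in>S i. f q)\<close> close to any target above \<open>max f (1 + i)\<close>. A congruence on \<open>p\<close> makes
  \<open>p + i\<close> equal to \<open>1 + i\<close> times \<open>\<Prod>(S i)\<close> times at most \<open>R\<close> large primes, and those change the value by
  a factor close to \<open>1\<close>, uniformly as \<open>R\<close> is fixed.

  For the fact itself, let \<open>y\<close> be large and sift the integers \<open>n\<close> of the class up to a fixed power of \<open>y\<close> so that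
  no \<open>n + i\<close> has a prime factor up to \<open>y\<close> outside \<open>M\<close>. The primes among the sifted \<open>n\<close> are detected by
  \<open>ln n = \<Sum>d dvd n. mangoldt d\<close> on \<open>n\<close> free of prime factors up to \<open>z\<close>: a lower bound sieve handles
  \<open>\<Sum> ln n / n\<close>, and the terms with \<open>1 < d < n\<close> form a bilinear sum, shown by Cauchy--Schwarz (dispersion) and
  the fundamental lemma of the sieve to be nearly proportional to the same sum without the sifting condition.
  The comparison leaves a positive proportion of what the Dirichlet--Mertens theorem
  \<open>\<Sum> mangoldt n / n = ln x / totient M + O(1)\<close> predicts, so no zero-free region or large sieve is needed.
\<close>

section \<open>The Brun--Hooley sieve\<close>

text \<open>The order of the choices shapes the proof. The accuracy \<eta> is chosen in terms of
  \<open>R\<close>, the sets \<open>S i\<close> in terms of \<eta>, and the modulus \<open>M\<close>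
  in terms of these sets; so \<open>R\<close> must not depend on \<open>M\<close>. Hence the sieve
  levels, the bound \<open>w\<close> and the ratio of \<open>ln x\<close> to \<open>ln y\<close> are
  functions of \<open>k\<close> alone, and only \<open>y\<close> may grow with \<open>M\<close>.
  This dictates the weights \<open>1 / n\<close> on a range from \<open>N\<close>, the square root
  of \<open>x\<close>, to \<open>x\<close>: the expected sum over the class, half of
  \<open>ln x / totient M\<close>, tends to infinity with \<open>y\<close>, so the
  \<open>O(1)\<close> of the Dirichlet--Mertens theorem may depend on \<open>M\<close> in any way. A
  sieve by itself cannot tell primes from products of two primes; here the primes are supplied by
  that theorem, and the sieve shows that the conditions on \<open>n + i\<close> act on them with the
  expected density \<open>V\<close>. The bilinear sum loses a fixed power of
  \<open>ln x / ln y\<close>. This ratio grows only linearly with each sieve level, while the sieve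
  errors decay exponentially in the level, so the loss can be outweighed.\<close>

lemma sum_Pow_insert:
  fixes F :: "'a set \<Rightarrow> 'b::comm_monoid_add"
  assumes "finite Q" "q \<notin> Q"
  shows "(\<Sum>T\<in>Pow (insert q Q). F T) = (\<Sum>T\<in>Pow Q. F T) + (\<Sum>T\<in>Pow Q. F (insert q T))"
proof -
  have inj: "inj_on (insert q) (Pow Q)"
    using assms(2) by (auto simp: inj_on_def)
  have "Pow Q \<inter> insert q ` Pow Q = {}"
    using assms(2) by auto
  then show ?thesis
    using assms(1) inj by (simp add: Pow_insert sum.union_disjoint sum.reindex)
qed

lemma sum_Pow_Un_disjoint:
  fixes F :: "'a set \<Rightarrow> 'b::comm_monoid_add"
  assumes "finite A" "finite B" "A \<inter> B = {}"
  shows "(\<Sum>T\<in>Pow (A \<union> B). F T) = (\<Sum>S\<in>Pow A. \<Sum>T\<in>Pow B. F (S \<union> T))"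
proof -
  have "(\<Sum>S\<in>Pow A. \<Sum>T\<in>Pow B. F (S \<union> T)) = (\<Sum>(S, T)\<in>Pow A \<times> Pow B. F (S \<union> T))"
    by (simp add: sum.cartesian_product)
  also have "\<dots> = (\<Sum>T\<in>Pow (A \<union> B). F T)"
    by (rule sum.reindex_bij_witness[of _ "\<lambda>T. (T \<inter> A, T \<inter> B)" "\<lambda>(S, T). S \<union> T"])
       (use assms in auto)
  finally show ?thesis by simp
qed

lemma sum_Pow_UN_disjoint:
  fixes F :: "'j \<Rightarrow> 'a set \<Rightarrow> 'b::comm_semiring_1"
  assumes "finite J" "\<And>j. j \<in> J \<Longrightarrow> finite (Q j)" "disjoint_family_on Q J"
  shows "(\<Sum>T\<in>Pow (\<Union>j\<in>J. Q j). \<Prod>j\<in>J. F j (T \<inter> Q j)) = (\<Prod>j\<in>J. \<Sum>T\<in>Pow (Q j). F j T)"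
  using assms
proof (induction J rule: finite_induct)
  case empty
  then show ?case by simp
next
  case (insert i J)
  have disj: "Q i \<inter> (\<Union>j\<in>J. Q j) = {}"
    using insert.prems(2) insert.hyps(2) by (fastforce simp: disjoint_family_on_def)
  have "(\<Sum>T\<in>Pow (\<Union>j\<in>insert i J. Q j). \<Prod>j\<in>insert i J. F j (T \<inter> Q j))
      = (\<Sum>S\<in>Pow (Q i). \<Sum>T\<in>Pow (\<Union>j\<in>J. Q j). \<Prod>j\<in>insert i J. F j ((S \<union> T) \<inter> Q j))"
    unfolding UN_insert
    by (rule sum_Pow_Un_disjoint) (use insert disj in auto)
  also have "\<dots> = (\<Sum>S\<in>Pow (Q i). \<Sum>T\<in>Pow (\<Union>j\<in>J. Q j). F i S * (\<Prod>j\<in>J. F j (T \<inter> Q j)))"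
  proof (intro sum.cong refl)
    fix S T assume S: "S \<in> Pow (Q i)" and T: "T \<in> Pow (\<Union>j\<in>J. Q j)"
    have "(S \<union> T) \<inter> Q i = S" using S T disj by auto
    moreover have "(S \<union> T) \<inter> Q j = T \<inter> Q j" if "j \<in> J" for j
      using S T disj that by blast
    ultimately show "(\<Prod>j\<in>insert i J. F j ((S \<union> T) \<inter> Q j)) = F i S * (\<Prod>j\<in>J. F j (T \<inter> Q j))"
      using insert.hyps by simp
  qed
  also have "\<dots> = (\<Sum>S\<in>Pow (Q i). F i S) * (\<Sum>T\<in>Pow (\<Union>j\<in>J. Q j). \<Prod>j\<in>J. F j (T \<inter> Q j))"
    by (simp add: sum_product)
  also have "(\<Sum>T\<in>Pow (\<Union>j\<in>J. Q j). \<Prod>j\<in>J. F j (T \<inter> Q j)) = (\<Prod>j\<in>J. \<Sum>T\<in>Pow (Q j). F j T)"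
    by (rule insert.IH) (use insert.prems in \<open>auto simp: disjoint_family_on_def\<close>)
  finally show ?case using insert.hyps by simp
qed

section \<open>Elementary symmetric sums and Bonferroni's inequalities\<close>

definition esym :: "nat \<Rightarrow> ('a \<Rightarrow> real) \<Rightarrow> 'a set \<Rightarrow> real" where
  "esym i \<rho> Q = (\<Sum>T\<in>Pow Q. if card T = i then \<Prod>q\<in>T. \<rho> q else 0)"

text \<open>Inclusion-exclusion for the product of the \<open>1 - \<rho> q\<close>, cut off after
  degree \<open>b\<close>. Like the elementary symmetric polynomial \<open>esym\<close>, it is
  written over all subsets with an indicator, so that \<open>sum_Pow_insert\<close> adjoins an
  element.\<close>

definition alt_sum :: "nat \<Rightarrow> ('a \<Rightarrow> real) \<Rightarrow> 'a set \<Rightarrow> real" where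
  "alt_sum b \<rho> Q = (\<Sum>T\<in>Pow Q. if card T \<le> b then (-1) ^ card T * (\<Prod>q\<in>T. \<rho> q) else 0)"

lemma esym_insert:
  assumes "finite Q" "q \<notin> Q"
  shows "esym (Suc i) \<rho> (insert q Q) = esym (Suc i) \<rho> Q + \<rho> q * esym i \<rho> Q"
proof -
  have "(\<Sum>T\<in>Pow Q. if card (insert q T) = Suc i then \<Prod>q\<in>insert q T. \<rho> q else 0)
      = (\<Sum>T\<in>Pow Q. \<rho> q * (if card T = i then \<Prod>q\<in>T. \<rho> q else 0))"
  proof (intro sum.cong refl)
    fix T assume "T \<in> Pow Q"
    then have "finite T" "q \<notin> T" using assms finite_subset by auto
    then show "(if card (insert q T) = Suc i then \<Prod>q\<in>insert q T. \<rho> q else 0)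
        = \<rho> q * (if card T = i then \<Prod>q\<in>T. \<rho> q else 0)" by simp
  qed
  then show ?thesis
    unfolding esym_def sum_Pow_insert[OF assms] by (simp add: sum_distrib_left)
qed

lemma esym_0 [simp]: "finite Q \<Longrightarrow> esym 0 \<rho> Q = 1"
proof -
  assume "finite Q"
  then have "esym 0 \<rho> Q = (\<Sum>T\<in>Pow Q. if T = {} then 1 else 0)"
    unfolding esym_def by (intro sum.cong refl) (auto dest: finite_subset)
  then show ?thesis using \<open>finite Q\<close> by (simp add: sum.delta)
qed

lemma esym_Suc_empty [simp]: "esym (Suc i) \<rho> {} = 0"
  by (simp add: esym_def)

lemma esym_nonneg: "(\<And>q. q \<in> Q \<Longrightarrow> 0 \<le> \<rho> q) \<Longrightarrow> 0 \<le> esym i \<rho> Q"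
  unfolding esym_def by (intro sum_nonneg) (auto intro!: prod_nonneg)

text \<open>Each product over an \<open>i\<close>-set occurs \<open>i!\<close> times in the expanded
  power of the sum. The induction step uses the first two terms of the binomial expansion of
  \<open>(s + \<rho> q) ^ Suc j\<close>.\<close>

lemma esym_le:
  assumes "finite Q" "\<And>q. q \<in> Q \<Longrightarrow> 0 \<le> \<rho> q"
  shows "esym i \<rho> Q \<le> (\<Sum>q\<in>Q. \<rho> q) ^ i / fact i"
  using assms
proof (induction Q arbitrary: i rule: finite_induct)
  case empty
  then show ?case by (cases i) auto
next
  case (insert q Q)
  show ?case
  proof (cases i)
    case 0
    then show ?thesis using insert.hyps by simp
  next
    case (Suc j)
    define s where "s = (\<Sum>q\<in>Q. \<rho> q)"
    have s0: "0 \<le> s" unfolding s_def using insert.prems by (intro sum_nonneg) auto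
    have r0: "0 \<le> \<rho> q" using insert.prems by auto
    have "esym i \<rho> (insert q Q) = esym (Suc j) \<rho> Q + \<rho> q * esym j \<rho> Q"
      unfolding Suc by (rule esym_insert) (use insert in auto)
    also have "\<dots> \<le> s ^ Suc j / fact (Suc j) + \<rho> q * (s ^ j / fact j)"
      unfolding s_def
      by (intro add_mono mult_left_mono insert.IH) (use insert.prems in auto)
    also have "\<dots> = (s ^ Suc j + (1 + real j) * \<rho> q * s ^ j) / fact (Suc j)"
    proof -
      have "\<rho> q * (s ^ j / fact j) = ((1 + real j) * \<rho> q * s ^ j) / ((1 + real j) * fact j)"
        by (subst mult.assoc, subst mult_divide_mult_cancel_left) auto
      then show ?thesis by (simp add: add_divide_distrib)
    qed
    also have "\<dots> \<le> (s + \<rho> q) ^ Suc j / fact (Suc j)"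
    proof (intro divide_right_mono)
      show "s ^ Suc j + (1 + real j) * \<rho> q * s ^ j \<le> (s + \<rho> q) ^ Suc j"
      proof (induction j)
        case (Suc j)
        have "s ^ Suc (Suc j) + (1 + real (Suc j)) * \<rho> q * s ^ Suc j
           \<le> (s ^ Suc j + (1 + real j) * \<rho> q * s ^ j) * (s + \<rho> q)"
          using s0 r0 by (simp add: algebra_simps)
        also have "\<dots> \<le> (s + \<rho> q) ^ Suc j * (s + \<rho> q)"
          using Suc s0 r0 by (intro mult_right_mono) auto
        finally show ?case by (simp add: algebra_simps)
      qed (simp add: algebra_simps)
    qed simp
    finally show ?thesis using insert.hyps Suc by (simp add: s_def add.commute)
  qed
qed

lemma alt_sum_0 [simp]: "finite Q \<Longrightarrow> alt_sum 0 \<rho> Q = 1"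
proof -
  assume "finite Q"
  then have "alt_sum 0 \<rho> Q = (\<Sum>T\<in>Pow Q. if T = {} then 1 else 0)"
    unfolding alt_sum_def by (intro sum.cong refl) (auto dest: finite_subset)
  then show ?thesis using \<open>finite Q\<close> by (simp add: sum.delta)
qed

lemma alt_sum_empty [simp]: "alt_sum b \<rho> {} = 1"
  by (simp add: alt_sum_def)

lemma alt_sum_insert:
  assumes "finite Q" "q \<notin> Q"
  shows "alt_sum (Suc b) \<rho> (insert q Q) = alt_sum (Suc b) \<rho> Q - \<rho> q * alt_sum b \<rho> Q"
proof -
  have "(\<Sum>T\<in>Pow Q. if card (insert q T) \<le> Suc b then (-1) ^ card (insert q T) * (\<Prod>q\<in>insert q T. \<rho> q) else 0)
      = (\<Sum>T\<in>Pow Q. - \<rho> q * (if card T \<le> b then (-1) ^ card T * (\<Prod>q\<in>T. \<rho> q) else 0))"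
  proof (intro sum.cong refl)
    fix T assume "T \<in> Pow Q"
    then have "finite T" "q \<notin> T" using assms finite_subset by auto
    then show "(if card (insert q T) \<le> Suc b then (-1) ^ card (insert q T) * (\<Prod>q\<in>insert q T. \<rho> q) else 0)
        = - \<rho> q * (if card T \<le> b then (-1) ^ card T * (\<Prod>q\<in>T. \<rho> q) else 0)" by simp
  qed
  then show ?thesis
    unfolding alt_sum_def sum_Pow_insert[OF assms] sum_distrib_left by (simp add: sum_negf)
qed

text \<open>Truncation errs on the side given by the parity of \<open>b\<close>, by at most the
  first omitted term. Both claims share one induction: adjoining \<open>q\<close> adds to the signed
  error at \<open>b\<close> the signed error at \<open>b - 1\<close> times \<open>\<rho> q\<close>,
  and the two signs agree.\<close>

lemma bonferroni:
  assumes "finite Q" "\<And>q. q \<in> Q \<Longrightarrow> 0 \<le> \<rho> q" "\<And>q. q \<in> Q \<Longrightarrow> \<rho> q \<le> 1"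
  shows "0 \<le> (-1) ^ b * (alt_sum b \<rho> Q - (\<Prod>q\<in>Q. 1 - \<rho> q))
       \<and> (-1) ^ b * (alt_sum b \<rho> Q - (\<Prod>q\<in>Q. 1 - \<rho> q)) \<le> esym (Suc b) \<rho> Q"
  using assms
proof (induction Q arbitrary: b rule: finite_induct)
  case empty
  then show ?case by simp
next
  case (insert q Q)
  let ?P = "\<Prod>q\<in>Q. 1 - \<rho> q"
  have r: "0 \<le> \<rho> q" "\<rho> q \<le> 1" using insert.prems by auto
  have P: "0 \<le> ?P" "?P \<le> 1" using insert.prems by (auto intro!: prod_nonneg prod_le_1)
  have e: "esym (Suc b) \<rho> (insert q Q) = esym (Suc b) \<rho> Q + \<rho> q * esym b \<rho> Q"
    by (rule esym_insert) (use insert in auto)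
  have prod: "(\<Prod>q\<in>insert q Q. 1 - \<rho> q) = ?P - \<rho> q * ?P"
    using insert.hyps by (simp add: algebra_simps)
  have IH: "0 \<le> (-1) ^ b * (alt_sum b \<rho> Q - ?P)" "(-1) ^ b * (alt_sum b \<rho> Q - ?P) \<le> esym (Suc b) \<rho> Q"
    for b using insert.IH[of b] insert.prems by auto
  show ?case
  proof (cases b)
    case 0
    have "alt_sum 0 \<rho> (insert q Q) = alt_sum 0 \<rho> Q" using insert.hyps by simp
    with 0 show ?thesis using IH[of 0] e prod r P insert.hyps mult_left_mono[OF P(2) r(1)]
        mult_nonneg_nonneg[OF r(1) P(1)]
      by (auto simp: algebra_simps)
  next
    case (Suc c)
    have alt: "alt_sum b \<rho> (insert q Q) = alt_sum b \<rho> Q - \<rho> q * alt_sum c \<rho> Q"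
      unfolding Suc by (rule alt_sum_insert) (use insert in auto)
    have eq: "(-1) ^ b * (alt_sum b \<rho> (insert q Q) - (\<Prod>q\<in>insert q Q. 1 - \<rho> q))
       = (-1) ^ b * (alt_sum b \<rho> Q - ?P) + \<rho> q * ((-1) ^ c * (alt_sum c \<rho> Q - ?P))"
      unfolding prod alt by (simp add: Suc algebra_simps)
    have "0 \<le> \<rho> q * ((-1) ^ c * (alt_sum c \<rho> Q - ?P))"
         "\<rho> q * ((-1) ^ c * (alt_sum c \<rho> Q - ?P)) \<le> \<rho> q * esym b \<rho> Q"
      using IH[of c] r Suc by (auto intro!: mult_nonneg_nonneg mult_left_mono)
    with IH[of b] show ?thesis unfolding eq e by auto
  qed
qed

section \<open>From single blocks of primes to all of them\<close>

text \<open>Hooley's device for lower bounds: from the product of the upper bounds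
  \<open>b j\<close> one subtracts corrections in which a single factor is replaced by its excess
  \<open>d l\<close>. Every term is again a product over blocks, hence accessible to the
  sieve.\<close>

lemma prod_diff_le_sum:
  fixes a b d :: "'j \<Rightarrow> real"
  assumes "finite J" "\<And>j. j \<in> J \<Longrightarrow> 0 \<le> a j" "\<And>j. j \<in> J \<Longrightarrow> a j \<le> b j"
    "\<And>j. j \<in> J \<Longrightarrow> b j \<le> a j + d j"
  shows "(\<Prod>j\<in>J. b j) - (\<Sum>l\<in>J. d l * (\<Prod>j\<in>J - {l}. b j)) \<le> (\<Prod>j\<in>J. a j)"
  using assms
proof (induction J rule: finite_induct)
  case empty
  then show ?case by simp
next
  case (insert i J)
  let ?A = "\<Prod>j\<in>J. a j" and ?B = "\<Prod>j\<in>J. b j" and ?S = "\<Sum>l\<in>J. d l * (\<Prod>j\<in>J - {l}. b j)"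
  have IH: "?B - ?S \<le> ?A" using insert by auto
  have AB: "?A \<le> ?B" using insert.prems by (intro prod_mono) auto
  have B0: "0 \<le> ?B" using insert.prems by (force intro!: prod_nonneg)
  have A0: "0 \<le> ?A" using insert.prems by (force intro!: prod_nonneg)
  have i: "0 \<le> a i" "a i \<le> b i" "b i \<le> a i + d i" using insert.prems by auto
  have "(\<Sum>l\<in>J. d l * (\<Prod>j\<in>insert i J - {l}. b j)) = b i * ?S"
    unfolding sum_distrib_left
  proof (intro sum.cong refl)
    fix l assume l: "l \<in> J"
    then have "insert i J - {l} = insert i (J - {l})" using insert.hyps by auto
    then show "d l * (\<Prod>j\<in>insert i J - {l}. b j) = b i * (d l * (\<Prod>j\<in>J - {l}. b j))"
      using insert.hyps by simp
  qed
  moreover have "insert i J - {i} = J" using insert.hyps by auto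
  ultimately have eq: "(\<Sum>l\<in>insert i J. d l * (\<Prod>j\<in>insert i J - {l}. b j)) = d i * ?B + b i * ?S"
    using insert.hyps by simp
  have "b i * ?B - (d i * ?B + b i * ?S) = (b i - d i) * ?B - b i * ?S" by (simp add: algebra_simps)
  also have "\<dots> \<le> a i * ?B - b i * ?S"
    using i B0 by (simp add: mult_right_mono)
  also have "\<dots> \<le> a i * ?A"
  proof -
    have "a i * (?B - ?A) \<le> b i * (?B - ?A)" using i AB by (intro mult_right_mono) auto
    also have "\<dots> \<le> b i * ?S" using i IH by (intro mult_left_mono) auto
    finally show ?thesis by (simp add: algebra_simps)
  qed
  finally show ?case unfolding eq using insert.hyps by simp
qed

lemma sieve_functional:
  fixes g :: "'i \<Rightarrow> real" and hit :: "'i \<Rightarrow> 'a set" and \<rho> h :: "'a \<Rightarrow> real" and F :: "'j \<Rightarrow> 'a set \<Rightarrow> real"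
  assumes J: "finite J" "\<And>j. j \<in> J \<Longrightarrow> finite (Q j)" "disjoint_family_on Q J"
    and I: "finite I"
    and count: "\<And>T. T \<subseteq> (\<Union>j\<in>J. Q j) \<Longrightarrow>
        \<bar>(\<Sum>n | n \<in> I \<and> T \<subseteq> hit n. g n) - X * (\<Prod>q\<in>T. \<rho> q)\<bar> \<le> r * (\<Prod>q\<in>T. h q)"
  shows "\<bar>(\<Sum>n\<in>I. g n * (\<Prod>j\<in>J. \<Sum>T\<in>Pow (Q j \<inter> hit n). F j T))
           - X * (\<Prod>j\<in>J. \<Sum>T\<in>Pow (Q j). F j T * (\<Prod>q\<in>T. \<rho> q))\<bar>
         \<le> r * (\<Prod>j\<in>J. \<Sum>T\<in>Pow (Q j). \<bar>F j T\<bar> * (\<Prod>q\<in>T. h q))"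
proof -
  define QQ where "QQ = (\<Union>j\<in>J. Q j)"
  define W where "W T = (\<Prod>j\<in>J. F j (T \<inter> Q j))" for T
  have fin: "finite QQ" using J by (auto simp: QQ_def)
  have prod_split: "(\<Prod>q\<in>T. f q) = (\<Prod>j\<in>J. \<Prod>q\<in>T \<inter> Q j. f q)" if "T \<subseteq> QQ" for T and f :: "'a \<Rightarrow> real"
  proof -
    have "T = (\<Union>j\<in>J. T \<inter> Q j)" using that by (auto simp: QQ_def)
    then have "(\<Prod>q\<in>T. f q) = prod f (\<Union>j\<in>J. T \<inter> Q j)" by simp
    also have "\<dots> = (\<Prod>j\<in>J. \<Prod>q\<in>T \<inter> Q j. f q)"
      by (rule prod.UNION_disjoint) (use J in \<open>auto simp: disjoint_family_on_def\<close>)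
    finally show ?thesis .
  qed
  have fact1: "(\<Sum>T\<in>Pow QQ. G T * (\<Prod>q\<in>T. f q)) = (\<Prod>j\<in>J. \<Sum>T\<in>Pow (Q j). F' j T * (\<Prod>q\<in>T. f q))"
    if "\<And>T. G T = (\<Prod>j\<in>J. F' j (T \<inter> Q j))" for G F' and f :: "'a \<Rightarrow> real"
  proof -
    have "(\<Sum>T\<in>Pow QQ. G T * (\<Prod>q\<in>T. f q)) = (\<Sum>T\<in>Pow QQ. \<Prod>j\<in>J. F' j (T \<inter> Q j) * (\<Prod>q\<in>T \<inter> Q j. f q))"
      by (intro sum.cong refl) (simp add: that prod_split prod.distrib)
    also have "\<dots> = (\<Prod>j\<in>J. \<Sum>T\<in>Pow (Q j). F' j T * (\<Prod>q\<in>T. f q))"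
      unfolding QQ_def by (rule sum_Pow_UN_disjoint[OF J, where F = "\<lambda>j T. F' j T * (\<Prod>q\<in>T. f q)"])
    finally show ?thesis .
  qed
  have ptw: "(\<Prod>j\<in>J. \<Sum>T\<in>Pow (Q j \<inter> hit n). F j T) = (\<Sum>T\<in>Pow QQ. if T \<subseteq> hit n then W T else 0)" for n
  proof -
    have "(\<Prod>j\<in>J. \<Sum>T\<in>Pow (Q j \<inter> hit n). F j T)
        = (\<Sum>T\<in>Pow (\<Union>j\<in>J. Q j \<inter> hit n). \<Prod>j\<in>J. F j (T \<inter> (Q j \<inter> hit n)))"
      by (rule sum_Pow_UN_disjoint[symmetric]) (use J in \<open>auto simp: disjoint_family_on_def\<close>)
    also have "\<dots> = (\<Sum>T\<in>Pow (\<Union>j\<in>J. Q j \<inter> hit n). W T)"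
    proof (intro sum.cong refl)
      fix T assume "T \<in> Pow (\<Union>j\<in>J. Q j \<inter> hit n)"
      then have "T \<inter> (Q j \<inter> hit n) = T \<inter> Q j" for j by auto
      then show "(\<Prod>j\<in>J. F j (T \<inter> (Q j \<inter> hit n))) = W T" by (simp add: W_def)
    qed
    also have "\<dots> = (\<Sum>T\<in>Pow QQ. if T \<subseteq> hit n then W T else 0)"
      by (rule sum.mono_neutral_cong_left) (use fin in \<open>auto simp: QQ_def\<close>)
    finally show ?thesis .
  qed
  define A where "A T = (\<Sum>n | n \<in> I \<and> T \<subseteq> hit n. g n)" for T
  have "(\<Sum>n\<in>I. g n * (\<Prod>j\<in>J. \<Sum>T\<in>Pow (Q j \<inter> hit n). F j T))
      = (\<Sum>n\<in>I. \<Sum>T\<in>Pow QQ. if T \<subseteq> hit n then W T * g n else 0)"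
    unfolding ptw sum_distrib_left by (intro sum.cong refl) auto
  also have "\<dots> = (\<Sum>T\<in>Pow QQ. W T * A T)"
    unfolding A_def sum_distrib_left using I
    by (subst sum.swap) (auto intro!: sum.cong simp: sum.If_cases Int_def)
  finally have e1: "(\<Sum>n\<in>I. g n * (\<Prod>j\<in>J. \<Sum>T\<in>Pow (Q j \<inter> hit n). F j T)) = (\<Sum>T\<in>Pow QQ. W T * A T)" .
  have e2: "X * (\<Prod>j\<in>J. \<Sum>T\<in>Pow (Q j). F j T * (\<Prod>q\<in>T. \<rho> q)) = (\<Sum>T\<in>Pow QQ. W T * (X * (\<Prod>q\<in>T. \<rho> q)))"
    using fact1[of W F \<rho>, OF W_def] by (simp add: sum_distrib_left[symmetric] mult.left_commute[of _ X])
  have e3: "r * (\<Prod>j\<in>J. \<Sum>T\<in>Pow (Q j). \<bar>F j T\<bar> * (\<Prod>q\<in>T. h q)) = (\<Sum>T\<in>Pow QQ. \<bar>W T\<bar> * (r * (\<Prod>q\<in>T. h q)))"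
    using fact1[of "\<lambda>T. \<bar>W T\<bar>" "\<lambda>j T. \<bar>F j T\<bar>" h] by (simp add: W_def abs_prod sum_distrib_left[symmetric] mult.left_commute[of _ r])
  have "\<bar>(\<Sum>T\<in>Pow QQ. W T * A T) - (\<Sum>T\<in>Pow QQ. W T * (X * (\<Prod>q\<in>T. \<rho> q)))\<bar>
      \<le> (\<Sum>T\<in>Pow QQ. \<bar>W T * (A T - X * (\<Prod>q\<in>T. \<rho> q))\<bar>)"
    by (simp add: sum_subtractf[symmetric] right_diff_distrib sum_abs)
  also have "\<dots> \<le> (\<Sum>T\<in>Pow QQ. \<bar>W T\<bar> * (r * (\<Prod>q\<in>T. h q)))"
    unfolding abs_mult by (intro sum_mono mult_left_mono) (use count in \<open>auto simp: A_def QQ_def\<close>)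
  finally show ?thesis unfolding e1 e2 e3 .
qed

lemma exp_le_1_plus_2x: "0 \<le> x \<Longrightarrow> x \<le> 1 \<Longrightarrow> exp x \<le> 1 + 2 * (x::real)"
  using exp_bound[of x] power_le_one[of x 2] mult_left_le[of x x] by (simp add: power2_eq_square)

text \<open>For the upper bound, the indicator of "no hit" in each block is majorised by its
  truncation at an even level, and the errors compound to the product of the
  \<open>1 + \<epsilon> j\<close>. For the lower bound, \<open>prod_diff_le_sum\<close> corrects one
  block at a time. The levels \<open>b j\<close> may vary with the block.\<close>

lemma brun_hooley:
  fixes g :: "'i \<Rightarrow> real" and hit :: "'i \<Rightarrow> 'a set" and \<rho> h :: "'a \<Rightarrow> real" and b :: "'j \<Rightarrow> nat"
  assumes J: "finite J" "\<And>j. j \<in> J \<Longrightarrow> finite (Q j)" "disjoint_family_on Q J"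
    and I: "finite I" and g: "\<And>n. n \<in> I \<Longrightarrow> 0 \<le> g n"
    and X: "0 \<le> X" and r: "0 \<le> r"
    and \<rho>: "\<And>j q. j \<in> J \<Longrightarrow> q \<in> Q j \<Longrightarrow> 0 \<le> \<rho> q \<and> \<rho> q < 1"
    and h: "\<And>j q. j \<in> J \<Longrightarrow> q \<in> Q j \<Longrightarrow> 0 \<le> h q"
    and count: "\<And>T. T \<subseteq> (\<Union>j\<in>J. Q j) \<Longrightarrow>
        \<bar>(\<Sum>n | n \<in> I \<and> T \<subseteq> hit n. g n) - X * (\<Prod>q\<in>T. \<rho> q)\<bar> \<le> r * (\<Prod>q\<in>T. h q)"
    and even: "\<And>j. j \<in> J \<Longrightarrow> even (b j)"
    and eps: "\<And>j. j \<in> J \<Longrightarrow> esym (Suc (b j)) \<rho> (Q j) \<le> \<epsilon> j * (\<Prod>q\<in>Q j. 1 - \<rho> q)"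
    and E: "(\<Sum>j\<in>J. \<epsilon> j) \<le> E" "E \<le> 1"
    and R: "\<And>j. j \<in> J \<Longrightarrow> (\<Sum>T\<in>Pow (Q j). if card T \<le> Suc (b j) then \<Prod>q\<in>T. h q else 0) \<le> R j"
  shows "\<bar>(\<Sum>n | n \<in> I \<and> (\<Union>j\<in>J. Q j) \<inter> hit n = {}. g n) - X * (\<Prod>q\<in>(\<Union>j\<in>J. Q j). 1 - \<rho> q)\<bar>
       \<le> 2 * E * X * (\<Prod>q\<in>(\<Union>j\<in>J. Q j). 1 - \<rho> q) + (1 + real (card J)) * r * (\<Prod>j\<in>J. R j)"
proof -
  define v where "v j = (\<Prod>q\<in>Q j. 1 - \<rho> q)" for j
  define u where "u j = alt_sum (b j) \<rho> (Q j)" for j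
  define e where "e j = esym (Suc (b j)) \<rho> (Q j)" for j
  \<comment> \<open>\<open>W\<close> yields the truncated inclusion-exclusion of a block,
    \<open>W'\<close> the term of the next degree, which bounds its excess over the
    indicator.\<close>
  define W where "W j T = (if card T \<le> b j then (-1) ^ card T else 0::real)" for j and T :: "'a set"
  define W' where "W' j T = (if card T = Suc (b j) then 1 else 0::real)" for j and T :: "'a set"
  define a where "a j n = (if Q j \<inter> hit n = {} then 1 else 0::real)" for j n
  define \<beta> where "\<beta> j n = (\<Sum>T\<in>Pow (Q j \<inter> hit n). W j T)" for j n
  define \<delta> where "\<delta> j n = (\<Sum>T\<in>Pow (Q j \<inter> hit n). W' j T)" for j n
  define VV where "VV = (\<Prod>q\<in>(\<Union>j\<in>J. Q j). 1 - \<rho> q)"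
  define RR where "RR = (\<Prod>j\<in>J. R j)"
  have VV: "VV = (\<Prod>j\<in>J. v j)"
    unfolding VV_def v_def by (rule prod.UNION_disjoint) (use J in \<open>auto simp: disjoint_family_on_def\<close>)
  have bon: "v j \<le> u j" "u j \<le> v j + e j" if "j \<in> J" for j
    using bonferroni[of "Q j" \<rho> "b j"] that J(2) \<rho> even[OF that]
    by (force simp: v_def u_def e_def less_imp_le)+
  \<comment> \<open>With all weights equal to 1, Bonferroni's inequalities concern the indicator
    that \<open>n\<close> is hit by no element of the block.\<close>
  have bonp: "a j n \<le> \<beta> j n" "\<beta> j n \<le> a j n + \<delta> j n" if "j \<in> J" for j n
  proof -
    have fin: "finite (Q j \<inter> hit n)" using J(2)[OF that] by auto
    have "(\<Prod>q\<in>Q j \<inter> hit n. 1 - 1::real) = a j n"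
      using fin by (auto simp: a_def)
    moreover have "alt_sum (b j) (\<lambda>_. 1) (Q j \<inter> hit n) = \<beta> j n"
      unfolding alt_sum_def \<beta>_def W_def by (intro sum.cong refl) auto
    moreover have "esym (Suc (b j)) (\<lambda>_. 1) (Q j \<inter> hit n) = \<delta> j n"
      unfolding esym_def \<delta>_def W'_def by (intro sum.cong refl) auto
    ultimately show "a j n \<le> \<beta> j n" "\<beta> j n \<le> a j n + \<delta> j n"
      using bonferroni[OF fin, of "\<lambda>_. 1" "b j"] even[OF that] by auto
  qed
  have a0: "0 \<le> a j n" for j n by (simp add: a_def)
  have v0: "0 < v j" if "j \<in> J" for j
    unfolding v_def using \<rho> that by (intro prod_pos) auto
  have e0: "0 \<le> e j" if "j \<in> J" for j
    unfolding e_def using \<rho> that by (intro esym_nonneg) auto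
  have eps0: "0 \<le> \<epsilon> j" if "j \<in> J" for j
    using eps[OF that] e0[OF that] v0[OF that] by (simp add: e_def v_def) (meson order_trans zero_le_mult_iff leD)
  have E0: "0 \<le> E" using E(1) sum_nonneg[of J \<epsilon>] eps0 by fastforce
  have VV0: "0 \<le> VV" unfolding VV using v0 by (intro prod_nonneg) (auto intro: less_imp_le)
  have hprod: "0 \<le> (\<Prod>q\<in>T. h q)" if "T \<subseteq> Q j" "j \<in> J" for T j
    using that h by (intro prod_nonneg) auto
  have R0: "0 \<le> R j" if "j \<in> J" for j
    by (rule order_trans[OF _ R[OF that]]) (intro sum_nonneg, use hprod that in auto)
  have RW: "(\<Sum>T\<in>Pow (Q j). \<bar>W j T\<bar> * (\<Prod>q\<in>T. h q)) \<le> R j" if "j \<in> J" for j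
    by (rule order_trans[OF sum_mono R[OF that]]) (use hprod that in \<open>auto simp: W_def power_abs\<close>)
  have RW': "(\<Sum>T\<in>Pow (Q j). \<bar>W' j T\<bar> * (\<Prod>q\<in>T. h q)) \<le> R j" if "j \<in> J" for j
    by (rule order_trans[OF sum_mono R[OF that]]) (use hprod that in \<open>auto simp: W'_def\<close>)
  have S: "(\<Sum>n | n \<in> I \<and> (\<Union>j\<in>J. Q j) \<inter> hit n = {}. g n) = (\<Sum>n\<in>I. g n * (\<Prod>j\<in>J. a j n))"
  proof -
    have eq: "(\<Prod>j\<in>J. a j n) = (if (\<Union>j\<in>J. Q j) \<inter> hit n = {} then 1 else 0)" for n
    proof (cases "(\<Union>j\<in>J. Q j) \<inter> hit n = {}")
      case True
      then have "a j n = 1" if "j \<in> J" for j using that by (auto simp: a_def)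
      then show ?thesis using True by simp
    next
      case False
      then show ?thesis using J(1) by (auto simp: a_def)
    qed
    show ?thesis unfolding eq using I by (intro sum.mono_neutral_cong_left) auto
  qed
  have Wu: "(\<Sum>T\<in>Pow (Q j). W j T * (\<Prod>q\<in>T. \<rho> q)) = u j" for j
    by (simp add: u_def alt_sum_def W_def if_distrib[of "\<lambda>x. x * _"] cong: if_cong)
  have Wu': "(\<Sum>T\<in>Pow (Q j). W' j T * (\<Prod>q\<in>T. \<rho> q)) = e j" for j
    by (simp add: e_def esym_def W'_def if_distrib[of "\<lambda>x. x * _"] cong: if_cong)
  have f1: "\<bar>(\<Sum>n\<in>I. g n * (\<Prod>j\<in>J. \<beta> j n)) - X * (\<Prod>j\<in>J. u j)\<bar> \<le> r * RR"
  proof -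
    have "\<bar>(\<Sum>n\<in>I. g n * (\<Prod>j\<in>J. \<beta> j n)) - X * (\<Prod>j\<in>J. u j)\<bar>
       \<le> r * (\<Prod>j\<in>J. \<Sum>T\<in>Pow (Q j). \<bar>W j T\<bar> * (\<Prod>q\<in>T. h q))"
      using sieve_functional[OF J I count, where F = W] unfolding \<beta>_def Wu by auto
    also have "\<dots> \<le> r * RR" unfolding RR_def
      by (intro mult_left_mono r prod_mono conjI RW sum_nonneg mult_nonneg_nonneg) (use hprod in auto)
    finally show ?thesis .
  qed
  have f2: "(\<Sum>n\<in>I. g n * (\<delta> l n * (\<Prod>j\<in>J - {l}. \<beta> j n))) \<le> X * (e l * (\<Prod>j\<in>J - {l}. u j)) + r * RR"
    if l: "l \<in> J" for l
  proof -
    \<comment> \<open>Block \<open>l\<close> carries its excess, all other blocks their truncated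
      sums.\<close>
    define F where "F j = (if j = l then W' l else W j)" for j
    have p: "(\<Prod>j\<in>J. G (F j) j) = G (W' l) l * (\<Prod>j\<in>J - {l}. G (W j) j)" for G :: "('a set \<Rightarrow> real) \<Rightarrow> 'j \<Rightarrow> real"
    proof -
      have "(\<Prod>j\<in>J. G (F j) j) = G (F l) l * (\<Prod>j\<in>J - {l}. G (F j) j)"
        using J(1) l by (rule prod.remove)
      also have "(\<Prod>j\<in>J - {l}. G (F j) j) = (\<Prod>j\<in>J - {l}. G (W j) j)"
        by (intro prod.cong) (auto simp: F_def)
      finally show ?thesis by (simp add: F_def)
    qed
    have "\<bar>(\<Sum>n\<in>I. g n * (\<Prod>j\<in>J. \<Sum>T\<in>Pow (Q j \<inter> hit n). F j T))
           - X * (\<Prod>j\<in>J. \<Sum>T\<in>Pow (Q j). F j T * (\<Prod>q\<in>T. \<rho> q))\<bar>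
         \<le> r * (\<Prod>j\<in>J. \<Sum>T\<in>Pow (Q j). \<bar>F j T\<bar> * (\<Prod>q\<in>T. h q))"
      by (rule sieve_functional[OF J I count]) auto
    moreover have "r * (\<Prod>j\<in>J. \<Sum>T\<in>Pow (Q j). \<bar>F j T\<bar> * (\<Prod>q\<in>T. h q)) \<le> r * RR"
      unfolding RR_def
      by (intro mult_left_mono r prod_mono conjI sum_nonneg mult_nonneg_nonneg)
         (use hprod RW RW' l in \<open>auto simp: F_def\<close>)
    ultimately show ?thesis
      using p[of "\<lambda>f j. \<Sum>T\<in>Pow (Q j). f T * (\<Prod>q\<in>T. \<rho> q)"]
        p[of "\<lambda>f j. \<Sum>T\<in>Pow (Q j \<inter> hit n). f T" for n]
      unfolding \<beta>_def[symmetric] \<delta>_def[symmetric] Wu Wu' by auto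
  qed
  have upper: "(\<Sum>n\<in>I. g n * (\<Prod>j\<in>J. a j n)) \<le> X * VV + 2 * E * X * VV + r * RR"
  proof -
    have 0: "(\<Sum>n\<in>I. g n * (\<Prod>j\<in>J. a j n)) \<le> (\<Sum>n\<in>I. g n * (\<Prod>j\<in>J. \<beta> j n))"
      by (intro sum_mono mult_left_mono prod_mono) (use g a0 bonp in auto)
    then have 1: "(\<Sum>n\<in>I. g n * (\<Prod>j\<in>J. a j n)) \<le> X * (\<Prod>j\<in>J. u j) + r * RR"
      using f1 by auto
    have "(\<Prod>j\<in>J. u j) \<le> (\<Prod>j\<in>J. v j * exp (\<epsilon> j))"
    proof (intro prod_mono conjI)
      fix j assume j: "j \<in> J"
      show "0 \<le> u j" using bon[OF j] v0[OF j] by auto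
      have "u j \<le> v j * (1 + \<epsilon> j)" using bon(2)[OF j] eps[OF j] by (simp add: e_def v_def algebra_simps)
      also have "\<dots> \<le> v j * exp (\<epsilon> j)" using v0[OF j] exp_ge_add_one_self by (intro mult_left_mono) auto
      finally show "u j \<le> v j * exp (\<epsilon> j)" .
    qed
    also have "(\<Prod>j\<in>J. v j * exp (\<epsilon> j)) = VV * exp (\<Sum>j\<in>J. \<epsilon> j)"
      by (simp add: VV prod.distrib exp_sum J(1))
    also have "\<dots> \<le> VV * (1 + 2 * E)"
      using E exp_le_1_plus_2x[of E] VV0 E0 by (intro mult_left_mono) (auto intro: order_trans[of _ "exp E"])
    finally have "X * (\<Prod>j\<in>J. u j) \<le> X * (VV * (1 + 2 * E))" using X by (rule mult_left_mono)
    with 1 show ?thesis by (simp add: algebra_simps)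
  qed
  \<comment> \<open>Each block's correction costs one further application of \<open>count\<close>,
    whence the factor \<open>1 + card J\<close> in front of the remainder.\<close>
  have lower: "X * VV - E * X * VV - (1 + real (card J)) * r * RR \<le> (\<Sum>n\<in>I. g n * (\<Prod>j\<in>J. a j n))"
  proof -
    have U0: "VV \<le> (\<Prod>j\<in>J. u j)" unfolding VV by (intro prod_mono) (use bon v0 in \<open>auto intro: less_imp_le\<close>)
    have "(\<Sum>l\<in>J. e l * (\<Prod>j\<in>J - {l}. u j)) \<le> (\<Sum>l\<in>J. \<epsilon> l * (\<Prod>j\<in>J. u j))"
    proof (rule sum_mono)
      fix l assume l: "l \<in> J"
      have "e l \<le> \<epsilon> l * u l"
        using eps[OF l] mult_left_mono[OF bon(1)[OF l] eps0[OF l]] by (simp add: e_def v_def)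
      moreover have "0 \<le> (\<Prod>j\<in>J - {l}. u j)" by (intro prod_nonneg) (use bon v0 in \<open>force intro: less_imp_le\<close>)
      ultimately have "e l * (\<Prod>j\<in>J - {l}. u j) \<le> \<epsilon> l * u l * (\<Prod>j\<in>J - {l}. u j)" by (rule mult_right_mono)
      then show "e l * (\<Prod>j\<in>J - {l}. u j) \<le> \<epsilon> l * (\<Prod>j\<in>J. u j)"
        using prod.remove[OF J(1) l, of u] by (simp add: mult.assoc)
    qed
    also have "\<dots> \<le> E * (\<Prod>j\<in>J. u j)"
      unfolding sum_distrib_right[symmetric] using E U0 VV0 by (intro mult_right_mono) auto
    finally have su: "(\<Sum>l\<in>J. e l * (\<Prod>j\<in>J - {l}. u j)) \<le> E * (\<Prod>j\<in>J. u j)" .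
    have "X * VV * (1 - E) \<le> X * (\<Prod>j\<in>J. u j) * (1 - E)"
      using U0 X E by (intro mult_right_mono mult_left_mono) auto
    also have "\<dots> \<le> X * (\<Prod>j\<in>J. u j) - X * (\<Sum>l\<in>J. e l * (\<Prod>j\<in>J - {l}. u j))"
      using mult_left_mono[OF su X] by (simp add: algebra_simps)
    also have "\<dots> \<le> (\<Sum>n\<in>I. g n * (\<Prod>j\<in>J. \<beta> j n)) - (\<Sum>l\<in>J. \<Sum>n\<in>I. g n * (\<delta> l n * (\<Prod>j\<in>J - {l}. \<beta> j n)))
         + (1 + real (card J)) * (r * RR)"
    proof -
      have "(\<Sum>l\<in>J. \<Sum>n\<in>I. g n * (\<delta> l n * (\<Prod>j\<in>J - {l}. \<beta> j n)))
          \<le> (\<Sum>l\<in>J. X * (e l * (\<Prod>j\<in>J - {l}. u j)) + r * RR)"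
        by (intro sum_mono f2)
      also have "\<dots> = X * (\<Sum>l\<in>J. e l * (\<Prod>j\<in>J - {l}. u j)) + real (card J) * (r * RR)"
        by (simp add: sum.distrib sum_distrib_left)
      finally show ?thesis using f1 by (simp add: algebra_simps) 
    qed
    also have "(\<Sum>n\<in>I. g n * (\<Prod>j\<in>J. \<beta> j n)) - (\<Sum>l\<in>J. \<Sum>n\<in>I. g n * (\<delta> l n * (\<Prod>j\<in>J - {l}. \<beta> j n)))
       = (\<Sum>n\<in>I. g n * ((\<Prod>j\<in>J. \<beta> j n) - (\<Sum>l\<in>J. \<delta> l n * (\<Prod>j\<in>J - {l}. \<beta> j n))))"
      by (subst sum.swap) (simp add: sum_subtractf right_diff_distrib sum_distrib_left)
    also have "\<dots> \<le> (\<Sum>n\<in>I. g n * (\<Prod>j\<in>J. a j n))"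
      by (intro sum_mono mult_left_mono prod_diff_le_sum J g) (use a0 bonp in auto)
    finally show ?thesis by (simp add: algebra_simps)
  qed
  have "0 \<le> r * RR" unfolding RR_def using r R0 by (intro mult_nonneg_nonneg prod_nonneg) auto
  moreover have "0 \<le> real (card J) * (r * RR)" using calculation by simp
  moreover have "0 \<le> E * X * VV" using E0 X VV0 by simp
  ultimately show ?thesis
    using upper lower unfolding S VV_def[symmetric] RR_def[symmetric]
    by (simp add: abs_le_iff algebra_simps)
qed

section \<open>Chebyshev and Mertens estimates\<close>

lemma sum_divisors_swap:
  fixes F :: "nat \<Rightarrow> nat \<Rightarrow> 'a::comm_monoid_add"
  shows "(\<Sum>n\<in>{1..N}. \<Sum>d | d dvd n. F d (n div d)) = (\<Sum>d\<in>{1..N}. \<Sum>m\<in>{1..N div d}. F d m)"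
proof -
  have "(\<Sum>n\<in>{1..N}. \<Sum>d | d dvd n. F d (n div d)) = (\<Sum>(n, d)\<in>(SIGMA n:{1..N}. {d. d dvd n}). F d (n div d))"
    by (rule sum.Sigma) auto
  also have "\<dots> = (\<Sum>(d, m)\<in>(SIGMA d:{1..N}. {1..N div d}). F d m)"
  proof (rule sum.reindex_bij_witness[of _ "\<lambda>(d, m). (d * m, d)" "\<lambda>(n, d). (d, n div d)"], goal_cases)
    case (2 p)
    then obtain n d where p: "p = (n, d)" "1 \<le> n" "n \<le> N" "d dvd n" by auto
    then have "d \<noteq> 0" "d \<le> n" by (auto dest: dvd_imp_le)
    then show ?case using p div_le_mono[of n N d] dvd_div_eq_0_iff[of d n] by auto
  next
    case (4 p)
    then obtain d m where p: "p = (d, m)" "1 \<le> d" "d \<le> N" "1 \<le> m" "m \<le> N div d" by auto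
    then have "d * m \<le> N" by (metis dual_order.trans mult_le_mono2 times_div_less_eq_dividend)
    then show ?case using p by auto
  qed auto
  also have "\<dots> = (\<Sum>d\<in>{1..N}. \<Sum>m\<in>{1..N div d}. F d m)"
    by (rule sum.Sigma[symmetric]) auto
  finally show ?thesis .
qed

text \<open>Legendre's formula in logarithmic form; all bounds on primes in this section come from
  it.\<close>

lemma ln_fact_eq_sum_mangoldt:
  "ln (fact N) = (\<Sum>d\<in>{1..N}. mangoldt d * real (N div d))"
proof -
  have "ln (fact N) = (\<Sum>n\<in>{1..N}. ln (real n))"
    by (simp add: fact_prod of_nat_prod) (rule ln_prod, auto)
  also have "\<dots> = (\<Sum>n\<in>{1..N}. \<Sum>d | d dvd n. mangoldt d)"
    by (intro sum.cong refl) (subst mangoldt_sum, auto)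
  also have "\<dots> = (\<Sum>d\<in>{1..N}. \<Sum>m\<in>{1..N div d}. mangoldt d)"
    by (rule sum_divisors_swap)
  finally show ?thesis by (simp add: mult.commute)
qed

text \<open>Chebyshev's argument: in the logarithm of the central binomial coefficient
  \<open>mangoldt d\<close> has the coefficient \<open>2 * n div d - 2 * (n div d)\<close>, which is
  nonnegative and equals 1 for \<open>n < d \<le> 2 * n\<close>; and the coefficient itself is at
  most \<open>2 ^ (2 * n)\<close>.\<close>

lemma sum_mangoldt_double:
  "(\<Sum>d\<in>{1..2*n}. mangoldt d) \<le> (\<Sum>d\<in>{1..n}. mangoldt d) + 2 * real n * ln 2"
proof -
  have le: "real (n div d) * 2 \<le> real (2 * n div d)" for d
  proof -
    have "n div d * 2 \<le> 2 * n div d"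
      by (cases "d = 0") (auto simp: less_eq_div_iff_mult_less_eq algebra_simps)
    then show ?thesis by linarith
  qed
  have "(\<Sum>d\<in>{n+1..2*n}. mangoldt d :: real) \<le> (\<Sum>d\<in>{1..2*n}. mangoldt d * (real (2 * n div d) - 2 * real (n div d)))"
  proof -
    have "(\<Sum>d\<in>{n+1..2*n}. mangoldt d :: real)
        \<le> (\<Sum>d\<in>{n+1..2*n}. mangoldt d * (real (2 * n div d) - 2 * real (n div d)))"
    proof (intro sum_mono)
      fix d assume d: "d \<in> {n+1..2*n}"
      then have "2 * n div d \<ge> 1" "n div d = 0" by (auto simp: Suc_le_eq div_greater_zero_iff)
      then have "1 \<le> real (2 * n div d) - 2 * real (n div d)" by simp
      then show "mangoldt d \<le> mangoldt d * (real (2 * n div d) - 2 * real (n div d))"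
        using mangoldt_nonneg mult_left_mono by fastforce
    qed
    also have "\<dots> \<le> (\<Sum>d\<in>{1..2*n}. mangoldt d * (real (2 * n div d) - 2 * real (n div d)))"
      by (intro sum_mono2) (use le mangoldt_nonneg in \<open>auto simp: mult.commute\<close>)
    finally show ?thesis .
  qed
  also have "\<dots> = ln (fact (2 * n)) - 2 * (\<Sum>d\<in>{1..2*n}. mangoldt d * real (n div d))"
    unfolding ln_fact_eq_sum_mangoldt by (simp add: algebra_simps sum_subtractf sum_distrib_left)
  also have "(\<Sum>d\<in>{1..2*n}. mangoldt d * real (n div d)) = (\<Sum>d\<in>{1..n}. mangoldt d * real (n div d))"
    by (rule sum.mono_neutral_right) auto
  also have "ln (fact (2 * n)) - 2 * \<dots> = ln (real (2 * n choose n))"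
    unfolding ln_fact_eq_sum_mangoldt[symmetric]
    by (simp add: binomial_fact ln_div ln_mult mult_2[symmetric] del: mult_2)
  also have "\<dots> \<le> ln (2 ^ (2 * n))"
  proof (subst ln_le_cancel_iff)
    show "real (2 * n choose n) \<le> 2 ^ (2 * n)"
      using binomial_le_pow2[of "2 * n" n] by (metis of_nat_le_iff of_nat_numeral of_nat_power)
  qed auto
  also have "\<dots> = 2 * real n * ln 2" by (simp add: ln_realpow)
  finally have "(\<Sum>d\<in>{n+1..2*n}. mangoldt d :: real) \<le> 2 * real n * ln 2" .
  moreover have "(\<Sum>d\<in>{1..2*n}. mangoldt d :: real) = (\<Sum>d\<in>{1..n}. mangoldt d) + (\<Sum>d\<in>{n+1..2*n}. mangoldt d)"
    by (subst sum.union_disjoint[symmetric]) (auto intro: sum.cong)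
  ultimately show ?thesis by simp
qed

text \<open>Halving \<open>n\<close> gives \<open>6 * m\<close> out of the available
  \<open>8 * m\<close>; the slack \<open>2 * m\<close> pays for the extra term \<open>ln n\<close>
  when \<open>n\<close> is odd.\<close>

lemma chebyshev_psi_le: "(\<Sum>d\<in>{1..n}. mangoldt d) \<le> 4 * real n"
proof (induction n rule: less_induct)
  case (less n)
  show ?case
  proof (cases "n = 0")
    case False
    define m where "m = n div 2"
    have IH: "(\<Sum>d\<in>{1..m}. mangoldt d) \<le> 4 * real m" using less False by (simp add: m_def)
    have "2 * real m * ln 2 \<le> 2 * real m * 1" using ln_2_less_1 by (intro mult_left_mono) auto
    then have D: "(\<Sum>d\<in>{1..2*m}. mangoldt d) \<le> 6 * real m" using sum_mangoldt_double[of m] IH by linarith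
    show ?thesis
    proof (cases "even n")
      case True
      then have "n = 2 * m" by (simp add: m_def)
      then show ?thesis using D by simp
    next
      case odd: False
      then have n: "n = Suc (2 * m)" by (simp add: m_def)
      have "mangoldt n \<le> ln (real n)" using mangoldt_le[of n] False by simp
      also have "\<dots> \<le> 2 * real m" using ln_le_minus_one[of "real n"] n by simp
      finally show ?thesis using D n by simp
    qed
  qed simp
qed

lemma ln_fact_ge: "n \<ge> 1 \<Longrightarrow> real n * ln (real n) - real n \<le> ln (fact n)"
proof (induction n rule: nat_induct_at_least)
  case base
  then show ?case by simp
next
  case (Suc n)
  have "real n * (ln (real (Suc n)) - ln (real n)) \<le> 1"
  proof -
    have "ln (real (Suc n)) - ln (real n) = ln (1 + 1 / real n)"
      using Suc.hyps by (subst ln_divide_pos[symmetric]) (auto simp: field_simps)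
    also have "\<dots> \<le> 1 / real n" by (rule ln_add_one_self_le_self) auto
    finally show ?thesis using Suc.hyps by (simp add: field_simps)
  qed
  moreover have "ln (fact (Suc n)) = ln (real (Suc n)) + ln (fact n)"
    by (simp only: fact_Suc) (subst ln_mult_pos, auto)
  moreover have "real (Suc n) * ln (real (Suc n)) = real n * ln (real (Suc n)) + ln (real (Suc n))"
    by (simp add: algebra_simps)
  ultimately show ?case using Suc.IH by (simp add: right_diff_distrib)
qed

lemma ln_fact_le: "ln (fact n) \<le> real n * ln (real n)"
proof (cases "n = 0")
  case False
  have "(fact n :: real) \<le> real n ^ n"
    using fact_le_power[of n, where ?'a = real] by simp
  then have "ln (fact n) \<le> ln (real n ^ n)" using False by (subst ln_le_cancel_iff) auto
  then show ?thesis using False by (simp add: ln_realpow)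
qed simp

text \<open>Legendre's formula divided by \<open>n\<close>; replacing \<open>n div d\<close> by
  \<open>n / d\<close> costs at most the Chebyshev sum, hence the 4.\<close>

lemma mertens_mangoldt:
  assumes "n \<ge> 1"
  shows "(\<Sum>d\<in>{1..n}. mangoldt d / real d) \<le> ln (real n) + 4"
    and "ln (real n) - 1 \<le> (\<Sum>d\<in>{1..n}. mangoldt d / real d)"
proof -
  have n: "real n > 0" using assms by simp
  have "real n * (\<Sum>d\<in>{1..n}. mangoldt d / real d) \<le> (\<Sum>d\<in>{1..n}. mangoldt d * (real (n div d) + 1))"
    unfolding sum_distrib_left
  proof (intro sum_mono)
    fix d assume "d \<in> {1..n}"
    then have "real n / real d \<le> real (n div d) + 1"
      using floor_divide_of_nat_eq[of n d, where ?'a = real] by linarith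
    from mult_left_mono[OF this mangoldt_nonneg[of d]]
    show "real n * (mangoldt d / real d) \<le> mangoldt d * (real (n div d) + 1)"
      by (simp add: mult.commute)
  qed
  also have "\<dots> = ln (fact n) + (\<Sum>d\<in>{1..n}. mangoldt d)"
    unfolding ln_fact_eq_sum_mangoldt by (simp add: algebra_simps sum.distrib)
  also have "\<dots> \<le> real n * (ln (real n) + 4)"
    using ln_fact_le[of n] chebyshev_psi_le[of n] by (simp add: algebra_simps)
  finally show "(\<Sum>d\<in>{1..n}. mangoldt d / real d) \<le> ln (real n) + 4" using n by simp
  have "real n * (ln (real n) - 1) \<le> ln (fact n)" using ln_fact_ge[OF assms] by (simp add: algebra_simps)
  also have "\<dots> \<le> real n * (\<Sum>d\<in>{1..n}. mangoldt d / real d)"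
    unfolding ln_fact_eq_sum_mangoldt sum_distrib_left
  proof (intro sum_mono)
    fix d
    have "real (n div d) \<le> real n / real d"
      using floor_divide_of_nat_eq[of n d, where ?'a = real] by linarith
    from mult_left_mono[OF this mangoldt_nonneg[of d]]
    show "mangoldt d * real (n div d) \<le> real n * (mangoldt d / real d)"
      by (simp add: mult.commute)
  qed
  finally show "ln (real n) - 1 \<le> (\<Sum>d\<in>{1..n}. mangoldt d / real d)" using n by simp
qed

lemma sum_prime_ln_div_le:
  assumes "1 \<le> u" "u \<le> v" "\<And>q. q \<in> Q \<Longrightarrow> prime q \<and> u < q \<and> q \<le> v"
  shows "(\<Sum>q\<in>Q. ln (real q) / real q) \<le> ln (real v) - ln (real u) + 5"
proof -
  have "(\<Sum>q\<in>Q. ln (real q) / real q) = (\<Sum>q\<in>Q. mangoldt q / real q)"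
    using assms(3) by (intro sum.cong) auto
  also have "\<dots> \<le> (\<Sum>q\<in>{u+1..v}. mangoldt q / real q)"
    by (intro sum_mono2) (use assms(3) mangoldt_nonneg in \<open>force+\<close>)
  also have "\<dots> = (\<Sum>q\<in>{1..v}. mangoldt q / real q) - (\<Sum>q\<in>{1..u}. mangoldt q / real q)"
  proof -
    have "{1..v} = {1..u} \<union> {u+1..v}" using assms by auto
    then show ?thesis by (simp only:) (subst sum.union_disjoint, auto)
  qed
  finally show ?thesis using mertens_mangoldt(1)[of v] mertens_mangoldt(2)[of u] assms by auto
qed

text \<open>Weighting with \<open>ln q\<close> bounds \<open>ln u\<close> times the sum by
  \<open>ln u + 5\<close>. Since \<open>ln u \<ge> ln 2 \<ge> 5 / 9\<close>, this is at most
  \<open>10 * ln u\<close>.\<close>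

lemma sum_prime_inverse_block_le:
  assumes "2 \<le> u" "v \<le> u ^ 2" "\<And>q. q \<in> Q \<Longrightarrow> prime q \<and> u < q \<and> q \<le> v"
  shows "(\<Sum>q\<in>Q. 1 / real q) \<le> 10"
proof (cases "Q = {}")
  case False
  then have uv: "u \<le> v" using assms(3) by fastforce
  have lnu: "ln (real u) \<ge> 5 / 9"
  proof -
    have "ln (real u) \<ge> ln 2" using assms(1) by (subst ln_le_cancel_iff) auto
    then show ?thesis using ln2_ge_two_thirds by linarith
  qed
  have "ln (real u) * (\<Sum>q\<in>Q. 1 / real q) \<le> (\<Sum>q\<in>Q. ln (real q) / real q)"
    unfolding sum_distrib_left
  proof (rule sum_mono)
    fix q assume "q \<in> Q"
    then have "real u \<le> real q" using assms(3) by fastforce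
    then have "ln (real u) \<le> ln (real q)" using assms(1) by (subst ln_le_cancel_iff) auto
    then show "ln (real u) * (1 / real q) \<le> ln (real q) / real q" by (simp add: divide_right_mono)
  qed
  also have "\<dots> \<le> ln (real v) - ln (real u) + 5"
    by (rule sum_prime_ln_div_le) (use assms uv in auto)
  also have "ln (real v) \<le> ln (real (u ^ 2))" using assms uv by (subst ln_le_cancel_iff) (auto simp del: of_nat_power)
  also have "\<dots> = 2 * ln (real u)" using assms by (simp add: ln_realpow)
  also have "2 * ln (real u) - ln (real u) + 5 \<le> ln (real u) * 10" using lnu by simp
  finally show ?thesis using lnu by (simp add: mult_le_cancel_left)
qed simp

text \<open>A crude bound by \<open>ln v\<close> instead of \<open>ln (ln v)\<close>. The factor
  \<open>1 / ln w\<close> compensates: for large \<open>w\<close>, products over such primes lose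
  only a small power of \<open>v\<close>.\<close>

lemma sum_prime_inverse_rough_le:
  assumes "1 < w" "1 \<le> v" "\<And>q. q \<in> Q \<Longrightarrow> prime q \<and> w < real q \<and> q \<le> v"
  shows "(\<Sum>q\<in>Q. 1 / real q) \<le> (ln (real v) + 5) / ln w"
proof -
  have "ln w * (\<Sum>q\<in>Q. 1 / real q) \<le> (\<Sum>q\<in>Q. ln (real q) / real q)"
    unfolding sum_distrib_left
  proof (rule sum_mono)
    fix q assume "q \<in> Q"
    then have "ln w \<le> ln (real q)" using assms by (subst ln_le_cancel_iff) force+
    then show "ln w * (1 / real q) \<le> ln (real q) / real q" by (simp add: divide_right_mono)
  qed
  also have "\<dots> \<le> ln (real v) - ln (real 1) + 5"
    by (rule sum_prime_ln_div_le) (use assms prime_gt_1_nat in auto)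
  finally show ?thesis using assms by (simp add: field_simps)
qed

section \<open>The fundamental lemma in residue classes\<close>

text \<open>Bounds the remainder produced by one block. Passing from \<open>b\<close> to
  \<open>Suc b\<close> adds an elementary symmetric sum, at most
  \<open>(c * card Q) ^ Suc b\<close>.\<close>

lemma sum_card_le_prod_le:
  fixes h :: "'a \<Rightarrow> real"
  assumes "finite Q" "\<And>q. q \<in> Q \<Longrightarrow> 0 \<le> h q" "\<And>q. q \<in> Q \<Longrightarrow> h q \<le> c"
  shows "(\<Sum>T\<in>Pow Q. if card T \<le> b then \<Prod>q\<in>T. h q else 0) \<le> (1 + c * real (card Q)) ^ b"
proof (cases "Q = {}")
  case False
  then have c: "0 \<le> c" using assms by (meson all_not_in_conv order_trans)
  show ?thesis
  proof (induction b)
    case 0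
    have "(\<Sum>T\<in>Pow Q. if card T \<le> 0 then \<Prod>q\<in>T. h q else 0) = esym 0 h Q"
      by (simp add: esym_def)
    then show ?case using assms(1) by simp
  next
    case (Suc b)
    have "(\<Sum>T\<in>Pow Q. if card T \<le> Suc b then \<Prod>q\<in>T. h q else 0)
        = (\<Sum>T\<in>Pow Q. if card T \<le> b then \<Prod>q\<in>T. h q else 0) + esym (Suc b) h Q"
      unfolding esym_def sum.distrib[symmetric] by (intro sum.cong refl) auto
    also have "esym (Suc b) h Q \<le> (\<Sum>q\<in>Q. h q) ^ Suc b / fact (Suc b)"
      by (rule esym_le) (use assms in auto)
    also have "\<dots> \<le> (c * real (card Q)) ^ Suc b / fact (Suc b)"
    proof (intro divide_right_mono power_mono)
      show "(\<Sum>q\<in>Q. h q) \<le> c * real (card Q)"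
        using sum_bounded_above[of Q h c] assms by (simp add: mult.commute)
    qed (use assms in \<open>auto intro: sum_nonneg\<close>)
    also have "\<dots> \<le> (c * real (card Q)) ^ Suc b / 1"
      using c by (intro divide_left_mono) (auto simp: fact_ge_1 simp del: fact_Suc)
    also have "\<dots> = (c * real (card Q)) ^ b * (c * real (card Q))" by simp
    also have "\<dots> \<le> (1 + c * real (card Q)) ^ b * (c * real (card Q))"
      using c by (intro mult_right_mono power_mono) auto
    finally show ?case using Suc by (simp add: algebra_simps)
  qed
qed simp

text \<open>A single term of the exponential series at \<open>4 * A\<close>. It trades the factorial
  for geometric decay in \<open>m\<close>.\<close>

lemma power_div_fact_le:
  assumes "0 \<le> (A::real)"
  shows "A ^ m / fact m \<le> exp (4 * A) / 4 ^ m"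
proof -
  have "(4 * A) ^ m / fact m \<le> exp (4 * A)"
  proof -
    have "(\<Sum>n\<in>{m}. inverse (fact n) *\<^sub>R (4 * A) ^ n) \<le> (\<Sum>n. inverse (fact n) *\<^sub>R (4 * A) ^ n)"
      by (rule sum_le_suminf[OF summable_exp_generic]) (use assms in auto)
    then show ?thesis by (simp add: exp_def divide_inverse mult.commute)
  qed
  then show ?thesis by (simp add: power_mult_distrib field_simps)
qed

text \<open>The primes of block \<open>i\<close> have about \<open>2 ^ i\<close> binary digits and
  the level there is linear in \<open>I - i\<close>. The digits double from block to block, so the
  last block dominates. The shift \<open>c\<close> varies in the induction because raising
  \<open>I\<close> raises all earlier levels by 2.\<close>

lemma block_exponent_sum: "(\<Sum>i\<le>I. 2 ^ (i + 2) * (c + 2 * (I - i))) \<le> 2 ^ I * (8 * c + (16::nat))"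
proof (induction I arbitrary: c)
  case (Suc I)
  have "(\<Sum>i\<le>Suc I. 2 ^ (i + 2) * (c + 2 * (Suc I - i)))
      = 2 ^ (I + 3) * c + (\<Sum>i\<le>I. 2 ^ (i + 2) * ((c + 2) + 2 * (I - i)))"
  proof -
    have "(\<Sum>i\<le>I. 2 ^ (i + 2) * (c + 2 * (Suc I - i))) = (\<Sum>i\<le>I. 2 ^ (i + 2) * ((c + 2) + 2 * (I - i)))"
      by (intro sum.cong refl) (simp add: Suc_diff_le)
    then show ?thesis by (simp add: power_add)
  qed
  also have "\<dots> \<le> 2 ^ (I + 3) * c + 2 ^ I * (8 * (c + 2) + 16)"
    using Suc.IH[of "c + 2"] by simp
  also have "\<dots> \<le> 2 ^ Suc I * (8 * c + 16)" by (simp add: algebra_simps power_add)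
  finally show ?case .
qed simp

lemma one_minus_ge_exp: "0 \<le> x \<Longrightarrow> x \<le> 1 / 2 \<Longrightarrow> exp (- 2 * x) \<le> 1 - (x::real)"
proof -
  assume x: "0 \<le> x" "x \<le> 1 / 2"
  have "1 \<le> (1 - x) * (1 + 2 * x)" using x mult_left_mono[of x "1/2" x] by (simp add: algebra_simps)
  also have "\<dots> \<le> (1 - x) * exp (2 * x)" using x exp_ge_add_one_self by (intro mult_left_mono) auto
  finally show ?thesis by (simp add: exp_minus field_simps)
qed

lemma prod_one_minus_ge_exp:
  assumes "\<And>q. q \<in> Q \<Longrightarrow> 0 \<le> \<rho> q \<and> \<rho> q \<le> 1 / (2::real)"
  shows "exp (- 2 * (\<Sum>q\<in>Q. \<rho> q)) \<le> (\<Prod>q\<in>Q. 1 - \<rho> q)"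
proof (cases "finite Q")
  case True
  then have "exp (- 2 * (\<Sum>q\<in>Q. \<rho> q)) = (\<Prod>q\<in>Q. exp (- 2 * \<rho> q))"
    by (simp add: sum_distrib_left exp_sum)
  also have "\<dots> \<le> (\<Prod>q\<in>Q. 1 - \<rho> q)"
    by (intro prod_mono conjI one_minus_ge_exp) (use assms in auto)
  finally show ?thesis .
qed simp

lemma ex_double_exp_block:
  assumes "3 \<le> (y::nat)"
  obtains I where "2 ^ 2 ^ I < y" "y \<le> 2 ^ 2 ^ Suc I"
proof -
  have "\<exists>I. y \<le> 2 ^ 2 ^ I"
    by (metis less_exp less_imp_le order.trans)
  define I where "I = (LEAST I. y \<le> 2 ^ 2 ^ I)"
  have I: "y \<le> 2 ^ 2 ^ I" unfolding I_def by (rule LeastI_ex) fact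
  then obtain I' where I': "I = Suc I'" using assms by (cases I) auto
  have "\<not> y \<le> 2 ^ 2 ^ I'" using not_less_Least[of I' "\<lambda>I. y \<le> 2 ^ 2 ^ I"] I' I_def by auto
  then show ?thesis using that[of I'] I I' by auto
qed

lemma in_double_exp_block:
  assumes "2 < (q::nat)" "q \<le> 2 ^ 2 ^ Suc I"
  obtains i where "i \<le> I" "2 ^ 2 ^ i < q" "q \<le> 2 ^ 2 ^ Suc i"
proof -
  obtain i where i: "2 ^ 2 ^ i < q" "q \<le> 2 ^ 2 ^ Suc i" using ex_double_exp_block[of q] assms by auto
  have "(2::nat) ^ 2 ^ i < 2 ^ 2 ^ Suc I" using i(1) assms(2) by (rule less_le_trans)
  then have "(2::nat) ^ i < 2 ^ Suc I" by (rule power_less_imp_less_exp[rotated]) simp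
  then have "i < Suc I" by (rule power_less_imp_less_exp[rotated]) simp
  then have "i \<le> I" by (simp only: less_Suc_eq_le)
  from that[OF this i] show ?thesis .
qed

text \<open>The primes are cut at the numbers \<open>2 ^ 2 ^ i\<close>, so that the densities sum to
  at most \<open>10 * \<kappa>\<close> on every block. The relative error is exponentially small in
  \<open>b\<close>, while the remainder stays a power of \<open>y\<close> with exponent linear in
  \<open>b\<close>.\<close>

theorem fundamental_lemma:
  fixes g :: "'i \<Rightarrow> real" and hit :: "'i \<Rightarrow> nat set" and h :: "nat \<Rightarrow> nat"
  assumes y: "3 \<le> y" and \<kappa>: "1 \<le> \<kappa>"
    and Q: "\<And>q. q \<in> Q \<Longrightarrow> prime q \<and> 2 * \<kappa> < q \<and> q \<le> y"
    and h: "\<And>q. q \<in> Q \<Longrightarrow> h q \<le> \<kappa>"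
    and b: "exp (60 * real \<kappa>) \<le> 2 ^ b"
    and I: "finite I" and g: "\<And>n. n \<in> I \<Longrightarrow> 0 \<le> g n"
    and X: "0 \<le> X" and r: "0 \<le> r"
    and count: "\<And>T. T \<subseteq> Q \<Longrightarrow>
        \<bar>(\<Sum>n | n \<in> I \<and> T \<subseteq> hit n. g n) - X * (\<Prod>q\<in>T. real (h q) / real q)\<bar> \<le> r * (\<Prod>q\<in>T. real (h q))"
  shows "\<bar>(\<Sum>n | n \<in> I \<and> Q \<inter> hit n = {}. g n) - X * (\<Prod>q\<in>Q. 1 - real (h q) / real q)\<bar>
       \<le> 2 * (exp (60 * real \<kappa>) / 2 ^ b) * X * (\<Prod>q\<in>Q. 1 - real (h q) / real q) + r * real y ^ (16 * b + 25)"
proof -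
  obtain m where m: "2 ^ 2 ^ m < y" "y \<le> 2 ^ 2 ^ Suc m" using ex_double_exp_block[OF y] by blast
  define B where "B i = {q \<in> Q. 2 ^ 2 ^ i < q \<and> q \<le> 2 ^ 2 ^ Suc i}" for i :: nat
  \<comment> \<open>The level rises by 2 per block towards the small primes, which makes the errors
    \<open>\<epsilon> i\<close> a geometric series; small blocks contribute so little to the
    remainder that this is affordable.\<close>
  define lev where "lev i = 2 * b + 2 * (m - i)" for i
  define \<rho> where "\<rho> q = real (h q) / real q" for q
  define A where "A = 10 * real \<kappa>"
  \<comment> \<open>The 6 is 4 + 2: \<open>exp (4 * A)\<close> from
    \<open>power_div_fact_le\<close>, and \<open>exp (2 * A)\<close> for dividing by the product of
    the \<open>1 - \<rho> q\<close>. Here \<open>6 * A\<close> is the \<open>60 * \<kappa>\<close>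
    of the statement.\<close>
  define \<epsilon> where "\<epsilon> i = exp (6 * A) / 4 ^ (Suc (lev i))" for i
  define R where "R i = real (2 ^ (2 ^ (i + 2) * Suc (lev i)))" for i
  have finQ: "finite Q" by (rule finite_subset[of _ "{..y}"]) (use Q in auto)
  have UB: "(\<Union>i\<in>{..m}. B i) = Q"
  proof (intro equalityI subsetI)
    fix q assume q: "q \<in> Q"
    then have "2 < q" "q \<le> 2 ^ 2 ^ Suc m" using Q[OF q] \<kappa> m by auto
    then obtain i where "i \<le> m" "2 ^ 2 ^ i < q" "q \<le> 2 ^ 2 ^ Suc i" by (rule in_double_exp_block)
    then show "q \<in> (\<Union>i\<in>{..m}. B i)" using q by (auto simp: B_def)
  qed (auto simp: B_def)
  have disj: "disjoint_family_on B {..m}"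
  proof -
    have "B i \<inter> B j = {}" if "i < j" for i j
    proof -
      have le: "(2::nat) ^ 2 ^ Suc i \<le> 2 ^ 2 ^ j" using that by (intro power_increasing) auto
      show ?thesis
      proof (rule ccontr)
        assume "B i \<inter> B j \<noteq> {}"
        then obtain x :: nat where "2 ^ 2 ^ j < x" "x \<le> 2 ^ 2 ^ Suc i" unfolding B_def by blast
        then have "(2::nat) ^ 2 ^ j < 2 ^ 2 ^ Suc i" by (rule less_le_trans)
        with leD[OF le] show False by (rule notE)
      qed
    qed
    then have "B i \<inter> B j = {}" if "i \<noteq> j" for i j
      using that by (cases "i < j") (simp, metis Int_commute linorder_neqE_nat)
    then show ?thesis by (auto simp only: disjoint_family_on_def)
  qed
  have \<rho>: "0 \<le> \<rho> q" "\<rho> q \<le> 1 / 2" if "q \<in> Q" for q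
  proof -
    have "2 * h q \<le> q" using Q[OF that] h[OF that] by linarith
    then have "2 * real (h q) \<le> real q" by (metis of_nat_le_iff of_nat_mult of_nat_numeral)
    then show "0 \<le> \<rho> q" "\<rho> q \<le> 1 / 2" using Q[OF that] by (auto simp: \<rho>_def field_simps)
  qed
  have \<sigma>: "(\<Sum>q\<in>B i. \<rho> q) \<le> A" for i
  proof -
    have "(\<Sum>q\<in>B i. \<rho> q) \<le> (\<Sum>q\<in>B i. real \<kappa> * (1 / real q))"
      unfolding \<rho>_def by (intro sum_mono) (use h in \<open>auto simp: B_def divide_right_mono\<close>)
    also have "\<dots> = real \<kappa> * (\<Sum>q\<in>B i. 1 / real q)" by (simp add: sum_distrib_left)
    also have "\<dots> \<le> real \<kappa> * 10"
    proof (rule mult_left_mono)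
    show "(\<Sum>q\<in>B i. 1 / real q) \<le> 10"
    proof (rule sum_prime_inverse_block_le)
      show "2 \<le> (2::nat) ^ 2 ^ i" using self_le_power[of "2::nat" "2 ^ i"] by simp
      show "(2::nat) ^ 2 ^ Suc i \<le> (2 ^ 2 ^ i)\<^sup>2" by (simp add: power_mult[symmetric] mult.commute)
    qed (use Q in \<open>auto simp: B_def\<close>)
    qed simp
    finally show ?thesis by (simp add: A_def mult.commute)
  qed
  have A0: "0 \<le> A" by (simp add: A_def)
  have eps: "esym (Suc (lev i)) \<rho> (B i) \<le> \<epsilon> i * (\<Prod>q\<in>B i. 1 - \<rho> q)" for i
  proof -
    have "esym (Suc (lev i)) \<rho> (B i) \<le> (\<Sum>q\<in>B i. \<rho> q) ^ Suc (lev i) / fact (Suc (lev i))"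
      by (rule esym_le) (use finQ \<rho> in \<open>auto simp: B_def\<close>)
    also have "\<dots> \<le> A ^ Suc (lev i) / fact (Suc (lev i))"
      by (intro divide_right_mono power_mono \<sigma> sum_nonneg) (use \<rho> in \<open>auto simp: B_def simp del: fact_Suc\<close>)
    also have "\<dots> \<le> exp (4 * A) / 4 ^ Suc (lev i)" by (rule power_div_fact_le[OF A0])
    also have "\<dots> = \<epsilon> i * exp (- 2 * A)" by (simp add: \<epsilon>_def exp_add[symmetric])
    also have "\<dots> \<le> \<epsilon> i * exp (- 2 * (\<Sum>q\<in>B i. \<rho> q))"
      using \<sigma>[of i] by (intro mult_left_mono) (auto simp: \<epsilon>_def)
    also have "\<dots> \<le> \<epsilon> i * (\<Prod>q\<in>B i. 1 - \<rho> q)"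
      by (intro mult_left_mono prod_one_minus_ge_exp) (use \<rho> in \<open>auto simp: B_def \<epsilon>_def\<close>)
    finally show ?thesis .
  qed
  define E where "E = exp (60 * real \<kappa>) / 2 ^ b"
  have E: "(\<Sum>i\<in>{..m}. \<epsilon> i) \<le> E"
  proof -
    have "(\<Sum>i\<in>{..m}. \<epsilon> i) \<le> (\<Sum>i\<in>{..m}. E * (1 / 4) * (1 / 2) ^ (m - i))"
    proof (rule sum_mono)
      fix i assume "i \<in> {..m}"
      have "(2::real) ^ b * (4 * 2 ^ (m - i)) \<le> 4 ^ (Suc (lev i))"
      proof -
        have "(2::real) ^ b \<le> 4 ^ (2 * b)" using power_increasing[of b "4 * b" "2::real"] by (simp add: power_mult)
        moreover have "(2::real) ^ (m - i) \<le> 4 ^ (2 * (m - i))"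
          using power_increasing[of "m - i" "4 * (m - i)" "2::real"] by (simp add: power_mult)
        ultimately have "(2::real) ^ b * 2 ^ (m - i) \<le> 4 ^ (2 * b) * 4 ^ (2 * (m - i))" by (intro mult_mono) auto
        then show ?thesis by (simp add: lev_def power_add)
      qed
      then have "exp (60 * real \<kappa>) / 4 ^ (Suc (lev i)) \<le> exp (60 * real \<kappa>) / (2 ^ b * (4 * 2 ^ (m - i)))"
        by (intro divide_left_mono) auto
      then show "\<epsilon> i \<le> E * (1 / 4) * (1 / 2) ^ (m - i)"
        by (simp add: \<epsilon>_def A_def E_def power_divide)
    qed
    also have "\<dots> = E * (1 / 4) * (\<Sum>i\<in>{..m}. (1 / 2) ^ (m - i))" by (simp add: sum_distrib_left)
    also have "(\<Sum>i\<in>{..m}. (1 / 2 :: real) ^ (m - i)) = (\<Sum>i\<in>{..m}. (1 / 2) ^ i)"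
      using sum.nat_diff_reindex[of "\<lambda>i. (1 / 2 :: real) ^ i" "Suc m"] by (simp add: lessThan_Suc_atMost)
    also have "(\<Sum>i\<in>{..m}. (1 / 2 :: real) ^ i) = 2 - (1 / 2) ^ m" by (induction m) auto
    also have "E * (1 / 4) * (2 - (1 / 2) ^ m) \<le> E * (1 / 4) * 4"
    proof (rule mult_left_mono)
      show "2 - (1 / 2) ^ m \<le> (4 :: real)"
        using zero_le_power[of "1 / 2 :: real" m] by linarith
    qed (simp add: E_def)
    finally show ?thesis by simp
  qed
  have E1: "E \<le> 1" using b by (simp add: E_def)
  have R: "(\<Sum>T\<in>Pow (B i). if card T \<le> Suc (lev i) then \<Prod>q\<in>T. real (h q) else 0) \<le> R i" for i
  proof (cases "B i = {}")
    case True
    have "(1::real) \<le> 2 ^ (2 ^ (i + 2) * Suc (lev i))" by (rule one_le_power) simp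
    with True show ?thesis by (simp add: R_def)
  next
    case False
    let ?v = "2 ^ 2 ^ Suc i :: nat"
    from False obtain q where q: "q \<in> Q" "q \<le> ?v" by (auto simp: B_def)
    then have \<kappa>v: "2 * \<kappa> < ?v" using Q by fastforce
    have "card (B i) \<le> card {2..?v}" by (rule card_mono) (use Q prime_ge_2_nat in \<open>auto simp: B_def\<close>)
    then have c: "card (B i) \<le> ?v - 1" by simp
    \<comment> \<open>As the block is nonempty, \<open>\<kappa>\<close> is smaller than the upper
      end \<open>?v\<close>, as is the number of its primes; so one subset element costs at most
      \<open>?v\<close> squared.\<close>
    have "1 + \<kappa> * card (B i) \<le> ?v * ?v"
    proof -
      have "\<kappa> * card (B i) \<le> ?v * (?v - 1)" using c \<kappa>v by (intro mult_le_mono) auto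
      also have "\<dots> + 1 \<le> ?v * ?v" using \<kappa>v by (cases ?v) auto
      finally show ?thesis by simp
    qed
    then have "real (1 + \<kappa> * card (B i)) \<le> real (?v * ?v)" by (rule of_nat_mono)
    then have c2: "1 + real \<kappa> * real (card (B i)) \<le> real (2 ^ 2 ^ (i + 2))"
      by (simp add: power_add[symmetric] mult_2[symmetric])
    have "(\<Sum>T\<in>Pow (B i). if card T \<le> Suc (lev i) then \<Prod>q\<in>T. real (h q) else 0)
        \<le> (1 + real \<kappa> * real (card (B i))) ^ Suc (lev i)"
      by (rule sum_card_le_prod_le) (use finQ h in \<open>auto simp: B_def\<close>)
    also have "\<dots> \<le> real (2 ^ 2 ^ (i + 2)) ^ Suc (lev i)" by (intro power_mono c2) auto
    also have "\<dots> = R i" by (simp only: R_def power_mult of_nat_power)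
    finally show ?thesis .
  qed
  have "\<bar>(\<Sum>n | n \<in> I \<and> (\<Union>i\<in>{..m}. B i) \<inter> hit n = {}. g n) - X * (\<Prod>q\<in>(\<Union>i\<in>{..m}. B i). 1 - \<rho> q)\<bar>
       \<le> 2 * E * X * (\<Prod>q\<in>(\<Union>i\<in>{..m}. B i). 1 - \<rho> q) + (1 + real (card {..m})) * r * (\<Prod>i\<in>{..m}. R i)"
  proof (rule brun_hooley[where b = lev and \<epsilon> = \<epsilon> and h = "\<lambda>q. real (h q)" and r = r and R = R])
    show "finite (B j)" for j using finQ by (simp add: B_def)
    show "0 \<le> \<rho> q \<and> \<rho> q < 1" if "q \<in> B j" for j q
      using \<rho>[of q] that by (auto simp: B_def)
    show "\<bar>(\<Sum>n | n \<in> I \<and> T \<subseteq> hit n. g n) - X * (\<Prod>q\<in>T. \<rho> q)\<bar> \<le> r * (\<Prod>q\<in>T. real (h q))"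
      if "T \<subseteq> (\<Union>i\<in>{..m}. B i)" for T
      using count[of T] that unfolding UB \<rho>_def by blast
    show "even (lev j)" for j by (simp add: lev_def)
  qed (use disj I g X r eps E E1 R in auto)
  then have main: "\<bar>(\<Sum>n | n \<in> I \<and> Q \<inter> hit n = {}. g n) - X * (\<Prod>q\<in>Q. 1 - \<rho> q)\<bar>
       \<le> 2 * E * X * (\<Prod>q\<in>Q. 1 - \<rho> q) + (1 + real (card {..m})) * r * (\<Prod>i\<in>{..m}. R i)"
    unfolding UB .
  \<comment> \<open>The block exponents add up to \<open>8 * (2 * b + 1) + 16\<close>, that is
    \<open>16 * b + 24\<close>; one more power of \<open>y\<close> absorbs the number of
    blocks.\<close>
  have "(1 + real (card {..m})) * (\<Prod>i\<in>{..m}. R i) \<le> real y * real y ^ (16 * b + 24)"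
  proof (intro mult_mono)
    have "m + 2 \<le> 2 ^ 2 ^ m"
    proof (induction m)
      case (Suc m)
      have "(2::nat) ^ 2 ^ m * 2 \<le> 2 ^ 2 ^ m * 2 ^ 2 ^ m"
        using self_le_power[of "2::nat" "2 ^ m"] by (intro mult_le_mono) auto
      then show ?case using Suc by (simp add: power_add[symmetric] mult_2[symmetric])
    qed simp
    then show "1 + real (card {..m}) \<le> real y" using m by simp
    have "(\<Prod>i\<in>{..m}. R i) = real (2 ^ (\<Sum>i\<le>m. 2 ^ (i + 2) * Suc (lev i)))"
      by (simp add: R_def power_sum)
    also have "\<dots> \<le> real (2 ^ (2 ^ m * (16 * b + 24)))"
    proof (intro of_nat_mono power_increasing)
      have "(\<Sum>i\<le>m. 2 ^ (i + 2) * Suc (lev i)) = (\<Sum>i\<le>m. 2 ^ (i + 2) * ((2 * b + 1) + 2 * (m - i)))"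
        by (simp add: lev_def)
      also have "\<dots> \<le> 2 ^ m * (8 * (2 * b + 1) + 16)" by (rule block_exponent_sum)
      finally show "(\<Sum>i\<le>m. 2 ^ (i + 2) * Suc (lev i)) \<le> 2 ^ m * (16 * b + 24)" by (simp add: add.commute)
    qed auto
    also have "\<dots> = real ((2 ^ 2 ^ m) ^ (16 * b + 24))" by (simp add: power_mult)
    also have "\<dots> \<le> real (y ^ (16 * b + 24))" using m by (intro of_nat_mono power_mono) auto
    finally show "(\<Prod>i\<in>{..m}. R i) \<le> real y ^ (16 * b + 24)" by simp
  qed (auto simp: R_def intro!: prod_nonneg)
  moreover have eq: "real y * real y ^ (16 * b + 24) = real y ^ (16 * b + 25)"
    unfolding power_Suc[symmetric] by (simp add: add.commute)
  ultimately have le: "(1 + real (card {..m})) * (\<Prod>i\<in>{..m}. R i) \<le> real y * real y ^ (16 * b + 24)" by simp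
  from mult_left_mono[OF le r]
  have "(1 + real (card {..m})) * r * (\<Prod>i\<in>{..m}. R i) \<le> r * real y ^ (16 * b + 25)"
    unfolding eq by (simp only: mult_ac)
  with main show ?thesis unfolding \<rho>_def E_def by linarith
qed

section \<open>Equidistribution of monotone weights in residue classes\<close>

text \<open>Shifting the class \<open>c\<close> down by \<open>s < m\<close> lands in the class
  \<open>c'\<close> and does not decrease the weights. At most one element lies too close to
  \<open>N1\<close> to be shifted; it costs \<open>g N1\<close>.\<close>

lemma sum_residue_interlace:
  fixes g :: "nat \<Rightarrow> real"
  assumes m: "0 < m" and c: "c < m" "c' < m"
    and g: "\<And>n. 0 \<le> g n" "\<And>i j. N1 \<le> i \<Longrightarrow> i \<le> j \<Longrightarrow> g j \<le> g i"
  shows "(\<Sum>n | n \<in> {N1..N2} \<and> n mod m = c. g n) \<le> g N1 + (\<Sum>n | n \<in> {N1..N2} \<and> n mod m = c'. g n)"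
proof -
  define s where "s = (c + m - c') mod m"
  have s: "s < m" using m by (simp add: s_def)
  define A where "A = {n. n \<in> {N1..N2} \<and> n mod m = c}"
  have fin: "finite A" by (simp add: A_def)
  define A1 where "A1 = {n \<in> A. n < N1 + s}"
  define A2 where "A2 = {n \<in> A. N1 + s \<le> n}"
  have "sum g A = sum g A1 + sum g A2"
    unfolding A1_def A2_def using fin by (subst sum.union_disjoint[symmetric]) (auto intro: sum.cong)
  also have "sum g A1 \<le> g N1"
  proof (cases "A1 = {}")
    case False
    then obtain n where n: "n \<in> A1" by auto
    have "A1 = {n}"
    proof -
      have le: "i = j" if "i \<in> A1" "j \<in> A1" "i \<le> j" for i j
      proof -
        have "m dvd j - i" using that by (auto simp: A1_def A_def mod_eq_dvd_iff_nat[symmetric])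
        moreover have "j - i < m" using that s by (auto simp: A1_def A_def)
        ultimately show ?thesis using that by (auto dest: dvd_imp_le)
      qed
      have "n' = n" if n': "n' \<in> A1" for n'
      proof (cases "n \<le> n'")
        case True
        from le[OF n n' True] show ?thesis by simp
      next
        case False
        then have "n' \<le> n" by simp
        from le[OF n' n this] show ?thesis .
      qed
      with n show ?thesis by blast
    qed
    then show ?thesis using n g(2) by (auto simp: A1_def A_def)
  qed (simp add: g)
  also have "sum g A2 \<le> (\<Sum>n\<in>A2. g (n - s))"
    by (intro sum_mono g) (auto simp: A2_def)
  also have "\<dots> = sum g ((\<lambda>n. n - s) ` A2)"
    by (subst sum.reindex) (auto simp: inj_on_def A2_def)
  also have "\<dots> \<le> (\<Sum>n | n \<in> {N1..N2} \<and> n mod m = c'. g n)"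
  proof (intro sum_mono2)
    show "(\<lambda>n. n - s) ` A2 \<subseteq> {n \<in> {N1..N2}. n mod m = c'}"
    proof safe
      fix n assume n: "n \<in> A2"
      then have "[n - s + s = c' + s] (mod m)"
      proof -
        have "[c' + s = c' + (c + m - c')] (mod m)" unfolding s_def by (simp add: cong_def mod_add_right_eq)
        moreover have "c' + (c + m - c') = c + m" using c by simp
        moreover have "[n = c + m] (mod m)" using n c by (auto simp: A2_def A_def cong_def)
        moreover have "n - s + s = n" using n by (auto simp: A2_def)
        ultimately show ?thesis by (metis cong_sym cong_trans)
      qed
      then have "[n - s = c'] (mod m)" by (simp add: cong_add_rcancel_nat)
      then show "(n - s) mod m = c'" using c by (simp add: cong_def)
      show "n - s \<in> {N1..N2}" using n by (auto simp: A2_def A_def)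
    qed
  qed (use g in auto)
  finally show ?thesis by (simp add: A_def)
qed

text \<open>Any two class sums differ by at most \<open>g N1\<close>, so each differs from their
  mean by at most \<open>g N1\<close>.\<close>

lemma sum_residue_set:
  fixes g :: "nat \<Rightarrow> real"
  assumes m: "0 < m" and C: "C \<subseteq> {..<m}"
    and g: "\<And>n. 0 \<le> g n" "\<And>i j. N1 \<le> i \<Longrightarrow> i \<le> j \<Longrightarrow> g j \<le> g i"
  shows "\<bar>(\<Sum>n | n \<in> {N1..N2} \<and> n mod m \<in> C. g n) - real (card C) / real m * (\<Sum>n\<in>{N1..N2}. g n)\<bar>
       \<le> real (card C) * g N1"
proof -
  define S where "S c = (\<Sum>n | n \<in> {N1..N2} \<and> n mod m = c. g n)" for c
  have finC: "finite C" using C by (rule finite_subset) simp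
  have part: "(\<Sum>n | n \<in> {N1..N2} \<and> n mod m \<in> D. g n) = (\<Sum>c\<in>D. S c)" if "finite D" for D
    unfolding S_def using that
    by (subst sum.UNION_disjoint[symmetric]) (auto intro!: sum.cong)
  have tot: "(\<Sum>n\<in>{N1..N2}. g n) = (\<Sum>c\<in>{..<m}. S c)"
  proof -
    have "{n. n \<in> {N1..N2} \<and> n mod m \<in> {..<m}} = {N1..N2}" using m by auto
    then show ?thesis using part[of "{..<m}"] by simp
  qed
  have one: "\<bar>S c - (\<Sum>n\<in>{N1..N2}. g n) / real m\<bar> \<le> g N1" if c: "c \<in> C" for c
  proof -
    have d: "\<bar>S c - S c'\<bar> \<le> g N1" if "c' \<in> {..<m}" for c'
      using sum_residue_interlace[where g = g and m = m and c = c and c' = c' and ?N1.0 = N1 and ?N2.0 = N2]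
        sum_residue_interlace[where g = g and m = m and c = c' and c' = c and ?N1.0 = N1 and ?N2.0 = N2]
        m C c that g unfolding S_def by (fastforce simp: abs_le_iff)
    have "real m * (S c - (\<Sum>n\<in>{N1..N2}. g n) / real m) = (\<Sum>c'\<in>{..<m}. S c - S c')"
      using m by (simp add: tot sum_subtractf right_diff_distrib)
    also have "\<bar>\<dots>\<bar> \<le> (\<Sum>c'\<in>{..<m}. g N1)"
      by (rule order_trans[OF sum_abs]) (intro sum_mono d)
    finally show ?thesis using m by (simp add: abs_mult)
  qed
  have "(\<Sum>n | n \<in> {N1..N2} \<and> n mod m \<in> C. g n) - real (card C) / real m * (\<Sum>n\<in>{N1..N2}. g n)
      = (\<Sum>c\<in>C. S c - (\<Sum>n\<in>{N1..N2}. g n) / real m)"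
    using part[OF finC] by (simp add: sum_subtractf)
  also have "\<bar>\<dots>\<bar> \<le> (\<Sum>c\<in>C. g N1)"
    by (rule order_trans[OF sum_abs]) (intro sum_mono one)
  finally show ?thesis by simp
qed

lemma combine_residue_sets:
  fixes a b :: nat
  assumes "coprime a b" "0 < a" "0 < b" "A \<subseteq> {..<a}" "B \<subseteq> {..<b}"
  shows "\<exists>C. C \<subseteq> {..<a * b} \<and> card C = card A * card B \<and>
    (\<forall>n. n mod (a * b) \<in> C \<longleftrightarrow> n mod a \<in> A \<and> n mod b \<in> B)"
proof -
  define C where "C = {r. r < a * b \<and> r mod a \<in> A \<and> r mod b \<in> B}"
  have uniq: "\<exists>!x. x < a * b \<and> [x = u] (mod a) \<and> [x = v] (mod b)" for u v
    by (rule binary_chinese_remainder_unique_nat) (use assms in auto)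
  have "bij_betw (\<lambda>r. (r mod a, r mod b)) C (A \<times> B)"
  proof (rule bij_betwI')
    fix x x' assume "x \<in> C" "x' \<in> C"
    moreover have "x = x'" if "x mod a = x' mod a" "x mod b = x' mod b"
    proof (rule ex1E[OF uniq[of x x]])
      fix z assume z: "\<forall>y. y < a * b \<and> [y = x] (mod a) \<and> [y = x] (mod b) \<longrightarrow> y = z"
      have "x = z" "x' = z" using z[rule_format, of x] z[rule_format, of x'] calculation that
        by (auto simp: C_def cong_def)
      then show ?thesis by simp
    qed
    ultimately show "((x mod a, x mod b) = (x' mod a, x' mod b)) = (x = x')" by auto
  next
    fix p assume "p \<in> A \<times> B"
    then obtain u v where p: "p = (u, v)" "u \<in> A" "v \<in> B" by auto
    obtain x where x: "x < a * b" "[x = u] (mod a)" "[x = v] (mod b)" using uniq[of u v] by auto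
    have "u < a" "v < b" using p assms by auto
    then have "x mod a = u" "x mod b = v" using x by (auto simp: cong_def)
    with p x show "\<exists>x\<in>C. p = (x mod a, x mod b)" by (auto simp: C_def intro!: bexI[of _ x])
  qed (auto simp: C_def)
  then have "card C = card A * card B" by (simp add: bij_betw_same_card card_cartesian_product)
  moreover have "n mod (a * b) \<in> C \<longleftrightarrow> n mod a \<in> A \<and> n mod b \<in> B" for n
    using assms by (simp add: C_def mod_mult2_eq' mod_mod_cancel)
  ultimately show ?thesis by (intro exI[of _ C]) (auto simp: C_def)
qed

lemma combine_prime_residue_sets:
  fixes M c :: nat and \<Omega> :: "nat \<Rightarrow> nat set"
  assumes "finite T" "0 < M" "\<And>q. q \<in> T \<Longrightarrow> prime q \<and> \<not> q dvd M \<and> \<Omega> q \<subseteq> {..<q}"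
  shows "\<exists>C. C \<subseteq> {..<M * \<Prod>T} \<and> card C = (\<Prod>q\<in>T. card (\<Omega> q)) \<and>
    (\<forall>n. n mod (M * \<Prod>T) \<in> C \<longleftrightarrow> [n = c] (mod M) \<and> (\<forall>q\<in>T. n mod q \<in> \<Omega> q))"
  using assms(1,3)
proof (induction T rule: finite_induct)
  case empty
  show ?case
    by (rule exI[of _ "{c mod M}"]) (use assms(2) in \<open>auto simp: cong_def\<close>)
next
  case (insert p T)
  have "\<exists>C. C \<subseteq> {..<M * \<Prod>T} \<and> card C = (\<Prod>q\<in>T. card (\<Omega> q)) \<and>
    (\<forall>n. n mod (M * \<Prod>T) \<in> C \<longleftrightarrow> [n = c] (mod M) \<and> (\<forall>q\<in>T. n mod q \<in> \<Omega> q))"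
    by (rule insert.IH) (use insert.prems in auto)
  then obtain C where C: "C \<subseteq> {..<M * \<Prod>T}" "card C = (\<Prod>q\<in>T. card (\<Omega> q))"
    "\<And>n. n mod (M * \<Prod>T) \<in> C \<longleftrightarrow> [n = c] (mod M) \<and> (\<forall>q\<in>T. n mod q \<in> \<Omega> q)" by auto
  have pp: "prime p" "\<not> p dvd M" "\<Omega> p \<subseteq> {..<p}" using insert.prems by auto
  have "coprime p q" if "q \<in> T" for q
    using insert.hyps(2) insert.prems(1)[of q] that pp(1) by (intro primes_coprime) auto
  then have "coprime p (\<Prod>T)" by (intro prod_coprime_right)
  moreover have "coprime p M" using pp by (simp add: prime_imp_coprime)
  ultimately have cop: "coprime (M * \<Prod>T) p" by (simp add: coprime_commute)
  have pos: "0 < M * \<Prod>T" "0 < p"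
    using assms(2) insert.prems pp(1) by (auto intro!: prod_pos simp: prime_gt_0_nat)
  obtain D where D: "D \<subseteq> {..<M * \<Prod>T * p}" "card D = card C * card (\<Omega> p)"
    "\<And>n. n mod (M * \<Prod>T * p) \<in> D \<longleftrightarrow> n mod (M * \<Prod>T) \<in> C \<and> n mod p \<in> \<Omega> p"
    using combine_residue_sets[OF cop pos C(1) pp(3)] by metis
  show ?case
    by (rule exI[of _ D])
       (use D C insert.hyps in \<open>auto simp: mult_ac\<close>)
qed

text \<open>The abstract sieve with remainder \<open>g N1\<close>: by the Chinese remainder theorem
  the conditions at the primes of \<open>T\<close> together with the class modulo \<open>M\<close>
  select a set of classes modulo \<open>M * \<Prod>T\<close>, as many as the product of the
  \<open>card (\<Omega> q)\<close>.\<close>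

theorem sieve_AP:
  fixes g :: "nat \<Rightarrow> real" and \<Omega> :: "nat \<Rightarrow> nat set"
  assumes y: "3 \<le> y" and \<kappa>: "1 \<le> \<kappa>" and M: "0 < M"
    and Q: "\<And>q. q \<in> Q \<Longrightarrow> prime q \<and> 2 * \<kappa> < q \<and> q \<le> y \<and> \<not> q dvd M"
    and \<Omega>: "\<And>q. q \<in> Q \<Longrightarrow> \<Omega> q \<subseteq> {..<q} \<and> card (\<Omega> q) \<le> \<kappa>"
    and b: "exp (60 * real \<kappa>) \<le> 2 ^ b"
    and g: "\<And>n. 0 \<le> g n" "\<And>i j. N1 \<le> i \<Longrightarrow> i \<le> j \<Longrightarrow> g j \<le> g i"
  shows "\<bar>(\<Sum>n | n \<in> {N1..N2} \<and> [n = c] (mod M) \<and> (\<forall>q\<in>Q. n mod q \<notin> \<Omega> q). g n)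
           - (\<Sum>n\<in>{N1..N2}. g n) / real M * (\<Prod>q\<in>Q. 1 - real (card (\<Omega> q)) / real q)\<bar>
       \<le> 2 * (exp (60 * real \<kappa>) / 2 ^ b) * ((\<Sum>n\<in>{N1..N2}. g n) / real M) * (\<Prod>q\<in>Q. 1 - real (card (\<Omega> q)) / real q)
         + g N1 * real y ^ (16 * b + 25)"
proof -
  define I where "I = {n \<in> {N1..N2}. [n = c] (mod M)}"
  define hit where "hit n = {q. n mod q \<in> \<Omega> q}" for n
  have finQ: "finite Q" by (rule finite_subset[of _ "{..y}"]) (use Q in auto)
  have eq: "{n. n \<in> {N1..N2} \<and> [n = c] (mod M) \<and> (\<forall>q\<in>Q. n mod q \<notin> \<Omega> q)} = {n. n \<in> I \<and> Q \<inter> hit n = {}}"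
    by (auto simp: I_def hit_def)
  show ?thesis unfolding eq
  proof (rule fundamental_lemma[OF y \<kappa>])
    fix T assume T: "T \<subseteq> Q"
    obtain C where C: "C \<subseteq> {..<M * \<Prod>T}" "card C = (\<Prod>q\<in>T. card (\<Omega> q))"
      "\<And>n. n mod (M * \<Prod>T) \<in> C \<longleftrightarrow> [n = c] (mod M) \<and> (\<forall>q\<in>T. n mod q \<in> \<Omega> q)"
    proof -
      have "\<exists>C. C \<subseteq> {..<M * \<Prod>T} \<and> card C = (\<Prod>q\<in>T. card (\<Omega> q)) \<and>
        (\<forall>n. n mod (M * \<Prod>T) \<in> C \<longleftrightarrow> [n = c] (mod M) \<and> (\<forall>q\<in>T. n mod q \<in> \<Omega> q))"
        by (rule combine_prime_residue_sets) (use T finQ Q \<Omega> M in \<open>auto intro: finite_subset\<close>)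
      then show ?thesis using that by blast
    qed
    have pos: "0 < M * \<Prod>T"
      using M T Q by (auto intro!: prod_pos simp: prime_gt_0_nat)
    have "\<bar>(\<Sum>n | n \<in> {N1..N2} \<and> n mod (M * \<Prod>T) \<in> C. g n) - real (card C) / real (M * \<Prod>T) * (\<Sum>n\<in>{N1..N2}. g n)\<bar>
       \<le> real (card C) * g N1"
      by (rule sum_residue_set) (use pos C g in auto)
    moreover have "{n. n \<in> {N1..N2} \<and> n mod (M * \<Prod>T) \<in> C} = {n. n \<in> I \<and> T \<subseteq> hit n}"
      using C(3) by (auto simp: I_def hit_def)
    ultimately show "\<bar>(\<Sum>n | n \<in> I \<and> T \<subseteq> hit n. g n)
         - (\<Sum>n\<in>{N1..N2}. g n) / real M * (\<Prod>q\<in>T. real (card (\<Omega> q)) / real q)\<bar>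
       \<le> g N1 * (\<Prod>q\<in>T. real (card (\<Omega> q)))"
      using C(2) by (simp add: prod_dividef mult.commute)
  qed (use Q \<Omega> b g in \<open>auto simp: I_def intro!: divide_nonneg_nonneg sum_nonneg\<close>)
qed

section \<open>Dirichlet characters\<close>

text \<open>
  A character of the subgroup \<open>H\<close> of the units modulo \<open>M\<close>, with \<open>H\<close> and the character lifted to the naturals;
  extending such characters one generator at a time yields enough of them to separate residues.
\<close>
definition partial_char :: "nat \<Rightarrow> nat set \<Rightarrow> (nat \<Rightarrow> complex) \<Rightarrow> bool" where
  "partial_char M H \<xi> \<longleftrightarrow> 1 \<in> H \<and> (\<forall>a\<in>H. \<forall>b\<in>H. a * b \<in> H \<and> \<xi> (a * b) = \<xi> a * \<xi> b)
     \<and> (\<forall>a\<in>H. \<forall>b. [a = b] (mod M) \<longrightarrow> b \<in> H \<and> \<xi> b = \<xi> a)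
     \<and> (\<forall>a\<in>H. coprime a M) \<and> \<xi> 1 = 1"

lemma partial_charD:
  assumes "partial_char M H \<xi>"
  shows "1 \<in> H" "a \<in> H \<Longrightarrow> b \<in> H \<Longrightarrow> a * b \<in> H" "a \<in> H \<Longrightarrow> b \<in> H \<Longrightarrow> \<xi> (a * b) = \<xi> a * \<xi> b"
    "a \<in> H \<Longrightarrow> [a = b] (mod M) \<Longrightarrow> b \<in> H" "a \<in> H \<Longrightarrow> [a = b] (mod M) \<Longrightarrow> \<xi> b = \<xi> a"
    "a \<in> H \<Longrightarrow> coprime a M" "\<xi> 1 = 1"
  using assms unfolding partial_char_def by blast+

lemma partial_char_power:
  assumes "partial_char M H \<xi>" "a \<in> H"
  shows "a ^ n \<in> H \<and> \<xi> (a ^ n) = \<xi> a ^ n"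
proof (induction n)
  case 0
  then show ?case using partial_charD(1,7)[OF assms(1)] by simp
next
  case (Suc n)
  then show ?case using partial_charD(2,3)[OF assms, of "a ^ n"] by simp
qed

text \<open>\<open>m\<close> is the order of \<open>g\<close> relative to \<open>H\<close>. The
  elements congruent to some \<open>h * g ^ j\<close> form the larger group and receive the value
  \<open>\<xi> h * \<zeta> ^ j\<close>; the condition on \<open>\<zeta> ^ m\<close> makes this
  independent of the representation.\<close>

lemma partial_char_extend:
  assumes P: "partial_char M H \<xi>" and g: "coprime g M" and M: "0 < M"
    and m: "0 < m" "g ^ m \<in> H" "\<And>r. 0 < r \<Longrightarrow> r < m \<Longrightarrow> g ^ r \<notin> H"
    and \<zeta>: "\<zeta> ^ m = \<xi> (g ^ m)"
  obtains H' \<xi>' where "partial_char M H' \<xi>'" "H \<subseteq> H'" "g \<in> H'" "\<And>h. h \<in> H \<Longrightarrow> \<xi>' h = \<xi> h" "\<xi>' g = \<zeta>"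
proof -
  note D = partial_charD[OF P]
  define H' where "H' = {n. \<exists>h\<in>H. \<exists>j. [n = h * g ^ j] (mod M)}"
  \<comment> \<open>\<open>H\<close> is closed under division, since by Euler's theorem
    \<open>h ^ (totient M - 1)\<close> is an inverse of \<open>h\<close>.\<close>
  have divide: "x \<in> H" if "h \<in> H" "h * x \<in> H" "coprime x M" for h x
  proof -
    have 1: "h ^ (totient M - 1) * (h * x) \<in> H"
      using partial_char_power[OF P that(1)] that(2) D(2) by blast
    have 2: "h ^ (totient M - 1) * (h * x) = h ^ totient M * x"
      using M by (simp add: power_eq_if mult_ac)
    have 3: "[h ^ totient M * x = 1 * x] (mod M)"
      by (intro cong_mult euler_theorem cong_refl) (use D(6)[OF that(1)] in auto)
    show ?thesis using D(4)[OF 1[unfolded 2] 3] by simp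
  qed
  \<comment> \<open>The exponents \<open>d\<close> with \<open>g ^ d\<close> in \<open>H\<close> are
    multiples of the least one: reduce \<open>d\<close> modulo \<open>m\<close> and divide.\<close>
  have mdvd: "m dvd d" if "g ^ d \<in> H" for d
  proof -
    have 1: "g ^ (m * (d div m)) * g ^ (d mod m) \<in> H" using that by (simp add: power_add[symmetric])
    have 2: "g ^ (m * (d div m)) \<in> H" using partial_char_power[OF P m(2)] by (simp add: power_mult)
    have "g ^ (d mod m) \<in> H" by (rule divide[OF 2 1]) (use g in simp)
    then have "d mod m = 0" using m(3)[of "d mod m"] m(1) by (metis mod_less_divisor neq0_conv)
    then show ?thesis by auto
  qed
  have aux: "\<xi> h * \<zeta> ^ i = \<xi> h' * \<zeta> ^ j"
    if "h \<in> H" "h' \<in> H" "[h * g ^ i = h' * g ^ j] (mod M)" "i \<le> j" for h h' i j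
  proof -
    have "[h * g ^ i = h' * g ^ (j - i) * g ^ i] (mod M)"
      using that by (simp add: mult.assoc power_add[symmetric])
    then have c: "[h = h' * g ^ (j - i)] (mod M)"
      using g by (subst (asm) cong_mult_rcancel_nat) auto
    then have "h' * g ^ (j - i) \<in> H" using D(4) that by blast
    then have gH: "g ^ (j - i) \<in> H" using divide[OF that(2)] g by auto
    then obtain q where q: "j - i = m * q" using mdvd by blast
    have "\<xi> (g ^ (j - i)) = \<zeta> ^ (j - i)"
      using partial_char_power[OF P m(2), of q] unfolding q power_mult \<zeta> by simp
    moreover have "\<xi> h = \<xi> h' * \<xi> (g ^ (j - i))"
      using D(5)[OF that(1) c] D(3)[OF that(2) gH] by simp
    ultimately have "\<xi> h * \<zeta> ^ i = \<xi> h' * (\<zeta> ^ (j - i) * \<zeta> ^ i)" by (simp add: mult.assoc)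
    then show ?thesis using that(4) by (simp add: power_add[symmetric])
  qed
  have wd: "\<xi> h * \<zeta> ^ i = \<xi> h' * \<zeta> ^ j"
    if "h \<in> H" "h' \<in> H" "[h * g ^ i = h' * g ^ j] (mod M)" for h h' i j
    using aux[OF that] aux[OF that(2,1) cong_sym[OF that(3)]] by (metis nat_le_linear)
  define \<xi>' where "\<xi>' n = (SOME z. \<exists>h\<in>H. \<exists>j. [n = h * g ^ j] (mod M) \<and> z = \<xi> h * \<zeta> ^ j)" for n
  have val: "\<xi>' n = \<xi> h * \<zeta> ^ j" if "h \<in> H" "[n = h * g ^ j] (mod M)" for n h j
    unfolding \<xi>'_def
  proof (rule some_equality)
    show "\<exists>h'\<in>H. \<exists>j'. [n = h' * g ^ j'] (mod M) \<and> \<xi> h * \<zeta> ^ j = \<xi> h' * \<zeta> ^ j'" using that by blast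
    fix z assume "\<exists>h'\<in>H. \<exists>j'. [n = h' * g ^ j'] (mod M) \<and> z = \<xi> h' * \<zeta> ^ j'"
    then obtain h' j' where h': "h' \<in> H" "[n = h' * g ^ j'] (mod M)" "z = \<xi> h' * \<zeta> ^ j'" by auto
    have "[h' * g ^ j' = h * g ^ j] (mod M)" using h'(2) that(2) by (metis cong_sym cong_trans)
    then show "z = \<xi> h * \<zeta> ^ j" using wd h' that by blast
  qed
  show ?thesis
  proof (rule that[of H' \<xi>'])
    show "H \<subseteq> H'" unfolding H'_def by (auto intro!: bexI exI[of _ 0])
    show "\<xi>' h = \<xi> h" if "h \<in> H" for h using val[OF that, of h 0] by simp
    show "g \<in> H'" unfolding H'_def using D(1) by (auto intro!: bexI[of _ 1] exI[of _ 1])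
    show "\<xi>' g = \<zeta>" using val[OF D(1), of g 1] D(7) by simp
    show "partial_char M H' \<xi>'"
      unfolding partial_char_def
    proof (intro conjI ballI allI impI)
      show "1 \<in> H'" unfolding H'_def using D(1) by (auto intro!: bexI[of _ 1] exI[of _ 0])
      show "\<xi>' 1 = 1" using val[OF D(1), of 1 0] D(7) by simp
      fix a assume "a \<in> H'"
      then obtain h i where a: "h \<in> H" "[a = h * g ^ i] (mod M)" by (auto simp: H'_def)
      show "coprime a M" using a g D(6)[of h] by (metis cong_imp_coprime cong_sym coprime_mult_left_iff coprime_power_left_iff)
      {
        fix b assume "b \<in> H'"
        then obtain h' j where b: "h' \<in> H" "[b = h' * g ^ j] (mod M)" by (auto simp: H'_def)
        have ab: "[a * b = (h * h') * g ^ (i + j)] (mod M)"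
          using cong_mult[OF a(2) b(2)] by (simp add: power_add mult_ac)
        show "a * b \<in> H'" unfolding H'_def using ab D(2)[OF a(1) b(1)] by blast
        show "\<xi>' (a * b) = \<xi>' a * \<xi>' b"
          using val[OF a] val[OF b] val[OF D(2)[OF a(1) b(1)] ab] D(3)[OF a(1) b(1)]
          by (simp add: power_add)
      }
      fix b assume "[a = b] (mod M)"
      then have b: "[b = h * g ^ i] (mod M)" using a by (metis cong_sym cong_trans)
      show "b \<in> H'" unfolding H'_def using a b by blast
      show "\<xi>' b = \<xi>' a" using val[OF a] val[OF a(1) b] by simp
    qed
  qed
qed

lemma partial_char_ex_order:
  assumes "partial_char M H \<xi>" "coprime g M" "0 < M"
  obtains m where "0 < m" "g ^ m \<in> H" "\<And>r. 0 < r \<Longrightarrow> r < m \<Longrightarrow> g ^ r \<notin> H"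
proof -
  have "[1 = g ^ totient M] (mod M)"
    using euler_theorem[of g M] assms(2) by (simp add: coprime_commute cong_sym)
  then have ex: "0 < totient M \<and> g ^ totient M \<in> H"
    using partial_charD(1,4)[OF assms(1)] assms(3) by fastforce
  define m where "m = (LEAST m. 0 < m \<and> g ^ m \<in> H)"
  have "0 < m \<and> g ^ m \<in> H" unfolding m_def by (rule LeastI[of _ "totient M"]) (rule ex)
  moreover have "g ^ r \<notin> H" if "0 < r" "r < m" for r
    using not_less_Least[of r "\<lambda>m. 0 < m \<and> g ^ m \<in> H"] that unfolding m_def by blast
  ultimately show ?thesis using that by blast
qed

text \<open>Complex numbers have \<open>m\<close>-th roots, so a missing unit can always be
  adjoined; each adjunction lowers the number of residues outside the group.\<close>

lemma partial_char_extend_total: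
  assumes "partial_char M H \<xi>" "0 < M"
  obtains H' \<xi>' where "partial_char M H' \<xi>'" "\<And>h. h \<in> H \<Longrightarrow> \<xi>' h = \<xi> h" "H \<subseteq> H'" "\<And>a. coprime a M \<Longrightarrow> a \<in> H'"
proof -
  have "\<exists>H' \<xi>'. partial_char M H' \<xi>' \<and> (\<forall>h\<in>H. \<xi>' h = \<xi> h) \<and> H \<subseteq> H' \<and> (\<forall>a. coprime a M \<longrightarrow> a \<in> H')"
    using assms
  proof (induction "card {a \<in> {..<M}. a \<notin> H}" arbitrary: H \<xi> rule: less_induct)
    case less
    show ?case
    proof (cases "\<forall>a. coprime a M \<longrightarrow> a \<in> H")
      case False
      then obtain g where g: "coprime g M" "g \<notin> H" by auto
      obtain m where m: "0 < m" "g ^ m \<in> H" "\<And>r. 0 < r \<Longrightarrow> r < m \<Longrightarrow> g ^ r \<notin> H"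
        using partial_char_ex_order[OF less.prems(1) g(1) less.prems(2)] by blast
      obtain \<zeta> where \<zeta>: "\<zeta> ^ m = \<xi> (g ^ m)"
        using m(1) by (metis exists_complex_root neq0_conv)
      obtain H1 \<xi>1 where H1: "partial_char M H1 \<xi>1" "H \<subseteq> H1" "g \<in> H1" "\<And>h. h \<in> H \<Longrightarrow> \<xi>1 h = \<xi> h"
        using partial_char_extend[OF less.prems(1) g(1) less.prems(2) m \<zeta>] by metis
      have gM: "g mod M \<in> H1" "g mod M \<notin> H"
        using partial_charD(4)[OF H1(1,3), of "g mod M"] partial_charD(4)[OF less.prems(1), of "g mod M" g] g
        by (auto simp: cong_def)
      have "card {a \<in> {..<M}. a \<notin> H1} < card {a \<in> {..<M}. a \<notin> H}"
      proof (rule psubset_card_mono)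
        show "{a \<in> {..<M}. a \<notin> H1} \<subset> {a \<in> {..<M}. a \<notin> H}"
          using H1(2) gM less.prems(2) by (auto intro!: psubsetI)
      qed simp
      then obtain H' \<xi>' where "partial_char M H' \<xi>'" "\<forall>h\<in>H1. \<xi>' h = \<xi>1 h" "H1 \<subseteq> H'" "\<forall>a. coprime a M \<longrightarrow> a \<in> H'"
        using less.hyps[OF _ H1(1) less.prems(2)] by blast
      then show ?thesis using H1 by (intro exI[of _ H'] exI[of _ \<xi>']) auto
    qed (use less.prems in blast)
  qed
  then show ?thesis using that by blast
qed

section \<open>Characters modulo \<open>M\<close> and their orthogonality\<close>

definition dchars :: "nat \<Rightarrow> (nat \<Rightarrow> complex) set" where
  "dchars M = {\<xi>. (\<forall>a b. \<xi> (a * b) = \<xi> a * \<xi> b) \<and> (\<forall>a b. [a = b] (mod M) \<longrightarrow> \<xi> a = \<xi> b)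
     \<and> \<xi> 1 = 1 \<and> (\<forall>a. \<not> coprime a M \<longrightarrow> \<xi> a = 0)}"

lemma dcharsD:
  assumes "\<xi> \<in> dchars M"
  shows "\<xi> (a * b) = \<xi> a * \<xi> b" "[a = b] (mod M) \<Longrightarrow> \<xi> a = \<xi> b" "\<xi> 1 = 1" "\<not> coprime a M \<Longrightarrow> \<xi> a = 0"
  using assms by (auto simp: dchars_def)

lemma dchars_power: "\<xi> \<in> dchars M \<Longrightarrow> \<xi> (a ^ n) = \<xi> a ^ n"
  by (induction n) (auto simp: dcharsD(1) dcharsD(3)[simplified])

lemma dchars_root:
  assumes "\<xi> \<in> dchars M" "coprime a M"
  shows "\<xi> a ^ totient M = 1"
  using dcharsD(2,3)[OF assms(1)] euler_theorem[of a M] assms(2) dchars_power[OF assms(1), of a]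
  by (metis coprime_commute)

lemma dchars_norm:
  assumes "\<xi> \<in> dchars M" "coprime a M" "0 < M"
  shows "norm (\<xi> a) = 1"
proof (rule power_eq_imp_eq_base)
  show "norm (\<xi> a) ^ totient M = 1 ^ totient M"
    using dchars_root[OF assms(1,2)] by (simp add: norm_power[symmetric])
qed (use assms in auto)

lemma dchars_norm_le:
  assumes "\<xi> \<in> dchars M" "0 < M"
  shows "norm (\<xi> a) \<le> 1"
  using dchars_norm[OF assms(1) _ assms(2), of a] dcharsD(4)[OF assms(1), of a] by (cases "coprime a M") auto

text \<open>Start from the trivial character of the trivial subgroup and send \<open>a\<close> to a
  primitive \<open>m\<close>-th root of unity, \<open>m\<close> being the order of \<open>a\<close>.
  Since \<open>a\<close> is not 1 modulo \<open>M\<close>, \<open>m\<close> is at least 2 and the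
  root differs from 1.\<close>

lemma dchars_separate:
  assumes "coprime a M" "\<not> [a = 1] (mod M)" "0 < M"
  obtains \<xi> where "\<xi> \<in> dchars M" "\<xi> a \<noteq> 1"
proof -
  define H0 where "H0 = {n. [n = 1] (mod M)}"
  have "partial_char M H0 (\<lambda>_. 1)"
    unfolding partial_char_def H0_def mem_Collect_eq Ball_def
  proof (intro conjI allI impI)
    fix x assume x: "[x = 1] (mod M)"
    show "coprime x M" using cong_imp_coprime[OF cong_sym[OF x]] by simp
    show "[x * y = 1] (mod M)" if "[y = 1] (mod M)" for y using cong_mult[OF x that] by simp
    show "[y = 1] (mod M)" if "[x = y] (mod M)" for y using that x by (metis cong_sym cong_trans)
  qed auto
  note H0 = this
  obtain m where m: "0 < m" "a ^ m \<in> H0" "\<And>r. 0 < r \<Longrightarrow> r < m \<Longrightarrow> a ^ r \<notin> H0"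
    using partial_char_ex_order[OF H0 assms(1,3)] by blast
  have m2: "2 \<le> m" using m(1,2) assms(2) by (cases "m = 1") (auto simp: H0_def)
  define \<zeta> where "\<zeta> = cis (2 * pi / real m)"
  have \<zeta>: "\<zeta> ^ m = 1" 
  proof -
    have "\<zeta> ^ m = cis (real m * (2 * pi / real m))" by (simp only: \<zeta>_def Complex.DeMoivre)
    also have "real m * (2 * pi / real m) = 2 * pi" using m2 by simp
    finally show ?thesis by simp
  qed
  have \<zeta>1: "\<zeta> \<noteq> 1"
  proof
    assume "\<zeta> = 1"
    then have "cos (2 * pi / real m) = 1" by (simp add: \<zeta>_def cis.ctr complex_eq_iff)
    moreover have "cos (2 * pi / real m) < cos 0"
      using m2 by (intro cos_monotone_0_pi) (auto simp: field_simps)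
    ultimately show False by simp
  qed
  obtain H1 \<xi>1 where H1: "partial_char M H1 \<xi>1" "a \<in> H1" "\<xi>1 a = \<zeta>"
    using partial_char_extend[OF H0 assms(1,3) m, of \<zeta>] \<zeta> by metis
  obtain H \<xi> where H: "partial_char M H \<xi>" "\<xi> a = \<zeta>" "\<And>b. coprime b M \<Longrightarrow> b \<in> H"
    using partial_char_extend_total[OF H1(1) assms(3)] H1 by metis
  note D = partial_charD[OF H(1)]
  define \<psi> where "\<psi> n = (if coprime n M then \<xi> n else 0)" for n
  have "\<psi> \<in> dchars M"
    unfolding dchars_def mem_Collect_eq
  proof (intro conjI allI impI)
    fix x y
    show "\<psi> (x * y) = \<psi> x * \<psi> y"
      using D(3)[of x y] H(3)[of x] H(3)[of y] by (simp add: \<psi>_def)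
    show "\<psi> x = \<psi> y" if xy: "[x = y] (mod M)"
    proof (cases "coprime x M")
      case True
      then show ?thesis using D(5)[OF H(3)[OF True] xy] cong_imp_coprime[OF xy] by (simp add: \<psi>_def)
    next
      case False
      then have "\<not> coprime y M" using cong_imp_coprime[OF cong_sym[OF xy]] by blast
      then show ?thesis using False by (simp add: \<psi>_def)
    qed
    show "\<psi> x = 0" if "\<not> coprime x M" using that by (simp add: \<psi>_def)
    show "\<psi> 1 = 1" using D(7) by (simp add: \<psi>_def)
  qed
  moreover have "\<psi> a \<noteq> 1" using \<zeta>1 H(2) assms(1) by (simp add: \<psi>_def)
  ultimately show ?thesis using that by blast
qed

lemma finite_dchars:
  assumes "0 < M"
  shows "finite (dchars M)"
proof -
  define Z where "Z = insert 0 {z::complex. z ^ totient M = 1}"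
  have "finite Z" unfolding Z_def using assms by (auto intro!: finite_roots_unity simp: Suc_le_eq)
  then have "finite (PiE {..<M} (\<lambda>_. Z))" by (intro finite_PiE) auto
  moreover have "(\<lambda>\<xi>. restrict \<xi> {..<M}) ` dchars M \<subseteq> PiE {..<M} (\<lambda>_. Z)"
  proof (intro image_subsetI PiE_I)
    fix \<xi> x assume "\<xi> \<in> dchars M" "x \<in> {..<M}"
    then show "restrict \<xi> {..<M} x \<in> Z"
      using dchars_root[of \<xi> M x] dcharsD(4)[of \<xi> M x] by (cases "coprime x M") (auto simp: Z_def)
  qed auto
  ultimately have "finite ((\<lambda>\<xi>. restrict \<xi> {..<M}) ` dchars M)" by (rule finite_subset[rotated])
  moreover have "inj_on (\<lambda>\<xi>. restrict \<xi> {..<M}) (dchars M)"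
  proof (rule inj_onI, rule ext)
    fix \<xi> \<psi> n assume *: "\<xi> \<in> dchars M" "\<psi> \<in> dchars M" "restrict \<xi> {..<M} = restrict \<psi> {..<M}"
    have "\<xi> (n mod M) = \<psi> (n mod M)" using fun_cong[OF *(3), of "n mod M"] assms by simp
    moreover have "[n mod M = n] (mod M)" by (simp add: cong_def)
    ultimately show "\<xi> n = \<psi> n" using dcharsD(2)[OF *(1)] dcharsD(2)[OF *(2)] by metis
  qed
  ultimately show ?thesis by (rule finite_imageD)
qed

text \<open>Multiplication by a character whose value at \<open>a\<close> is not 1 permutes the
  characters and multiplies the sum by that value.\<close>

lemma sum_dchars:
  assumes "0 < M" "coprime a M"
  shows "(\<Sum>\<xi>\<in>dchars M. \<xi> a) = (if [a = 1] (mod M) then of_nat (card (dchars M)) else 0)"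
proof (cases "[a = 1] (mod M)")
  case True
  then have "\<xi> a = 1" if "\<xi> \<in> dchars M" for \<xi> using dcharsD(2)[OF that True] dcharsD(3)[OF that] by simp
  then have "(\<Sum>\<xi>\<in>dchars M. \<xi> a) = (\<Sum>\<xi>\<in>dchars M. 1)" by (intro sum.cong refl)
  then show ?thesis using True by simp
next
  case False
  obtain \<psi> where \<psi>: "\<psi> \<in> dchars M" "\<psi> a \<noteq> 1" using dchars_separate[OF assms(2) False assms(1)] by blast
  define F where "F \<xi> = (\<lambda>n. \<psi> n * \<xi> n)" for \<xi> :: "nat \<Rightarrow> complex"
  have sub: "F ` dchars M \<subseteq> dchars M"
    using \<psi>(1) by (auto simp: F_def dchars_def)
  have inj: "inj_on F (dchars M)"
  proof (rule inj_onI, rule ext)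
    fix \<xi>1 \<xi>2 n assume *: "\<xi>1 \<in> dchars M" "\<xi>2 \<in> dchars M" "F \<xi>1 = F \<xi>2"
    show "\<xi>1 n = \<xi>2 n"
    proof (cases "coprime n M")
      case True
      then have "\<psi> n \<noteq> 0" using dchars_norm[OF \<psi>(1) True assms(1)] by auto
      then show ?thesis using fun_cong[OF *(3), of n] by (simp add: F_def)
    qed (use dcharsD(4)[OF *(1)] dcharsD(4)[OF *(2)] in auto)
  qed
  have im: "F ` dchars M = dchars M"
    by (rule card_subset_eq[OF finite_dchars[OF assms(1)] sub]) (simp add: card_image inj)
  have "(\<Sum>\<xi>\<in>dchars M. \<xi> a) = (\<Sum>\<xi>\<in>F ` dchars M. \<xi> a)" by (simp add: im)
  also have "\<dots> = \<psi> a * (\<Sum>\<xi>\<in>dchars M. \<xi> a)"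
    by (subst sum.reindex[OF inj]) (simp add: F_def sum_distrib_left)
  finally have "(\<psi> a - 1) * (\<Sum>\<xi>\<in>dchars M. \<xi> a) = 0" by (simp add: algebra_simps)
  then show ?thesis using \<psi>(2) False by simp
qed

definition principal :: "nat \<Rightarrow> nat \<Rightarrow> complex" where
  "principal M n = (if coprime n M then 1 else 0)"

lemma principal_in_dchars: "principal M \<in> dchars M"
proof -
  have "coprime a M \<longleftrightarrow> coprime b M" if "[a = b] (mod M)" for a b
    using cong_imp_coprime[OF that] cong_imp_coprime[OF cong_sym[OF that]] by blast
  then show ?thesis unfolding dchars_def principal_def by simp
qed

lemma sum_dchar_period:
  assumes "0 < M" "\<xi> \<in> dchars M"
  shows "(\<Sum>n<M. \<xi> n) = (if \<xi> = principal M then of_nat (totient M) else 0)"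
proof (cases "\<xi> = principal M")
  case True
  have "(\<Sum>n<M. principal M n) = of_nat (card {n \<in> {..<M}. coprime n M})"
    by (simp add: principal_def sum.If_cases Int_def)
  also have "card {n \<in> {..<M}. coprime n M} = totient M"
  proof (cases "M = 1")
    case True
    have "{n \<in> {..<1::nat}. coprime n 1} = {0}" by auto
    then show ?thesis using True by simp
  next
    case False
    then have "{n \<in> {..<M}. coprime n M} = totatives M"
      using assms(1) by (auto simp: totatives_def le_less intro: Nat.gr0I)
    then show ?thesis by (simp add: totient_def)
  qed
  finally show ?thesis using True by simp
next
  case False
  then obtain n where "\<xi> n \<noteq> principal M n" by auto
  then have n: "coprime n M" "\<xi> n \<noteq> 1"
    using dcharsD(4)[OF assms(2), of n] by (auto simp: principal_def split: if_splits)
  define F where "F k = (n * k) mod M" for k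
  have \<xi>F: "\<xi> (F k) = \<xi> n * \<xi> k" for k
    using dcharsD(2)[OF assms(2), of "F k" "n * k"] dcharsD(1)[OF assms(2)] by (simp add: F_def cong_def)
  have inj: "inj_on F {..<M}"
    by (rule inj_onI) (use n in \<open>auto simp: F_def cong_def[symmetric] cong_mult_lcancel_nat cong_less_modulus_unique_nat\<close>)
  have im: "F ` {..<M} = {..<M}"
    by (rule card_subset_eq) (use assms(1) in \<open>auto simp: F_def card_image[OF inj, unfolded F_def]\<close>)
  have "(\<Sum>k<M. \<xi> k) = (\<Sum>k\<in>F ` {..<M}. \<xi> k)" by (simp add: im)
  also have "\<dots> = \<xi> n * (\<Sum>k<M. \<xi> k)" by (subst sum.reindex[OF inj]) (simp add: \<xi>F sum_distrib_left)
  finally have "(\<xi> n - 1) * (\<Sum>k<M. \<xi> k) = 0" by (simp add: algebra_simps)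
  then show ?thesis using n False by simp
qed

text \<open>Summing all characters over a full period in both orders gives the number of characters
  on one side and \<open>totient M\<close> on the other.\<close>

lemma card_dchars:
  assumes "0 < M"
  shows "card (dchars M) = totient M"
proof -
  have "(\<Sum>n<M. \<Sum>\<xi>\<in>dchars M. \<xi> n) = (\<Sum>n<M. if n = 1 mod M then of_nat (card (dchars M)) else 0)"
  proof (intro sum.cong refl)
    fix n assume n: "n \<in> {..<M}"
    show "(\<Sum>\<xi>\<in>dchars M. \<xi> n) = (if n = 1 mod M then of_nat (card (dchars M)) else 0)"
    proof (cases "coprime n M")
      case True
      then show ?thesis using sum_dchars[OF assms True] n by (auto simp: cong_def)
    next
      case False
      then have "n \<noteq> 1 mod M" by (cases "M = 1") (use assms in auto)
      then show ?thesis using dcharsD(4)[OF _ False] by (auto intro!: sum.neutral)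
    qed
  qed
  also have "\<dots> = of_nat (card (dchars M))" using assms by (simp add: sum.delta)
  finally have "of_nat (card (dchars M)) = (\<Sum>\<xi>\<in>dchars M. \<Sum>n<M. \<xi> n)" by (subst sum.swap) simp
  also have "\<dots> = (\<Sum>\<xi>\<in>dchars M. if \<xi> = principal M then of_nat (totient M) else 0)"
    by (intro sum.cong refl sum_dchar_period assms)
  also have "\<dots> = (of_nat (totient M) :: complex)"
    using finite_dchars[OF assms] principal_in_dchars by (simp add: sum.delta)
  finally show ?thesis by (simp only: of_nat_eq_iff)
qed

section \<open>Primes in arithmetic progressions\<close>

text \<open>Full periods contribute nothing, so fewer than \<open>M\<close> terms remain.\<close>

lemma norm_sum_dchar_le:
  assumes "0 < M" "\<xi> \<in> dchars M" "\<xi> \<noteq> principal M"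
  shows "norm (\<Sum>n\<in>{i..<j}. \<xi> n) \<le> real M"
proof (induction "j - i" arbitrary: i rule: less_induct)
  case less
  have per: "(\<Sum>n\<in>{k..<k + M}. \<xi> n) = 0" for k
  proof (induction k)
    case 0
    then show ?case using sum_dchar_period[OF assms(1,2)] assms(3) by (simp add: lessThan_atLeast0)
  next
    case (Suc k)
    have "(\<Sum>n\<in>{k..<Suc k + M}. \<xi> n) = \<xi> k + (\<Sum>n\<in>{Suc k..<Suc k + M}. \<xi> n)"
      by (rule sum.atLeast_Suc_lessThan) simp
    moreover have "(\<Sum>n\<in>{k..<Suc k + M}. \<xi> n) = (\<Sum>n\<in>{k..<k + M}. \<xi> n) + \<xi> (k + M)"
      by simp
    moreover have "\<xi> (k + M) = \<xi> k" by (rule dcharsD(2)[OF assms(2)]) (simp add: cong_def)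
    ultimately show ?case using Suc by simp
  qed
  show ?case
  proof (cases "j - i < M")
    case True
    have "norm (\<Sum>n\<in>{i..<j}. \<xi> n) \<le> (\<Sum>n\<in>{i..<j}. 1)"
      by (rule order_trans[OF norm_sum]) (intro sum_mono dchars_norm_le[OF assms(2,1)])
    then show ?thesis using True by simp
  next
    case False
    then have "(\<Sum>n\<in>{i..<j}. \<xi> n) = (\<Sum>n\<in>{i..<i + M}. \<xi> n) + (\<Sum>n\<in>{i + M..<j}. \<xi> n)"
      using assms(1) by (intro sum.atLeastLessThan_concat[symmetric]) auto
    then show ?thesis using per less[of "i + M"] False assms(1) by simp
  qed
qed

text \<open>Partial summation; the differences of the weights are nonnegative and telescope.\<close>

lemma norm_sum_abel_le:
  fixes c :: "nat \<Rightarrow> complex" and f :: "nat \<Rightarrow> real"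
  assumes B: "\<And>j. norm (\<Sum>n\<in>{a..<j}. c n) \<le> B"
    and f: "\<And>n. a \<le> n \<Longrightarrow> 0 \<le> f n" "\<And>n. a \<le> n \<Longrightarrow> f (Suc n) \<le> f n"
  shows "norm (\<Sum>n\<in>{a..<b}. c n * of_real (f n)) \<le> B * f a"
proof -
  define S where "S j = (\<Sum>n\<in>{a..<j}. c n)" for j
  have B0: "0 \<le> B" using B[of a] by simp
  have eq: "(\<Sum>n\<in>{a..<Suc (a + k)}. c n * of_real (f n))
      = S (Suc (a + k)) * of_real (f (a + k)) + (\<Sum>n\<in>{a..<a + k}. S (Suc n) * of_real (f n - f (Suc n)))" for k
    by (induction k) (simp_all add: S_def algebra_simps)
  show ?thesis
  proof (cases "b \<le> a")
    case True
    then show ?thesis using B0 f by simp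
  next
    case False
    define k where "k = b - Suc a"
    have b: "b = Suc (a + k)" using False by (simp add: k_def)
    have tel: "(\<Sum>n\<in>{a..<a + k}. f n - f (Suc n)) = f a - f (a + k)" by (induction k) auto
    have "norm (\<Sum>n\<in>{a..<b}. c n * of_real (f n))
        \<le> norm (S (Suc (a + k)) * of_real (f (a + k))) + (\<Sum>n\<in>{a..<a + k}. norm (S (Suc n) * of_real (f n - f (Suc n))))"
      unfolding b eq by (rule order_trans[OF norm_triangle_ineq]) (intro add_left_mono norm_sum)
    also have "\<dots> \<le> B * f (a + k) + (\<Sum>n\<in>{a..<a + k}. B * (f n - f (Suc n)))"
    proof (intro add_mono sum_mono)
      show "norm (S (Suc (a + k)) * complex_of_real (f (a + k))) \<le> B * f (a + k)"
        using B[of "Suc (a + k)"] f(1)[of "a + k"] by (auto simp: norm_mult S_def intro!: mult_right_mono)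
      show "norm (S (Suc n) * complex_of_real (f n - f (Suc n))) \<le> B * (f n - f (Suc n))"
        if "n \<in> {a..<a + k}" for n
        using B[of "Suc n"] f(2)[of n] that
        by (simp add: norm_mult S_def norm_of_real mult_right_mono del: of_real_diff)
    qed
    also have "\<dots> = B * f a" by (simp only: sum_distrib_left[symmetric] tel) (simp add: algebra_simps)
    finally show ?thesis .
  qed
qed

lemma norm_sum_dchar_weighted_le:
  fixes f :: "nat \<Rightarrow> real"
  assumes "0 < M" "\<xi> \<in> dchars M" "\<xi> \<noteq> principal M"
    and "\<And>n. a \<le> n \<Longrightarrow> 0 \<le> f n" "\<And>n. a \<le> n \<Longrightarrow> f (Suc n) \<le> f n"
  shows "norm (\<Sum>n\<in>{a..b}. \<xi> n * of_real (f n)) \<le> real M * f a"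
  using norm_sum_abel_le[where a = a and c = \<xi> and B = "real M" and f = f and b = "Suc b"] norm_sum_dchar_le[OF assms(1-3)] assms(4,5)
  by (simp add: atLeastLessThanSuc_atLeastAtMost)

lemma ln_over_id_antimono:
  assumes "3 \<le> i" "i \<le> (j::nat)"
  shows "ln (real j) / real j \<le> ln (real i) / real i"
proof (rule DERIV_nonpos_imp_nonincreasing[of "real i" "real j" "\<lambda>x. ln x / x"])
  show "real i \<le> real j" using assms by simp
  fix x assume x: "real i \<le> x" "x \<le> real j"
  have "1 \<le> ln x"
  proof -
    have "exp 1 \<le> x" using exp_le assms x by linarith
    then show ?thesis using x assms by (subst ln_ge_iff) auto
  qed
  moreover have "((\<lambda>x. ln x / x) has_real_derivative (1 - ln x) / x ^ 2) (at x)"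
    using x assms by (auto intro!: derivative_eq_intros simp: power2_eq_square field_simps)
  ultimately show "\<exists>y. ((\<lambda>x. ln x / x) has_real_derivative y) (at x) \<and> y \<le> 0"
    by (intro exI[of _ "(1 - ln x) / x ^ 2"]) (auto simp: divide_nonpos_nonneg)
qed

section \<open>The value at 1 and Mertens' argument\<close>

text \<open>The Dirichlet L-function at 1. The limit is meaningful for non-principal characters, for
  which \<open>norm_L1_minus_le\<close> shows convergence with an explicit tail bound.\<close>

definition L1 :: "(nat \<Rightarrow> complex) \<Rightarrow> complex" where
  "L1 \<xi> = lim (\<lambda>N. \<Sum>n\<in>{1..N}. \<xi> n / of_nat n)"

lemma norm_L1_minus_le:
  assumes "0 < M" "\<xi> \<in> dchars M" "\<xi> \<noteq> principal M"
  shows "norm (L1 \<xi> - (\<Sum>n\<in>{1..N}. \<xi> n / of_nat n)) \<le> real M / real (Suc N)"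
proof -
  define s where "s N = (\<Sum>n\<in>{1..N}. \<xi> n / of_nat n)" for N
  have tail: "norm (s K - s N) \<le> real M / real (Suc N)" if "N \<le> K" for K N
  proof -
    have "s K = s N + (\<Sum>n\<in>{Suc N..K}. \<xi> n / of_nat n)"
      unfolding s_def using that by (subst sum.union_disjoint[symmetric]) (auto intro!: sum.cong)
    also have "(\<Sum>n\<in>{Suc N..K}. \<xi> n / of_nat n) = (\<Sum>n\<in>{Suc N..K}. \<xi> n * of_real (1 / real n))"
      by (simp add: divide_inverse)
    finally have "s K - s N = (\<Sum>n\<in>{Suc N..K}. \<xi> n * of_real (1 / real n))" by simp
    moreover have "norm (\<Sum>n\<in>{Suc N..K}. \<xi> n * of_real (1 / real n)) \<le> real M * (1 / real (Suc N))"
      by (rule norm_sum_dchar_weighted_le[OF assms]) (auto simp: field_simps)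
    ultimately show ?thesis by (simp only: mult_1_right times_divide_eq_right)
  qed
  have "Cauchy s"
  proof (rule CauchyI)
    fix e :: real assume e: "0 < e"
    obtain N0 where N0: "2 * real M / e < real N0" using reals_Archimedean2 by blast
    then have N0': "0 < real N0" using e by (smt (verit) divide_nonneg_pos of_nat_0_le_iff)
    have "norm (s m - s n) < e" if "N0 \<le> m" "N0 \<le> n" for m n
    proof -
      have "norm (s m - s n) \<le> norm (s m - s N0) + norm (s n - s N0)"
        by (metis norm_triangle_ineq4 diff_diff_eq2 diff_add_cancel add_diff_cancel_right')
      also have "\<dots> \<le> 2 * real M / real (Suc N0)" using tail[of N0 m] tail[of N0 n] that by simp
      also have "\<dots> \<le> 2 * real M / real N0" using N0' by (intro divide_left_mono) auto
      also have "\<dots> < e" using N0 N0' e by (simp add: field_simps)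
      finally show ?thesis .
    qed
    then show "\<exists>N0. \<forall>m\<ge>N0. \<forall>n\<ge>N0. norm (s m - s n) < e" by blast
  qed
  then have "s \<longlonglongrightarrow> L1 \<xi>" using Cauchy_convergent_iff convergent_LIMSEQ_iff unfolding L1_def s_def by blast
  then have "(\<lambda>K. norm (s K - s N)) \<longlonglongrightarrow> norm (L1 \<xi> - s N)" by (intro tendsto_intros)
  then have "norm (L1 \<xi> - s N) \<le> real M / real (Suc N)"
    by (rule Lim_bounded[where M = N]) (use tail in auto)
  then show ?thesis by (simp add: s_def)
qed

text \<open>Partial sums of the Dirichlet series of \<open>-L'/L\<close> at the point 1.\<close>

definition SL :: "(nat \<Rightarrow> complex) \<Rightarrow> nat \<Rightarrow> complex" where
  "SL \<xi> N = (\<Sum>n\<in>{1..N}. \<xi> n * mangoldt n / of_nat n)"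

lemma Suc_div_ge: "0 < d \<Longrightarrow> real N / real d \<le> real (Suc (N div d))"
  using floor_divide_of_nat_eq[of N d, where ?'a = real] by (simp; linarith)

text \<open>The sums of \<open>\<xi> n * ln n / n\<close> are bounded by partial summation. Writing
  \<open>ln n\<close> as a divisor sum of \<open>mangoldt\<close> turns them into a sum over
  \<open>d\<close> with partial sums of the L-series up to \<open>N div d\<close>; replacing these
  by \<open>L1 \<xi>\<close> costs \<open>M * d / N\<close> each, which Chebyshev's bound makes
  \<open>O(M)\<close> in total.\<close>

lemma L1_times_SL_bounded:
  assumes "0 < M" "\<xi> \<in> dchars M" "\<xi> \<noteq> principal M"
  shows "\<exists>C. \<forall>N. norm (L1 \<xi> * SL \<xi> N) \<le> C"
proof -
  define T where "T N = (\<Sum>n\<in>{1..N}. \<xi> n * of_real (ln (real n) / real n))" for N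
  have Tb: "norm (T N) \<le> 2 + real M * (ln (real 3) / real 3)" for N
  proof -
    have le1: "norm (\<xi> n * of_real (ln (real n) / real n)) \<le> 1" if "1 \<le> n" for n
    proof -
      have "\<bar>ln (real n) / real n\<bar> \<le> 1"
        using ln_le_minus_one[of "real n"] that by (auto simp: abs_if field_simps)
      then show ?thesis using dchars_norm_le[OF assms(2,1), of n]
        by (simp only: norm_mult norm_of_real) (metis mult_le_one abs_ge_zero)
    qed
    show ?thesis
    \<comment> \<open>The quotient \<open>ln n / n\<close> decreases from \<open>n = 3\<close> on
      (the turning point is \<open>exp 1\<close>), so two terms are bounded separately.\<close>
    proof (cases "N \<le> 2")
      case True
      have "norm (T N) \<le> (\<Sum>n\<in>{1..N}. 1)"
        unfolding T_def by (rule order_trans[OF norm_sum]) (intro sum_mono le1, auto)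
      then have "norm (T N) \<le> 2" using True by simp
      moreover have "0 \<le> real M * (ln (real 3) / real 3)" by simp
      ultimately show ?thesis by linarith
    next
      case False
      then have "T N = (\<Sum>n\<in>{1..2}. \<xi> n * of_real (ln (real n) / real n)) + (\<Sum>n\<in>{3..N}. \<xi> n * of_real (ln (real n) / real n))"
        unfolding T_def by (subst sum.union_disjoint[symmetric]) (auto intro!: sum.cong)
      moreover have "norm (\<Sum>n\<in>{1..2}. \<xi> n * of_real (ln (real n) / real n)) \<le> (\<Sum>n\<in>{1..2::nat}. 1)"
        by (rule order_trans[OF norm_sum]) (intro sum_mono le1, auto)
      moreover have "norm (\<Sum>n\<in>{3..N}. \<xi> n * of_real (ln (real n) / real n)) \<le> real M * (ln (real 3) / real 3)"
      proof (rule norm_sum_dchar_weighted_le[OF assms])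
        show "ln (real (Suc n)) / real (Suc n) \<le> ln (real n) / real n" if "3 \<le> n" for n
          by (rule ln_over_id_antimono) (use that in auto)
      qed auto
      ultimately have "norm (T N) \<le> (\<Sum>n\<in>{1..2::nat}. 1) + real M * (ln (real 3) / real 3)"
        by (metis (no_types, lifting) add_mono norm_triangle_le)
      then show ?thesis by simp
    qed
  qed
  have "norm (L1 \<xi> * SL \<xi> N) \<le> 2 + real M * (ln (real 3) / real 3) + 4 * real M" for N
  proof (cases "N = 0")
    case False
    define s where "s K = (\<Sum>n\<in>{1..K}. \<xi> n / of_nat n)" for K
    have "T N = (\<Sum>n\<in>{1..N}. \<Sum>d | d dvd n. \<xi> d * mangoldt d / of_nat d * (\<xi> (n div d) / of_nat (n div d)))"
      unfolding T_def
    proof (intro sum.cong refl)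
      fix n assume n: "n \<in> {1..N}"
      have "\<xi> n * of_real (ln (real n) / real n) = \<xi> n / of_nat n * (\<Sum>d | d dvd n. mangoldt d)"
        using n by (subst mangoldt_sum) auto
      also have "\<dots> = (\<Sum>d | d dvd n. \<xi> d * mangoldt d / of_nat d * (\<xi> (n div d) / of_nat (n div d)))"
        unfolding sum_distrib_left
      proof (intro sum.cong refl)
        fix d assume "d \<in> {d. d dvd n}"
        then have "n = d * (n div d)" by simp
        then have "\<xi> n = \<xi> d * \<xi> (n div d)" "(of_nat n :: complex) = of_nat d * of_nat (n div d)"
          using dcharsD(1)[OF assms(2)] by (metis, metis of_nat_mult)
        then show "\<xi> n / of_nat n * mangoldt d = \<xi> d * mangoldt d / of_nat d * (\<xi> (n div d) / of_nat (n div d))"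
          by simp
      qed
      finally show "\<xi> n * of_real (ln (real n) / real n) = (\<Sum>d | d dvd n. \<xi> d * mangoldt d / of_nat d * (\<xi> (n div d) / of_nat (n div d)))" .
    qed
    also have "\<dots> = (\<Sum>d\<in>{1..N}. \<Sum>m\<in>{1..N div d}. \<xi> d * mangoldt d / of_nat d * (\<xi> m / of_nat m))"
      by (rule sum_divisors_swap)
    also have "\<dots> = (\<Sum>d\<in>{1..N}. \<xi> d * mangoldt d / of_nat d * s (N div d))"
      by (simp add: s_def sum_distrib_left)
    finally have T: "T N = (\<Sum>d\<in>{1..N}. \<xi> d * mangoldt d / of_nat d * s (N div d))" .
    have "L1 \<xi> * SL \<xi> N - T N = (\<Sum>d\<in>{1..N}. \<xi> d * mangoldt d / of_nat d * (L1 \<xi> - s (N div d)))"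
      unfolding T SL_def by (simp add: sum_distrib_left sum_subtractf[symmetric] right_diff_distrib diff_divide_distrib mult_ac)
    also have "norm \<dots> \<le> (\<Sum>d\<in>{1..N}. real M / real N * mangoldt d)"
    proof (rule order_trans[OF norm_sum], rule sum_mono)
      fix d assume d: "d \<in> {1..N}"
      have "norm (L1 \<xi> - s (N div d)) \<le> real M / real (Suc (N div d))"
        unfolding s_def by (rule norm_L1_minus_le[OF assms])
      also have "\<dots> \<le> real M / (real N / real d)"
        using Suc_div_ge[of d N] d False by (intro divide_left_mono mult_pos_pos) auto
      finally have 1: "norm (L1 \<xi> - s (N div d)) \<le> real M * real d / real N" by simp
      have 2: "norm (\<xi> d * mangoldt d / of_nat d) \<le> 1 * mangoldt d / real d"
        unfolding norm_divide norm_mult norm_mangoldt norm_of_nat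
        using dchars_norm_le[OF assms(2,1), of d] by (intro divide_right_mono mult_right_mono mangoldt_nonneg) auto
      have "norm (\<xi> d * mangoldt d / of_nat d * (L1 \<xi> - s (N div d))) \<le> (1 * mangoldt d / real d) * (real M * real d / real N)"
        unfolding norm_mult[of "\<xi> d * mangoldt d / of_nat d"] using mangoldt_nonneg by (intro mult_mono 1 2) auto
      then show "norm (\<xi> d * mangoldt d / of_nat d * (L1 \<xi> - s (N div d))) \<le> real M / real N * mangoldt d"
        using d by (simp add: field_simps)
    qed
    also have "\<dots> \<le> real M / real N * (4 * real N)"
      unfolding sum_distrib_left[symmetric] by (intro mult_left_mono chebyshev_psi_le) auto
    also have "\<dots> = 4 * real M" using False by simp
    finally have "norm (L1 \<xi> * SL \<xi> N - T N) \<le> 4 * real M" .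
    then show ?thesis using Tb[of N] norm_triangle_sub[of "L1 \<xi> * SL \<xi> N" "T N"] by linarith
  qed (simp add: SL_def)
  then show ?thesis by blast
qed

section \<open>Moebius inversion and the effect of a zero at 1\<close>

definition mu :: "nat \<Rightarrow> real" where
  "mu n = (if squarefree n then (-1) ^ card (prime_factors n) else 0)"

lemma abs_mu_le: "\<bar>mu n\<bar> \<le> 1"
  by (simp add: mu_def power_abs)

lemma squarefree_prod_primes:
  assumes "finite T" "\<And>p. p \<in> T \<Longrightarrow> prime (p::nat)"
  shows "squarefree (\<Prod>T)" "prime_factors (\<Prod>T) = T"
proof -
  show pf: "prime_factors (\<Prod>T) = T"
    using assms
  proof (induction T rule: finite_induct)
    case (insert p T)
    have "0 \<notin> T" using insert.prems[of 0] not_prime_0 by blast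
    then have "\<Prod>T \<noteq> 0" using insert.hyps by (simp add: prod_zero_iff)
    then have "prime_factors (p * \<Prod>T) = prime_factors p \<union> prime_factors (\<Prod>T)"
      using prime_gt_0_nat[of p] insert.prems by (intro prime_factors_product) auto
    then show ?case using insert by (simp add: prime_factorization_prime)
  qed simp
  show "squarefree (\<Prod>T)"
    using assms
  proof (induction T rule: finite_induct)
    case (insert p T)
    have "coprime p (\<Prod>T)"
    proof (rule prod_coprime_right)
      fix q assume "q \<in> T"
      then show "coprime p q" using insert by (intro primes_coprime) auto
    qed
    then show ?case using insert by (simp add: squarefree_mult_coprime squarefree_prime)
  qed simp
qed

lemma prod_primes_dvd:
  assumes "finite T" "\<And>p. p \<in> T \<Longrightarrow> prime (p::nat) \<and> p dvd n"
  shows "\<Prod>T dvd n"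
  using assms
proof (induction T rule: finite_induct)
  case (insert p T)
  have "coprime p (\<Prod>T)"
  proof (rule prod_coprime_right)
    fix q assume "q \<in> T"
    then show "coprime p q" using insert by (intro primes_coprime) auto
  qed
  then show ?case using insert by (simp add: divides_mult)
qed simp

lemma squarefree_eq_prod_primes: "squarefree (n::nat) \<Longrightarrow> n > 0 \<Longrightarrow> n = \<Prod>(prime_factors n)"
proof -
  assume n: "squarefree n" "n > 0"
  have "n = (\<Prod>p\<in>prime_factors n. p ^ multiplicity p n)"
    using n prime_factorization_nat by simp
  also have "\<dots> = (\<Prod>p\<in>prime_factors n. p)"
  proof (intro prod.cong refl)
    fix p assume p: "p \<in> prime_factors n"
    then have "multiplicity p n = 1"
      using n squarefree_factorial_semiring'[of n] by auto
    then show "p ^ multiplicity p n = p" by simp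
  qed
  finally show ?thesis .
qed

lemma sum_mu_divisors:
  assumes "0 < n"
  shows "(\<Sum>d | d dvd n. mu d) = (if n = 1 then 1 else 0)"
proof -
  define P where "P = prime_factors n"
  have fin: "finite P" by (simp add: P_def)
  have "(\<Sum>d | d dvd n. mu d) = (\<Sum>d | d dvd n \<and> squarefree d. (-1) ^ card (prime_factors d))"
    by (rule sum.mono_neutral_cong_right) (use assms in \<open>auto simp: mu_def\<close>)
  also have "\<dots> = (\<Sum>T\<in>Pow P. (-1) ^ card T)"
  proof (rule sum.reindex_bij_witness[of _ "\<lambda>T. \<Prod>T" prime_factors])
    fix d assume d: "d \<in> {d. d dvd n \<and> squarefree d}"
    then have "d > 0" using assms by (auto intro: Nat.gr0I)
    then show "\<Prod>(prime_factors d) = d" using squarefree_eq_prod_primes[of d] d by simp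
    show "prime_factors d \<in> Pow P" using d assms by (auto simp: P_def dvd_prime_factors intro: subsetD[OF dvd_prime_factors])
    show "(- 1) ^ card (prime_factors d) = (- 1) ^ card (prime_factors d)" ..
  next
    fix T assume T: "T \<in> Pow P"
    have fT: "finite T" and pr: "\<And>p. p \<in> T \<Longrightarrow> prime p \<and> p dvd n"
      using T fin by (auto simp: P_def intro: finite_subset)
    show "prime_factors (\<Prod>T) = T" using squarefree_prod_primes(2)[OF fT] pr by blast
    show "\<Prod>T \<in> {d. d dvd n \<and> squarefree d}"
      using squarefree_prod_primes(1)[OF fT] prod_primes_dvd[OF fT pr] pr by blast
  qed
  \<comment> \<open>At level \<open>card P\<close> nothing is truncated and the first omitted term
    is 0, so Bonferroni's inequalities become the identity for the full alternating sum.\<close>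
  also have "\<dots> = (\<Prod>p\<in>P. 1 - 1)"
  proof -
    have "alt_sum (card P) (\<lambda>_. 1) P = (\<Sum>T\<in>Pow P. (-1) ^ card T)"
      unfolding alt_sum_def by (intro sum.cong refl) (auto simp: card_mono[OF fin])
    moreover have "esym (Suc (card P)) (\<lambda>_. 1) P = 0"
      unfolding esym_def
    proof (intro sum.neutral ballI)
      fix T assume "T \<in> Pow P"
      then have "card T \<le> card P" using card_mono[OF fin] by simp
      then show "(if card T = Suc (card P) then \<Prod>q\<in>T. 1 else 0) = (0::real)" by simp
    qed
    ultimately show ?thesis
      using bonferroni[OF fin, of "\<lambda>_. 1" "card P"] by (cases "even (card P)") auto
  qed
  also have "\<dots> = (if n = 1 then 1 else 0)"
  proof (cases "P = {}")
    case True
    then have "n = 1" using assms by (simp add: P_def prime_factorization_empty_iff)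
    then show ?thesis using True by simp
  next
    case False
    then have "n \<noteq> 1" by (auto simp: P_def)
    then show ?thesis using False fin by (simp add: card_gt_0_iff)
  qed
  finally show ?thesis .
qed

lemma sum_mu_ln_divisors:
  assumes "0 < n"
  shows "(\<Sum>d | d dvd n. mu d * ln (real (n div d))) = mangoldt n"
proof -
  have fin: "finite {d. d dvd m}" if "m dvd n" for m using that assms by (auto intro!: finite_divisors_nat Nat.gr0I)
  have sw: "e dvd n \<and> d dvd n div e" if de: "d dvd n" "e dvd n div d" for d e
  proof -
    obtain a where a: "n = d * a" using de(1) by (elim dvdE)
    then have "0 < d" using assms by (auto intro: Nat.gr0I)
    then obtain b where b: "a = e * b" using de(2) a by auto
    have "0 < e" using a b assms by (auto intro: Nat.gr0I)
    then show ?thesis using a b by (auto simp: mult.left_commute)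
  qed
  have "(\<Sum>d | d dvd n. mu d * ln (real (n div d))) = (\<Sum>d | d dvd n. \<Sum>e | e dvd n div d. mu d * mangoldt e)"
  proof (intro sum.cong refl)
    fix d assume "d \<in> {d. d dvd n}"
    then have "n div d \<noteq> 0" using assms by (auto simp: dvd_div_eq_0_iff)
    then show "mu d * ln (real (n div d)) = (\<Sum>e | e dvd n div d. mu d * mangoldt e)"
      using mangoldt_sum[of "n div d", where ?'a = real] by (simp add: sum_distrib_left[symmetric])
  qed
  also have "\<dots> = (\<Sum>(d, e)\<in>(SIGMA d:{d. d dvd n}. {e. e dvd n div d}). mu d * mangoldt e)"
    by (rule sum.Sigma) (use fin in \<open>auto intro!: fin\<close>)
  also have "\<dots> = (\<Sum>(e, d)\<in>(SIGMA e:{e. e dvd n}. {d. d dvd n div e}). mu d * mangoldt e)"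
    by (rule sum.reindex_bij_witness[of _ "\<lambda>(e, d). (d, e)" "\<lambda>(d, e). (e, d)"]) (use sw in auto)
  also have "\<dots> = (\<Sum>e | e dvd n. \<Sum>d | d dvd n div e. mu d * mangoldt e)"
    by (rule sum.Sigma[symmetric]) (use fin in \<open>auto intro!: fin\<close>)
  also have "\<dots> = (\<Sum>e | e dvd n. if e = n then mangoldt e else 0)"
  proof (intro sum.cong refl)
    fix e assume "e \<in> {e. e dvd n}"
    then have e: "e dvd n" by simp
    then have "0 < n div e" using assms by (auto simp: dvd_div_eq_0_iff intro: Nat.gr0I)
    moreover have "n div e = 1 \<longleftrightarrow> e = n" using e assms by (auto elim!: dvdE)
    ultimately show "(\<Sum>d | d dvd n div e. mu d * mangoldt e) = (if e = n then mangoldt e else 0)"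
      using sum_mu_divisors[of "n div e"] by (simp add: sum_distrib_right[symmetric])
  qed
  also have "\<dots> = mangoldt n" using assms by (simp add: sum.delta)
  finally show ?thesis .
qed

text \<open>The weights \<open>mu d * ln (N / d)\<close> have the divisor sum
  \<open>mangoldt n\<close>, plus \<open>ln N\<close> at \<open>n = 1\<close>. After interchanging
  sums, partial sums of a series with value 0 appear, of size \<open>M * d / N\<close>, and the sum
  of \<open>ln (N / d)\<close> over \<open>d\<close> is at most \<open>N\<close>. So a zero
  contributes a full \<open>-ln N\<close>.\<close>

lemma SL_bounded_if_L1_zero:
  assumes "0 < M" "\<xi> \<in> dchars M" "\<xi> \<noteq> principal M" "L1 \<xi> = 0" "1 \<le> N"
  shows "norm (SL \<xi> N + of_real (ln (real N))) \<le> real M"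
proof -
  define s where "s K = (\<Sum>n\<in>{1..K}. \<xi> n / of_nat n)" for K
  define w where "w d = mu d * ln (real N / real d)" for d
  have ptw: "(\<Sum>d | d dvd n. w d) = mangoldt n + (if n = 1 then ln (real N) else 0)" if n: "n \<in> {1..N}" for n
  proof -
    have "(\<Sum>d | d dvd n. w d) = (\<Sum>d | d dvd n. mu d * ln (real (n div d)) + ln (real N / real n) * mu d)"
    proof (intro sum.cong refl)
      fix d assume d: "d \<in> {d. d dvd n}"
      then have "0 < d" using n by (auto intro: Nat.gr0I)
      moreover have "real (n div d) = real n / real d" using d by (simp add: real_of_nat_div)
      ultimately show "w d = mu d * ln (real (n div d)) + ln (real N / real n) * mu d"
        using n by (simp add: w_def ln_divide_pos algebra_simps)
    qed
    also have "\<dots> = mangoldt n + ln (real N / real n) * (if n = 1 then 1 else 0)"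
      using sum_mu_ln_divisors[of n] sum_mu_divisors[of n] n by (simp add: sum.distrib sum_distrib_left[symmetric])
    finally show ?thesis by auto
  qed
  have "SL \<xi> N + of_real (ln (real N)) = (\<Sum>n\<in>{1..N}. \<xi> n / of_nat n * of_real (mangoldt n + (if n = 1 then ln (real N) else 0)))"
  proof -
    have "(\<Sum>n\<in>{1..N}. \<xi> n / of_nat n * of_real (if n = 1 then ln (real N) else 0)) = (\<Sum>n\<in>{1..N}. if n = 1 then of_real (ln (real N)) else 0)"
      using dcharsD(3)[OF assms(2)] by (intro sum.cong) auto
    also have "\<dots> = of_real (ln (real N))" using assms(5) by (simp add: sum.delta)
    finally show ?thesis unfolding SL_def by (simp only: of_real_add distrib_left sum.distrib) (simp add: mult_ac)
  qed
  also have "\<dots> = (\<Sum>n\<in>{1..N}. \<Sum>d | d dvd n. \<xi> d / of_nat d * of_real (w d) * (\<xi> (n div d) / of_nat (n div d)))"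
  proof (intro sum.cong refl)
    fix n assume n: "n \<in> {1..N}"
    have "\<xi> n / of_nat n * of_real (mangoldt n + (if n = 1 then ln (real N) else 0)) = \<xi> n / of_nat n * (\<Sum>d | d dvd n. of_real (w d))"
      unfolding ptw[OF n, symmetric] by simp
    also have "\<dots> = (\<Sum>d | d dvd n. \<xi> d / of_nat d * of_real (w d) * (\<xi> (n div d) / of_nat (n div d)))"
      unfolding sum_distrib_left
    proof (intro sum.cong refl)
      fix d assume "d \<in> {d. d dvd n}"
      then have "n = d * (n div d)" by simp
      then have "\<xi> n = \<xi> d * \<xi> (n div d)" "(of_nat n :: complex) = of_nat d * of_nat (n div d)"
        using dcharsD(1)[OF assms(2)] by (metis, metis of_nat_mult)
      then show "\<xi> n / of_nat n * of_real (w d) = \<xi> d / of_nat d * of_real (w d) * (\<xi> (n div d) / of_nat (n div d))"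
        by simp
    qed
    finally show "\<xi> n / of_nat n * of_real (mangoldt n + (if n = 1 then ln (real N) else 0))
      = (\<Sum>d | d dvd n. \<xi> d / of_nat d * of_real (w d) * (\<xi> (n div d) / of_nat (n div d)))" .
  qed
  also have "\<dots> = (\<Sum>d\<in>{1..N}. \<Sum>m\<in>{1..N div d}. \<xi> d / of_nat d * of_real (w d) * (\<xi> m / of_nat m))"
    by (rule sum_divisors_swap)
  also have "\<dots> = (\<Sum>d\<in>{1..N}. \<xi> d / of_nat d * of_real (w d) * s (N div d))"
    by (simp add: s_def sum_distrib_left)
  finally have "SL \<xi> N + of_real (ln (real N)) = (\<Sum>d\<in>{1..N}. \<xi> d / of_nat d * of_real (w d) * s (N div d))" .
  also have "norm \<dots> \<le> (\<Sum>d\<in>{1..N}. real M / real N * (ln (real N) - ln (real d)))"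
  proof (rule order_trans[OF norm_sum], rule sum_mono)
    fix d assume d: "d \<in> {1..N}"
    have "norm (s (N div d)) \<le> real M / real (Suc (N div d))"
      using norm_L1_minus_le[OF assms(1-3), of "N div d"] assms(4) by (simp add: s_def)
    also have "\<dots> \<le> real M / (real N / real d)"
      using Suc_div_ge[of d N] d by (intro divide_left_mono mult_pos_pos) auto
    finally have 1: "norm (s (N div d)) \<le> real M * real d / real N" by simp
    have ln0: "0 \<le> ln (real N) - ln (real d)" using d by simp
    have w: "\<bar>w d\<bar> \<le> ln (real N) - ln (real d)"
      using mult_right_mono[OF abs_mu_le[of d] ln0] d ln0 by (simp add: w_def ln_divide_pos abs_mult)
    have 2: "norm (\<xi> d / of_nat d * of_real (w d)) \<le> 1 / real d * (ln (real N) - ln (real d))"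
      unfolding norm_divide norm_mult norm_of_nat norm_of_real
      using dchars_norm_le[OF assms(2,1), of d] w by (intro mult_mono divide_right_mono) auto
    have "norm (\<xi> d / of_nat d * of_real (w d) * s (N div d)) \<le> (1 / real d * (ln (real N) - ln (real d))) * (real M * real d / real N)"
      unfolding norm_mult[of "\<xi> d / of_nat d * of_real (w d)"] using ln0 by (intro mult_mono 1 2) auto
    then show "norm (\<xi> d / of_nat d * of_real (w d) * s (N div d)) \<le> real M / real N * (ln (real N) - ln (real d))"
      using d by (simp add: mult_ac)
  qed
  also have "\<dots> = real M / real N * (real N * ln (real N) - ln (fact N))"
  proof -
    have "ln (fact N) = (\<Sum>n\<in>{1..N}. ln (real n))"
      by (simp add: fact_prod of_nat_prod) (rule ln_prod, auto)
    then have "(\<Sum>d\<in>{1..N}. ln (real N) - ln (real d)) = real N * ln (real N) - ln (fact N)"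
      by (simp add: sum_subtractf)
    then show ?thesis by (simp only: sum_distrib_left[symmetric])
  qed
  also have "\<dots> \<le> real M / real N * real N"
    using ln_fact_ge[OF assms(5)] by (intro mult_left_mono) auto
  also have "\<dots> = real M" using assms(5) by simp
  finally show ?thesis .
qed

lemma sum_inverse_powers_le: "2 \<le> (p::nat) \<Longrightarrow> (\<Sum>j\<in>{1..J}. 1 / real p ^ j) \<le> 1 - 1 / real p ^ J"
proof (induction J)
  case (Suc J)
  have "2 * (1 / real p ^ Suc J) \<le> 1 / real p ^ J" using Suc.prems by (simp add: field_simps)
  moreover have "(\<Sum>j\<in>{1..Suc J}. 1 / real p ^ j) = (\<Sum>j\<in>{1..J}. 1 / real p ^ j) + 1 / real p ^ Suc J" by simp
  ultimately show ?case using Suc by linarith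
qed simp

text \<open>The terms missing from the Mertens sum belong to powers of primes dividing
  \<open>M\<close>; for each such \<open>p\<close> they add up to at most \<open>ln p\<close>, a
  constant for fixed \<open>M\<close>.\<close>

lemma SL_principal_bounded:
  assumes "0 < M"
  shows "\<exists>C. \<forall>N\<ge>1. norm (SL (principal M) N - of_real (ln (real N))) \<le> C"
proof -
  define C where "C = (\<Sum>p\<in>prime_factors M. ln (real p))"
  have "norm (SL (principal M) N - of_real (ln (real N))) \<le> C + 4" if N: "1 \<le> N" for N
  proof -
    define A where "A = {n \<in> {1..N}. \<not> coprime n M}"
    define tot where "tot = (\<Sum>n\<in>{1..N}. mangoldt n / real n :: real)"
    define bad where "bad = (\<Sum>n\<in>A. mangoldt n / real n :: real)"
    have "SL (principal M) N = of_real (tot - bad)"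
    proof -
      have "tot - bad = (\<Sum>n\<in>{1..N} - A. mangoldt n / real n)"
        unfolding tot_def bad_def by (subst sum_diff) (auto simp: A_def)
      moreover have "SL (principal M) N = (\<Sum>n\<in>{1..N} - A. mangoldt n / of_nat n)"
        unfolding SL_def by (rule sum.mono_neutral_cong_right) (auto simp: A_def principal_def)
      ultimately show ?thesis by simp
    qed
    then have eq: "norm (SL (principal M) N - of_real (ln (real N))) = \<bar>tot - bad - ln (real N)\<bar>"
      by (metis norm_of_real of_real_diff)
    have bad0: "0 \<le> bad" unfolding bad_def by (intro sum_nonneg) (auto simp: mangoldt_nonneg)
    have "bad = (\<Sum>n\<in>{n\<in>A. primepow n}. mangoldt n / real n)"
      unfolding bad_def by (rule sum.mono_neutral_right) (auto simp: A_def mangoldt_def)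
    also have "\<dots> \<le> (\<Sum>n\<in>(\<lambda>(p, j). p ^ j) ` (prime_factors M \<times> {1..N}). mangoldt n / real n)"
    proof (rule sum_mono2)
      show "{n \<in> A. primepow n} \<subseteq> (\<lambda>(p, j). p ^ j) ` (prime_factors M \<times> {1..N})"
      proof
        fix n assume n: "n \<in> {n \<in> A. primepow n}"
        then obtain p j where pj: "prime p" "0 < j" "n = p ^ j" by (auto simp: primepow_def)
        have "p dvd M"
          using n pj by (auto simp: A_def) (metis coprime_power_left_iff prime_imp_coprime)
        then have "p \<in> prime_factors M" using pj assms by (simp add: prime_factors_dvd)
        moreover have "j \<le> N"
        proof -
          have "j < 2 ^ j" by (rule less_exp)
          also have "2 ^ j \<le> p ^ j" using prime_ge_2_nat[OF pj(1)] by (intro power_mono) auto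
          also have "\<dots> \<le> N" using n pj by (simp add: A_def)
          finally show ?thesis by simp
        qed
        ultimately show "n \<in> (\<lambda>(p, j). p ^ j) ` (prime_factors M \<times> {1..N})"
          using pj by (intro image_eqI[of _ _ "(p, j)"]) auto
      qed
    qed (auto simp: mangoldt_nonneg)
    also have "\<dots> \<le> (\<Sum>(p, j)\<in>prime_factors M \<times> {1..N}. mangoldt (p ^ j) / real (p ^ j))"
    proof -
      have "(\<Sum>n\<in>(\<lambda>(p, j). p ^ j) ` (prime_factors M \<times> {1..N}). mangoldt n / real n)
         \<le> sum ((\<lambda>n. mangoldt n / real n) \<circ> (\<lambda>(p, j). p ^ j)) (prime_factors M \<times> {1..N})"
        by (rule sum_image_le) (auto simp: mangoldt_nonneg)
      then show ?thesis by (simp add: case_prod_unfold comp_def)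
    qed
    also have "\<dots> = (\<Sum>p\<in>prime_factors M. \<Sum>j\<in>{1..N}. mangoldt (p ^ j) / real (p ^ j))"
      by (simp add: sum.cartesian_product)
    also have "\<dots> \<le> (\<Sum>p\<in>prime_factors M. ln (real p))"
    proof (rule sum_mono)
      fix p assume p: "p \<in> prime_factors M"
      then have pr: "prime p" by auto
      have "(\<Sum>j\<in>{1..N}. mangoldt (p ^ j) / real (p ^ j)) = ln (real p) * (\<Sum>j\<in>{1..N}. 1 / real p ^ j)"
        unfolding sum_distrib_left using pr by (intro sum.cong) auto
      also have "\<dots> \<le> ln (real p) * 1"
      proof (rule mult_left_mono)
        have "0 \<le> 1 / real p ^ N" by simp
        then show "(\<Sum>j\<in>{1..N}. 1 / real p ^ j) \<le> 1"
          using sum_inverse_powers_le[OF prime_ge_2_nat[OF pr], of N] by linarith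
        show "0 \<le> ln (real p)" using prime_ge_1_nat[OF pr] by simp
      qed
      finally show "(\<Sum>j\<in>{1..N}. mangoldt (p ^ j) / real (p ^ j)) \<le> ln (real p)" by simp
    qed
    finally have "bad \<le> C" by (simp add: C_def)
    then show ?thesis using mertens_mangoldt[OF N] bad0 unfolding eq tot_def[symmetric] by linarith
  qed
  then show ?thesis by blast
qed

section \<open>Real characters\<close>

text \<open>The properties of a real non-principal character that enter the non-vanishing argument.
  The bound on sums over intervals replaces periodicity and excludes the principal
  character.\<close>

definition real_char :: "nat \<Rightarrow> (nat \<Rightarrow> real) \<Rightarrow> bool" where
  "real_char M \<psi> \<longleftrightarrow> (\<forall>a b. \<psi> (a * b) = \<psi> a * \<psi> b) \<and> \<psi> 1 = 1 \<and> (\<forall>a. \<psi> a \<in> {-1, 0, 1})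
     \<and> (\<forall>i j. \<bar>\<Sum>n\<in>{i..<j}. \<psi> n\<bar> \<le> real M)"

lemma sum_divisors_coprime_mult:
  fixes F :: "nat \<Rightarrow> real"
  assumes "coprime a b" "0 < a" "0 < b" "\<And>x y. F (x * y) = F x * F y"
  shows "(\<Sum>d | d dvd a * b. F d) = (\<Sum>d | d dvd a. F d) * (\<Sum>d | d dvd b. F d)"
proof -
  have cancel: "gcd (d * e) a = d \<and> gcd (d * e) b = e" if "d dvd a" "e dvd b" for d e
  proof -
    have "coprime a e" "coprime b d"
      using coprime_divisors[OF dvd_refl that(2) assms(1)] coprime_divisors[OF that(1) dvd_refl assms(1)]
      by (simp_all add: coprime_commute)
    then have "gcd (d * e) a = gcd d a" "gcd (d * e) b = gcd e b"
      by (simp_all add: gcd_mult_left_right_cancel gcd_mult_left_left_cancel)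
    then show ?thesis using that by (simp add: gcd_proj1_iff)
  qed
  have "(\<Sum>d | d dvd a. F d) * (\<Sum>d | d dvd b. F d) = (\<Sum>(d, e)\<in>{d. d dvd a} \<times> {e. e dvd b}. F (d * e))"
    by (simp add: sum_product sum.cartesian_product assms(4))
  also have "\<dots> = (\<Sum>d | d dvd a * b. F d)"
  proof (rule sum.reindex_bij_witness[of _ "\<lambda>d. (gcd d a, gcd d b)" "\<lambda>(d, e). d * e"])
    fix p assume "p \<in> {d. d dvd a} \<times> {e. e dvd b}"
    then obtain d e where p: "p = (d, e)" "d dvd a" "e dvd b" by auto
    then show "(gcd (case p of (d, e) \<Rightarrow> d * e) a, gcd (case p of (d, e) \<Rightarrow> d * e) b) = p"
      using cancel by simp
    show "(case p of (d, e) \<Rightarrow> d * e) \<in> {d. d dvd a * b}" using p by (auto intro: mult_dvd_mono)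
  next
    fix d assume "d \<in> {d. d dvd a * b}"
    then obtain x y where "d = x * y" "x dvd a" "y dvd b" using division_decomp[of d a b] by auto
    then show "(case (gcd d a, gcd d b) of (d, e) \<Rightarrow> d * e) = d" using cancel by simp
  qed auto
  finally show ?thesis by simp
qed

text \<open>By multiplicativity the divisor sum is a product of sums
  \<open>1 + \<psi> p + ... + \<psi> p ^ j\<close> over prime powers. With \<open>\<psi> p\<close>
  in -1, 0, 1 each of them is nonnegative, and at least 1 for even \<open>j\<close>; squares have
  even exponents.\<close>

lemma real_char_divisor_sum:
  assumes "real_char M \<psi>" "0 < n"
  shows "0 \<le> (\<Sum>d | d dvd n. \<psi> d) \<and> 1 \<le> (\<Sum>d | d dvd n ^ 2. \<psi> d)"
  using assms(2)
proof (induction n rule: less_induct)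
  case (less n)
  have mult: "\<psi> (x * y) = \<psi> x * \<psi> y" for x y using assms(1) by (simp add: real_char_def)
  have one: "\<psi> 1 = 1" using assms(1) by (simp add: real_char_def)
  show ?case
  proof (cases "n = 1")
    case False
    then obtain p where p: "prime p" "p dvd n" using prime_factor_nat by blast
    define k where "k = multiplicity p n"
    have k: "0 < k" using p less.prems by (simp add: k_def prime_multiplicity_gt_zero_iff)
    obtain m where m: "n = p ^ k * m" "\<not> p dvd m"
      using multiplicity_decompose'[of n p] less.prems p unfolding k_def by (metis not_prime_unit neq0_conv)
    have m0: "0 < m" using m less.prems by (auto intro: Nat.gr0I)
    have "1 < p ^ k" using prime_gt_1_nat[OF p(1)] k by (rule one_less_power)
    then have mn: "m < n" using m m0 by simp
    have cop: "coprime (p ^ j) m'" if "m' = m \<or> m' = m ^ 2" for j m'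
      using m(2) p(1) that prime_imp_coprime by (auto intro!: coprime_power_right_iff[THEN iffD2] simp: coprime_power_left_iff)
    have pw: "(\<Sum>d | d dvd p ^ j. \<psi> d) = (\<Sum>i\<le>j. \<psi> p ^ i)" for j
    proof -
      have "{d. d dvd p ^ j} = (\<lambda>i. p ^ i) ` {..j}" using divides_primepow_nat[OF p(1)] by auto
      moreover have "inj_on (\<lambda>i. p ^ i) {..j}" using prime_gt_1_nat[OF p(1)] by (auto simp: inj_on_def power_inject_exp)
      moreover have "\<psi> (p ^ i) = \<psi> p ^ i" for i by (induction i) (use one mult in auto)
      ultimately show ?thesis by (simp add: sum.reindex)
    qed
    have "\<psi> p \<in> {-1, 0, 1}" using assms(1) unfolding real_char_def by blast
    then have vals: "\<psi> p = -1 \<or> \<psi> p = 0 \<or> \<psi> p = 1" by auto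
    have alt: "(\<Sum>i\<le>j. (-1) ^ i) = (if even j then 1 else 0::real)" for j by (induction j) auto
    have zer: "(\<Sum>i\<le>j. 0 ^ i) = (1::real)" for j by (induction j) auto
    have 1: "0 \<le> (\<Sum>i\<le>j. \<psi> p ^ i)" for j using vals alt[of j] zer[of j] by auto
    have 2: "1 \<le> (\<Sum>i\<le>2 * k. \<psi> p ^ i)" using vals alt[of "2 * k"] zer[of "2 * k"] by auto
    have n2: "n ^ 2 = p ^ (2 * k) * m ^ 2" using m by (simp add: power_mult_distrib power_mult[symmetric] mult.commute)
    have IH: "0 \<le> (\<Sum>d | d dvd m. \<psi> d)" "1 \<le> (\<Sum>d | d dvd m ^ 2. \<psi> d)" using less.IH[OF mn m0] by auto
    have "0 \<le> (\<Sum>d | d dvd p ^ k * m. \<psi> d)"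
      using sum_divisors_coprime_mult[of "p ^ k" m \<psi>] cop mult p(1) m0 1[of k] IH by (simp add: pw prime_gt_0_nat)
    moreover have "1 * 1 \<le> (\<Sum>i\<le>2 * k. \<psi> p ^ i) * (\<Sum>d | d dvd m ^ 2. \<psi> d)"
      using 2 IH by (intro mult_mono) auto
    then have "1 \<le> (\<Sum>d | d dvd p ^ (2 * k) * m ^ 2. \<psi> d)"
      using sum_divisors_coprime_mult[of "p ^ (2 * k)" "m ^ 2" \<psi>] cop mult p(1) m0 by (simp add: pw prime_gt_0_nat)
    ultimately show ?thesis using m(1) n2 by simp
  qed (use one in simp)
qed

text \<open>Pairing the terms \<open>i\<close> and \<open>n - 1 - i\<close> and using the
  arithmetic-geometric mean inequality.\<close>

lemma geometric_sum_ge: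
  fixes s :: real
  assumes "0 \<le> s"
  shows "real n * s ^ (n - 1) \<le> (\<Sum>i<n. (s ^ 2) ^ i)"
proof -
  have "2 * (real n * s ^ (n - 1)) = (\<Sum>i<n. 2 * s ^ (n - 1))" by simp
  also have "\<dots> \<le> (\<Sum>i<n. (s ^ 2) ^ i + (s ^ 2) ^ (n - Suc i))"
  proof (rule sum_mono)
    fix i assume i: "i \<in> {..<n}"
    have "0 \<le> (s ^ i - s ^ (n - Suc i)) ^ 2" by simp
    also have "\<dots> = (s ^ 2) ^ i + (s ^ 2) ^ (n - Suc i) - 2 * (s ^ i * s ^ (n - Suc i))"
      by (simp add: power2_diff power_mult[symmetric] mult.commute)
    also have "s ^ i * s ^ (n - Suc i) = s ^ (n - 1)" using i by (simp add: power_add[symmetric])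
    finally show "2 * s ^ (n - 1) \<le> (s ^ 2) ^ i + (s ^ 2) ^ (n - Suc i)" by simp
  qed
  also have "\<dots> = 2 * (\<Sum>i<n. (s ^ 2) ^ i)"
    by (simp add: sum.distrib sum.nat_diff_reindex[of "\<lambda>i. (s ^ 2) ^ i"])
  finally show ?thesis by simp
qed

text \<open>
  Non-vanishing at \<open>1\<close> for real characters, after Monsky: if \<open>L(1, \<psi>) = 0\<close>, then the Lambert series
  \<open>\<Sum> \<psi>(d) t\<^sup>d / (1 - t\<^sup>d)\<close> stays bounded as \<open>t\<close> tends to \<open>1\<close>, because
  \<open>1/d - (1 - t) t\<^sup>d / (1 - t\<^sup>d)\<close> decreases in \<open>d\<close>; but its coefficients are at least \<open>1\<close> at the squares.
\<close>
lemma real_char_L1_nonzero: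
  assumes \<psi>: "real_char M \<psi>" and L: "\<And>N. \<bar>\<Sum>n\<in>{1..N}. \<psi> n / real n\<bar> \<le> real M / real (Suc N)"
  shows False
proof -
  have \<psi>1: "\<bar>\<psi> n\<bar> \<le> 1" for n
  proof -
    have "\<psi> n \<in> {-1, 0, 1}" using \<psi> unfolding real_char_def by blast
    then show ?thesis by auto
  qed
  \<comment> \<open>The number of squares used is one more than the bound \<open>M\<close> that will
    emerge for it.\<close>
  define K where "K = M + 1"
  have key: "real K * (s ^ 2) ^ (K ^ 2) \<le> real M" if s: "0 < s" "s < 1" for s :: real
  proof -
    \<comment> \<open>The parameter is taken as a square so that \<open>geometric_sum_ge\<close>
      bounds the sums \<open>G n\<close> below in terms of \<open>s\<close>.\<close>
    define t where "t = s ^ 2"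
    have t: "0 < t" "t < 1" using s mult_strict_mono[of s 1 s 1] by (auto simp: t_def power2_eq_square)
    define G where "G n = (\<Sum>i<n. t ^ i)" for n
    have G1: "(1 - t) * G n = 1 - t ^ n" for n using sum_gp_strict[of t n] t by (simp add: G_def)
    have Gs: "real n * s ^ (n - 1) \<le> G n" for n unfolding G_def t_def using s by (intro geometric_sum_ge) simp
    have Gpos: "0 < G n" if "1 \<le> n" for n
    proof -
      have "0 < real n * s ^ (n - 1)" using s that by simp
      then show ?thesis using Gs[of n] by linarith
    qed
    define \<beta> where "\<beta> n = 1 / real n - t ^ n / G n" for n
    have \<beta>0: "0 \<le> \<beta> n" if "1 \<le> n" for n
    proof -
      have "t ^ n \<le> s ^ (n - 1)"
        unfolding t_def power_mult[symmetric] using s by (intro power_decreasing) auto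
      then have "real n * t ^ n \<le> G n" using Gs[of n] mult_left_mono[of "t ^ n" "s ^ (n - 1)" "real n"] by linarith
      then show ?thesis using Gpos[OF that] that by (simp add: \<beta>_def field_simps)
    qed
    \<comment> \<open>Monotonicity amounts to
      \<open>n * (n + 1) * t ^ n \<le> G n * G (Suc n)\<close>, which the lower bounds for
      \<open>G n\<close> and \<open>G (Suc n)\<close> give together.\<close>
    have \<beta>dec: "\<beta> (Suc n) \<le> \<beta> n" if n: "1 \<le> n" for n
    proof -
      have GS: "G (Suc n) = 1 + t * G n" "G (Suc n) = G n + t ^ n"
      proof -
        show "G (Suc n) = G n + t ^ n" by (simp add: G_def)
        show "G (Suc n) = 1 + t * G n" unfolding G_def by (subst sum.lessThan_Suc_shift) (simp add: sum_distrib_left)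
      qed
      have "t ^ n \<le> s ^ (n - 1) * s ^ n"
        unfolding t_def power_mult[symmetric] power_add[symmetric] using s by (intro power_decreasing) auto
      then have "real n * real (Suc n) * t ^ n \<le> (real n * s ^ (n - 1)) * (real (Suc n) * s ^ (Suc n - 1))"
        using mult_left_mono[of "t ^ n" "s ^ (n - 1) * s ^ n" "real n * real (Suc n)"] by (simp add: mult_ac)
      also have "\<dots> \<le> G n * G (Suc n)"
        using Gs[of n] Gs[of "Suc n"] s Gpos[OF n] by (intro mult_mono) auto
      finally have le: "real n * real (Suc n) * t ^ n \<le> G n * G (Suc n)" .
      have "t ^ n / G n - t ^ Suc n / G (Suc n) = t ^ n / (G n * G (Suc n))"
      proof -
        have "t ^ n / G n - t ^ Suc n / G (Suc n) = (t ^ n * (G (Suc n) - t * G n)) / (G n * G (Suc n))"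
          using Gpos[OF n] Gpos[of "Suc n"] by (simp add: field_simps)
        then show ?thesis using GS(1) by simp
      qed
      also have "\<dots> \<le> 1 / (real n * real (Suc n))"
      proof -
        define A where "A = real n * real (Suc n)"
        define B where "B = G n * G (Suc n)"
        have "0 < A" "0 < B" using Gpos[OF n] Gpos[of "Suc n"] n by (auto simp: A_def B_def)
        moreover have "A * t ^ n \<le> B" using le by (simp only: A_def B_def)
        ultimately have "t ^ n / B \<le> 1 / A" by (simp add: field_simps)
        then show ?thesis by (simp only: A_def B_def)
      qed
      also have "\<dots> = 1 / real n - 1 / real (Suc n)" using n by (simp add: field_simps)
      finally show ?thesis by (simp add: \<beta>_def)
    qed
    \<comment> \<open>The Lambert series is truncated at \<open>X\<close>. Cutting the geometric
      series for each \<open>d\<close> costs at most \<open>t ^ X / (1 - t)\<close>, altogether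
      \<open>X * t ^ X\<close> after multiplication by \<open>1 - t\<close>; both this and
      \<open>M / Suc X\<close> vanish as \<open>X\<close> grows.\<close>
    have main: "(1 - t) * (real K * t ^ (K ^ 2)) \<le> real M / real (Suc X) + real M * (1 - t) + real X * t ^ X"
      if X: "K ^ 2 \<le> X" for X
    proof -
      have "real K * t ^ (K ^ 2) = (\<Sum>m\<in>{1..K}. t ^ (K ^ 2))" by simp
      also have "\<dots> \<le> (\<Sum>m\<in>{1..K}. t ^ (m ^ 2))"
        using t by (intro sum_mono power_decreasing) auto
      also have "\<dots> \<le> (\<Sum>m\<in>{1..K}. (\<Sum>d | d dvd m ^ 2. \<psi> d) * t ^ (m ^ 2))"
      proof (rule sum_mono)
        fix m assume "m \<in> {1..K}"
        then have "1 * t ^ (m ^ 2) \<le> (\<Sum>d | d dvd m ^ 2. \<psi> d) * t ^ (m ^ 2)"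
          using real_char_divisor_sum[OF \<psi>, of m] t by (intro mult_right_mono) auto
        then show "t ^ (m ^ 2) \<le> (\<Sum>d | d dvd m ^ 2. \<psi> d) * t ^ (m ^ 2)" by simp
      qed
      also have "\<dots> = (\<Sum>n\<in>(\<lambda>m. m ^ 2) ` {1..K}. (\<Sum>d | d dvd n. \<psi> d) * t ^ n)"
        by (subst sum.reindex) (auto simp: inj_on_def)
      also have "\<dots> \<le> (\<Sum>n\<in>{1..X}. (\<Sum>d | d dvd n. \<psi> d) * t ^ n)"
      proof (rule sum_mono2)
        show "(\<lambda>m. m ^ 2) ` {1..K} \<subseteq> {1..X}"
        proof safe
          fix m assume m: "m \<in> {1..K}"
          then have "m ^ 2 \<le> X" by (intro le_trans[OF power_mono X]) auto
          then show "m ^ 2 \<in> {1..X}" using m by simp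
        qed
        show "0 \<le> (\<Sum>d | d dvd n. \<psi> d) * t ^ n" if "n \<in> {1..X} - (\<lambda>m. m ^ 2) ` {1..K}" for n
          using real_char_divisor_sum[OF \<psi>, of n] that t by auto
      qed simp
      also have "\<dots> = (\<Sum>n\<in>{1..X}. \<Sum>d | d dvd n. \<psi> d * t ^ (d * (n div d)))"
        unfolding sum_distrib_right by (intro sum.cong refl) auto
      also have "\<dots> = (\<Sum>d\<in>{1..X}. \<Sum>m\<in>{1..X div d}. \<psi> d * t ^ (d * m))"
        by (rule sum_divisors_swap[where F = "\<lambda>d m. \<psi> d * t ^ (d * m)"])
      also have "\<dots> \<le> (\<Sum>d\<in>{1..X}. \<psi> d * (t ^ d / (1 - t ^ d)) + t ^ X / (1 - t))"
      proof (rule sum_mono)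
        fix d assume d: "d \<in> {1..X}"
        have td: "t ^ d \<le> t" using d t power_decreasing[of 1 d t] by simp
        have geo: "(\<Sum>m\<in>{1..k}. t ^ (d * m)) = t ^ d / (1 - t ^ d) - t ^ (d * Suc k) / (1 - t ^ d)" for k
        proof -
          define r where "r = t ^ d"
          have r1: "r < 1" using td t by (simp add: r_def)
          have "(1 - r) * (\<Sum>m\<in>{1..k}. r ^ m) = r - r ^ Suc k"
          proof (induction k)
            case (Suc k)
            have "(1 - r) * (\<Sum>m\<in>{1..Suc k}. r ^ m) = (1 - r) * (\<Sum>m\<in>{1..k}. r ^ m) + (1 - r) * r ^ Suc k"
              by (simp add: distrib_left)
            also have "\<dots> = r - r ^ Suc (Suc k)" unfolding Suc by (simp add: left_diff_distrib)
            finally show ?case .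
          qed simp
          then have "(\<Sum>m\<in>{1..k}. r ^ m) = (r - r ^ Suc k) / (1 - r)"
            using r1 by (simp add: eq_divide_eq mult.commute)
          then show ?thesis unfolding r_def power_mult by (simp only: diff_divide_distrib)
        qed
        define k where "k = X div d"
        have "X \<le> d * Suc k" unfolding k_def using d by (metis Suc_leI atLeastAtMost_iff dividend_less_times_div less_le_trans less_or_eq_imp_le mult_Suc_right add.commute zero_less_one)
        then have zw: "t ^ (d * Suc k) / (1 - t ^ d) \<le> t ^ X / (1 - t)"
          using t td by (intro frac_le power_decreasing) auto
        have z0: "0 \<le> t ^ (d * Suc k) / (1 - t ^ d)" using t td by simp
        have "\<bar>\<psi> d * (t ^ (d * Suc k) / (1 - t ^ d))\<bar> \<le> 1 * (t ^ X / (1 - t))"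
          unfolding abs_mult abs_of_nonneg[OF z0] by (intro mult_mono \<psi>1 zw z0) simp
        then have "- (\<psi> d * (t ^ (d * Suc k) / (1 - t ^ d))) \<le> 1 * (t ^ X / (1 - t))" by (rule abs_le_D2)
        then show "(\<Sum>m\<in>{1..X div d}. \<psi> d * t ^ (d * m)) \<le> \<psi> d * (t ^ d / (1 - t ^ d)) + t ^ X / (1 - t)"
          unfolding sum_distrib_left[symmetric] k_def[symmetric] geo right_diff_distrib[of "\<psi> d"] by linarith
      qed
      finally have "(1 - t) * (real K * t ^ (K ^ 2)) \<le> (1 - t) * (\<Sum>d\<in>{1..X}. \<psi> d * (t ^ d / (1 - t ^ d)) + t ^ X / (1 - t))"
        using t by (intro mult_left_mono) auto
      also have "\<dots> = (\<Sum>d\<in>{1..X}. \<psi> d / real d) - (\<Sum>d\<in>{1..X}. \<psi> d * \<beta> d) + real X * t ^ X"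
      proof -
        have pt: "(1 - t) * (\<psi> d * (t ^ d / (1 - t ^ d)) + t ^ X / (1 - t)) = \<psi> d / real d - \<psi> d * \<beta> d + t ^ X"
          if "d \<in> {1..X}" for d
        proof -
          have "(1 - t) * (t ^ d / (1 - t ^ d)) = t ^ d / G d"
            using G1[of d] t Gpos[of d] that by (simp add: G1[symmetric])
          then have "(1 - t) * (\<psi> d * (t ^ d / (1 - t ^ d))) = \<psi> d * (t ^ d / G d)"
            by (metis mult.left_commute)
          then show ?thesis using t by (simp add: \<beta>_def distrib_left right_diff_distrib)
        qed
        have "(1 - t) * (\<Sum>d\<in>{1..X}. \<psi> d * (t ^ d / (1 - t ^ d)) + t ^ X / (1 - t))
            = (\<Sum>d\<in>{1..X}. (1 - t) * (\<psi> d * (t ^ d / (1 - t ^ d)) + t ^ X / (1 - t)))"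
          by (rule sum_distrib_left)
        also have "\<dots> = (\<Sum>d\<in>{1..X}. \<psi> d / real d - \<psi> d * \<beta> d + t ^ X)"
          by (intro sum.cong refl pt)
        also have "\<dots> = (\<Sum>d\<in>{1..X}. \<psi> d / real d) - (\<Sum>d\<in>{1..X}. \<psi> d * \<beta> d) + real X * t ^ X"
          by (simp add: sum.distrib sum_subtractf)
        finally show ?thesis .
      qed
      also have "\<dots> \<le> real M / real (Suc X) + real M * (1 - t) + real X * t ^ X"
      proof -
        have "norm (\<Sum>d\<in>{1..<Suc X}. of_real (\<psi> d) * complex_of_real (\<beta> d)) \<le> real M * \<beta> 1"
        proof (rule norm_sum_abel_le)
          fix j
          have "norm (\<Sum>n\<in>{1..<j}. complex_of_real (\<psi> n)) = \<bar>\<Sum>n\<in>{1..<j}. \<psi> n\<bar>"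
            by (metis norm_of_real of_real_sum)
          then show "norm (\<Sum>n\<in>{1..<j}. complex_of_real (\<psi> n)) \<le> real M"
            using \<psi> unfolding real_char_def by presburger
        qed (use \<beta>0 \<beta>dec in auto)
        moreover have "norm (\<Sum>d\<in>{1..<Suc X}. of_real (\<psi> d) * complex_of_real (\<beta> d)) = \<bar>\<Sum>d\<in>{1..X}. \<psi> d * \<beta> d\<bar>"
          by (simp add: atLeastLessThanSuc_atLeastAtMost del: of_real_mult of_real_sum add: of_real_mult[symmetric] of_real_sum[symmetric])
        moreover have "\<beta> 1 = 1 - t" by (simp add: \<beta>_def G_def)
        ultimately show ?thesis using L[of X] by auto
      qed
      finally show ?thesis .
    qed
    have "(\<lambda>X. real M / real (Suc X) + real M * (1 - t) + real X * t ^ X) \<longlonglongrightarrow> 0 + real M * (1 - t) + 0"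
    proof (intro tendsto_add tendsto_const)
      show "(\<lambda>X. real M / real (Suc X)) \<longlonglongrightarrow> 0" by real_asymp
      show "(\<lambda>X. real X * t ^ X) \<longlonglongrightarrow> 0" using powser_times_n_limit_0[of t] t by simp
    qed
    then have "(1 - t) * (real K * t ^ (K ^ 2)) \<le> 0 + real M * (1 - t) + 0"
      by (rule LIMSEQ_le_const) (use main in blast)
    then have "(1 - t) * (real K * t ^ (K ^ 2)) \<le> (1 - t) * real M" by (simp add: mult.commute)
    then show ?thesis using t by (simp add: t_def)
  qed
  \<comment> \<open>As \<open>s\<close> tends to 1 the powers tend to 1, leaving
    \<open>K \<le> M\<close>.\<close>
  have "(\<lambda>j. real K * ((1 - 1 / real (j + 2)) ^ 2) ^ (K ^ 2)) \<longlonglongrightarrow> real K * ((1 - 0) ^ 2) ^ (K ^ 2)"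
  proof (intro tendsto_intros)
    show "(\<lambda>j. 1 / real (j + 2)) \<longlonglongrightarrow> 0" by real_asymp
  qed
  then have "real K * ((1 - 0) ^ 2) ^ (K ^ 2) \<le> real M"
    by (rule LIMSEQ_le_const2) (use key in \<open>auto intro!: exI[of _ 0]\<close>)
  then show False by (simp add: K_def)
qed

section \<open>Non-vanishing for all characters and Mertens' theorem in progressions\<close>

lemma L1_tendsto:
  assumes "0 < M" "\<xi> \<in> dchars M" "\<xi> \<noteq> principal M"
  shows "(\<lambda>N. \<Sum>n\<in>{1..N}. \<xi> n / of_nat n) \<longlonglongrightarrow> L1 \<xi>"
proof (rule LIM_zero_cancel, rule Lim_null_comparison)
  show "\<forall>\<^sub>F N in sequentially. norm ((\<Sum>n\<in>{1..N}. \<xi> n / of_nat n) - L1 \<xi>) \<le> real M / real (Suc N)"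
    using norm_L1_minus_le[OF assms] by (intro always_eventually allI) (metis norm_minus_commute)
  show "(\<lambda>N. real M / real (Suc N)) \<longlonglongrightarrow> 0" by real_asymp
qed

lemma cnj_in_dchars: "\<xi> \<in> dchars M \<Longrightarrow> (\<lambda>n. cnj (\<xi> n)) \<in> dchars M"
  unfolding dchars_def by fastforce

lemma L1_cnj:
  assumes "0 < M" "\<xi> \<in> dchars M" "\<xi> \<noteq> principal M" "(\<lambda>n. cnj (\<xi> n)) \<noteq> principal M"
  shows "L1 (\<lambda>n. cnj (\<xi> n)) = cnj (L1 \<xi>)"
proof -
  have "(\<lambda>N. cnj (\<Sum>n\<in>{1..N}. \<xi> n / of_nat n)) \<longlonglongrightarrow> cnj (L1 \<xi>)"
    using L1_tendsto[OF assms(1-3)] by (rule tendsto_cnj)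
  then have "(\<lambda>N. \<Sum>n\<in>{1..N}. cnj (\<xi> n) / of_nat n) \<longlonglongrightarrow> cnj (L1 \<xi>)" by simp
  moreover have "(\<lambda>N. \<Sum>n\<in>{1..N}. cnj (\<xi> n) / of_nat n) \<longlonglongrightarrow> L1 (\<lambda>n. cnj (\<xi> n))"
    using L1_tendsto[OF assms(1) cnj_in_dchars[OF assms(2)] assms(4)] .
  ultimately show ?thesis by (rule LIMSEQ_unique[symmetric])
qed

lemma L1_nonzero_if_self_conjugate:
  assumes "0 < M" "\<xi> \<in> dchars M" "\<xi> \<noteq> principal M" "(\<lambda>n. cnj (\<xi> n)) = \<xi>"
  shows "L1 \<xi> \<noteq> 0"
proof
  assume L: "L1 \<xi> = 0"
  define \<psi> where "\<psi> n = Re (\<xi> n)" for n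
  have re: "\<xi> n = of_real (\<psi> n)" for n
    using fun_cong[OF assms(4), of n] by (simp add: \<psi>_def complex_eq_iff)
  have "real_char M \<psi>"
    unfolding real_char_def
  proof (intro conjI allI)
    show "\<psi> (a * b) = \<psi> a * \<psi> b" for a b using dcharsD(1)[OF assms(2), of a b] unfolding re by (simp flip: of_real_mult)
    show "\<psi> 1 = 1" using dcharsD(3)[OF assms(2)] by (simp add: \<psi>_def)
    show "\<psi> a \<in> {-1, 0, 1}" for a
    proof (cases "coprime a M")
      case True
      then have "\<bar>\<psi> a\<bar> = 1" using dchars_norm[OF assms(2) True assms(1)] unfolding re by simp
      then show ?thesis by auto
    next
      case False
      then show ?thesis using dcharsD(4)[OF assms(2) False] by (simp add: \<psi>_def)
    qed
    show "\<bar>\<Sum>n\<in>{i..<j}. \<psi> n\<bar> \<le> real M" for i j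
      using norm_sum_dchar_le[OF assms(1-3), of i j] unfolding re by (simp flip: of_real_sum)
  qed
  moreover have "\<bar>\<Sum>n\<in>{1..N}. \<psi> n / real n\<bar> \<le> real M / real (Suc N)" for N
  proof -
    have "(\<Sum>n\<in>{1..N}. \<xi> n / of_nat n) = of_real (\<Sum>n\<in>{1..N}. \<psi> n / real n)" by (simp add: re)
    then have "norm (\<Sum>n\<in>{1..N}. \<xi> n / of_nat n) = \<bar>\<Sum>n\<in>{1..N}. \<psi> n / real n\<bar>"
      by (metis norm_of_real)
    then show ?thesis using norm_L1_minus_le[OF assms(1-3), of N] L by (simp del: of_nat_Suc)
  qed
  ultimately show False by (rule real_char_L1_nonzero)
qed

text \<open>Orthogonality picks out the class of \<open>a\<close>. The value at an inverse
  \<open>a'\<close> takes the place of the conjugate of \<open>\<xi> a\<close>.\<close>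

lemma sum_SL_eq:
  assumes "0 < M" "coprime a M" "[a * a' = 1] (mod M)"
  shows "(\<Sum>\<xi>\<in>dchars M. \<xi> a' * SL \<xi> N) = of_real (real (totient M) * (\<Sum>n | n \<in> {1..N} \<and> [n = a] (mod M). mangoldt n / real n))"
proof -
  have a': "coprime a' M" using cong_imp_coprime[OF cong_sym[OF assms(3)]] by simp
  have "(\<Sum>\<xi>\<in>dchars M. \<xi> a' * SL \<xi> N) = (\<Sum>n\<in>{1..N}. (\<Sum>\<xi>\<in>dchars M. \<xi> (a' * n)) * (mangoldt n / of_nat n))"
    unfolding SL_def sum_distrib_left sum_distrib_right
    by (subst sum.swap) (intro sum.cong refl, simp add: dcharsD(1))
  also have "\<dots> = (\<Sum>n\<in>{1..N}. if [n = a] (mod M) then of_nat (totient M) * (mangoldt n / of_nat n) else 0)"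
  proof (intro sum.cong refl)
    fix n
    have iff: "[a' * n = 1] (mod M) \<longleftrightarrow> [n = a] (mod M)"
    proof
      assume "[a' * n = 1] (mod M)"
      then have "[a * (a' * n) = a * 1] (mod M)" by (rule cong_scalar_left)
      moreover have "[a * (a' * n) = 1 * n] (mod M)"
        unfolding mult.assoc[symmetric] using assms(3) by (rule cong_scalar_right)
      ultimately show "[n = a] (mod M)" by (simp add: cong_def)
    next
      assume "[n = a] (mod M)"
      then have "[a' * n = a' * a] (mod M)" by (rule cong_scalar_left)
      then show "[a' * n = 1] (mod M)" using assms(3) by (simp add: cong_def mult.commute)
    qed
    show "(\<Sum>\<xi>\<in>dchars M. \<xi> (a' * n)) * (mangoldt n / of_nat n) = (if [n = a] (mod M) then of_nat (totient M) * (mangoldt n / of_nat n) else 0)"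
    proof (cases "coprime n M")
      case True
      then show ?thesis using sum_dchars[OF assms(1), of "a' * n"] a' by (simp only: iff card_dchars[OF assms(1)]) simp
    next
      case False
      then have "\<not> [n = a] (mod M)" using assms(2) cong_imp_coprime[OF cong_sym, of n a M] by blast
      moreover have "(\<Sum>\<xi>\<in>dchars M. \<xi> (a' * n)) = 0"
        using dcharsD(4) False by (intro sum.neutral) auto
      ultimately show ?thesis by simp
    qed
  qed
  also have "\<dots> = (\<Sum>n | n \<in> {1..N} \<and> [n = a] (mod M). of_nat (totient M) * (mangoldt n / of_nat n))"
    by (intro sum.mono_neutral_cong_right) auto
  also have "\<dots> = of_real (real (totient M) * (\<Sum>n | n \<in> {1..N} \<and> [n = a] (mod M). mangoldt n / real n))"
    by (simp add: sum_distrib_left)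
  finally show ?thesis .
qed

text \<open>Summed over all characters, \<open>SL\<close> becomes a nonnegative sum over the class
  of 1, while each zero subtracts \<open>ln N\<close>; hence there is at most one zero. The
  conjugate of a zero is a zero, so a lone zero belongs to a real character, which is
  excluded.\<close>

lemma L1_nonzero:
  assumes "0 < M" "\<xi> \<in> dchars M" "\<xi> \<noteq> principal M"
  shows "L1 \<xi> \<noteq> 0"
proof
  assume L0: "L1 \<xi> = 0"
  define Z where "Z = {\<xi> \<in> dchars M. \<xi> \<noteq> principal M \<and> L1 \<xi> = 0}"
  \<comment> \<open>The coefficient of \<open>ln N\<close> in \<open>SL \<xi> N\<close>.\<close>
  define e where "e \<xi> = (if \<xi> = principal M then 1 else if L1 \<xi> = 0 then -1 else 0 :: real)" for \<xi>
  have "\<exists>C. \<forall>N\<ge>1. norm (SL \<xi> N - of_real (e \<xi> * ln (real N))) \<le> C" if xi: "\<xi> \<in> dchars M" for \<xi>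
  proof -
    consider "\<xi> = principal M" | "\<xi> \<noteq> principal M" "L1 \<xi> = 0" | "\<xi> \<noteq> principal M" "L1 \<xi> \<noteq> 0" by blast
    then show ?thesis
    proof cases
      case 1
      then show ?thesis using SL_principal_bounded[OF assms(1)] by (simp add: e_def)
    next
      case 2
      then show ?thesis using SL_bounded_if_L1_zero[OF assms(1) xi] by (intro exI[of _ "real M"]) (auto simp: e_def)
    next
      case 3
      obtain C where C: "\<And>N. norm (L1 \<xi> * SL \<xi> N) \<le> C" using L1_times_SL_bounded[OF assms(1) xi 3(1)] by blast
      have "norm (SL \<xi> N) \<le> C / norm (L1 \<xi>)" for N using C[of N] 3 by (simp add: norm_mult field_simps)
      then show ?thesis using 3 by (auto simp: e_def)
    qed
  qed
  then obtain C where C: "\<And>\<xi> N. \<xi> \<in> dchars M \<Longrightarrow> 1 \<le> N \<Longrightarrow> norm (SL \<xi> N - of_real (e \<xi> * ln (real N))) \<le> C \<xi>"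
    by metis
  have fin: "finite (dchars M)" by (rule finite_dchars[OF assms(1)])
  have sume: "(\<Sum>\<xi>\<in>dchars M. e \<xi>) = 1 - real (card Z)"
  proof -
    have "(\<Sum>\<xi>\<in>dchars M. e \<xi>) = (\<Sum>\<xi>\<in>dchars M. (if \<xi> = principal M then 1 else 0) - (if \<xi> \<in> Z then 1 else 0))"
      by (intro sum.cong) (auto simp: e_def Z_def)
    also have "\<dots> = 1 - real (card Z)"
      unfolding sum_subtractf using fin principal_in_dchars by (simp add: sum.delta sum.If_cases Z_def Int_def conj_commute)
    finally show ?thesis .
  qed
  have "0 \<le> (1 - real (card Z)) * ln (real N) + (\<Sum>\<xi>\<in>dchars M. C \<xi>)" if N: "1 \<le> N" for N
  proof -
    define P where "P = real (totient M) * (\<Sum>n | n \<in> {1..N} \<and> [n = 1] (mod M). mangoldt n / real n)"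
    have P0: "0 \<le> P" unfolding P_def by (intro mult_nonneg_nonneg sum_nonneg) (auto simp: mangoldt_nonneg)
    have "of_real P = (\<Sum>\<xi>\<in>dchars M. \<xi> 1 * SL \<xi> N)" unfolding P_def by (rule sum_SL_eq[symmetric]) (use assms in auto)
    also have "\<dots> = (\<Sum>\<xi>\<in>dchars M. SL \<xi> N)" using dcharsD(3) by (intro sum.cong) auto
    finally have "of_real (P - (1 - real (card Z)) * ln (real N)) = (\<Sum>\<xi>\<in>dchars M. SL \<xi> N - of_real (e \<xi> * ln (real N)))"
      unfolding sume[symmetric] by (simp add: sum_subtractf sum_distrib_right)
    then have "\<bar>P - (1 - real (card Z)) * ln (real N)\<bar> = norm (\<Sum>\<xi>\<in>dchars M. SL \<xi> N - of_real (e \<xi> * ln (real N)))"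
      by (metis norm_of_real)
    also have "\<dots> \<le> (\<Sum>\<xi>\<in>dchars M. C \<xi>)"
      by (rule order_trans[OF norm_sum]) (intro sum_mono C N)
    finally show ?thesis using P0 by linarith
  qed
  note bound = this
  have "card Z \<le> 1"
  proof (rule ccontr)
    assume "\<not> card Z \<le> 1"
    then have "(1 - real (card Z)) * ln (real N) \<le> (-1) * ln (real N)" if "1 \<le> N" for N
      using that by (intro mult_right_mono) auto
    then have le: "ln (real N) \<le> (\<Sum>\<xi>\<in>dchars M. C \<xi>)" if "1 \<le> N" for N
      using bound[OF that] that by fastforce
    obtain N where N: "exp ((\<Sum>\<xi>\<in>dchars M. C \<xi>) + 1) < real N" using reals_Archimedean2 by blast
    then have "0 < real N" by (meson exp_gt_zero less_trans)
    then have "ln (exp ((\<Sum>\<xi>\<in>dchars M. C \<xi>) + 1)) < ln (real N)" using N by (subst ln_less_cancel_iff) auto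
    then show False using le[of N] \<open>0 < real N\<close> by auto
  qed
  moreover have finZ: "finite Z" using fin by (simp add: Z_def)
  moreover have "\<xi> \<in> Z" using assms L0 by (simp add: Z_def)
  moreover have "(\<lambda>n. cnj (\<xi> n)) \<in> Z"
  proof -
    have np: "(\<lambda>n. cnj (\<xi> n)) \<noteq> principal M"
    proof
      assume "(\<lambda>n. cnj (\<xi> n)) = principal M"
      then have "cnj (\<xi> n) = principal M n" for n by metis
      then have "\<xi> n = principal M n" for n by (metis complex_cnj_cnj complex_cnj_one complex_cnj_zero principal_def)
      then show False using assms(3) by blast
    qed
    then show ?thesis using L1_cnj[OF assms np] L0 cnj_in_dchars[OF assms(2)] by (simp add: Z_def)
  qed
  ultimately have "(\<lambda>n. cnj (\<xi> n)) = \<xi>" by (metis card_le_Suc0_iff_eq One_nat_def)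
  then show False using L1_nonzero_if_self_conjugate[OF assms] L0 by blast
qed

text \<open>With \<open>L1 \<xi>\<close> nonzero, \<open>SL \<xi>\<close> is bounded for every
  non-principal character, so the growing term comes from the principal one alone. Nothing is
  claimed about how \<open>C\<close> depends on \<open>M\<close> and \<open>a\<close>.\<close>

theorem dirichlet_mertens:
  assumes "0 < M" "coprime a M"
  obtains C where "\<And>N. 1 \<le> N \<Longrightarrow>
    \<bar>(\<Sum>n | n \<in> {1..N} \<and> [n = a] (mod M). mangoldt n / real n) - ln (real N) / real (totient M)\<bar> \<le> C"
proof -
  obtain a' where a': "[a * a' = 1] (mod M)" using cong_solve_coprime_nat[OF assms(2)] by auto
  have ca': "coprime a' M" using cong_imp_coprime[OF cong_sym[OF a']] by simp
  define e where "e \<xi> = (if \<xi> = principal M then 1 else 0 :: real)" for \<xi>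
  have "\<exists>C. \<forall>N\<ge>1. norm (SL \<xi> N - of_real (e \<xi> * ln (real N))) \<le> C" if xi: "\<xi> \<in> dchars M" for \<xi>
  proof (cases "\<xi> = principal M")
    case True
    then show ?thesis using SL_principal_bounded[OF assms(1)] by (simp add: e_def)
  next
    case False
    obtain C where C: "\<And>N. norm (L1 \<xi> * SL \<xi> N) \<le> C" using L1_times_SL_bounded[OF assms(1) xi False] by blast
    have "norm (SL \<xi> N) \<le> C / norm (L1 \<xi>)" for N
      using C[of N] L1_nonzero[OF assms(1) xi False] by (simp add: norm_mult field_simps)
    then show ?thesis using False by (auto simp: e_def)
  qed
  then obtain C where C: "\<And>\<xi> N. \<xi> \<in> dchars M \<Longrightarrow> 1 \<le> N \<Longrightarrow> norm (SL \<xi> N - of_real (e \<xi> * ln (real N))) \<le> C \<xi>"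
    by metis
  have fin: "finite (dchars M)" by (rule finite_dchars[OF assms(1)])
  have "\<bar>(\<Sum>n | n \<in> {1..N} \<and> [n = a] (mod M). mangoldt n / real n) - ln (real N) / real (totient M)\<bar>
      \<le> (\<Sum>\<xi>\<in>dchars M. C \<xi>) / real (totient M)" if N: "1 \<le> N" for N
  proof -
    define P where "P = (\<Sum>n | n \<in> {1..N} \<and> [n = a] (mod M). mangoldt n / real n :: real)"
    have t: "0 < real (totient M)" using assms(1) by simp
    have "(\<Sum>\<xi>\<in>dchars M. \<xi> a' * of_real (e \<xi> * ln (real N))) = (\<Sum>\<xi>\<in>dchars M. if \<xi> = principal M then of_real (ln (real N)) else 0)"
      by (intro sum.cong) (auto simp: e_def principal_def ca')
    also have "\<dots> = of_real (ln (real N))" using fin principal_in_dchars by (simp add: sum.delta)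
    finally have "of_real (real (totient M) * P - ln (real N)) = (\<Sum>\<xi>\<in>dchars M. \<xi> a' * (SL \<xi> N - of_real (e \<xi> * ln (real N))))"
      unfolding P_def of_real_diff sum_SL_eq[OF assms a', symmetric] by (simp only: right_diff_distrib sum_subtractf)
    then have "\<bar>real (totient M) * P - ln (real N)\<bar> = norm (\<Sum>\<xi>\<in>dchars M. \<xi> a' * (SL \<xi> N - of_real (e \<xi> * ln (real N))))"
      by (metis norm_of_real)
    also have "\<dots> \<le> (\<Sum>\<xi>\<in>dchars M. C \<xi>)"
    proof (rule order_trans[OF norm_sum], rule sum_mono)
      fix \<xi> assume x: "\<xi> \<in> dchars M"
      have "norm (\<xi> a' * (SL \<xi> N - of_real (e \<xi> * ln (real N)))) \<le> 1 * C \<xi>"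
        unfolding norm_mult using dchars_norm_le[OF x assms(1)] C[OF x N] by (intro mult_mono) auto
      then show "norm (\<xi> a' * (SL \<xi> N - of_real (e \<xi> * ln (real N)))) \<le> C \<xi>" by simp
    qed
    finally have "\<bar>real (totient M) * P - ln (real N)\<bar> \<le> (\<Sum>\<xi>\<in>dchars M. C \<xi>)" .
    moreover have "P - ln (real N) / real (totient M) = (real (totient M) * P - ln (real N)) / real (totient M)"
      using t by (simp add: field_simps)
    ultimately show ?thesis using t unfolding P_def[symmetric] by (simp add: divide_right_mono)
  qed
  then show ?thesis using that by blast
qed

section \<open>Smooth numbers and residue sets\<close>

lemma sum_inverse_le: "1 \<le> N \<Longrightarrow> (\<Sum>n\<in>{1..N}. 1 / real n) \<le> 1 + ln (real N)"
proof (induction N rule: nat_induct_at_least)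
  case (Suc n)
  have "ln (real n / real (Suc n)) \<le> real n / real (Suc n) - 1"
    using Suc.hyps by (intro ln_le_minus_one) auto
  moreover have "ln (real n / real (Suc n)) = ln (real n) - ln (real (Suc n))"
    using Suc.hyps by (intro ln_divide_pos) auto
  moreover have "real n / real (Suc n) - 1 = - (1 / real (Suc n))" by (simp add: field_simps)
  ultimately have "1 / real (Suc n) \<le> ln (real (Suc n)) - ln (real n)" by linarith
  then show ?case using Suc.IH by simp
qed simp

lemma ln_le_sum_inverse: "ln (real N) \<le> (\<Sum>n\<in>{1..N}. 1 / real n)"
proof (cases "N = 0")
  case False
  then have "ln (real N) \<le> ln (real N + 1)" by simp
  also have "\<dots> \<le> harm N" by (rule ln_le_harm)
  finally show ?thesis by (simp add: harm_def inverse_eq_divide)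
qed simp

text \<open>A finite Euler product: splitting off the exact power of \<open>p\<close> maps the
  integers counted into a product of a geometric series and the sum over the remaining
  primes.\<close>

lemma sum_smooth_le:
  assumes "finite S" "\<And>p. p \<in> S \<Longrightarrow> prime p"
  shows "(\<Sum>n | n \<in> {1..v} \<and> prime_factors n \<subseteq> S. 1 / real n) \<le> (\<Prod>p\<in>S. 1 / (1 - 1 / real p))"
  using assms
proof (induction S rule: finite_induct)
  case empty
  have "{n. n \<in> {1..v} \<and> prime_factors n \<subseteq> {}} \<subseteq> {1}"
    by (auto simp: prime_factorization_empty_iff)
  then have "(\<Sum>n | n \<in> {1..v} \<and> prime_factors n \<subseteq> {}. 1 / real n) \<le> (\<Sum>n\<in>{1}. 1 / real n)"
    by (intro sum_mono2) auto
  then show ?case by simp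
next
  case (insert p S)
  have p: "prime p" using insert.prems by auto
  define A where "A T = {n. n \<in> {1..v} \<and> prime_factors n \<subseteq> T}" for T
  have finA: "finite (A T)" for T by (simp add: A_def)
  define J where "J = {..v}"
  have sub: "A (insert p S) \<subseteq> (\<lambda>(j, m). p ^ j * m) ` (J \<times> A S)"
  proof
    fix n assume n: "n \<in> A (insert p S)"
    then have n0: "n \<noteq> 0" by (auto simp: A_def)
    define j where "j = multiplicity p n"
    obtain m where m: "n = p ^ j * m" "\<not> p dvd m"
      using multiplicity_decompose'[of n p] n0 p unfolding j_def by (metis not_prime_unit)
    have m0: "0 < m" using m n0 by (auto intro: Nat.gr0I)
    have "j < 2 ^ j" by (rule less_exp)
    also have "2 ^ j \<le> p ^ j" using prime_ge_2_nat[OF p] by (intro power_mono) auto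
    also have "p ^ j \<le> n" using m n0 by (intro dvd_imp_le) auto
    also have "n \<le> v" using n by (auto simp: A_def)
    finally have "j \<in> J" by (simp add: J_def)
    moreover have "m \<in> A S"
    proof -
      have "m \<le> n" using m n0 by (intro dvd_imp_le) auto
      moreover have "prime_factors m \<subseteq> prime_factors n" using m n0 by (intro dvd_prime_factors) auto
      moreover have "p \<notin> prime_factors m" using m(2) by auto
      ultimately show ?thesis using n m0 by (auto simp: A_def)
    qed
    ultimately show "n \<in> (\<lambda>(j, m). p ^ j * m) ` (J \<times> A S)" using m by (intro image_eqI[of _ _ "(j, m)"]) auto
  qed
  have "(\<Sum>n\<in>A (insert p S). 1 / real n) \<le> (\<Sum>n\<in>(\<lambda>(j, m). p ^ j * m) ` (J \<times> A S). 1 / real n)"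
    by (intro sum_mono2 sub) (auto simp: J_def finA)
  also have "\<dots> \<le> sum ((\<lambda>n. 1 / real n) \<circ> (\<lambda>(j, m). p ^ j * m)) (J \<times> A S)"
    by (rule sum_image_le) (auto simp: J_def finA)
  also have "\<dots> = (\<Sum>j\<in>J. \<Sum>m\<in>A S. (1 / real p) ^ j * (1 / real m))"
    by (simp add: sum.cartesian_product case_prod_unfold comp_def power_divide)
  also have "\<dots> = (\<Sum>j\<in>J. (1 / real p) ^ j) * (\<Sum>m\<in>A S. 1 / real m)"
    by (simp only: sum_product)
  also have "\<dots> \<le> (1 / (1 - 1 / real p)) * (\<Prod>p\<in>S. 1 / (1 - 1 / real p))"
  proof (intro mult_mono)
    have p1: "1 / real p < 1" using prime_gt_1_nat[OF p] by simp
    have "(\<Sum>j\<in>J. (1 / real p) ^ j) = (1 - (1 / real p) ^ Suc v) / (1 - 1 / real p)"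
    proof -
      define u where "u = 1 / real p"
      have "(1 - u) * (\<Sum>j\<le>v. u ^ j) = 1 - u ^ Suc v" "u < 1" using p1 by (simp_all add: u_def sum_gp_basic)
      then show ?thesis unfolding J_def u_def[symmetric] by (simp add: eq_divide_eq mult.commute)
    qed
    also have "\<dots> \<le> 1 / (1 - 1 / real p)" using p1 by (intro divide_right_mono) auto
    finally show "(\<Sum>j\<in>J. (1 / real p) ^ j) \<le> 1 / (1 - 1 / real p)" .
    show "(\<Sum>m\<in>A S. 1 / real m) \<le> (\<Prod>p\<in>S. 1 / (1 - 1 / real p))"
      unfolding A_def using insert.IH insert.prems by simp
    show "0 \<le> 1 / (1 - 1 / real p)" using p1 by simp
  qed (auto intro: sum_nonneg)
  finally show ?case using insert.hyps by (simp add: A_def)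
qed

text \<open>Every integer up to \<open>v\<close> has all its prime factors up to \<open>v\<close>,
  so the inverse product dominates the harmonic sum.\<close>

lemma prod_primes_le_inverse_ln:
  assumes "2 \<le> v"
  shows "(\<Prod>p | prime p \<and> p \<le> v. 1 - 1 / real p) \<le> 1 / ln (real v)"
proof -
  define P where "P = {p. prime p \<and> p \<le> v}"
  have fin: "finite P" by (simp add: P_def)
  have pos: "0 < (\<Prod>p\<in>P. 1 - 1 / real p)"
    by (intro prod_pos) (auto simp: P_def dest: prime_gt_1_nat)
  have "ln (real v) \<le> (\<Sum>n\<in>{1..v}. 1 / real n)" by (rule ln_le_sum_inverse)
  also have "{1..v} = {n. n \<in> {1..v} \<and> prime_factors n \<subseteq> P}"
    by (auto simp: P_def prime_factors_dvd dest!: dvd_imp_le)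
  also have "(\<Sum>n\<in>\<dots>. 1 / real n) \<le> (\<Prod>p\<in>P. 1 / (1 - 1 / real p))"
    by (rule sum_smooth_le[OF fin]) (auto simp: P_def)
  also have "\<dots> = 1 / (\<Prod>p\<in>P. 1 - 1 / real p)" by (simp add: prod_dividef)
  finally have "ln (real v) * (\<Prod>p\<in>P. 1 - 1 / real p) \<le> 1" using pos by (simp add: field_simps)
  moreover have "0 < ln (real v)" using assms by simp
  ultimately show ?thesis unfolding P_def by (simp add: field_simps)
qed

text \<open>The factors at primes dividing \<open>M\<close> multiply to
  \<open>totient M / M\<close>, which turns the density \<open>1 / M\<close> of a class into
  \<open>1 / totient M\<close>. This is the natural scale of all later estimates.\<close>

lemma prod_primes_not_dvd_le:
  assumes "2 \<le> v" "0 < M"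
  shows "(\<Prod>p | prime p \<and> p \<le> v \<and> \<not> p dvd M. 1 - 1 / real p) / real M \<le> 1 / (real (totient M) * ln (real v))"
proof -
  define A where "A = {p. prime p \<and> p \<le> v \<and> \<not> p dvd M}"
  define P where "P = {p. prime p \<and> p \<le> v}"
  have fin: "finite A" "finite P" by (simp_all add: A_def P_def)
  have "(\<Prod>p\<in>A. 1 - 1 / real p) * (\<Prod>p\<in>prime_factors M. 1 - 1 / real p) = (\<Prod>p\<in>A \<union> prime_factors M. 1 - 1 / real p)"
    by (rule prod.union_disjoint[symmetric]) (auto simp: fin A_def)
  also have "\<dots> \<le> (\<Prod>p\<in>P. 1 - 1 / real p)"
  proof -
    define B where "B = A \<union> prime_factors M"
    have pr: "prime p" if "p \<in> B" for p using that by (auto simp: B_def A_def)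
    have bd: "0 \<le> 1 - 1 / real p" "1 - 1 / real p \<le> 1" if "p \<in> B" for p
      using prime_gt_1_nat[OF pr[OF that]] by auto
    have sub: "P \<subseteq> B" using assms(2) by (auto simp: B_def P_def A_def prime_factors_dvd)
    have "(\<Prod>p\<in>B. 1 - 1 / real p) = (\<Prod>p\<in>B - P. 1 - 1 / real p) * (\<Prod>p\<in>P. 1 - 1 / real p)"
      by (rule prod.subset_diff[OF sub]) (simp add: B_def fin)
    also have "\<dots> \<le> 1 * (\<Prod>p\<in>P. 1 - 1 / real p)"
      by (intro mult_right_mono prod_le_1 prod_nonneg) (use bd sub in auto)
    finally show ?thesis by (simp add: B_def)
  qed
  also have "\<dots> \<le> 1 / ln (real v)" unfolding P_def by (rule prod_primes_le_inverse_ln[OF assms(1)])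
  finally have "(\<Prod>p\<in>A. 1 - 1 / real p) * (real (totient M) / real M) \<le> 1 / ln (real v)"
    using assms(2) by (simp add: totient_formula2)
  moreover have "0 < real (totient M)" "0 < ln (real v)" using assms by simp_all
  ultimately show ?thesis unfolding A_def[symmetric] by (simp add: field_simps)
qed

section \<open>Residues removed by the sieve\<close>

text \<open>The zeros modulo \<open>q\<close> of the linear form \<open>c * r + i\<close>; for
  \<open>c = 1\<close> and \<open>i = 0\<close> just the class of 0.\<close>

definition root_set :: "nat \<Rightarrow> nat \<Rightarrow> nat \<Rightarrow> nat set" where
  "root_set q c i = {r. r < q \<and> q dvd c * r + i}"

lemma root_set_subset: "root_set q c i \<subseteq> {..<q}"
  by (auto simp: root_set_def)

lemma finite_root_set [simp]: "finite (root_set q c i)"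
  by (rule finite_subset[OF root_set_subset]) simp

lemma mod_in_root_set: "0 < q \<Longrightarrow> n mod q \<in> root_set q c i \<longleftrightarrow> q dvd c * n + i"
  unfolding root_set_def dvd_eq_mod_eq_0 mem_Collect_eq by (metis mod_add_left_eq mod_less_divisor mod_mult_right_eq)

lemma card_root_set:
  assumes "prime q" "\<not> q dvd c"
  shows "card (root_set q c i) = 1"
proof -
  have q0: "0 < q" using prime_gt_0_nat[OF assms(1)] .
  have cop: "coprime c q" using assms prime_imp_coprime[of q c] by (simp add: coprime_commute)
  obtain d where d: "[c * d = 1] (mod q)" using cong_solve_coprime_nat[OF cop] by auto
  define r where "r = (d * (q - i mod q)) mod q"
  have "[c * r + i = (c * d) * (q - i mod q) + i] (mod q)"
    unfolding r_def mult.assoc by (intro cong_add cong_mult cong_refl) (simp add: cong_def)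
  also have "[(c * d) * (q - i mod q) + i = 1 * (q - i mod q) + i mod q] (mod q)"
    by (intro cong_add cong_mult d cong_refl) (simp add: cong_def)
  also have "1 * (q - i mod q) + i mod q = q" using q0 by simp
  finally have "q dvd c * r + i" by (simp add: cong_def dvd_eq_mod_eq_0)
  then have "r \<in> root_set q c i" using q0 by (simp add: root_set_def r_def)
  moreover have "r' = r''" if "r' \<in> root_set q c i" "r'' \<in> root_set q c i" for r' r''
  proof -
    have "[c * r' + i = c * r'' + i] (mod q)" using that by (auto simp: root_set_def cong_def dvd_eq_mod_eq_0)
    then have "[r' = r''] (mod q)" using cop by (simp add: cong_add_rcancel_nat cong_mult_lcancel_nat)
    then show ?thesis using that by (auto simp: root_set_def cong_def)
  qed
  ultimately have "root_set q c i = {r}" by blast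
  then show ?thesis by simp
qed

lemma root_set_disjoint_same:
  assumes "i < q" "j < q" "i \<noteq> j"
  shows "root_set q c i \<inter> root_set q c j = {}"
proof (rule ccontr)
  assume "root_set q c i \<inter> root_set q c j \<noteq> {}"
  then obtain r where "q dvd c * r + i" "q dvd c * r + j" by (auto simp: root_set_def)
  then have "[c * r + i = c * r + j] (mod q)" by (simp add: cong_def dvd_eq_mod_eq_0)
  then have "[i = j] (mod q)" by (simp add: cong_add_lcancel_nat)
  then show False using assms by (simp add: cong_def)
qed

lemma root_set_disjoint_other:
  assumes "\<not> [i * d' = j * d] (mod q)"
  shows "root_set q d i \<inter> root_set q d' j = {}"
proof (rule ccontr)
  assume "root_set q d i \<inter> root_set q d' j \<noteq> {}"
  then obtain r where r: "q dvd d * r + i" "q dvd d' * r + j" by (auto simp: root_set_def)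
  then have "q dvd d' * (d * r + i)" "q dvd d * (d' * r + j)" by auto
  then have "[d * d' * r + i * d' = d * d' * r + j * d] (mod q)"
    by (simp add: cong_def dvd_eq_mod_eq_0 algebra_simps)
  then show False using assms by (simp add: cong_add_lcancel_nat)
qed

text \<open>The residues of \<open>m\<close> for which \<open>q\<close> divides one of the shifts of
  \<open>d * m\<close>.\<close>

definition roots1 :: "nat \<Rightarrow> nat \<Rightarrow> nat \<Rightarrow> nat set" where
  "roots1 k q d = (\<Union>i\<in>{1..k}. root_set q d i)"

lemma finite_roots1 [simp]: "finite (roots1 k q d)"
  by (simp add: roots1_def)

lemma card_roots1:
  assumes "prime q" "\<not> q dvd d" "k < q"
  shows "card (roots1 k q d) = k" "root_set q 1 0 \<inter> roots1 k q d = {}"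
    "card (root_set q 1 0 \<union> roots1 k q d) = k + 1"
proof -
  show 1: "card (roots1 k q d) = k"
    unfolding roots1_def using assms
    by (subst card_UN_disjoint) (auto simp: card_root_set root_set_disjoint_same)
  show 2: "root_set q 1 0 \<inter> roots1 k q d = {}"
  proof (rule ccontr)
    assume "root_set q 1 0 \<inter> roots1 k q d \<noteq> {}"
    then obtain r i where r: "r < q" "q dvd r" "i \<in> {1..k}" "q dvd d * r + i"
      unfolding roots1_def root_set_def by fastforce
    then have "r = 0" by (auto dest: dvd_imp_le)
    then show False using r assms(3) by (auto dest: dvd_imp_le)
  qed
  show "card (root_set q 1 0 \<union> roots1 k q d) = k + 1"
    using 1 2 card_root_set[OF assms(1), of 1 0] prime_gt_1_nat[OF assms(1)]
    by (subst card_Un_disjoint) auto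
qed

text \<open>The union is smaller than \<open>2 * k + 1\<close> only if a shift of
  \<open>d * m\<close> and a shift of \<open>d' * m\<close> vanish for the same residue of
  \<open>m\<close>. These coincidences are the source of the loss \<open>SS\<close>.\<close>

lemma card_roots2:
  assumes "prime q" "\<not> q dvd d" "\<not> q dvd d'" "k < q"
  shows "k + 1 \<le> card (root_set q 1 0 \<union> roots1 k q d \<union> roots1 k q d')"
    "card (root_set q 1 0 \<union> roots1 k q d \<union> roots1 k q d') \<le> 2 * k + 1"
    "(\<And>i j. i \<in> {1..k} \<Longrightarrow> j \<in> {1..k} \<Longrightarrow> \<not> [i * d' = j * d] (mod q)) \<Longrightarrow>
      card (root_set q 1 0 \<union> roots1 k q d \<union> roots1 k q d') = 2 * k + 1"
proof -
  note c = card_roots1[OF assms(1,2,4)] card_roots1[OF assms(1,3,4)]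
  show "k + 1 \<le> card (root_set q 1 0 \<union> roots1 k q d \<union> roots1 k q d')"
    unfolding c(3)[symmetric] by (rule card_mono) auto
  have "card (root_set q 1 0 \<union> roots1 k q d \<union> roots1 k q d') \<le> (k + 1) + k"
    using card_Un_le[of "root_set q 1 0 \<union> roots1 k q d" "roots1 k q d'"] c by simp
  then show "card (root_set q 1 0 \<union> roots1 k q d \<union> roots1 k q d') \<le> 2 * k + 1" by simp
  assume "\<And>i j. i \<in> {1..k} \<Longrightarrow> j \<in> {1..k} \<Longrightarrow> \<not> [i * d' = j * d] (mod q)"
  then have "roots1 k q d \<inter> roots1 k q d' = {}"
    using root_set_disjoint_other unfolding roots1_def by blast
  then have "card (root_set q 1 0 \<union> roots1 k q d \<union> roots1 k q d') = (k + 1) + k"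
    using c by (subst card_Un_disjoint) auto
  then show "card (root_set q 1 0 \<union> roots1 k q d \<union> roots1 k q d') = 2 * k + 1" by simp
qed

text \<open>The largest element of \<open>S\<close> is at least \<open>card S\<close>, so its term
  is bounded by twice a difference of consecutive square roots.\<close>

lemma sum_inverse_sqrt_le:
  assumes "finite (S :: nat set)" "0 \<notin> S"
  shows "(\<Sum>q\<in>S. 1 / sqrt (real q)) \<le> 2 * sqrt (real (card S))"
  using assms
proof (induction S rule: finite_linorder_max_induct)
  case (insert q S)
  define n where "n = card S"
  have "insert q S \<subseteq> {1..q}" using insert by (force simp: Suc_le_eq intro: Nat.gr0I)
  then have "card (insert q S) \<le> card {1..q}" by (rule card_mono[rotated]) simp
  moreover have "q \<notin> S" using insert.hyps by auto
  ultimately have nq: "Suc n \<le> q" using insert.hyps by (simp add: n_def)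
  have "1 / sqrt (real q) \<le> 1 / sqrt (real (Suc n))" using nq by (intro divide_left_mono) auto
  also have "\<dots> \<le> 2 * (sqrt (real (Suc n)) - sqrt (real n))"
  proof -
    define u v where "u = sqrt (real (Suc n))" and "v = sqrt (real n)"
    have uv: "0 < u" "v \<le> u" "0 \<le> v" by (auto simp: u_def v_def)
    have "(u - v) * (u + v) = 1" by (simp add: u_def v_def algebra_simps)
    moreover have "(u - v) * (u + v) \<le> (u - v) * (2 * u)"
      using uv by (intro mult_left_mono) auto
    ultimately have "1 / u \<le> 2 * (u - v)" using uv by (simp add: field_simps)
    then show ?thesis by (simp only: u_def v_def)
  qed
  finally show ?case using insert \<open>q \<notin> S\<close> by (simp add: n_def)
qed simp

lemma sum_inverse_squares_le:
  assumes "1 \<le> w" "finite Q" "\<And>q. q \<in> Q \<Longrightarrow> w < q"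
  shows "(\<Sum>q\<in>Q. 1 / real q ^ 2) \<le> 1 / real w"
proof -
  have tel: "(\<Sum>q\<in>{Suc w..w + n}. 1 / real q ^ 2) \<le> 1 / real w - 1 / real (w + n)" for n
  proof (induction n)
    case (Suc n)
    have "1 / real (w + Suc n) ^ 2 \<le> 1 / (real (w + n) * real (w + Suc n))"
      using assms(1) by (intro divide_left_mono) (auto simp: power2_eq_square intro!: mult_right_mono)
    also have "\<dots> = 1 / real (w + n) - 1 / real (w + Suc n)" using assms(1) by (simp add: field_simps)
    finally show ?case using Suc by simp
  qed simp
  obtain n where n: "Q \<subseteq> {..w + n}" using assms(2) by (meson finite_nat_iff_bounded_le finite_subset atMost_subset_iff le_add2 order_trans)
  have "(\<Sum>q\<in>Q. 1 / real q ^ 2) \<le> (\<Sum>q\<in>{Suc w..w + n}. 1 / real q ^ 2)"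
    by (rule sum_mono2) (use n assms(3) in \<open>auto simp: Suc_le_eq\<close>)
  also have "\<dots> \<le> 1 / real w" using tel[of n] by (smt (verit) divide_nonneg_nonneg of_nat_0_le_iff)
  finally show ?thesis .
qed

lemma prod_one_plus_eq_sum_Pow:
  fixes a :: "'a \<Rightarrow> real"
  assumes "finite Q"
  shows "(\<Prod>q\<in>Q. 1 + a q) = (\<Sum>T\<in>Pow Q. \<Prod>q\<in>T. a q)"
  using assms
proof (induction Q rule: finite_induct)
  case (insert q Q)
  have "(\<Sum>T\<in>Pow Q. \<Prod>x\<in>insert q T. a x) = a q * (\<Sum>T\<in>Pow Q. \<Prod>x\<in>T. a x)"
    unfolding sum_distrib_left
  proof (intro sum.cong refl)
    fix T assume "T \<in> Pow Q"
    then have "finite T" "q \<notin> T" using insert.hyps finite_subset by auto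
    then show "(\<Prod>x\<in>insert q T. a x) = a q * (\<Prod>x\<in>T. a x)" by simp
  qed
  then show ?case using insert by (simp add: sum_Pow_insert algebra_simps)
qed simp

lemma card_prime_divisors_le:
  assumes "0 < (D::nat)" "D \<le> 2 ^ J"
  shows "card (prime_factors D) \<le> J"
proof -
  have "2 ^ card (prime_factors D) = (\<Prod>p\<in>prime_factors D. 2::nat)" by simp
  also have "\<dots> \<le> \<Prod>(prime_factors D)"
    by (intro prod_mono conjI prime_ge_2_nat in_prime_factors_imp_prime) auto
  also have "\<dots> \<le> D" by (intro dvd_imp_le prod_primes_dvd) (use assms in auto)
  finally have "(2::nat) ^ card (prime_factors D) \<le> 2 ^ J" using assms(2) by (rule le_trans)
  then show ?thesis by simp
qed

lemma interval_of_ge: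
  assumes "0 < (d::nat)"
  obtains c where "\<And>m. N \<le> d * m \<longleftrightarrow> c \<le> m"
proof -
  define c where "c = (LEAST m. N \<le> d * m)"
  have "N \<le> d * N" using assms by simp
  then have c: "N \<le> d * c" unfolding c_def by (rule LeastI)
  have "N \<le> d * m \<longleftrightarrow> c \<le> m" for m
    using c Least_le[of "\<lambda>m. N \<le> d * m" m, folded c_def] by (meson le_trans mult_le_mono2)
  then show ?thesis using that by blast
qed

section \<open>The dispersion estimate\<close>

definition sieve_primes :: "nat \<Rightarrow> nat \<Rightarrow> nat set" where
  "sieve_primes M v = {q. prime q \<and> q \<le> v \<and> \<not> q dvd M}"

definition rough :: "nat \<Rightarrow> nat \<Rightarrow> nat \<Rightarrow> bool" where
  "rough M v n \<longleftrightarrow> (\<forall>q\<in>sieve_primes M v. \<not> q dvd n)"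

definition sifted :: "nat \<Rightarrow> nat \<Rightarrow> nat \<Rightarrow> nat \<Rightarrow> bool" where
  "sifted k M v n \<longleftrightarrow> (\<forall>q\<in>sieve_primes M v. \<forall>i\<in>{1..k}. \<not> q dvd n + i)"

definition UU :: "nat \<Rightarrow> nat \<Rightarrow> real" where
  "UU M v = (\<Prod>q\<in>sieve_primes M v. 1 - 1 / real q)"

text \<open>The density of the sifting condition among integers already coprime to \<open>q\<close>:
  \<open>k\<close> of the \<open>q - 1\<close> nonzero residues are excluded. With the factors of
  \<open>UU\<close> it gives \<open>1 - (k + 1) / q\<close>.\<close>

definition VV :: "nat \<Rightarrow> nat \<Rightarrow> nat \<Rightarrow> real" where
  "VV k M v = (\<Prod>q\<in>sieve_primes M v. 1 - real k / (real q - 1))"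

lemma finite_sieve_primes [simp]: "finite (sieve_primes M v)"
  by (rule finite_subset[of _ "{..v}"]) (auto simp: sieve_primes_def)

text \<open>
  The shifts \<open>n + i\<close> are sifted up to \<open>y\<close>, and \<open>n\<close> itself up to the larger level \<open>r0\<^sup>2\<close>, a square so that its
  root can serve as a cut-off. The last assumption makes the remainder of the sieve negligible.
\<close>
locale sieve_setup =
  fixes k M a y r0 N x b w :: nat
  assumes k1: "1 \<le> k" and M: "0 < M" and cop: "coprime a M"
    and w: "\<And>q. prime q \<Longrightarrow> q \<le> w \<Longrightarrow> q dvd M"
    and wk: "4 * k + 2 \<le> w"
    and y3: "3 \<le> y" and yz: "y \<le> r0\<^sup>2"
    and b: "2 * exp (60 * real (2 * k + 1)) \<le> 2 ^ b"
    and N1: "1 \<le> N" and x1: "1 \<le> x"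
    and SZ: "real y ^ (16 * b + 25) * real M \<le> UU M y * real r0"
begin

text \<open>Relative error and remainder of a sieve of level \<open>b\<close> up to
  \<open>y\<close>. Its dimension is \<open>2 * k + 1\<close> because a correlation involves
  \<open>m\<close> itself, the shifts of \<open>d * m\<close> and the shifts of
  \<open>d' * m\<close>.\<close>

definition "e = 2 * (exp (60 * real (2 * k + 1)) / 2 ^ b)"
definition "err = real y ^ (16 * b + 25)"
definition "z0 = r0\<^sup>2"
definition "L = ln (real x)"
definition "H = 1 + ln (real x)"
abbreviation "Q \<equiv> sieve_primes M y"
abbreviation "U \<equiv> UU M y"
abbreviation "V \<equiv> VV k M y"

lemma e01: "0 \<le> e" "e \<le> 1"
  using b by (auto simp: e_def)

lemma L0: "0 \<le> L" and H1: "1 \<le> H" and LH: "L \<le> H"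
  using x1 by (auto simp: L_def H_def)

lemma r0pos: "0 < r0"
  using yz y3 by (cases "r0 = 0") auto

lemma sieve_primesD:
  assumes "q \<in> sieve_primes M v"
  shows "prime q" "q \<le> v" "\<not> q dvd M" "w < q" "2 * (2 * k + 1) < q" "0 < q"
proof -
  show "prime q" "q \<le> v" "\<not> q dvd M" using assms by (auto simp: sieve_primes_def)
  then show "w < q" using w[of q] by (meson not_le)
  then show "2 * (2 * k + 1) < q" "0 < q" using wk by auto
qed

lemma frac_bounds:
  assumes "q \<in> sieve_primes M v"
  shows "0 < 1 - 1 / real q" "1 / 2 \<le> 1 - 1 / real q" "1 - 1 / real q \<le> 1"
    "0 < 1 - real k / (real q - 1)" "1 - real k / (real q - 1) \<le> 1" "1 / 2 \<le> 1 - real k / (real q - 1)"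
proof -
  have q: "2 * (2 * real k + 1) + 1 \<le> real q" using sieve_primesD(5)[OF assms] by (simp flip: of_nat_mult of_nat_add)
  then show "0 < 1 - 1 / real q" "1 / 2 \<le> 1 - 1 / real q" "1 - 1 / real q \<le> 1" by (auto simp: field_simps)
  show "1 / 2 \<le> 1 - real k / (real q - 1)" "1 - real k / (real q - 1) \<le> 1"
    using q by (auto simp: field_simps)
  then show "0 < 1 - real k / (real q - 1)" by linarith
qed

lemma UU_pos: "0 < UU M v" unfolding UU_def by (intro prod_pos frac_bounds)
lemma UU_le1: "UU M v \<le> 1" unfolding UU_def by (intro prod_le_1) (use frac_bounds in \<open>auto intro: less_imp_le\<close>)
lemma VV_pos: "0 < VV k M v" unfolding VV_def by (intro prod_pos frac_bounds)
lemma VV_le1: "VV k M v \<le> 1" unfolding VV_def by (intro prod_le_1) (use frac_bounds in \<open>auto intro: less_imp_le\<close>)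

lemma sieve_inverse:
  assumes "0 < M'" "Q' \<subseteq> Q" "\<And>q. q \<in> Q' \<Longrightarrow> \<not> q dvd M'"
    and "\<And>q. q \<in> Q' \<Longrightarrow> \<Omega> q \<subseteq> {..<q} \<and> card (\<Omega> q) \<le> 2 * k + 1" "1 \<le> N1"
  shows "\<bar>(\<Sum>n | n \<in> {N1..N2} \<and> [n = c] (mod M') \<and> (\<forall>q\<in>Q'. n mod q \<notin> \<Omega> q). 1 / real n)
           - (\<Sum>n\<in>{N1..N2}. 1 / real n) / real M' * (\<Prod>q\<in>Q'. 1 - real (card (\<Omega> q)) / real q)\<bar>
       \<le> e * ((\<Sum>n\<in>{N1..N2}. 1 / real n) / real M') * (\<Prod>q\<in>Q'. 1 - real (card (\<Omega> q)) / real q)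
         + err / real N1"
proof -
  have "exp (60 * real (2 * k + 1)) \<le> 2 ^ b" using b by (smt (verit) exp_gt_zero)
  then have "\<bar>(\<Sum>n | n \<in> {N1..N2} \<and> [n = c] (mod M') \<and> (\<forall>q\<in>Q'. n mod q \<notin> \<Omega> q). 1 / real n)
           - (\<Sum>n\<in>{N1..N2}. 1 / real n) / real M' * (\<Prod>q\<in>Q'. 1 - real (card (\<Omega> q)) / real q)\<bar>
       \<le> 2 * (exp (60 * real (2 * k + 1)) / 2 ^ b) * ((\<Sum>n\<in>{N1..N2}. 1 / real n) / real M') * (\<Prod>q\<in>Q'. 1 - real (card (\<Omega> q)) / real q)
         + 1 / real N1 * real y ^ (16 * b + 25)"
    by (intro sieve_AP y3) (use assms sieve_primesD in \<open>auto simp: frac_le subset_iff\<close>)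
  then show ?thesis by (simp add: e_def err_def)
qed

lemma sum_inverse_interval_le: "1 \<le> N1 \<Longrightarrow> N2 \<le> x \<Longrightarrow> (\<Sum>n\<in>{N1..N2}. 1 / real n) \<le> H"
proof -
  assume "1 \<le> N1" "N2 \<le> x"
  then have "(\<Sum>n\<in>{N1..N2}. 1 / real n) \<le> (\<Sum>n\<in>{1..x}. 1 / real n)"
    by (intro sum_mono2) auto
  also have "\<dots> \<le> H" unfolding H_def by (rule sum_inverse_le[OF x1])
  finally show ?thesis .
qed

text \<open>In a factorisation \<open>d * m\<close> of an element of \<open>S0\<close> with both
  factors above 1, both lie in \<open>R\<close>. After Cauchy--Schwarz, \<open>m\<close> runs over
  the larger \<open>R'\<close>, where primes are excluded only up to \<open>y\<close>: there the sum
  over \<open>m\<close> is a sieve problem with remainder at most \<open>err / z0\<close>.\<close>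

definition "R = {d \<in> {2..x}. coprime d M \<and> rough M z0 d}"
definition "R' = {m \<in> {Suc z0..x}. rough M y m}"

lemma finite_R [simp]: "finite R" "finite R'" by (simp_all add: R_def R'_def)

lemma R_gt: assumes "d \<in> R" shows "z0 < d"
proof -
  from assms have d: "2 \<le> d" "coprime d M" "rough M z0 d" by (auto simp: R_def)
  obtain q where q: "prime q" "q dvd d" using prime_factor_nat[of d] d(1) by auto
  have "\<not> q dvd M" using d(2) q by (metis coprime_common_divisor not_prime_unit)
  then have "q \<in> sieve_primes M z0" if "q \<le> z0" using q that by (simp add: sieve_primes_def)
  then have "z0 < q" using d(3) q(2) unfolding rough_def by (meson not_le)
  also have "q \<le> d" using q d by (intro dvd_imp_le) auto
  finally show ?thesis .
qed

lemma z0_ge: "y \<le> z0" using yz by (simp add: z0_def)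

lemma sieve_primes_mono: "v \<le> v' \<Longrightarrow> sieve_primes M v \<subseteq> sieve_primes M v'"
  by (auto simp: sieve_primes_def)

lemma rough_mono: "rough M v' n \<Longrightarrow> v \<le> v' \<Longrightarrow> rough M v n"
  using sieve_primes_mono by (auto simp: rough_def)

lemma R_subset: "R \<subseteq> R'"
  using R_gt rough_mono[OF _ z0_ge] by (auto simp: R_def R'_def Suc_le_eq)

lemma R_not_dvd: "d \<in> R \<Longrightarrow> q \<in> Q \<Longrightarrow> \<not> q dvd d"
  using sieve_primes_mono[OF z0_ge] by (auto simp: R_def rough_def)

text \<open>
  \<open>G d d'\<close> is the correlation arising from the squared dispersion. Its main terms cancel except at the
  primes of \<open>Bd d d'\<close>, for which the sifting conditions on \<open>d * m\<close> and \<open>d' * m\<close> share a residue of \<open>m\<close>;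
  \<open>SS d d'\<close> bounds the resulting loss.
\<close>
definition "cnd d m \<longleftrightarrow> N \<le> d * m \<and> d * m \<le> x \<and> [d * m = a] (mod M)"
definition "\<sigma> n = (of_bool (sifted k M y n) :: real)"
definition "G d d' = (\<Sum>m | m \<in> R' \<and> cnd d m \<and> cnd d' m. 1 / real m * ((\<sigma> (d * m) - V) * (\<sigma> (d' * m) - V)))"
definition "Bd d d' = {q \<in> Q. \<exists>i\<in>{1..k}. \<exists>j\<in>{1..k}. [i * d' = j * d] (mod q)}"
definition "SS d d' = (\<Prod>q\<in>Bd d d'. 1 + 4 * real k / real q)"

lemma finite_Bd [simp]: "finite (Bd d d')" by (simp add: Bd_def)

lemma SS_ge1: "1 \<le> SS d d'"
  unfolding SS_def by (intro prod_ge_1) auto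

section \<open>Local densities and the correlation of two sifting conditions\<close>

lemma local_factor_one: "q \<in> Q \<Longrightarrow> 1 - (real k + 1) / real q = (1 - 1 / real q) * (1 - real k / (real q - 1))"
  using sieve_primesD(5)[of q y] by (simp add: field_simps)

text \<open>At a coincidence as few as \<open>k + 1\<close> residues may be removed, so one of the
  two factors \<open>u = 1 - k / (q - 1)\<close> is missing; \<open>1 / u\<close> is at most
  \<open>1 + 4 * k / q\<close>.\<close>

lemma local_factor_bad:
  assumes "q \<in> Q" "real k + 1 \<le> c"
  shows "1 - c / real q \<le> (1 - 1 / real q) * (1 - real k / (real q - 1))\<^sup>2 * (1 + 4 * real k / real q)"
proof -
  define u where "u = 1 - real k / (real q - 1)"
  have q: "2 * (2 * real k + 1) + 1 \<le> real q" using sieve_primesD(5)[OF assms(1)] by (simp flip: of_nat_mult of_nat_add)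
  note fb = frac_bounds[OF assms(1)]
  have "1 \<le> u * (1 + 4 * real k / real q)"
  proof -
    have "real k / (real q - 1) \<le> 2 * real k / real q" using q k1 by (simp add: field_simps)
    moreover have "1 / 2 * (4 * real k / real q) \<le> u * (4 * real k / real q)"
      using fb(6) by (intro mult_right_mono) (auto simp: u_def)
    ultimately show ?thesis by (simp add: distrib_left) (simp add: u_def)
  qed
  then have "(1 - 1 / real q) * u * 1 \<le> (1 - 1 / real q) * u * (u * (1 + 4 * real k / real q))"
    using fb(1)[THEN less_imp_le] fb(4)[THEN less_imp_le]
    by (intro mult_left_mono mult_nonneg_nonneg) (simp_all add: u_def)
  moreover have "1 - c / real q \<le> 1 - (real k + 1) / real q" using assms(2) by (simp add: divide_right_mono)
  ultimately show ?thesis using local_factor_one[OF assms(1)] by (simp add: u_def power2_eq_square mult_ac)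
qed

text \<open>With \<open>p = q - 1\<close> the claim reduces to
  \<open>p * (p - 2 * k) \<le> (p - k)\<^sup>2\<close>.\<close>

lemma local_factor_good:
  assumes "q \<in> Q"
  shows "1 - (2 * real k + 1) / real q \<le> (1 - 1 / real q) * (1 - real k / (real q - 1))\<^sup>2"
proof -
  have q: "2 * (2 * real k + 1) + 1 \<le> real q" using sieve_primesD(5)[OF assms(1)] by (simp flip: of_nat_mult of_nat_add)
  define p where "p = real q - 1"
  have p: "0 < p" "real q = p + 1" using q by (auto simp: p_def)
  have "1 - (2 * real k + 1) / real q = (p - 2 * real k) / (p + 1)"
    using p by (simp add: field_simps)
  also have "\<dots> = (p * (p - 2 * real k)) / (p * (p + 1))" using p by simp
  also have "\<dots> \<le> ((p - real k) * (p - real k)) / (p * (p + 1))"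
    using p by (intro divide_right_mono) (auto simp: algebra_simps)
  also have "\<dots> = (p / (p + 1)) * (((p - real k) / p) * ((p - real k) / p))"
    using p by simp
  also have "p / (p + 1) = 1 - 1 / real q" using p by (simp add: field_simps)
  also have "(p - real k) / p = 1 - real k / p" using p by (simp add: diff_divide_distrib)
  finally show ?thesis by (simp add: power2_eq_square p_def)
qed

lemma cnd_cong_iff:
  assumes "d \<in> R" "d' \<in> R"
  obtains c where "\<And>m. [d * m = a] (mod M) \<longleftrightarrow> [m = c] (mod M)"
    "\<And>m. [d = d'] (mod M) \<Longrightarrow> [d' * m = a] (mod M) \<longleftrightarrow> [m = c] (mod M)"
proof -
  have cd: "coprime d M" using assms(1) by (simp add: R_def)
  obtain d1 where d1: "[d * d1 = 1] (mod M)" using cong_solve_coprime_nat[OF cd] by auto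
  have dc: "[d * (d1 * a) = a] (mod M)"
    using cong_scalar_right[OF d1, of a] by (simp add: mult.assoc)
  have iff: "[d * m = a] (mod M) \<longleftrightarrow> [m = d1 * a] (mod M)" for m
  proof -
    have "[d * m = a] (mod M) \<longleftrightarrow> [d * m = d * (d1 * a)] (mod M)"
      using dc by (meson cong_sym cong_trans)
    also have "\<dots> \<longleftrightarrow> [m = d1 * a] (mod M)" using cd by (simp add: cong_mult_lcancel_nat)
    finally show ?thesis .
  qed
  have "[d' * m = a] (mod M) \<longleftrightarrow> [m = d1 * a] (mod M)" if "[d = d'] (mod M)" for m
  proof -
    have "[d' * m = d * m] (mod M)" using that by (simp add: cong_scalar_right cong_sym)
    then show ?thesis using iff[of m] by (meson cong_sym cong_trans)
  qed
  with iff that show ?thesis by blast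
qed

lemma G_eq_0:
  assumes "\<not> [d = d'] (mod M)"
  shows "G d d' = 0"
proof -
  have "{m. m \<in> R' \<and> cnd d m \<and> cnd d' m} = {}"
  proof (rule ccontr)
    assume "{m. m \<in> R' \<and> cnd d m \<and> cnd d' m} \<noteq> {}"
    then obtain m where m: "[d * m = a] (mod M)" "[d' * m = a] (mod M)" by (auto simp: cnd_def)
    have "coprime (d * m) M" using cong_imp_coprime[OF cong_sym[OF m(1)] cop] .
    then have cm: "coprime m M" by simp
    have "[d * m = d' * m] (mod M)" using m by (meson cong_sym cong_trans)
    then show False using assms cm by (simp add: cong_mult_rcancel_nat)
  qed
  then show ?thesis by (simp only: G_def sum.empty)
qed

text \<open>The trivial bound, kept for the few degenerate pairs.\<close>

lemma G_le_H: "G d d' \<le> H"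
proof -
  have "G d d' \<le> (\<Sum>m | m \<in> R' \<and> cnd d m \<and> cnd d' m. 1 / real m)"
    unfolding G_def
  proof (rule sum_mono)
    fix m
    have "\<bar>\<sigma> n - V\<bar> \<le> 1" for n using VV_pos[of y] VV_le1[of y] by (auto simp: \<sigma>_def)
    then have "\<bar>(\<sigma> (d * m) - V) * (\<sigma> (d' * m) - V)\<bar> \<le> 1" unfolding abs_mult by (intro mult_le_one) auto
    then have "(\<sigma> (d * m) - V) * (\<sigma> (d' * m) - V) \<le> 1" by linarith
    then show "1 / real m * ((\<sigma> (d * m) - V) * (\<sigma> (d' * m) - V)) \<le> 1 / real m"
      using mult_left_mono[of _ 1 "1 / real m"] by simp
  qed
  also have "\<dots> \<le> (\<Sum>m\<in>{1..x}. 1 / real m)"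
    by (rule sum_mono2) (auto simp: R'_def)
  also have "\<dots> \<le> H" by (rule sum_inverse_interval_le) auto
  finally show ?thesis .
qed

text \<open>Expanding the product gives sums over \<open>m\<close> with two, one or no sifting
  conditions. Their main terms combine to \<open>X * U * V\<^sup>2\<close> times
  \<open>SS - 2 + 1\<close>, so the pair contributes only through coincidences and sieve
  errors.\<close>

lemma G_le:
  assumes d: "d \<in> R" "d' \<in> R" and dd: "[d = d'] (mod M)"
  shows "G d d' \<le> H / real M * (U * V\<^sup>2) * (2 * (SS d d' - 1) + 4 * e) + 4 * err / real z0"
proof -
  have d0: "0 < d" "0 < d'" using d by (auto simp: R_def)
  obtain c1 where c1: "\<And>m. N \<le> d * m \<longleftrightarrow> c1 \<le> m" using interval_of_ge[where N = N, OF d0(1)] by metis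
  obtain c2 where c2: "\<And>m. N \<le> d' * m \<longleftrightarrow> c2 \<le> m" using interval_of_ge[where N = N, OF d0(2)] by metis
  obtain c where c: "\<And>m. [d * m = a] (mod M) \<longleftrightarrow> [m = c] (mod M)"
    "\<And>m. [d' * m = a] (mod M) \<longleftrightarrow> [m = c] (mod M)"
    using cnd_cong_iff[OF d] dd by metis
  \<comment> \<open>The conditions for both \<open>d\<close> and \<open>d'\<close> confine
    \<open>m\<close> to one interval. Its lower end exceeds \<open>z0\<close>, which keeps the
    remainder small.\<close>
  define N1 where "N1 = max (Suc z0) (max c1 c2)"
  define N2 where "N2 = min x (min (x div d) (x div d'))"
  have xd: "d * m \<le> x \<longleftrightarrow> m \<le> x div d" "d' * m \<le> x \<longleftrightarrow> m \<le> x div d'" for m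
    using d0 by (simp_all add: less_eq_div_iff_mult_less_eq mult.commute)
  define W where "W = {m. m \<in> {N1..N2} \<and> [m = c] (mod M) \<and> rough M y m}"
  have W: "{m. m \<in> R' \<and> cnd d m \<and> cnd d' m} = W"
    unfolding W_def R'_def cnd_def N1_def N2_def c c1 c2 xd by auto
  have finW: "finite W" by (simp add: W_def)
  define X where "X = (\<Sum>n\<in>{N1..N2}. 1 / real n) / real M"
  have N1: "1 \<le> N1" "Suc z0 \<le> N1" by (auto simp: N1_def)
  have X0: "0 \<le> X" unfolding X_def by (intro divide_nonneg_nonneg sum_nonneg) auto
  have XH: "X \<le> H / real M" unfolding X_def
    by (intro divide_right_mono sum_inverse_interval_le N1) (auto simp: N2_def)
  define g0 where "g0 = (\<Sum>m\<in>W. 1 / real m)"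
  define g1 where "g1 d = (\<Sum>m\<in>W. 1 / real m * \<sigma> (d * m))" for d
  define g2 where "g2 = (\<Sum>m\<in>W. 1 / real m * (\<sigma> (d * m) * \<sigma> (d' * m)))"
  have Geq: "G d d' = g2 - V * g1 d - V * g1 d' + V\<^sup>2 * g0"
  proof -
    have alg: "r * ((s - v) * (s' - v)) = r * (s * s') - v * (r * s) - v * (r * s') + v\<^sup>2 * r"
      for r s s' v :: real by (simp add: algebra_simps power2_eq_square)
    show ?thesis
      unfolding G_def W g0_def g1_def g2_def alg
      by (simp only: sum_distrib_left sum.distrib sum_subtractf)
  qed
  have errN: "err / real N1 \<le> err / real z0"
    using N1 r0pos by (intro divide_left_mono) (auto simp: err_def z0_def intro!: mult_pos_pos)
  have rgh: "rough M y m \<longleftrightarrow> (\<forall>q\<in>Q. m mod q \<notin> root_set q 1 0)" for m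
    using mod_in_root_set sieve_primesD(6) by (auto simp: rough_def)
  have sft: "sifted k M y (d * m) \<longleftrightarrow> (\<forall>q\<in>Q. m mod q \<notin> roots1 k q d)" for d m
    using mod_in_root_set sieve_primesD(6) by (force simp: sifted_def roots1_def)
  define \<Omega>1 where "\<Omega>1 d q = root_set q 1 0 \<union> roots1 k q d" for d q
  define \<Omega>2 where "\<Omega>2 q = root_set q 1 0 \<union> roots1 k q d \<union> roots1 k q d'" for q
  have subs: "roots1 k q d \<subseteq> {..<q}" for q d using root_set_subset by (force simp: roots1_def)
  have g0_eq: "g0 = (\<Sum>n | n \<in> {N1..N2} \<and> [n = c] (mod M) \<and> (\<forall>q\<in>Q. n mod q \<notin> root_set q 1 0). 1 / real n)"
    unfolding g0_def W_def rgh ..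
  have g1_eq: "g1 d = (\<Sum>n | n \<in> {N1..N2} \<and> [n = c] (mod M) \<and> (\<forall>q\<in>Q. n mod q \<notin> \<Omega>1 d q). 1 / real n)" for d
    unfolding g1_def by (rule sum.mono_neutral_cong_right) (auto simp: finW W_def rgh sft \<sigma>_def \<Omega>1_def)
  have g2_eq: "g2 = (\<Sum>n | n \<in> {N1..N2} \<and> [n = c] (mod M) \<and> (\<forall>q\<in>Q. n mod q \<notin> \<Omega>2 q). 1 / real n)"
    unfolding g2_def by (rule sum.mono_neutral_cong_right) (auto simp: finW W_def rgh sft \<sigma>_def \<Omega>2_def)
  have kq: "k < q" if "q \<in> Q" for q using sieve_primesD(5)[OF that] by simp
  have c0: "card (root_set q 1 0) = 1" if "q \<in> Q" for q
    using sieve_primesD(1)[OF that] prime_gt_1_nat by (intro card_root_set) auto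
  have c1': "card (\<Omega>1 d q) = k + 1" if "q \<in> Q" "d \<in> R" for q d
    unfolding \<Omega>1_def using sieve_primesD(1)[OF that(1)] R_not_dvd[OF that(2,1)] kq[OF that(1)] by (rule card_roots1(3))
  have c2': "k + 1 \<le> card (\<Omega>2 q)" "card (\<Omega>2 q) \<le> 2 * k + 1" "q \<notin> Bd d d' \<Longrightarrow> card (\<Omega>2 q) = 2 * k + 1" if "q \<in> Q" for q
    using card_roots2[OF sieve_primesD(1)[OF that] R_not_dvd[OF d(1) that] R_not_dvd[OF d(2) that] kq[OF that]] that
    unfolding \<Omega>2_def Bd_def by blast+
  define P2 where "P2 = (\<Prod>q\<in>Q. 1 - real (card (\<Omega>2 q)) / real q)"
  have b0: "\<bar>g0 - X * U\<bar> \<le> e * X * U + err / real N1"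
  proof -
    have "(\<Prod>q\<in>Q. 1 - real (card (root_set q 1 0)) / real q) = U"
      unfolding UU_def by (intro prod.cong refl) (simp only: c0 of_nat_1)
    then show ?thesis
      using sieve_inverse[of M Q "\<lambda>q. root_set q 1 0" N1 N2 c] M N1 sieve_primesD(3) root_set_subset c0
      unfolding g0_eq X_def by auto
  qed
  have b1: "\<bar>g1 d - X * (U * V)\<bar> \<le> e * X * (U * V) + err / real N1" if "d \<in> R" for d
  proof -
    have "(\<Prod>q\<in>Q. 1 - real (card (\<Omega>1 d q)) / real q) = U * V"
      unfolding UU_def VV_def prod.distrib[symmetric]
      by (intro prod.cong refl) (simp add: c1' that local_factor_one[symmetric])
    moreover have "\<Omega>1 d q \<subseteq> {..<q}" for q using subs root_set_subset by (auto simp: \<Omega>1_def)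
    ultimately show ?thesis
      using sieve_inverse[of M Q "\<Omega>1 d" N1 N2 c] M N1 sieve_primesD(3) c1'[OF _ that]
      unfolding g1_eq X_def by auto
  qed
  have b2: "\<bar>g2 - X * P2\<bar> \<le> e * X * P2 + err / real N1"
  proof -
    have "\<Omega>2 q \<subseteq> {..<q}" for q using subs root_set_subset unfolding \<Omega>2_def by blast
    then show ?thesis
      using sieve_inverse[of M Q \<Omega>2 N1 N2 c] M N1 sieve_primesD(3) c2'
      unfolding g2_eq X_def P2_def by auto
  qed
  have P2: "P2 \<le> U * V\<^sup>2 * SS d d'"
  proof -
    have "SS d d' = (\<Prod>q\<in>Q. if q \<in> Bd d d' then 1 + 4 * real k / real q else 1)"
      unfolding SS_def by (rule prod.mono_neutral_cong_left) (auto simp: Bd_def)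
    then have eq: "U * V\<^sup>2 * SS d d' = (\<Prod>q\<in>Q. (1 - 1 / real q) * (1 - real k / (real q - 1))\<^sup>2 * (if q \<in> Bd d d' then 1 + 4 * real k / real q else 1))"
      by (simp add: UU_def VV_def prod.distrib prod_power_distrib)
    show ?thesis unfolding eq P2_def
    proof (intro prod_mono conjI)
      fix q assume q: "q \<in> Q"
      have "real (card (\<Omega>2 q)) \<le> 2 * real k + 1" using c2'(2)[OF q] by (simp flip: of_nat_mult of_nat_add of_nat_Suc)
      moreover have "2 * real k + 1 \<le> real q" using sieve_primesD(5)[OF q] by (simp flip: of_nat_mult of_nat_add of_nat_Suc)
      ultimately show "0 \<le> 1 - real (card (\<Omega>2 q)) / real q" using sieve_primesD(6)[OF q] by (simp add: field_simps)
      show "1 - real (card (\<Omega>2 q)) / real q \<le> (1 - 1 / real q) * (1 - real k / (real q - 1))\<^sup>2 * (if q \<in> Bd d d' then 1 + 4 * real k / real q else 1)"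
      proof (cases "q \<in> Bd d d'")
        case True
        have "real k + 1 \<le> real (card (\<Omega>2 q))" using c2'(1)[OF q] by (simp flip: of_nat_Suc)
        then show ?thesis using True local_factor_bad[OF q] by simp
      next
        case False
        then show ?thesis using c2'(3)[OF q False] local_factor_good[OF q] False by (simp add: add.commute)
      qed
    qed
  qed
  have "g2 \<le> (1 + e) * X * P2 + err / real N1" using b2 by (simp add: algebra_simps abs_le_iff)
  also have "(1 + e) * X * P2 \<le> (1 + e) * X * (U * V\<^sup>2 * SS d d')"
    using e01 X0 by (intro mult_left_mono P2) auto
  finally have u2: "g2 \<le> (1 + e) * X * (U * V\<^sup>2 * SS d d') + err / real N1" by simp
  have u1: "V * ((1 - e) * X * (U * V) - err / real N1) \<le> V * g1 d''" if "d'' \<in> R" for d''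
    using b1[OF that] VV_pos[of y] by (intro mult_left_mono) (auto simp: algebra_simps abs_le_iff)
  have u0: "V\<^sup>2 * g0 \<le> V\<^sup>2 * ((1 + e) * X * U + err / real N1)"
    using b0 by (intro mult_left_mono) (auto simp: algebra_simps abs_le_iff)
  have v2: "V\<^sup>2 \<le> 1" using VV_pos[of y] VV_le1[of y] by (simp add: power_le_one)
  have en0: "0 \<le> err / real N1" by (simp add: err_def)
  have "G d d' \<le> (1 + e) * X * (U * V\<^sup>2 * SS d d') + err / real N1
      - 2 * (V * ((1 - e) * X * (U * V) - err / real N1)) + V\<^sup>2 * ((1 + e) * X * U + err / real N1)"
    unfolding Geq using u2 u1[OF d(1)] u1[OF d(2)] u0 by linarith
  \<comment> \<open>The \<open>4 * e\<close> adds the relative errors of the four sieve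
    applications; the four remainders have weights 1, \<open>V\<close>, \<open>V\<close> and
    \<open>V\<^sup>2\<close>.\<close>
  also have "\<dots> = X * (U * V\<^sup>2) * ((1 + e) * (SS d d' - 1) + 4 * e) + (1 + 2 * V + V\<^sup>2) * (err / real N1)"
    by (simp add: algebra_simps power2_eq_square)
  also have "\<dots> \<le> H / real M * (U * V\<^sup>2) * (2 * (SS d d' - 1) + 4 * e) + 4 * (err / real z0)"
  proof (rule add_mono)
    have s: "(1 + e) * (SS d d' - 1) \<le> 2 * (SS d d' - 1)" "0 \<le> (1 + e) * (SS d d' - 1)"
      using e01 SS_ge1[of d d'] mult_right_mono[of "1 + e" 2 "SS d d' - 1"] by auto
    have c: "X * (U * V\<^sup>2) \<le> H / real M * (U * V\<^sup>2)"
      using XH UU_pos[of y] by (intro mult_right_mono) auto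
    have c0: "0 \<le> X * (U * V\<^sup>2)" using X0 UU_pos[of y] by auto
    show "X * (U * V\<^sup>2) * ((1 + e) * (SS d d' - 1) + 4 * e) \<le> H / real M * (U * V\<^sup>2) * (2 * (SS d d' - 1) + 4 * e)"
      by (rule mult_mono[OF c]) (use s e01 c c0 in auto)
    show "(1 + 2 * V + V\<^sup>2) * (err / real N1) \<le> 4 * (err / real z0)"
      by (rule mult_mono[OF _ errN]) (use v2 VV_le1[of y] en0 in auto)
  qed
  finally show ?thesis by simp
qed

end

section \<open>Averaging the correlation over pairs\<close>

context sieve_setup
begin

text \<open>An upper bound sieve inside classes modulo \<open>M * \<Prod>T\<close>. The primes of
  \<open>T\<close> cannot be sieved as well; omitting them costs a factor 2 each, the 2 in the
  product. The assumption \<open>\<Prod>T \<le> r0\<close> keeps the remainder below the main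
  term.\<close>

lemma rough_sum_le:
  assumes T: "T \<subseteq> Q" "\<Prod>T \<le> r0" and \<Phi>: "\<And>q. q \<in> T \<Longrightarrow> \<Phi> q \<subseteq> {..<q}"
  shows "(\<Sum>m | m \<in> R' \<and> [m = c] (mod M) \<and> (\<forall>q\<in>T. m mod q \<in> \<Phi> q). 1 / real m)
    \<le> (\<Prod>q\<in>T. 2 * real (card (\<Phi> q)) / real q) * (3 * H * U / real M)"
proof -
  have finT: "finite T" using T(1) by (rule finite_subset) simp
  define P where "P = \<Prod>T"
  have P0: "0 < P" unfolding P_def using T(1) sieve_primesD(6) by (intro prod_pos) auto
  have "\<exists>C. C \<subseteq> {..<M * \<Prod>T} \<and> card C = (\<Prod>q\<in>T. card (\<Phi> q)) \<and>
    (\<forall>n. n mod (M * \<Prod>T) \<in> C \<longleftrightarrow> [n = c] (mod M) \<and> (\<forall>q\<in>T. n mod q \<in> \<Phi> q))"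
    by (rule combine_prime_residue_sets) (use finT T(1) sieve_primesD M \<Phi> in auto)
  then obtain C where C: "C \<subseteq> {..<M * P}" "card C = (\<Prod>q\<in>T. card (\<Phi> q))"
    "\<And>n. n mod (M * P) \<in> C \<longleftrightarrow> [n = c] (mod M) \<and> (\<forall>q\<in>T. n mod q \<in> \<Phi> q)"
    unfolding P_def by blast
  have finC: "finite C" using C(1) by (rule finite_subset) simp
  define A where "A = {m. m \<in> R' \<and> [m = c] (mod M) \<and> (\<forall>q\<in>T. m mod q \<in> \<Phi> q)}"
  have finA: "finite A" by (simp add: A_def)
  have UT: "(\<Prod>q\<in>Q - T. 1 - 1 / real q) \<le> U * 2 ^ card T"
  proof -
    have "U = (\<Prod>q\<in>Q - T. 1 - 1 / real q) * (\<Prod>q\<in>T. 1 - 1 / real q)"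
      unfolding UU_def by (rule prod.subset_diff[OF T(1)]) simp
    moreover have "(\<Prod>q\<in>T. 1 / 2) \<le> (\<Prod>q\<in>T. 1 - 1 / real q)"
      using T(1) frac_bounds(2) by (intro prod_mono) auto
    moreover have "0 \<le> (\<Prod>q\<in>Q - T. 1 - 1 / real q)" using frac_bounds(1) by (intro prod_nonneg) (auto intro: less_imp_le)
    ultimately have "(\<Prod>q\<in>Q - T. 1 - 1 / real q) * (\<Prod>q\<in>T. 1 / 2) \<le> U"
      by (metis mult_left_mono)
    then have "(\<Prod>q\<in>Q - T. 1 - 1 / real q) * (1 / 2 ^ card T) \<le> U" by (simp add: power_one_over)
    then show ?thesis by (simp add: field_simps)
  qed
  have one: "(\<Sum>m | m \<in> A \<and> m mod (M * P) = r. 1 / real m) \<le> 3 * H * U * 2 ^ card T / (real M * real P)" if r: "r \<in> C" for r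
  proof -
    define X where "X = (\<Sum>n\<in>{Suc z0..x}. 1 / real n) / real (M * P)"
    have XH: "X \<le> H / (real M * real P)"
      unfolding X_def of_nat_mult by (intro divide_right_mono sum_inverse_interval_le) auto
    have X0: "0 \<le> X" unfolding X_def by (intro divide_nonneg_nonneg sum_nonneg) auto
    define W where "W = (\<Prod>q\<in>Q - T. 1 - 1 / real q)"
    have W0: "0 \<le> W" unfolding W_def using frac_bounds(1) by (intro prod_nonneg) (auto intro: less_imp_le)
    have sub: "{m. m \<in> A \<and> m mod (M * P) = r} \<subseteq>
       {n. n \<in> {Suc z0..x} \<and> [n = r] (mod (M * P)) \<and> (\<forall>q\<in>Q - T. n mod q \<notin> root_set q 1 0)}"
      using mod_in_root_set sieve_primesD(6) by (auto simp: A_def R'_def rough_def cong_def)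
    have "(\<Sum>m | m \<in> A \<and> m mod (M * P) = r. 1 / real m) \<le>
       (\<Sum>n | n \<in> {Suc z0..x} \<and> [n = r] (mod (M * P)) \<and> (\<forall>q\<in>Q - T. n mod q \<notin> root_set q 1 0). 1 / real n)"
      by (rule sum_mono2[OF _ sub]) auto
    also have "\<dots> \<le> X * W + (e * X * W + err / real (Suc z0))"
    proof -
      have c0: "card (root_set q 1 0) = 1" if "q \<in> Q" for q
        using sieve_primesD(1)[OF that] prime_gt_1_nat by (intro card_root_set) auto
      have "(\<Prod>q\<in>Q - T. 1 - real (card (root_set q 1 0)) / real q) = W"
        unfolding W_def by (intro prod.cong refl) (simp add: c0[simplified])
      moreover have "\<not> q dvd M * P" if qq: "q \<in> Q - T" for q
      proof
        assume "q dvd M * P"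
        then have "q dvd P" using prime_dvd_mult_iff[of q M P] sieve_primesD(1,3)[of q y] qq by auto
        then obtain p where "p \<in> T" "q dvd p"
          unfolding P_def using prime_dvd_prod_iff[OF finT, of q "\<lambda>x. x"] sieve_primesD(1)[of q y] qq by auto
        then show False using qq T(1) sieve_primesD(1) primes_dvd_imp_eq by blast
      qed
      ultimately show ?thesis
        using sieve_inverse[of "M * P" "Q - T" "\<lambda>q. root_set q 1 0" "Suc z0" x r] M P0 c0 root_set_subset
        unfolding X_def by (auto simp: abs_le_iff)
    qed
    also have "\<dots> \<le> 2 * (X * W) + err / real z0"
    proof -
      have "e * X * W \<le> 1 * X * W" using e01 X0 W0 by (intro mult_right_mono) auto
      moreover have "err / real (Suc z0) \<le> err / real z0"
        using r0pos by (intro divide_left_mono mult_pos_pos) (auto simp: err_def z0_def add_pos_pos)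
      ultimately show ?thesis by (simp add: mult.commute)
    qed
    \<comment> \<open>Two copies come from the main term with its relative error, the third from the
      remainder: by \<open>SZ\<close>, \<open>err / z0\<close> is at most
      \<open>U / (M * r0)\<close>.\<close>
    also have "\<dots> \<le> 2 * (H / (real M * real P) * (U * 2 ^ card T)) + H / (real M * real P) * (U * 2 ^ card T)"
    proof (intro add_mono mult_left_mono mult_mono XH)
      show "W \<le> U * 2 ^ card T" unfolding W_def by (rule UT)
      have "err * real M \<le> U * real r0" using SZ by (simp add: err_def)
      then have "err \<le> U * real r0 / real M" using M by (simp add: field_simps)
      then have "err / real z0 \<le> U * real r0 / real M / real z0" by (intro divide_right_mono) auto
      also have "\<dots> = U / (real M * real r0)" using r0pos by (simp add: z0_def power2_eq_square)
      also have "\<dots> \<le> U / (real M * real P)"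
        using P0 M T(2)[folded P_def] UU_pos[of y] r0pos
        by (intro divide_left_mono mult_left_mono mult_pos_pos) auto
      also have "\<dots> = 1 / (real M * real P) * (U * 1)" by simp
      also have "\<dots> \<le> H / (real M * real P) * (U * 2 ^ card T)"
        using H1 UU_pos[of y] by (intro mult_mono divide_right_mono) auto
      finally show "err / real z0 \<le> H / (real M * real P) * (U * 2 ^ card T)" .
    qed (use H1 W0 in auto)
    finally show ?thesis by (simp add: mult_ac)
  qed
  have "(\<Sum>m\<in>A. 1 / real m) = (\<Sum>r\<in>C. \<Sum>m | m \<in> A \<and> m mod (M * P) = r. 1 / real m)"
    by (rule sum.group[symmetric]) (use finA finC C(3) in \<open>auto simp: A_def\<close>)
  also have "\<dots> \<le> (\<Sum>r\<in>C. 3 * H * U * 2 ^ card T / (real M * real P))" by (intro sum_mono one)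
  also have "\<dots> = real (\<Prod>q\<in>T. card (\<Phi> q)) * 2 ^ card T / real P * (3 * H * U / real M)"
    by (simp add: C(2) mult_ac)
  also have "real (\<Prod>q\<in>T. card (\<Phi> q)) * 2 ^ card T / real P = (\<Prod>q\<in>T. 2 * real (card (\<Phi> q)) / real q)"
    by (simp add: P_def prod_dividef prod.distrib mult.commute)
  finally show ?thesis unfolding A_def .
qed

lemma mangoldt_le_L: "d \<in> R \<Longrightarrow> mangoldt d \<le> L"
proof -
  assume "d \<in> R"
  then have d: "2 \<le> d" "d \<le> x" by (auto simp: R_def)
  then have "mangoldt d \<le> ln (real d)" by (intro mangoldt_le) auto
  also have "\<dots> \<le> L" unfolding L_def using d by simp
  finally show ?thesis .
qed

text \<open>Bounds the sum of \<open>mangoldt d / d\<close> over a class: each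
  \<open>mangoldt d\<close> is at most \<open>L\<close>, and the rest is a rough sum. Against the
  expected \<open>L / totient M\<close> this loses a factor of order \<open>L / ln y\<close>, which
  the later parameters keep constant.\<close>

definition "T0 = L * (3 * H * U / real M)"

lemma T0_nonneg: "0 \<le> T0"
  unfolding T0_def using L0 H1 UU_pos[of y] by (intro mult_nonneg_nonneg divide_nonneg_nonneg) auto

lemma mangoldt_sum_le:
  assumes T: "T \<subseteq> Q" "\<Prod>T \<le> r0" and \<Phi>: "\<And>q. q \<in> T \<Longrightarrow> \<Phi> q \<subseteq> {..<q}"
  shows "(\<Sum>d | d \<in> R \<and> [d = c] (mod M) \<and> (\<forall>q\<in>T. d mod q \<in> \<Phi> q). mangoldt d / real d)
    \<le> (\<Prod>q\<in>T. 2 * real (card (\<Phi> q)) / real q) * T0"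
proof -
  have "(\<Sum>d | d \<in> R \<and> [d = c] (mod M) \<and> (\<forall>q\<in>T. d mod q \<in> \<Phi> q). mangoldt d / real d)
     \<le> (\<Sum>d | d \<in> R \<and> [d = c] (mod M) \<and> (\<forall>q\<in>T. d mod q \<in> \<Phi> q). L * (1 / real d))"
    by (intro sum_mono) (use mangoldt_le_L in \<open>auto simp: divide_right_mono\<close>)
  also have "\<dots> \<le> (\<Sum>d | d \<in> R' \<and> [d = c] (mod M) \<and> (\<forall>q\<in>T. d mod q \<in> \<Phi> q). L * (1 / real d))"
    by (rule sum_mono2) (use R_subset L0 in auto)
  also have "\<dots> \<le> L * ((\<Prod>q\<in>T. 2 * real (card (\<Phi> q)) / real q) * (3 * H * U / real M))"
    unfolding sum_distrib_left[symmetric] by (intro mult_left_mono rough_sum_le assms L0)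
  finally show ?thesis by (simp add: T0_def mult_ac)
qed

lemma mangoldt_class_sum_le: "(\<Sum>d | d \<in> R \<and> [d = c] (mod M). mangoldt d / real d) \<le> T0"
  using mangoldt_sum_le[of "{}" "\<lambda>_. {}" c] r0pos by simp

lemma inverse_sum_R_le: "(\<Sum>m\<in>R. 1 / real m) \<le> 3 * H * U * real (totient M) / real M"
proof -
  define C where "C = (\<lambda>c. c mod M) ` totatives M"
  have "(\<Sum>m\<in>R. 1 / real m) = (\<Sum>c\<in>C. \<Sum>m | m \<in> R \<and> m mod M = c. 1 / real m)"
  proof (rule sum.group[symmetric])
    show "(\<lambda>m. m mod M) ` R \<subseteq> C"
    proof
      fix c assume "c \<in> (\<lambda>m. m mod M) ` R"
      then obtain m where m: "m \<in> R" "c = m mod M" by auto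
      then have cm: "coprime (m mod M) M" using M by (simp add: R_def coprime_mod_left_iff)
      show "c \<in> C"
      proof (cases "M = 1")
        case True
        then show ?thesis using m by (auto simp: C_def intro!: image_eqI[of _ _ 1])
      next
        case False
        then have "m mod M \<noteq> 0" using cm by (intro notI) auto
        then have "m mod M \<in> totatives M" using cm M by (auto simp: totatives_def intro: less_imp_le)
        then show ?thesis unfolding C_def m(2) by (intro image_eqI[of _ _ "m mod M"]) auto
      qed
    qed
  qed (auto simp: C_def)
  also have "\<dots> \<le> (\<Sum>c\<in>C. 3 * H * U / real M)"
  proof (rule sum_mono)
    fix c
    have "(\<Sum>m | m \<in> R \<and> m mod M = c. 1 / real m) \<le> (\<Sum>m | m \<in> R' \<and> [m = c] (mod M). 1 / real m)"
      by (rule sum_mono2) (use R_subset in \<open>auto simp: cong_def\<close>)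
    also have "\<dots> \<le> 3 * H * U / real M" using rough_sum_le[of "{}" "\<lambda>_. {}" c] r0pos by simp
    finally show "(\<Sum>m | m \<in> R \<and> m mod M = c. 1 / real m) \<le> 3 * H * U / real M" .
  qed
  also have "\<dots> = real (card C) * (3 * H * U / real M)" by simp
  also have "\<dots> \<le> real (totient M) * (3 * H * U / real M)"
  proof (intro mult_right_mono)
    show "real (card C) \<le> real (totient M)" unfolding C_def totient_def by (intro of_nat_mono card_image_le) auto
    show "0 \<le> 3 * H * U / real M" using H1 UU_pos[of y] by (intro divide_nonneg_nonneg) auto
  qed
  finally show ?thesis by (simp add: mult_ac)
qed

text \<open>For such a pair every sieving prime belongs to \<open>Bd d d'\<close>, and
  \<open>SS\<close> is of no use.\<close>

definition "degenerate d d' \<longleftrightarrow> (\<exists>i\<in>{1..k}. \<exists>j\<in>{1..k}. i * d' = j * d)"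

text \<open>A bound for \<open>card (Bd d d')\<close>: each of the \<open>k\<^sup>2\<close> nonzero
  differences \<open>i * d' - j * d\<close> is at most \<open>k * x\<close> in size and has at most
  its binary logarithm, rounded up, many prime factors.\<close>

definition "n0 = (real k)\<^sup>2 * (log 2 (real k * real x) + 1)"
definition "\<tau> = exp (8 * real k * sqrt n0) / sqrt (real r0)"

lemma card_Bd_le:
  assumes "d \<in> R" "d' \<in> R" "\<not> degenerate d d'"
  shows "real (card (Bd d d')) \<le> n0"
proof -
  define D where "D i j = nat \<bar>int (i * d') - int (j * d)\<bar>" for i j
  define J where "J = nat \<lceil>log 2 (real k * real x)\<rceil>"
  have kx: "1 \<le> k * x" using k1 x1 by simp
  have DJ: "0 < D i j" "D i j \<le> 2 ^ J" if ij: "i \<in> {1..k}" "j \<in> {1..k}" for i j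
  proof -
    have ne: "i * d' \<noteq> j * d" using assms(3) ij by (auto simp: degenerate_def)
    then show "0 < D i j" unfolding D_def by (metis zero_less_nat_eq zero_less_abs_iff right_minus_eq of_nat_eq_iff)
    have "i * d' \<le> k * x" "j * d \<le> k * x" using ij assms(1,2) by (auto simp: R_def intro!: mult_le_mono)
    then have "D i j \<le> k * x" unfolding D_def by linarith
    also have "k * x \<le> 2 ^ J"
    proof -
      have "real (k * x) = 2 powr (log 2 (real (k * x)))" using kx by simp
      also have "\<dots> \<le> 2 powr (real J)" unfolding J_def by (intro powr_mono) (auto simp: real_nat_ceiling_ge)
      also have "\<dots> = real (2 ^ J)" by (simp add: powr_realpow)
      finally show ?thesis by (simp only: of_nat_le_iff)
    qed
    finally show "D i j \<le> 2 ^ J" .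
  qed
  have "Bd d d' \<subseteq> (\<Union>(i, j)\<in>{1..k} \<times> {1..k}. prime_factors (D i j))"
  proof
    fix q assume q: "q \<in> Bd d d'"
    then obtain i j where ij: "i \<in> {1..k}" "j \<in> {1..k}" "[i * d' = j * d] (mod q)" by (auto simp: Bd_def)
    have "int q dvd int (i * d') - int (j * d)" using ij(3) by (simp add: cong_int_iff[symmetric] cong_iff_dvd_diff)
    then have "q dvd D i j" unfolding D_def by (simp only: dvd_nat_abs_iff)
    moreover have "prime q" using q sieve_primesD(1) by (auto simp: Bd_def)
    ultimately have "q \<in> prime_factors (D i j)" using DJ(1)[OF ij(1,2)] by (simp add: prime_factors_dvd)
    then show "q \<in> (\<Union>(i, j)\<in>{1..k} \<times> {1..k}. prime_factors (D i j))"
      using ij by (intro UN_I[of "(i, j)"]) auto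
  qed
  then have "card (Bd d d') \<le> card (\<Union>(i, j)\<in>{1..k} \<times> {1..k}. prime_factors (D i j))"
    by (intro card_mono) auto
  also have "\<dots> \<le> (\<Sum>p\<in>{1..k} \<times> {1..k}. card (case p of (i, j) \<Rightarrow> prime_factors (D i j)))"
    by (rule card_UN_le) simp
  also have "\<dots> \<le> (\<Sum>p\<in>{1..k} \<times> {1..k}. J)"
    by (intro sum_mono) (auto intro!: card_prime_divisors_le DJ)
  also have "\<dots> = k * k * J" by simp
  finally have "real (card (Bd d d')) \<le> real k * real k * real J" by (simp flip: of_nat_mult)
  also have "\<dots> \<le> real k * real k * (log 2 (real k * real x) + 1)"
  proof (intro mult_left_mono)
    have "0 \<le> log 2 (real k * real x)" using kx by (simp flip: of_nat_mult)
    then show "real J \<le> log 2 (real k * real x) + 1" unfolding J_def by linarith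
  qed auto
  finally show ?thesis by (simp add: n0_def power2_eq_square)
qed

text \<open>Rankin's trick: as \<open>\<Prod>T > r0\<close>, the factor
  \<open>1 / sqrt (\<Prod>T)\<close> may be replaced by \<open>1 / sqrt r0\<close>. What remains is
  a product over \<open>Bd d d'\<close>, controlled by the sum of \<open>1 / sqrt q\<close>, hence
  by its cardinality alone.\<close>

lemma SS_tail_le:
  assumes "d \<in> R" "d' \<in> R" "\<not> degenerate d d'"
  shows "(\<Sum>T | T \<in> Pow (Bd d d') \<and> r0 < \<Prod>T. \<Prod>q\<in>T. 4 * real k / real q) \<le> \<tau>"
proof -
  have Q0: "0 < q" if "q \<in> Bd d d'" for q using that sieve_primesD(6) by (auto simp: Bd_def)
  have "(\<Sum>T | T \<in> Pow (Bd d d') \<and> r0 < \<Prod>T. \<Prod>q\<in>T. 4 * real k / real q)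
     \<le> (\<Sum>T | T \<in> Pow (Bd d d') \<and> r0 < \<Prod>T. (\<Prod>q\<in>T. 4 * real k / sqrt (real q)) / sqrt (real r0))"
  proof (rule sum_mono)
    fix T assume T: "T \<in> {T. T \<in> Pow (Bd d d') \<and> r0 < \<Prod>T}"
    have "(\<Prod>q\<in>T. 4 * real k / real q) = (\<Prod>q\<in>T. 4 * real k / sqrt (real q) / sqrt (real q))"
      by (intro prod.cong refl) (simp add: mult.assoc)
    also have "\<dots> = (\<Prod>q\<in>T. 4 * real k / sqrt (real q)) / (\<Prod>q\<in>T. sqrt (real q))" by (rule prod_dividef)
    also have "(\<Prod>q\<in>T. sqrt (real q)) = sqrt (real (\<Prod>T))"
    proof -
      have "finite T" using T by (auto intro: finite_subset[OF _ finite_Bd])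
      then show ?thesis by (induction T rule: finite_induct) (auto simp: real_sqrt_mult)
    qed
    also have "(\<Prod>q\<in>T. 4 * real k / sqrt (real q)) / sqrt (real (\<Prod>T)) \<le> (\<Prod>q\<in>T. 4 * real k / sqrt (real q)) / sqrt (real r0)"
    proof (rule divide_left_mono)
      have "r0 < \<Prod>T" using T by blast
      then show "sqrt (real r0) \<le> sqrt (real (\<Prod>T))" by (simp del: of_nat_prod)
      then show "0 < sqrt (real (\<Prod>T)) * sqrt (real r0)" using r0pos \<open>r0 < \<Prod>T\<close> by (intro mult_pos_pos) (simp_all del: of_nat_prod)
    qed (auto intro: prod_nonneg)
    finally show "(\<Prod>q\<in>T. 4 * real k / real q) \<le> (\<Prod>q\<in>T. 4 * real k / sqrt (real q)) / sqrt (real r0)" .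
  qed
  also have "\<dots> \<le> (\<Sum>T\<in>Pow (Bd d d'). (\<Prod>q\<in>T. 4 * real k / sqrt (real q)) / sqrt (real r0))"
    by (rule sum_mono2) (auto intro!: divide_nonneg_nonneg prod_nonneg)
  also have "\<dots> = (\<Prod>q\<in>Bd d d'. 1 + 4 * real k / sqrt (real q)) / sqrt (real r0)"
    by (simp add: prod_one_plus_eq_sum_Pow sum_divide_distrib)
  also have "(\<Prod>q\<in>Bd d d'. 1 + 4 * real k / sqrt (real q)) \<le> (\<Prod>q\<in>Bd d d'. exp (4 * real k / sqrt (real q)))"
    by (intro prod_mono conjI exp_ge_add_one_self) auto
  also have "\<dots> = exp (4 * real k * (\<Sum>q\<in>Bd d d'. 1 / sqrt (real q)))"
    by (simp add: exp_sum sum_distrib_left)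
  also have "\<dots> \<le> exp (4 * real k * (2 * sqrt n0))"
  proof -
    have "(\<Sum>q\<in>Bd d d'. 1 / sqrt (real q)) \<le> 2 * sqrt (real (card (Bd d d')))"
      by (rule sum_inverse_sqrt_le) (use Q0 in auto)
    also have "\<dots> \<le> 2 * sqrt n0" using card_Bd_le[OF assms] by simp
    finally have "4 * real k * (\<Sum>q\<in>Bd d d'. 1 / sqrt (real q)) \<le> 4 * real k * (2 * sqrt n0)"
      by (rule mult_left_mono) simp
    then show ?thesis by simp
  qed
  also have "exp (4 * real k * (2 * sqrt n0)) / sqrt (real r0) = \<tau>" by (simp add: \<tau>_def)
  finally show ?thesis by (simp add: divide_right_mono)
qed

text \<open>A single \<open>SS\<close> may be large, but its average over \<open>d'\<close> is near
  1. Expand \<open>SS - 1\<close> over nonempty subsets \<open>T\<close>: if \<open>\<Prod>T\<close>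
  is at most \<open>r0\<close>, then \<open>d'\<close> lies in at most \<open>k\<^sup>2\<close>
  classes modulo each \<open>q\<close> in \<open>T\<close>, which turns the coefficient
  \<open>4 * k / q\<close> into \<open>8 * k ^ 3 / q ^ 2\<close>. All \<open>q\<close> exceed
  \<open>w\<close>, so the sum is at most \<open>exp (8 * k ^ 3 / w) - 1\<close>; larger products go
  into \<tau>.\<close>

lemma SS_average_le:
  assumes d: "d \<in> R"
  shows "(\<Sum>d' | d' \<in> R \<and> [d = d'] (mod M) \<and> \<not> degenerate d d'. mangoldt d' / real d' * (SS d d' - 1))
    \<le> T0 * ((exp (8 * real k ^ 3 / real w) - 1) + \<tau>)"
proof -
  define A where "A = {d'. d' \<in> R \<and> [d = d'] (mod M) \<and> \<not> degenerate d d'}"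
  define S where "S = {T. T \<in> Pow Q \<and> T \<noteq> {} \<and> \<Prod>T \<le> r0}"
  define f where "f T = (\<Prod>q\<in>T. 4 * real k / real q)" for T
  define \<Phi> where "\<Phi> q = (\<Union>i\<in>{1..k}. \<Union>j\<in>{1..k}. {r. r < q \<and> [i * r = j * d] (mod q)})" for q
  have finA: "finite A" by (simp add: A_def)
  have f0: "0 \<le> f T" for T unfolding f_def by (intro prod_nonneg) auto
  have SSb: "SS d d' - 1 \<le> (\<Sum>T\<in>S. if T \<subseteq> Bd d d' then f T else 0) + \<tau>" if "d' \<in> A" for d'
  proof -
    have "SS d d' = (\<Sum>T\<in>Pow (Bd d d'). f T)" unfolding SS_def f_def by (rule prod_one_plus_eq_sum_Pow) simp
    also have "\<dots> \<le> (\<Sum>T\<in>{{}} \<union> ({T \<in> S. T \<subseteq> Bd d d'} \<union> {T. T \<in> Pow (Bd d d') \<and> r0 < \<Prod>T}). f T)"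
      by (rule sum_mono2) (use f0 in \<open>auto simp: S_def Bd_def\<close>)
    also have "\<dots> \<le> f {} + ((\<Sum>T | T \<in> S \<and> T \<subseteq> Bd d d'. f T) + (\<Sum>T | T \<in> Pow (Bd d d') \<and> r0 < \<Prod>T. f T))"
    proof -
      have "sum f (B \<union> C) \<le> sum f B + sum f C" if "finite B" "finite C" for B C
        using that f0 sum_nonneg[of "B \<inter> C" f] by (simp add: sum_Un)
      from this[of "{{}}" "{T \<in> S. T \<subseteq> Bd d d'} \<union> {T. T \<in> Pow (Bd d d') \<and> r0 < \<Prod>T}"]
        this[of "{T \<in> S. T \<subseteq> Bd d d'}" "{T. T \<in> Pow (Bd d d') \<and> r0 < \<Prod>T}"]
      show ?thesis by (auto simp: S_def)
    qed
    also have "(\<Sum>T | T \<in> Pow (Bd d d') \<and> r0 < \<Prod>T. f T) \<le> \<tau>"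
      unfolding f_def by (rule SS_tail_le[OF d]) (use that in \<open>auto simp: A_def\<close>)
    finally show ?thesis by (simp add: f_def[of "{}"] sum.inter_filter[symmetric] S_def)
  qed
  have card\<Phi>: "card (\<Phi> q) \<le> k * k" if q: "q \<in> Q" for q
  proof -
    have one: "card {r. r < q \<and> [i * r = j * d] (mod q)} \<le> 1" if i: "i \<in> {1..k}" for i j
    proof -
      have "\<not> q dvd i" using i sieve_primesD(5)[OF q] by (auto dest: dvd_imp_le)
      then have ci: "coprime i q" using sieve_primesD(1)[OF q] prime_imp_coprime coprime_commute by blast
      have "r = r'" if "r < q" "r' < q" "[i * r = j * d] (mod q)" "[i * r' = j * d] (mod q)" for r r'
      proof -
        have "[i * r = i * r'] (mod q)" using that(3,4) by (meson cong_sym cong_trans)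
        then have "[r = r'] (mod q)" using ci by (simp add: cong_mult_lcancel_nat)
        then show ?thesis using that by (simp add: cong_def)
      qed
      then show ?thesis by (subst card_le_Suc0_iff_eq[unfolded One_nat_def[symmetric]]) auto
    qed
    have "card (\<Phi> q) \<le> (\<Sum>i\<in>{1..k}. card (\<Union>j\<in>{1..k}. {r. r < q \<and> [i * r = j * d] (mod q)}))"
      unfolding \<Phi>_def by (rule card_UN_le) simp
    also have "\<dots> \<le> (\<Sum>i\<in>{1..k}. \<Sum>j\<in>{1..k}. card {r. r < q \<and> [i * r = j * d] (mod q)})"
      by (intro sum_mono card_UN_le) simp
    also have "\<dots> \<le> (\<Sum>i\<in>{1..k}. \<Sum>j\<in>{1..k}. 1)" by (intro sum_mono one)
    finally show ?thesis by simp
  qed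
  have mem\<Phi>: "q \<in> Bd d d' \<longleftrightarrow> d' mod q \<in> \<Phi> q" if "q \<in> Q" for q d'
  proof -
    have "[i * (d' mod q) = j * d] (mod q) \<longleftrightarrow> [i * d' = j * d] (mod q)" for i j
      by (simp add: cong_def mod_mult_right_eq)
    then show ?thesis using that sieve_primesD(6)[OF that] by (auto simp: Bd_def \<Phi>_def)
  qed
  have L0': "0 \<le> mangoldt d' / real d'" for d' by (simp add: mangoldt_nonneg)
  have tau0: "0 \<le> \<tau>" by (simp add: \<tau>_def)
  have "(\<Sum>d'\<in>A. mangoldt d' / real d' * (SS d d' - 1))
      \<le> (\<Sum>d'\<in>A. mangoldt d' / real d' * ((\<Sum>T\<in>S. if T \<subseteq> Bd d d' then f T else 0) + \<tau>))"
    by (intro sum_mono mult_left_mono SSb L0')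
  also have "\<dots> = (\<Sum>T\<in>S. f T * (\<Sum>d' | d' \<in> A \<and> T \<subseteq> Bd d d'. mangoldt d' / real d')) + \<tau> * (\<Sum>d'\<in>A. mangoldt d' / real d')"
  proof -
    have "(\<Sum>d'\<in>A. mangoldt d' / real d' * (\<Sum>T\<in>S. if T \<subseteq> Bd d d' then f T else 0))
       = (\<Sum>T\<in>S. \<Sum>d'\<in>A. if T \<subseteq> Bd d d' then f T * (mangoldt d' / real d') else 0)"
      unfolding sum_distrib_left by (subst sum.swap) (intro sum.cong refl, auto)
    also have "\<dots> = (\<Sum>T\<in>S. f T * (\<Sum>d' | d' \<in> A \<and> T \<subseteq> Bd d d'. mangoldt d' / real d'))"
      unfolding sum_distrib_left using finA by (intro sum.cong refl sum.inter_filter[symmetric])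
    finally show ?thesis by (simp add: distrib_left sum.distrib sum_distrib_left mult.commute)
  qed
  also have "\<dots> \<le> (\<Sum>T\<in>S. (\<Prod>q\<in>T. 8 * real k ^ 3 / real q ^ 2) * T0) + \<tau> * T0"
  proof (intro add_mono sum_mono mult_left_mono tau0)
    show "(\<Sum>d'\<in>A. mangoldt d' / real d') \<le> T0"
      by (rule order_trans[OF sum_mono2 mangoldt_class_sum_le[of d]])
         (use L0' in \<open>auto simp: A_def cong_sym_eq\<close>)
    fix T assume T: "T \<in> S"
    have TQ: "T \<subseteq> Q" "\<Prod>T \<le> r0" using T by (auto simp: S_def)
    have "(\<Sum>d' | d' \<in> A \<and> T \<subseteq> Bd d d'. mangoldt d' / real d')
       \<le> (\<Sum>d' | d' \<in> R \<and> [d' = d] (mod M) \<and> (\<forall>q\<in>T. d' mod q \<in> \<Phi> q). mangoldt d' / real d')"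
      by (rule sum_mono2) (use L0' TQ mem\<Phi> in \<open>auto simp: A_def cong_sym_eq subset_iff\<close>)
    also have "\<dots> \<le> (\<Prod>q\<in>T. 2 * real (card (\<Phi> q)) / real q) * T0"
      by (rule mangoldt_sum_le[OF TQ]) (auto simp: \<Phi>_def)
    also have "\<dots> \<le> (\<Prod>q\<in>T. 2 * (real k * real k) / real q) * T0"
    proof (intro mult_right_mono prod_mono conjI divide_right_mono mult_left_mono T0_nonneg)
      fix q assume "q \<in> T"
      then have "card (\<Phi> q) \<le> k * k" using TQ card\<Phi> by auto
      then show "real (card (\<Phi> q)) \<le> real k * real k" by (simp flip: of_nat_mult)
    qed auto
    finally have "f T * (\<Sum>d' | d' \<in> A \<and> T \<subseteq> Bd d d'. mangoldt d' / real d') \<le> f T * ((\<Prod>q\<in>T. 2 * (real k * real k) / real q) * T0)"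
      using f0 by (intro mult_left_mono)
    also have "\<dots> = (\<Prod>q\<in>T. 8 * real k ^ 3 / real q ^ 2) * T0"
    proof -
      have "f T * (\<Prod>q\<in>T. 2 * (real k * real k) / real q) = (\<Prod>q\<in>T. 8 * real k ^ 3 / real q ^ 2)"
        unfolding f_def prod.distrib[symmetric]
        by (intro prod.cong refl) (simp add: power2_eq_square power3_eq_cube)
      then show ?thesis by (metis mult.assoc)
    qed
    finally show "f T * (\<Sum>d' | d' \<in> A \<and> T \<subseteq> Bd d d'. mangoldt d' / real d') \<le> (\<Prod>q\<in>T. 8 * real k ^ 3 / real q ^ 2) * T0" .
  qed
  also have "(\<Sum>T\<in>S. (\<Prod>q\<in>T. 8 * real k ^ 3 / real q ^ 2) * T0) \<le> (exp (8 * real k ^ 3 / real w) - 1) * T0"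
  proof -
    have "(\<Sum>T\<in>S. \<Prod>q\<in>T. 8 * real k ^ 3 / real q ^ 2) \<le> (\<Sum>T\<in>Pow Q - {{}}. \<Prod>q\<in>T. 8 * real k ^ 3 / real q ^ 2)"
      by (rule sum_mono2) (auto simp: S_def intro!: prod_nonneg)
    also have "\<dots> = (\<Prod>q\<in>Q. 1 + 8 * real k ^ 3 / real q ^ 2) - 1"
      by (simp add: prod_one_plus_eq_sum_Pow sum_diff1)
    also have "(\<Prod>q\<in>Q. 1 + 8 * real k ^ 3 / real q ^ 2) \<le> (\<Prod>q\<in>Q. exp (8 * real k ^ 3 / real q ^ 2))"
      by (intro prod_mono conjI exp_ge_add_one_self) auto
    also have "\<dots> = exp (8 * real k ^ 3 * (\<Sum>q\<in>Q. 1 / real q ^ 2))" by (simp add: exp_sum sum_distrib_left)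
    also have "\<dots> \<le> exp (8 * real k ^ 3 * (1 / real w))"
    proof -
      have "(\<Sum>q\<in>Q. 1 / real q ^ 2) \<le> 1 / real w"
        by (rule sum_inverse_squares_le) (use wk sieve_primesD(4) in auto)
      then show ?thesis by (simp add: mult_left_mono del: times_divide_eq_right)
    qed
    finally show ?thesis
      unfolding sum_distrib_right[symmetric] by (intro mult_right_mono T0_nonneg) simp
  qed
  finally show ?thesis unfolding A_def by (simp add: algebra_simps)
qed

text \<open>\<open>d\<close>, \<open>i\<close> and \<open>j\<close> determine \<open>d'\<close>,
  leaving at most \<open>k\<^sup>2\<close> terms, each of size at most \<open>L / z0\<close> because
  elements of \<open>R\<close> exceed \<open>z0\<close>.\<close>

lemma degenerate_sum_le:
  assumes d: "d \<in> R"
  shows "(\<Sum>d' | d' \<in> R \<and> degenerate d d'. mangoldt d' / real d') \<le> real k ^ 2 * (L / real z0)"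
proof -
  define A where "A = {d'. d' \<in> R \<and> degenerate d d'}"
  have "A \<subseteq> (\<lambda>(i, j). j * d div i) ` ({1..k} \<times> {1..k})"
  proof
    fix d' assume "d' \<in> A"
    then obtain i j where ij: "i \<in> {1..k}" "j \<in> {1..k}" "i * d' = j * d" by (auto simp: A_def degenerate_def)
    then have "d' = j * d div i" by (metis atLeastAtMost_iff nonzero_mult_div_cancel_left not_one_le_zero)
    then show "d' \<in> (\<lambda>(i, j). j * d div i) ` ({1..k} \<times> {1..k})" using ij by (intro image_eqI[of _ _ "(i, j)"]) auto
  qed
  then have "card A \<le> card ((\<lambda>(i, j). j * d div i) ` ({1..k} \<times> {1..k}))" by (intro card_mono) auto
  also have "\<dots> \<le> card ({1..k} \<times> {1..k})" by (rule card_image_le) simp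
  finally have "real (card A) \<le> real k ^ 2" by (simp add: power2_eq_square flip: of_nat_mult)
  have "(\<Sum>d'\<in>A. mangoldt d' / real d') \<le> (\<Sum>d'\<in>A. L / real z0)"
  proof (rule sum_mono)
    fix d' assume "d' \<in> A"
    then have "d' \<in> R" by (simp add: A_def)
    then show "mangoldt d' / real d' \<le> L / real z0"
      using mangoldt_le_L R_gt[of d'] L0 r0pos by (intro frac_le) (auto simp: z0_def intro: less_imp_le)
  qed
  also have "\<dots> = real (card A) * (L / real z0)" by simp
  also have "\<dots> \<le> real k ^ 2 * (L / real z0)" using \<open>real (card A) \<le> real k ^ 2\<close> L0 by (intro mult_right_mono) auto
  finally show ?thesis by (simp add: A_def)
qed

end

section \<open>From sums of logarithms to primes\<close>

context sieve_setup
begin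

definition "S0 = {n \<in> {N..x}. [n = a] (mod M) \<and> rough M z0 n}"
definition "S1 = {n \<in> S0. sifted k M y n}"

lemma finite_S [simp]: "finite S0" "finite S1" by (simp_all add: S0_def S1_def)

lemma S0_coprime: "n \<in> S0 \<Longrightarrow> coprime n M"
  unfolding S0_def using cong_imp_coprime[OF cong_sym cop] by auto

lemma rough_dvd: "rough M v n \<Longrightarrow> d dvd n \<Longrightarrow> rough M v d"
  unfolding rough_def by (meson dvd_trans)

lemma mult_in_S0_iff:
  assumes "d \<in> R" "m \<in> R"
  shows "d * m \<in> S0 \<longleftrightarrow> cnd d m"
proof -
  have "rough M z0 (d * m)"
    unfolding rough_def
  proof
    fix q assume q: "q \<in> sieve_primes M z0"
    then show "\<not> q dvd d * m"
      using assms prime_dvd_mult_iff[OF sieve_primesD(1)[OF q]] by (auto simp: R_def rough_def)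
  qed
  then show ?thesis by (auto simp: S0_def cnd_def)
qed

text \<open>In \<open>ln n\<close>, written as a divisor sum of \<open>mangoldt\<close>, the divisor
  \<open>n\<close> gives the term to be detected and the divisor 1 gives 0. Every other divisor and
  its cofactor inherit roughness and coprimality from \<open>n\<close>.\<close>

lemma ln_sum_decompose:
  assumes S: "S \<subseteq> S0"
  shows "(\<Sum>n\<in>S. ln (real n) / real n) = (\<Sum>n\<in>S. mangoldt n / real n)
    + (\<Sum>m\<in>R. \<Sum>d | d \<in> R \<and> d * m \<in> S. 1 / real m * (mangoldt d / real d))"
proof -
  have finS: "finite S" using S by (rule finite_subset) simp
  have n1: "1 \<le> n" "n \<le> x" if "n \<in> S" for n using that S N1 by (auto simp: S0_def)
  have "(\<Sum>n\<in>S. ln (real n) / real n) = (\<Sum>n\<in>S. mangoldt n / real n + (\<Sum>d\<in>{d. d dvd n} - {1, n}. mangoldt d / real n))"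
  proof (intro sum.cong refl)
    fix n assume n: "n \<in> S"
    have fin: "finite {d. d dvd n}" using n1[OF n] by (intro finite_divisors_nat) auto
    have "ln (real n) = (\<Sum>d | d dvd n. mangoldt d)" using n1[OF n] by (subst mangoldt_sum) auto
    also have "\<dots> = mangoldt n + (\<Sum>d\<in>{d. d dvd n} - {n}. mangoldt d)"
      using fin by (subst sum.remove[of _ n]) auto
    also have "(\<Sum>d\<in>{d. d dvd n} - {n}. mangoldt d :: real) = (\<Sum>d\<in>{d. d dvd n} - {1, n}. mangoldt d)"
      using fin by (intro sum.mono_neutral_right) auto
    finally show "ln (real n) / real n = mangoldt n / real n + (\<Sum>d\<in>{d. d dvd n} - {1, n}. mangoldt d / real n)"
      by (simp add: add_divide_distrib sum_divide_distrib)
  qed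
  also have "\<dots> = (\<Sum>n\<in>S. mangoldt n / real n) + (\<Sum>n\<in>S. \<Sum>d\<in>{d. d dvd n} - {1, n}. mangoldt d / real n)"
    by (rule sum.distrib)
  also have "(\<Sum>n\<in>S. \<Sum>d\<in>{d. d dvd n} - {1, n}. mangoldt d / real n)
     = (\<Sum>(n, d)\<in>(SIGMA n:S. {d. d dvd n} - {1, n}). mangoldt d / real n)"
  proof (rule sum.Sigma[OF finS], rule ballI)
    fix n assume "n \<in> S"
    then show "finite ({d. d dvd n} - {1, n})" using n1[of n] by (intro finite_Diff finite_divisors_nat) auto
  qed
  also have "\<dots> = (\<Sum>(m, d)\<in>(SIGMA m:R. {d. d \<in> R \<and> d * m \<in> S}). 1 / real m * (mangoldt d / real d))"
  proof (rule sum.reindex_bij_witness[of _ "\<lambda>(m, d). (d * m, d)" "\<lambda>(n, d). (n div d, d)"])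
    fix p assume "p \<in> (SIGMA n:S. {d. d dvd n} - {1, n})"
    then obtain n d where p: "p = (n, d)" "n \<in> S" "d dvd n" "d \<noteq> 1" "d \<noteq> n" by auto
    then obtain m where m: "n = d * m" by auto
    have d0: "0 < d" "0 < m" using n1[OF p(2)] m by (auto intro: Nat.gr0I)
    have m1: "m \<noteq> 1" using p(5) m by auto
    have mx: "d \<le> x" "m \<le> x" using n1[OF p(2)] m d0 le_trans[of d "d * m" x] le_trans[of m "d * m" x] by simp_all
    have nS: "n \<in> S0" using p(2) S by auto
    have "coprime d M" "coprime m M" using S0_coprime[OF nS] m by auto
    moreover have "rough M z0 d" "rough M z0 m" using rough_dvd[of z0 n] nS m by (auto simp: S0_def)
    ultimately have R: "d \<in> R" "m \<in> R" using d0 p(4) m1 mx by (auto simp: R_def)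
    show "(case case p of (n, d) \<Rightarrow> (n div d, d) of (m, d) \<Rightarrow> (d * m, d)) = p" using p m d0 by simp
    show "(case p of (n, d) \<Rightarrow> (n div d, d)) \<in> (SIGMA m:R. {d. d \<in> R \<and> d * m \<in> S})" using p m d0 R by simp
    show "(case case p of (n, d) \<Rightarrow> (n div d, d) of (m, d) \<Rightarrow> 1 / real m * (mangoldt d / real d)) = (case p of (n, d) \<Rightarrow> mangoldt d / real n)"
      using p(1) m d0 by simp
  next
    fix p assume "p \<in> (SIGMA m:R. {d. d \<in> R \<and> d * m \<in> S})"
    then obtain m d where p: "p = (m, d)" "m \<in> R" "d \<in> R" "d * m \<in> S" by auto
    then have "2 \<le> m" "2 \<le> d" by (auto simp: R_def)
    with p show "(case case p of (m, d) \<Rightarrow> (d * m, d) of (n, d) \<Rightarrow> (n div d, d)) = p"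
      "(case p of (m, d) \<Rightarrow> (d * m, d)) \<in> (SIGMA n:S. {d. d dvd n} - {1, n})" by auto
  qed
  also have "\<dots> = (\<Sum>m\<in>R. \<Sum>d | d \<in> R \<and> d * m \<in> S. 1 / real m * (mangoldt d / real d))"
    by (rule sum.Sigma[symmetric]) auto
  finally show ?thesis .
qed

text \<open>
  \<open>B0\<close> and \<open>B1\<close> are the contributions to \<open>\<Sum> ln n / n\<close>, over \<open>S0\<close> and \<open>S1\<close>, of the
  factorisations \<open>n = d * m\<close> with \<open>m > 1\<close>.
\<close>
definition "B0 = (\<Sum>m\<in>R. \<Sum>d | d \<in> R \<and> cnd d m. 1 / real m * (mangoldt d / real d))"
definition "B1 = (\<Sum>m\<in>R. \<Sum>d | d \<in> R \<and> cnd d m. 1 / real m * (mangoldt d / real d * \<sigma> (d * m)))"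

lemma ln_sum_S0: "(\<Sum>n\<in>S0. ln (real n) / real n) = (\<Sum>n\<in>S0. mangoldt n / real n) + B0"
proof -
  have "(\<Sum>m\<in>R. \<Sum>d | d \<in> R \<and> d * m \<in> S0. 1 / real m * (mangoldt d / real d)) = B0"
    unfolding B0_def
  proof (rule sum.cong[OF refl])
    fix m assume m: "m \<in> R"
    have "{d. d \<in> R \<and> d * m \<in> S0} = {d. d \<in> R \<and> cnd d m}" using mult_in_S0_iff[OF _ m] by auto
    then show "(\<Sum>d | d \<in> R \<and> d * m \<in> S0. 1 / real m * (mangoldt d / real d)) = (\<Sum>d | d \<in> R \<and> cnd d m. 1 / real m * (mangoldt d / real d))"
      by simp
  qed
  then show ?thesis using ln_sum_decompose[of S0] by simp
qed

lemma ln_sum_S1: "(\<Sum>n\<in>S1. ln (real n) / real n) = (\<Sum>n\<in>S1. mangoldt n / real n) + B1"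
proof -
  have "(\<Sum>m\<in>R. \<Sum>d | d \<in> R \<and> d * m \<in> S1. 1 / real m * (mangoldt d / real d)) = B1"
    unfolding B1_def
  proof (rule sum.cong[OF refl])
    fix m assume m: "m \<in> R"
    show "(\<Sum>d | d \<in> R \<and> d * m \<in> S1. 1 / real m * (mangoldt d / real d)) = (\<Sum>d | d \<in> R \<and> cnd d m. 1 / real m * (mangoldt d / real d * \<sigma> (d * m)))"
      by (rule sum.mono_neutral_cong_left) (use mult_in_S0_iff[OF _ m] in \<open>auto simp: S1_def \<sigma>_def\<close>)
  qed
  then show ?thesis using ln_sum_decompose[of S1] by (simp add: S1_def)
qed

text \<open>The discrepancy between the sifted sum over \<open>d\<close> and its expected value for
  fixed \<open>m\<close>; \<open>D2\<close> is its weighted second moment, the dispersion.\<close>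

definition "Y m = (\<Sum>d | d \<in> R \<and> cnd d m. mangoldt d / real d * (\<sigma> (d * m) - V))"
definition "D2 = (\<Sum>m\<in>R'. 1 / real m * (Y m)\<^sup>2)"

lemma B_diff_eq: "B1 - V * B0 = (\<Sum>m\<in>R. 1 / real m * Y m)"
  unfolding B1_def B0_def Y_def sum_distrib_left sum_subtractf[symmetric]
  by (intro sum.cong refl) (simp add: algebra_simps)

lemma B_diff_sq_le: "(B1 - V * B0)\<^sup>2 \<le> (\<Sum>m\<in>R. 1 / real m) * D2"
proof -
  have "(B1 - V * B0)\<^sup>2 = (\<Sum>m\<in>R. 1 / sqrt (real m) * (Y m / sqrt (real m)))\<^sup>2"
    unfolding B_diff_eq by (intro arg_cong[of _ _ "\<lambda>z. z\<^sup>2"] sum.cong refl) simp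
  also have "\<dots> \<le> (\<Sum>m\<in>R. (1 / sqrt (real m))\<^sup>2) * (\<Sum>m\<in>R. (Y m / sqrt (real m))\<^sup>2)"
    by (rule Cauchy_Schwarz_ineq_sum)
  also have "\<dots> = (\<Sum>m\<in>R. 1 / real m) * (\<Sum>m\<in>R. 1 / real m * (Y m)\<^sup>2)"
    by (simp add: power_divide)
  also have "\<dots> \<le> (\<Sum>m\<in>R. 1 / real m) * D2"
    unfolding D2_def by (intro mult_left_mono sum_mono2 R_subset sum_nonneg) auto
  finally show ?thesis .
qed

lemma D2_eq: "D2 = (\<Sum>d\<in>R. \<Sum>d'\<in>R. mangoldt d / real d * (mangoldt d' / real d' * G d d'))"
proof -
  define u where "u d m = (if cnd d m then mangoldt d / real d * (\<sigma> (d * m) - V) else 0)" for d m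
  have Y: "Y m = (\<Sum>d\<in>R. u d m)" for m
    unfolding Y_def u_def by (rule sum.mono_neutral_cong_left) auto
  have "D2 = (\<Sum>m\<in>R'. \<Sum>d\<in>R. \<Sum>d'\<in>R. 1 / real m * (u d m * u d' m))"
    unfolding D2_def Y power2_eq_square sum_product by (simp add: sum_distrib_left)
  also have "\<dots> = (\<Sum>d\<in>R. \<Sum>m\<in>R'. \<Sum>d'\<in>R. 1 / real m * (u d m * u d' m))" by (rule sum.swap)
  also have "\<dots> = (\<Sum>d\<in>R. \<Sum>d'\<in>R. \<Sum>m\<in>R'. 1 / real m * (u d m * u d' m))"
    by (intro sum.cong refl sum.swap)
  also have "\<dots> = (\<Sum>d\<in>R. \<Sum>d'\<in>R. mangoldt d / real d * (mangoldt d' / real d' * G d d'))"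
  proof (intro sum.cong refl)
    fix d d'
    have "(\<Sum>m\<in>R'. 1 / real m * (u d m * u d' m)) = (\<Sum>m | m \<in> R' \<and> cnd d m \<and> cnd d' m. 1 / real m * (u d m * u d' m))"
      by (rule sum.mono_neutral_right) (auto simp: u_def)
    also have "\<dots> = (\<Sum>m | m \<in> R' \<and> cnd d m \<and> cnd d' m. mangoldt d / real d * (mangoldt d' / real d' * (1 / real m * ((\<sigma> (d * m) - V) * (\<sigma> (d' * m) - V)))))"
      by (rule sum.cong) (auto simp: u_def mult_ac)
    also have "\<dots> = mangoldt d / real d * (mangoldt d' / real d' * G d d')"
      by (simp only: G_def sum_distrib_left)
    finally show "(\<Sum>m\<in>R'. 1 / real m * (u d m * u d' m)) = mangoldt d / real d * (mangoldt d' / real d' * G d d')" .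
  qed
  finally show ?thesis .
qed

definition "h = H / real M * (U * V\<^sup>2)"
text \<open>\<eta> collects the relative losses from coincidences and the sieve error;
  \<open>\<rho>\<close> collects the sieve remainder and the degenerate pairs, both saved by the
  division by \<open>z0\<close>.\<close>

definition "\<eta> = 2 * ((exp (8 * real k ^ 3 / real w) - 1) + \<tau>) + 4 * e"
definition "\<rho> = 4 * err / real z0 * T0 + H * (real k ^ 2 * (L / real z0))"

lemma h_nonneg: "0 \<le> h" unfolding h_def using H1 UU_pos[of y] by auto

lemma D2_inner_le:
  assumes d: "d \<in> R"
  shows "(\<Sum>d'\<in>R. mangoldt d' / real d' * G d d') \<le> h * T0 * \<eta> + \<rho>"
proof -
  define A where "A = {d'. d' \<in> R \<and> [d = d'] (mod M) \<and> \<not> degenerate d d'}"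
  define D where "D = {d'. d' \<in> R \<and> degenerate d d'}"
  have L0': "0 \<le> mangoldt d' / real d'" for d' by (simp add: mangoldt_nonneg)
  have c0: "0 \<le> 4 * e * h + 4 * err / real z0" using e01 h_nonneg by (simp add: err_def)
  have "(\<Sum>d'\<in>R. mangoldt d' / real d' * G d d')
     \<le> (\<Sum>d'\<in>R. (if d' \<in> A then mangoldt d' / real d' * (2 * h * (SS d d' - 1) + (4 * e * h + 4 * err / real z0)) else 0)
           + (if d' \<in> D then mangoldt d' / real d' * H else 0))"
  proof (rule sum_mono)
    fix d' assume d': "d' \<in> R"
    \<comment> \<open>Incongruent pairs vanish; degenerate ones receive the trivial bound; only the
      others use the correlation estimate.\<close>
    consider "d' \<in> A" "d' \<notin> D" | "d' \<in> D" "d' \<notin> A" | "\<not> [d = d'] (mod M)" "d' \<notin> A" "d' \<notin> D"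
      using d' by (auto simp: A_def D_def G_eq_0)
    then show "mangoldt d' / real d' * G d d' \<le> (if d' \<in> A then mangoldt d' / real d' * (2 * h * (SS d d' - 1) + (4 * e * h + 4 * err / real z0)) else 0)
           + (if d' \<in> D then mangoldt d' / real d' * H else 0)"
    proof cases
      case 1
      have "G d d' \<le> h * (2 * (SS d d' - 1) + 4 * e) + 4 * err / real z0"
        unfolding h_def by (rule G_le) (use d d' 1 in \<open>auto simp: A_def\<close>)
      also have "\<dots> = 2 * h * (SS d d' - 1) + (4 * e * h + 4 * err / real z0)" by (simp add: algebra_simps)
      finally show ?thesis using 1 L0' by (simp add: mult_left_mono del: times_divide_eq_left)
    next
      case 2
      then show ?thesis using mult_left_mono[OF G_le_H L0'[of d']] by simp
    next
      case 3
      then show ?thesis by (simp add: G_eq_0)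
    qed
  qed
  also have "\<dots> = (\<Sum>d'\<in>A. mangoldt d' / real d' * (2 * h * (SS d d' - 1) + (4 * e * h + 4 * err / real z0)))
       + (\<Sum>d'\<in>D. mangoldt d' / real d' * H)"
  proof -
    have "A \<subseteq> R" "D \<subseteq> R" by (auto simp: A_def D_def)
    then show ?thesis by (simp add: sum.distrib sum.If_cases Int_absorb1)
  qed
  also have "\<dots> = 2 * h * (\<Sum>d'\<in>A. mangoldt d' / real d' * (SS d d' - 1))
       + (4 * e * h + 4 * err / real z0) * (\<Sum>d'\<in>A. mangoldt d' / real d') + H * (\<Sum>d'\<in>D. mangoldt d' / real d')"
  proof -
    define c where "c = 4 * e * h + 4 * err / real z0"
    have "(\<Sum>d'\<in>A. mangoldt d' / real d' * (2 * h * (SS d d' - 1) + c))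
        = (\<Sum>d'\<in>A. 2 * h * (mangoldt d' / real d' * (SS d d' - 1)) + c * (mangoldt d' / real d'))"
      by (intro sum.cong refl) (simp only: distrib_left mult_ac)
    moreover have "(\<Sum>d'\<in>D. mangoldt d' / real d' * H) = H * (\<Sum>d'\<in>D. mangoldt d' / real d')"
      unfolding sum_distrib_left by (intro sum.cong refl) (rule mult.commute)
    ultimately show ?thesis unfolding c_def[symmetric] by (simp only: sum.distrib sum_distrib_left)
  qed
  also have "\<dots> \<le> 2 * h * (T0 * ((exp (8 * real k ^ 3 / real w) - 1) + \<tau>))
       + (4 * e * h + 4 * err / real z0) * T0 + H * (real k ^ 2 * (L / real z0))"
  proof (intro add_mono mult_left_mono c0)
    show "(\<Sum>d'\<in>A. mangoldt d' / real d' * (SS d d' - 1)) \<le> T0 * ((exp (8 * real k ^ 3 / real w) - 1) + \<tau>)"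
      unfolding A_def by (rule SS_average_le[OF d])
    show "(\<Sum>d'\<in>A. mangoldt d' / real d') \<le> T0"
      by (rule order_trans[OF sum_mono2 mangoldt_class_sum_le[of d]])
         (use L0' in \<open>auto simp: A_def cong_sym_eq\<close>)
    show "(\<Sum>d'\<in>D. mangoldt d' / real d') \<le> real k ^ 2 * (L / real z0)"
      unfolding D_def by (rule degenerate_sum_le[OF d])
  qed (use H1 h_nonneg in auto)
  also have "\<dots> = h * T0 * \<eta> + \<rho>" by (simp add: \<eta>_def \<rho>_def algebra_simps)
  finally show ?thesis .
qed

lemma \<eta>_nonneg: "0 \<le> \<eta>"
  using e01 by (simp add: \<eta>_def \<tau>_def add_nonneg_nonneg)

lemma \<rho>_nonneg: "0 \<le> \<rho>"
  unfolding \<rho>_def using T0_nonneg H1 L0 by (intro add_nonneg_nonneg mult_nonneg_nonneg) (auto simp: err_def)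

lemma dispersion_le:
  "(B1 - V * B0)\<^sup>2 \<le> (3 * H * U * real (totient M) / real M) * ((L + 4) * (h * T0 * \<eta> + \<rho>))"
proof -
  have L0': "0 \<le> mangoldt d' / real d'" for d' by (simp add: mangoldt_nonneg)
  have E0: "0 \<le> h * T0 * \<eta> + \<rho>" using h_nonneg T0_nonneg \<eta>_nonneg \<rho>_nonneg by auto
  have "D2 = (\<Sum>d\<in>R. mangoldt d / real d * (\<Sum>d'\<in>R. mangoldt d' / real d' * G d d'))"
    unfolding D2_eq by (simp only: sum_distrib_left)
  also have "\<dots> \<le> (\<Sum>d\<in>R. mangoldt d / real d * (h * T0 * \<eta> + \<rho>))"
    by (intro sum_mono mult_left_mono D2_inner_le L0')
  also have "\<dots> = (\<Sum>d\<in>R. mangoldt d / real d) * (h * T0 * \<eta> + \<rho>)" by (simp only: sum_distrib_right)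
  also have "\<dots> \<le> (L + 4) * (h * T0 * \<eta> + \<rho>)"
  proof (intro mult_right_mono E0)
    have "(\<Sum>d\<in>R. mangoldt d / real d) \<le> (\<Sum>d\<in>{1..x}. mangoldt d / real d)"
      by (rule sum_mono2) (use L0' in \<open>auto simp: R_def\<close>)
    also have "\<dots> \<le> L + 4" unfolding L_def by (rule mertens_mangoldt(1)[OF x1])
    finally show "(\<Sum>d\<in>R. mangoldt d / real d) \<le> L + 4" .
  qed
  finally have D2: "D2 \<le> (L + 4) * (h * T0 * \<eta> + \<rho>)" .
  have D20: "0 \<le> D2" unfolding D2_def by (intro sum_nonneg) auto
  have "(B1 - V * B0)\<^sup>2 \<le> (\<Sum>m\<in>R. 1 / real m) * D2" by (rule B_diff_sq_le)
  also have "\<dots> \<le> (3 * H * U * real (totient M) / real M) * ((L + 4) * (h * T0 * \<eta> + \<rho>))"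
    by (rule mult_mono[OF inverse_sum_R_le D2]) (use H1 UU_pos[of y] D20 in auto)
  finally show ?thesis .
qed

text \<open>The sums of \<open>ln n / n\<close> over \<open>S1\<close> and \<open>S0\<close> are
  sieved up to \<open>z0\<close>; their main terms differ exactly by the factor \<open>V\<close>.
  Subtracting the bilinear parts, for which \<open>B1\<close> is close to \<open>V * B0\<close>,
  leaves the comparison of the sums over primes. The level \<open>b1\<close> is separate from
  \<open>b\<close> because this sieve runs to \<open>z0\<close> instead of \<open>y\<close>.\<close>

lemma prime_sum_lower:
  assumes b1: "exp (60 * real (2 * k + 1)) \<le> 2 ^ b1" and N3: "3 \<le> N"
  defines "e1 \<equiv> 2 * (exp (60 * real (2 * k + 1)) / 2 ^ b1)"
    and "err1 \<equiv> ln (real N) / real N * real z0 ^ (16 * b1 + 25)"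
  shows "(\<Sum>n\<in>S1. mangoldt n / real n) \<ge> V * (\<Sum>n\<in>S0. mangoldt n / real n)
     - 2 * e1 * (L * H * UU M z0 / real M) * V - 2 * err1 - \<bar>B1 - V * B0\<bar>"
proof -
  define X where "X = (\<Sum>n\<in>{N..x}. ln (real n) / real n) / real M"
  \<comment> \<open>Primes up to \<open>y\<close> exclude 0 and the classes of the \<open>k\<close>
    shifts; those between \<open>y\<close> and \<open>z0\<close> exclude 0 alone.\<close>
  define \<Omega> where "\<Omega> q = (if q \<le> y then root_set q 1 0 \<union> roots1 k q 1 else root_set q 1 0)" for q
  have z3: "3 \<le> z0" using z0_ge y3 by simp
  have g: "0 \<le> ln (real n) / real n" for n by (cases "n = 0") auto
  have g': "ln (real j) / real j \<le> ln (real i) / real i" if "N \<le> i" "i \<le> j" for i j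
    using N3 that by (intro ln_over_id_antimono) auto
  have qprop: "prime q \<and> 2 * (2 * k + 1) < q \<and> q \<le> z0 \<and> \<not> q dvd M" if "q \<in> sieve_primes M z0" for q
    using sieve_primesD[OF that] by auto
  have c0: "card (root_set q 1 0) = 1" if "q \<in> sieve_primes M z0" for q
    using sieve_primesD(1)[OF that] prime_gt_1_nat by (intro card_root_set) auto
  have c1: "card (root_set q 1 0 \<union> roots1 k q 1) = k + 1" if "q \<in> sieve_primes M z0" for q
    using sieve_primesD[OF that] prime_gt_1_nat[of q] by (intro card_roots1(3)) auto
  have U0: "0 < UU M z0" by (rule UU_pos)
  have "\<bar>(\<Sum>n | n \<in> {N..x} \<and> [n = a] (mod M) \<and> (\<forall>q\<in>sieve_primes M z0. n mod q \<notin> root_set q 1 0). ln (real n) / real n)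
     - X * (\<Prod>q\<in>sieve_primes M z0. 1 - real (card (root_set q 1 0)) / real q)\<bar>
     \<le> e1 * X * (\<Prod>q\<in>sieve_primes M z0. 1 - real (card (root_set q 1 0)) / real q) + err1"
    unfolding X_def e1_def err1_def
    by (rule sieve_AP[OF z3 _ M qprop _ b1 g g']) (use c0 root_set_subset in auto)
  moreover have "(\<Prod>q\<in>sieve_primes M z0. 1 - real (card (root_set q 1 0)) / real q) = UU M z0"
    unfolding UU_def by (intro prod.cong refl) (simp only: c0 of_nat_1)
  moreover have "{n. n \<in> {N..x} \<and> [n = a] (mod M) \<and> (\<forall>q\<in>sieve_primes M z0. n mod q \<notin> root_set q 1 0)} = S0"
    using mod_in_root_set sieve_primesD(6) by (auto simp: S0_def rough_def)
  ultimately have C: "\<bar>(\<Sum>n\<in>S0. ln (real n) / real n) - X * UU M z0\<bar> \<le> e1 * X * UU M z0 + err1" by simp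
  have "\<bar>(\<Sum>n | n \<in> {N..x} \<and> [n = a] (mod M) \<and> (\<forall>q\<in>sieve_primes M z0. n mod q \<notin> \<Omega> q). ln (real n) / real n)
     - X * (\<Prod>q\<in>sieve_primes M z0. 1 - real (card (\<Omega> q)) / real q)\<bar>
     \<le> e1 * X * (\<Prod>q\<in>sieve_primes M z0. 1 - real (card (\<Omega> q)) / real q) + err1"
    unfolding X_def e1_def err1_def
  proof (rule sieve_AP[OF z3 _ M qprop _ b1 g g'])
    fix q assume q: "q \<in> sieve_primes M z0"
    have "\<Omega> q \<subseteq> {..<q}" using root_set_subset by (auto simp: \<Omega>_def roots1_def)
    moreover have "card (\<Omega> q) \<le> 2 * k + 1" using c0[OF q] c1[OF q] by (auto simp: \<Omega>_def)
    ultimately show "\<Omega> q \<subseteq> {..<q} \<and> card (\<Omega> q) \<le> 2 * k + 1" ..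
  qed auto
  moreover have "(\<Prod>q\<in>sieve_primes M z0. 1 - real (card (\<Omega> q)) / real q) = UU M z0 * V"
  proof -
    have "V = (\<Prod>q\<in>sieve_primes M z0. if q \<le> y then 1 - real k / (real q - 1) else 1)"
      unfolding VV_def by (rule prod.mono_neutral_cong_left) (use z0_ge in \<open>auto simp: sieve_primes_def\<close>)
    then have "UU M z0 * V = (\<Prod>q\<in>sieve_primes M z0. (1 - 1 / real q) * (if q \<le> y then 1 - real k / (real q - 1) else 1))"
      by (simp add: UU_def prod.distrib)
    also have "\<dots> = (\<Prod>q\<in>sieve_primes M z0. 1 - real (card (\<Omega> q)) / real q)"
    proof (intro prod.cong refl)
      fix q assume q: "q \<in> sieve_primes M z0"
      show "(1 - 1 / real q) * (if q \<le> y then 1 - real k / (real q - 1) else 1) = 1 - real (card (\<Omega> q)) / real q"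
      proof (cases "q \<le> y")
        case True
        then have "q \<in> Q" using q by (simp add: sieve_primes_def)
        then show ?thesis using local_factor_one[of q] c1[OF q] True by (simp add: \<Omega>_def add.commute)
      next
        case False
        then show ?thesis using c0[OF q] by (simp add: \<Omega>_def)
      qed
    qed
    finally show ?thesis by simp
  qed
  moreover have "{n. n \<in> {N..x} \<and> [n = a] (mod M) \<and> (\<forall>q\<in>sieve_primes M z0. n mod q \<notin> \<Omega> q)} = S1"
  proof -
    have "(\<forall>q\<in>sieve_primes M z0. n mod q \<notin> \<Omega> q) \<longleftrightarrow> rough M z0 n \<and> sifted k M y n" for n
    proof -
      have "n mod q \<notin> \<Omega> q \<longleftrightarrow> \<not> q dvd n \<and> (q \<le> y \<longrightarrow> (\<forall>i\<in>{1..k}. \<not> q dvd n + i))" if "q \<in> sieve_primes M z0" for q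
        using mod_in_root_set[OF sieve_primesD(6)[OF that]] by (auto simp: \<Omega>_def roots1_def)
      moreover have "Q = {q \<in> sieve_primes M z0. q \<le> y}" using z0_ge by (auto simp: sieve_primes_def)
      ultimately show ?thesis unfolding rough_def sifted_def by auto
    qed
    then show ?thesis by (auto simp: S0_def S1_def)
  qed
  ultimately have A: "\<bar>(\<Sum>n\<in>S1. ln (real n) / real n) - X * (UU M z0 * V)\<bar> \<le> e1 * X * (UU M z0 * V) + err1" by simp
  have X: "0 \<le> X" "X \<le> L * H / real M"
  proof -
    have "0 \<le> (\<Sum>n\<in>{N..x}. ln (real n) / real n)" by (intro sum_nonneg g)
    then show "0 \<le> X" unfolding X_def by (intro divide_nonneg_nonneg) auto
    have "(\<Sum>n\<in>{N..x}. ln (real n) / real n) \<le> (\<Sum>n\<in>{N..x}. L * (1 / real n))"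
    proof (rule sum_mono)
      fix n assume "n \<in> {N..x}"
      then have "ln (real n) \<le> L" unfolding L_def using N1 by simp
      then show "ln (real n) / real n \<le> L * (1 / real n)" by (simp add: divide_right_mono)
    qed
    also have "\<dots> \<le> L * H"
      unfolding sum_distrib_left[symmetric] by (intro mult_left_mono sum_inverse_interval_le N1 L0) simp
    finally show "X \<le> L * H / real M" unfolding X_def by (intro divide_right_mono) auto
  qed
  have e10: "0 \<le> e1" by (simp add: e1_def)
  have V: "0 < V" "V \<le> 1" by (rule VV_pos, rule VV_le1)
  have err10: "0 \<le> err1" unfolding err1_def by (intro mult_nonneg_nonneg g) simp
  have Xe: "e1 * X * UU M z0 \<le> e1 * (L * H * UU M z0 / real M)"
  proof -
    have "X * UU M z0 \<le> L * H / real M * UU M z0" using X U0 by (intro mult_right_mono) auto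
    from mult_left_mono[OF this e10] show ?thesis by (simp add: mult.assoc)
  qed
  define w where "w = e1 * (L * H * UU M z0 / real M)"
  define p0 where "p0 = (\<Sum>n\<in>S0. mangoldt n / real n :: real)"
  define p1 where "p1 = (\<Sum>n\<in>S1. mangoldt n / real n :: real)"
  have "V * (p0 + B0) \<le> V * (X * UU M z0 + (e1 * X * UU M z0 + err1))"
    using C V unfolding ln_sum_S0 p0_def by (intro mult_left_mono) (auto simp: abs_le_iff)
  then have 1: "V * p0 + V * B0 \<le> V * (X * UU M z0) + V * (e1 * X * UU M z0) + V * err1"
    by (simp only: distrib_left add.assoc)
  have "X * (UU M z0 * V) - (e1 * X * (UU M z0 * V) + err1) \<le> p1 + B1"
    using A unfolding ln_sum_S1 p1_def by (auto simp: abs_le_iff)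
  then have 2: "V * (X * UU M z0) - V * (e1 * X * UU M z0) - err1 \<le> p1 + B1"
    by (simp only: mult_ac diff_diff_eq)
  have 3: "B1 - V * B0 \<le> \<bar>B1 - V * B0\<bar>" by simp
  have 4: "V * err1 \<le> err1" using V err10 by (simp add: mult_left_le_one_le)
  have 5: "V * (e1 * X * UU M z0) \<le> V * w"
    using Xe V unfolding w_def by (intro mult_left_mono) auto
  have "2 * e1 * (L * H * UU M z0 / real M) * V = 2 * (V * w)" by (simp add: w_def)
  then show ?thesis unfolding p0_def[symmetric] p1_def[symmetric] using 1 2 3 4 5 by linarith
qed

end

section \<open>Shifted primes with few large prime factors\<close>

text \<open>The cube is the power of \<open>ln x / ln y\<close> lost in the bilinear estimate; the
  exponential gain of the sieve beats it.\<close>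

lemma ex_nat_small:
  assumes "0 < (\<epsilon>::real)"
  obtains b :: nat where "K / 2 ^ b * (16 * real b + 27) ^ 3 \<le> \<epsilon>" "K \<le> 2 ^ b"
proof -
  have "((\<lambda>b. K / 2 ^ b * (16 * real b + 27) ^ 3) \<longlongrightarrow> 0) at_top" by real_asymp
  then have "eventually (\<lambda>b. K / 2 ^ b * (16 * real b + 27) ^ 3 < \<epsilon>) at_top"
    using assms by (rule order_tendstoD)
  moreover have "((\<lambda>b::nat. K / 2 ^ b) \<longlongrightarrow> 0) at_top" by real_asymp
  then have "eventually (\<lambda>b::nat. K / 2 ^ b < 1) at_top" by (rule order_tendstoD) simp
  ultimately have "eventually (\<lambda>b. K / 2 ^ b * (16 * real b + 27) ^ 3 < \<epsilon> \<and> K / 2 ^ b < 1) at_top"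
    by (rule eventually_conj)
  then obtain b where "K / 2 ^ b * (16 * real b + 27) ^ 3 < \<epsilon>" "K / 2 ^ b < 1"
    by (auto simp: eventually_at_top_linorder)
  then show ?thesis using that[of b] by (simp add: field_simps)
qed

text \<open>A lower bound for both sieve products, of order \<open>y powr (-1/8)\<close>; its square
  still beats \<open>1 / y\<close> by a power.\<close>

definition vlow :: "nat \<Rightarrow> real" where
  "vlow y = exp (- ((ln (real y) + 5) / 8))"

lemma vlow_bounds: "1 \<le> y \<Longrightarrow> 0 < vlow y \<and> vlow y \<le> 1"
  by (simp add: vlow_def)

lemma eventually_vlow:
  "eventually (\<lambda>y. A * (1 + ln (real y)) ^ 2 \<le> vlow y ^ 2 * real y) at_top"
proof -
  have "((\<lambda>y. A * (1 + ln (real y)) ^ 2 / (exp (- ((ln (real y) + 5) / 8)) ^ 2 * real y)) \<longlongrightarrow> 0) at_top"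
    by real_asymp
  then have "eventually (\<lambda>y. A * (1 + ln (real y)) ^ 2 / (exp (- ((ln (real y) + 5) / 8)) ^ 2 * real y) < 1) at_top"
    by (rule order_tendstoD) simp
  then show ?thesis using eventually_gt_at_top[of 0]
    by eventually_elim (auto simp: vlow_def field_simps)
qed

lemma tau_tendsto:
  assumes "0 < (c1::real)" "0 < c2" "0 < c3"
  shows "((\<lambda>y::nat. exp (c1 * sqrt (c2 + c3 * ln (real y))) / sqrt (real y)) \<longlongrightarrow> 0) at_top"
  using assms by real_asymp

text \<open>Since \<open>ln w \<ge> 32 * k\<close>, the reciprocals of the sieving primes sum to at
  most \<open>(ln y + 5) / (32 * k)\<close>. Factors 2 from \<open>q - 1\<close> against
  \<open>q\<close> and 2 from \<open>1 - u\<close> against \<open>exp (- 2 * u)\<close> leave the 8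
  of \<open>vlow\<close>.\<close>

lemma sieve_product_ge:
  assumes "exp (32 * real k) \<le> real w" "1 \<le> k" "1 \<le> y"
    and w: "\<And>q. prime q \<Longrightarrow> q \<le> w \<Longrightarrow> q dvd M" and wk: "4 * k + 2 \<le> w"
  shows "vlow y \<le> VV k M y" "vlow y \<le> UU M y"
proof -
  have qs: "prime q \<and> w < q \<and> q \<le> y" if "q \<in> sieve_primes M y" for q
    using that w[of q] by (auto simp: sieve_primes_def) (meson not_le)
  have w1: "1 < real w" using wk by simp
  have lnw: "32 * real k \<le> ln (real w)" using assms(1) w1 by (subst ln_ge_iff) auto
  define S where "S = (\<Sum>q\<in>sieve_primes M y. 1 / real q)"
  have S: "S \<le> (ln (real y) + 5) / ln (real w)"
    unfolding S_def by (rule sum_prime_inverse_rough_le) (use w1 assms(3) qs in auto)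
  have "0 \<le> ln (real y) + 5" using assms(3) by simp
  then have S': "S * (32 * real k) \<le> ln (real y) + 5"
  proof -
    have "S * (32 * real k) \<le> S * ln (real w)" using lnw unfolding S_def by (intro mult_left_mono sum_nonneg) auto
    also have "\<dots> \<le> ln (real y) + 5" using S w1 by (simp add: pos_le_divide_eq)
    finally show ?thesis .
  qed
  have S0: "0 \<le> S" unfolding S_def by (intro sum_nonneg) auto
  have S32: "32 * S \<le> S * (32 * real k)" using S0 assms(2) by (simp add: mult_le_cancel_left1)
  have q: "4 * real k + 3 \<le> real q" if "q \<in> sieve_primes M y" for q
  proof -
    have "4 * k + 3 \<le> q" using qs[OF that] wk by simp
    then have "real (4 * k + 3) \<le> real q" by (rule of_nat_mono)
    then show ?thesis by simp
  qed
  show "vlow y \<le> VV k M y"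
  proof -
    have "(\<Sum>q\<in>sieve_primes M y. real k / (real q - 1)) \<le> (\<Sum>q\<in>sieve_primes M y. 2 * real k * (1 / real q))"
    proof (rule sum_mono)
      fix p assume "p \<in> sieve_primes M y"
      from q[OF this] have "1 / (real p - 1) \<le> 2 / real p" using assms(2) by (simp add: field_simps)
      from mult_left_mono[OF this, of "real k"] show "real k / (real p - 1) \<le> 2 * real k * (1 / real p)" by (simp add: mult.commute)
    qed
    then have kS: "(\<Sum>q\<in>sieve_primes M y. real k / (real q - 1)) \<le> 2 * real k * S" by (simp add: S_def sum_distrib_left)
    have "- ((ln (real y) + 5) / 8) \<le> - 2 * (\<Sum>q\<in>sieve_primes M y. real k / (real q - 1))"
    proof -
      define t where "t = real k * S"
      define W where "W = (\<Sum>q\<in>sieve_primes M y. real k / (real q - 1))"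
      have "32 * t \<le> ln (real y) + 5" using S' by (simp add: t_def mult_ac)
      moreover have "W \<le> 2 * t" using kS by (simp add: t_def W_def)
      ultimately show ?thesis unfolding W_def[symmetric] by (simp add: field_simps)
    qed
    then have "vlow y \<le> exp (- 2 * (\<Sum>q\<in>sieve_primes M y. real k / (real q - 1)))" by (simp add: vlow_def)
    also have "\<dots> \<le> VV k M y"
      unfolding VV_def
    proof (rule prod_one_minus_ge_exp)
      fix p assume "p \<in> sieve_primes M y"
      from q[OF this] show "0 \<le> real k / (real p - 1) \<and> real k / (real p - 1) \<le> 1 / 2" by (auto simp: field_simps)
    qed
    finally show ?thesis .
  qed
  show "vlow y \<le> UU M y"
  proof -
    have "- ((ln (real y) + 5) / 8) \<le> - 2 * S" using S' S32 S0 by simp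
    then have "vlow y \<le> exp (- 2 * S)" by (simp add: vlow_def)
    also have "\<dots> \<le> UU M y"
      unfolding UU_def S_def
    proof (rule prod_one_minus_ge_exp)
      fix p assume "p \<in> sieve_primes M y"
      from q[OF this] show "0 \<le> 1 / real p \<and> 1 / real p \<le> 1 / 2" by (auto simp: field_simps)
    qed
    finally show ?thesis .
  qed
qed

section \<open>Removing square factors and recovering a prime\<close>

context sieve_setup
begin

text \<open>The shift 0 is included to rule out proper prime powers \<open>n\<close>.\<close>

definition "bad n \<longleftrightarrow> (\<exists>i\<in>{0..k}. \<exists>q. y < q \<and> q\<^sup>2 dvd n + i)"

text \<open>Parametrise the bad \<open>n\<close> as \<open>j * q\<^sup>2 - i\<close>. Up to the
  factor \<open>k + 1\<close> the weight \<open>1 / n\<close> is \<open>1 / (j * q\<^sup>2)\<close>,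
  and the sum over \<open>q > y\<close> saves \<open>1 / y\<close>.\<close>

lemma bad_sum_le: "(\<Sum>n | n \<in> S1 \<and> bad n. mangoldt n / real n) \<le> L * ((real k + 1)\<^sup>2 * (1 + L + real k)) / real y"
proof -
  define z where "z = x + k"
  have S1x: "1 \<le> n \<and> n \<le> x" if "n \<in> S1" for n using that N1 by (auto simp: S1_def S0_def)
  have kz: "ln (real z) \<le> L + real k"
  proof -
    have "real z \<le> real x * (1 + real k)" using x1 mult_left_mono[of 1 "real x" "real k"] by (simp add: z_def algebra_simps)
    then have "ln (real z) \<le> ln (real x * (1 + real k))" using x1 by (subst ln_le_cancel_iff) (auto simp: z_def)
    also have "\<dots> = L + ln (1 + real k)" using x1 by (simp add: L_def ln_mult_pos)
    also have "ln (1 + real k) \<le> real k" by (rule ln_add_one_self_le_self) simp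
    finally show ?thesis by simp
  qed
  have sub: "{n. n \<in> S1 \<and> bad n} \<subseteq> (\<lambda>(i, q, j). j * q\<^sup>2 - i) ` ({0..k} \<times> {Suc y..y + z} \<times> {1..z})"
  proof
    fix n assume "n \<in> {n. n \<in> S1 \<and> bad n}"
    then obtain i q where n: "n \<in> S1" "i \<in> {0..k}" "y < q" "q\<^sup>2 dvd n + i" by (auto simp: bad_def)
    obtain j where j: "n + i = q\<^sup>2 * j" using n(4) by auto
    have "1 \<le> n + i" "n + i \<le> z" using S1x[OF n(1)] n(2) by (auto simp: z_def)
    then have "1 \<le> j" "q \<le> n + i" "j \<le> n + i" using j n(3)
      by (auto simp: power2_eq_square Suc_le_eq intro!: Nat.gr0I)
    moreover have "q \<le> z" "j \<le> z" using calculation \<open>n + i \<le> z\<close> by simp_all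
    ultimately show "n \<in> (\<lambda>(i, q, j). j * q\<^sup>2 - i) ` ({0..k} \<times> {Suc y..y + z} \<times> {1..z})"
      using n j by (intro image_eqI[of _ _ "(i, q, j)"]) (auto simp: mult.commute)
  qed
  \<comment> \<open>Cutting \<open>f\<close> off outside \<open>S1\<close> makes parameters harmless
    for which the natural number difference \<open>j * q\<^sup>2 - i\<close> is 0 or
    irrelevant.\<close>
  define f where "f n = (if n \<in> S1 then 1 / real n else 0)" for n
  have "(\<Sum>n | n \<in> S1 \<and> bad n. mangoldt n / real n) \<le> (\<Sum>n | n \<in> S1 \<and> bad n. L * f n)"
  proof (rule sum_mono)
    fix n assume n: "n \<in> {n. n \<in> S1 \<and> bad n}"
    then have "mangoldt n \<le> ln (real n)" using S1x[of n] by (intro mangoldt_le) auto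
    also have "\<dots> \<le> L" unfolding L_def using S1x[of n] n by simp
    finally show "mangoldt n / real n \<le> L * f n" using n by (simp add: f_def divide_right_mono)
  qed
  also have "\<dots> = L * (\<Sum>n | n \<in> S1 \<and> bad n. f n)" by (simp add: sum_distrib_left)
  finally have 1: "(\<Sum>n | n \<in> S1 \<and> bad n. mangoldt n / real n) \<le> L * (\<Sum>n | n \<in> S1 \<and> bad n. f n)" .
  have "(\<Sum>n | n \<in> S1 \<and> bad n. f n) \<le> (\<Sum>n\<in>(\<lambda>(i, q, j). j * q\<^sup>2 - i) ` ({0..k} \<times> {Suc y..y + z} \<times> {1..z}). f n)"
    by (rule sum_mono2[OF _ sub]) (auto simp: f_def)
  also have "\<dots> \<le> sum (f \<circ> (\<lambda>(i, q, j). j * q\<^sup>2 - i)) ({0..k} \<times> {Suc y..y + z} \<times> {1..z})"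
    by (rule sum_image_le) (auto simp: f_def)
  also have "\<dots> \<le> (\<Sum>(i, q, j)\<in>{0..k} \<times> {Suc y..y + z} \<times> {1..z}. (real k + 1) * (1 / real q ^ 2 * (1 / real j)))"
  proof (rule sum_mono)
    fix p assume "p \<in> {0..k} \<times> {Suc y..y + z} \<times> {1..z}"
    then obtain i q j where p: "p = (i, q, j)" "i \<le> k" "y < q" "1 \<le> j" by auto
    have "f (j * q\<^sup>2 - i) \<le> (real k + 1) / real (j * q\<^sup>2)"
    proof (cases "j * q\<^sup>2 - i \<in> S1")
      case True
      define n where "n = j * q\<^sup>2 - i"
      have n: "1 \<le> n" using S1x[OF True] by (simp add: n_def)
      then have nj: "j * q\<^sup>2 = n + i" by (simp add: n_def)
      have "n + i \<le> (k + 1) * n" using n p(2) by (cases n) auto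
      then have "real (n + i) \<le> (real k + 1) * real n" by (metis of_nat_1 of_nat_add of_nat_le_iff of_nat_mult)
      then show ?thesis using n True unfolding f_def n_def[symmetric] nj by (simp add: field_simps)
    qed (auto simp: f_def)
    then show "(f \<circ> (\<lambda>(i, q, j). j * q\<^sup>2 - i)) p \<le> (case p of (i, q, j) \<Rightarrow> (real k + 1) * (1 / real q ^ 2 * (1 / real j)))"
      using p(1) by (simp add: mult.commute)
  qed
  also have "\<dots> = (\<Sum>i\<in>{0..k}. \<Sum>q\<in>{Suc y..y + z}. \<Sum>j\<in>{1..z}. (real k + 1) * (1 / real q ^ 2 * (1 / real j)))"
    by (simp only: sum.cartesian_product)
  also have "\<dots> = (real k + 1) * ((real k + 1) * ((\<Sum>q\<in>{Suc y..y + z}. 1 / real q ^ 2) * (\<Sum>j\<in>{1..z}. 1 / real j)))"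
    by (simp only: sum_product) (simp add: sum_distrib_left add.commute)
  also have "\<dots> \<le> (real k + 1) * ((real k + 1) * (1 / real y * (1 + ln (real z))))"
  proof (intro mult_left_mono mult_mono)
    show "(\<Sum>q\<in>{Suc y..y + z}. 1 / real q ^ 2) \<le> 1 / real y" by (rule sum_inverse_squares_le) (use y3 in auto)
    show "(\<Sum>j\<in>{1..z}. 1 / real j) \<le> 1 + ln (real z)" by (rule sum_inverse_le) (use x1 in \<open>simp add: z_def\<close>)
  qed (auto intro: sum_nonneg)
  also have "\<dots> \<le> (real k + 1) * ((real k + 1) * (1 / real y * (1 + (L + real k))))"
    using kz by (intro mult_left_mono add_left_mono) auto
  finally have 2: "(\<Sum>n | n \<in> S1 \<and> bad n. f n) \<le> (real k + 1) * ((real k + 1) * (1 / real y * (1 + (L + real k))))" .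
  have "L * (\<Sum>n | n \<in> S1 \<and> bad n. f n) \<le> L * ((real k + 1) * ((real k + 1) * (1 / real y * (1 + (L + real k)))))"
    using 2 L0 by (rule mult_left_mono)
  also have "\<dots> = L * ((real k + 1)\<^sup>2 * (1 + L + real k)) / real y"
    by (simp add: power2_eq_square add.assoc)
  finally show ?thesis using 1 by linarith
qed

text \<open>The bad part is too small to account for the whole sum, so some \<open>n\<close> that is
  not bad has \<open>mangoldt n\<close> nonzero. It is a power of a prime exceeding
  \<open>z0\<close>, hence \<open>y\<close>, and the shift 0 forces the exponent 1.\<close>

lemma good_prime_exists:
  assumes "L * ((real k + 1)\<^sup>2 * (1 + L + real k)) / real y < (\<Sum>n\<in>S1. mangoldt n / real n)"
  obtains p where "prime p" "[p = a] (mod M)" "p \<le> x" "sifted k M y p"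
    "\<And>i q. i \<in> {1..k} \<Longrightarrow> y < q \<Longrightarrow> \<not> q\<^sup>2 dvd p + i"
proof -
  have "\<exists>n\<in>S1. \<not> bad n \<and> mangoldt n \<noteq> (0::real)"
  proof (rule ccontr)
    assume "\<not> ?thesis"
    then have "(\<Sum>n\<in>S1. mangoldt n / real n :: real) = (\<Sum>n | n \<in> S1 \<and> bad n. mangoldt n / real n)"
      by (intro sum.mono_neutral_right) auto
    then show False using bad_sum_le assms by simp
  qed
  then obtain n where n: "n \<in> S1" "\<not> bad n" "mangoldt n \<noteq> (0::real)" by auto
  then have "primepow n" by (auto simp: mangoldt_def split: if_splits)
  then obtain p j where pj: "prime p" "0 < j" "n = p ^ j" by (auto simp: primepow_def)
  have nS0: "n \<in> S0" using n by (simp add: S1_def)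
  have pn: "p dvd n" using pj by simp
  have "\<not> p dvd M" using S0_coprime[OF nS0] pn pj(1) by (metis coprime_common_divisor not_prime_unit)
  moreover have "p \<notin> sieve_primes M z0" using nS0 pn by (auto simp: S0_def rough_def)
  ultimately have "z0 < p" using pj(1) by (auto simp: sieve_primes_def)
  then have yp: "y < p" using z0_ge by simp
  have "j = 1"
  proof (rule ccontr)
    assume "j \<noteq> 1"
    then have "p\<^sup>2 dvd n + 0" using pj by (auto intro: le_imp_power_dvd)
    then show False using n(2) yp unfolding bad_def by force
  qed
  then have np: "n = p" using pj by simp
  show ?thesis
  proof (rule that[of p])
    show "\<not> q\<^sup>2 dvd p + i" if "i \<in> {1..k}" "y < q" for i q
      using n(2) that unfolding bad_def np by force
  qed (use pj n np in \<open>auto simp: S1_def S0_def\<close>)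
qed

text \<open>Dirichlet--Mertens at \<open>x\<close> and at \<open>N - 1\<close> gives the full sum
  over the class. Prime powers missing from \<open>S0\<close> are powers of primes up to
  \<open>z0\<close>; there are at most \<open>z0 * J\<close> of them, each of weight at most
  \<open>L / N\<close>.\<close>

lemma prime_sum_S0_ge:
  assumes C: "\<And>N. 1 \<le> N \<Longrightarrow>
      \<bar>(\<Sum>n | n \<in> {1..N} \<and> [n = a] (mod M). mangoldt n / real n) - ln (real N) / real (totient M)\<bar> \<le> C"
    and N2: "2 \<le> N" "N \<le> x" and J: "x < 2 ^ J"
  shows "(\<Sum>n\<in>S0. mangoldt n / real n) \<ge> (L - ln (real N)) / real (totient M) - 2 * C - real (z0 * J) * L / real N"
proof -
  have L0': "0 \<le> mangoldt d' / real d'" for d' by (simp add: mangoldt_nonneg)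
  define A where "A = {n. n \<in> {N..x} \<and> [n = a] (mod M)}"
  define D where "D = {n \<in> A. primepow n \<and> n \<notin> S0}"
  have finA: "finite A" by (simp add: A_def)
  have S0A: "S0 \<subseteq> A" by (auto simp: S0_def A_def)
  have "(\<Sum>n | n \<in> {1..x} \<and> [n = a] (mod M). mangoldt n / real n)
     = (\<Sum>n | n \<in> {1..N - 1} \<and> [n = a] (mod M). mangoldt n / real n) + (\<Sum>n\<in>A. mangoldt n / real n)"
    unfolding A_def using N2 by (subst sum.union_disjoint[symmetric]) (auto intro!: sum.cong)
  moreover have "\<bar>(\<Sum>n | n \<in> {1..x} \<and> [n = a] (mod M). mangoldt n / real n) - L / real (totient M)\<bar> \<le> C"
    unfolding L_def by (rule C[OF x1])
  moreover have "\<bar>(\<Sum>n | n \<in> {1..N - 1} \<and> [n = a] (mod M). mangoldt n / real n) - ln (real (N - 1)) / real (totient M)\<bar> \<le> C"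
    by (rule C) (use N2 in auto)
  moreover have "ln (real (N - 1)) / real (totient M) \<le> ln (real N) / real (totient M)"
    using N2 by (intro divide_right_mono) auto
  ultimately have 1: "(L - ln (real N)) / real (totient M) - 2 * C \<le> (\<Sum>n\<in>A. mangoldt n / real n)"
    unfolding diff_divide_distrib by linarith
  have "(\<Sum>n\<in>A. mangoldt n / real n :: real) = (\<Sum>n\<in>S0 \<union> D. mangoldt n / real n)"
    by (rule sum.mono_neutral_right) (use finA S0A in \<open>auto simp: D_def mangoldt_def\<close>)
  also have "\<dots> = (\<Sum>n\<in>S0. mangoldt n / real n) + (\<Sum>n\<in>D. mangoldt n / real n)"
    by (rule sum.union_disjoint) (use finA in \<open>auto simp: D_def\<close>)
  also have "(\<Sum>n\<in>D. mangoldt n / real n) \<le> (\<Sum>n\<in>D. L / real N)"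
  proof (rule sum_mono)
    fix n assume "n \<in> D"
    then have n: "N \<le> n" "n \<le> x" by (auto simp: D_def A_def)
    have "mangoldt n \<le> ln (real n)" using n N2 by (intro mangoldt_le) auto
    also have "\<dots> \<le> L" unfolding L_def using n N2 by simp
    finally show "mangoldt n / real n \<le> L / real N" using n N2 L0 by (intro frac_le) auto
  qed
  also have "\<dots> = real (card D) * (L / real N)" by simp
  also have "\<dots> \<le> real (z0 * J) * (L / real N)"
  proof (intro mult_right_mono of_nat_mono)
    have "D \<subseteq> (\<lambda>(q, j). q ^ j) ` ({1..z0} \<times> {0..<J})"
    proof
      fix n assume n: "n \<in> D"
      then obtain q j where qj: "prime q" "0 < j" "n = q ^ j" by (auto simp: D_def primepow_def)
      have nx: "n \<le> x" "[n = a] (mod M)" "\<not> rough M z0 n" using n by (auto simp: D_def A_def S0_def)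
      have "q \<le> z0"
      proof -
        obtain r where r: "r \<in> sieve_primes M z0" "r dvd n" using nx(3) by (auto simp: rough_def)
        then have "r dvd q" using qj sieve_primesD(1) prime_dvd_power by blast
        then have "r = q" using primes_dvd_imp_eq[OF sieve_primesD(1)[OF r(1)] qj(1)] by simp
        then show ?thesis using sieve_primesD(2)[OF r(1)] by simp
      qed
      moreover have "j < J"
      proof -
        have "(2::nat) ^ j \<le> q ^ j" using prime_ge_2_nat[OF qj(1)] by (intro power_mono) auto
        also have "\<dots> \<le> x" using qj nx(1) by simp
        finally have "(2::nat) ^ j < 2 ^ J" using J by (rule le_less_trans)
        then show ?thesis by simp
      qed
      ultimately show "n \<in> (\<lambda>(q, j). q ^ j) ` ({1..z0} \<times> {0..<J})"
        using qj prime_ge_1_nat[OF qj(1)] by (intro image_eqI[of _ _ "(q, j)"]) auto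
    qed
    then have "card D \<le> card ((\<lambda>(q, j). q ^ j) ` ({1..z0} \<times> {0..<J}))" by (intro card_mono) auto
    also have "\<dots> \<le> card ({1..z0} \<times> {0..<J})" by (rule card_image_le) simp
    finally show "card D \<le> z0 * J" by simp
  qed (use L0 in auto)
  finally show ?thesis using 1 by simp
qed

end

section \<open>Uniformity in the modulus and choice of the parameters\<close>

definition almost_prime_shifts :: "nat \<Rightarrow> nat \<Rightarrow> nat \<Rightarrow> bool" where
  "almost_prime_shifts k w R \<longleftrightarrow> (\<forall>M a. 0 < M \<and> (\<forall>q. prime q \<and> q \<le> w \<longrightarrow> q dvd M) \<and> coprime a M \<longrightarrow>
    (\<exists>p. prime p \<and> [p = a] (mod M) \<and> (\<forall>i\<in>{1..k}. card {q \<in> prime_factors (p + i). \<not> q dvd M} \<le> R \<and>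
      (\<forall>q. prime q \<and> \<not> q dvd M \<longrightarrow> \<not> q\<^sup>2 dvd p + i))))"

text \<open>The scales are \<open>y ^ s\<close> for \<open>r0\<close>,
  \<open>z = y ^ (2 * s)\<close>, \<open>N = z ^ t\<close> and \<open>x = N\<^sup>2\<close>, with
  \<open>s\<close> and \<open>t\<close> linear in \<open>b\<close> and \<open>b1\<close>. The
  choices follow the order \<open>b1\<close>, \<open>b\<close>, \<open>w\<close>, and finally
  \<open>y\<close>, large in terms of \<open>M\<close>.\<close>

theorem ex_almost_prime_shifts:
  fixes k :: nat
  assumes k1: "1 \<le> k"
  shows "\<exists>w R. almost_prime_shifts k w R"
proof -
  define K where "K = 2 * exp (60 * real (2 * k + 1))"
  have K0: "0 < K" by (simp add: K_def)
  \<comment> \<open>The sieve up to \<open>z\<close> will contribute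
    \<open>8 * (e1 * t) * D\<close>, which the value 1/128 turns into \<open>D / 16\<close>.\<close>
  obtain b1 where b1: "K / 2 ^ b1 * (16 * real b1 + 27) ^ 3 \<le> 1 / 128" "K \<le> 2 ^ b1"
    by (rule ex_nat_small[of "1 / 128"]) auto
  define t where "t = 16 * b1 + 27"
  have t: "real t = 16 * real b1 + 27" "1 \<le> real t" by (simp_all add: t_def)
  \<comment> \<open>9216 is 9 * 16 * 64, the constant in the dispersion bound; 512 is 2 * 256, since
    two parts of that bound must together stay below \<open>(D / 16)\<^sup>2\<close>. Below,
    \<open>\<eta> * st\<close> is kept under \<open>c\<close> by giving a third of it to each of the
    three parts of \<eta>; hence the 12 and the 6.\<close>
  define c where "c = 1 / (512 * 9216 :: real)"
  have c0: "0 < c" by (simp add: c_def)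
  obtain b where bK: "K / 2 ^ b * (16 * real b + 27) ^ 3 \<le> c / (12 * real t ^ 3)" "K \<le> 2 ^ b"
    by (rule ex_nat_small[of "c / (12 * real t ^ 3)"]) (use c0 t in auto)
  define s where "s = 16 * b + 27"
  have s: "real s = 16 * real b + 27" "1 \<le> real s" by (simp_all add: s_def)
  define st where "st = real s ^ 3 * real t ^ 3"
  have st0: "0 < st" unfolding st_def using s t by simp
  have "((\<lambda>w::nat. exp (8 * real k ^ 3 / real w) - 1) \<longlongrightarrow> 0) at_top" by real_asymp
  then have "eventually (\<lambda>w::nat. exp (8 * real k ^ 3 / real w) - 1 < c / (6 * st)) at_top"
    by (rule order_tendstoD) (use c0 st0 in simp)
  moreover have "eventually (\<lambda>w::nat. exp (32 * real k) \<le> real w) at_top"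
    using filterlim_real_sequentially by (simp add: filterlim_at_top)
  ultimately have "eventually (\<lambda>w::nat. exp (8 * real k ^ 3 / real w) - 1 < c / (6 * st) \<and> exp (32 * real k) \<le> real w \<and> 4 * k + 2 \<le> w) at_top"
    using eventually_ge_at_top[of "4 * k + 2"] by eventually_elim simp
  then obtain w where wB: "exp (8 * real k ^ 3 / real w) - 1 < c / (6 * st)" "exp (32 * real k) \<le> real w" "4 * k + 2 \<le> w"
    by (auto simp: eventually_at_top_linorder)
  \<comment> \<open>Relevant prime factors exceed \<open>y\<close>, and \<open>p + i\<close> is at
    most \<open>x * y\<close>, which is \<open>y ^ (4 * s * t + 1)\<close>.\<close>
  define R where R_eq: "R = 4 * s * t + 1"
  have "almost_prime_shifts k w R"
    unfolding almost_prime_shifts_def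
  proof (intro allI impI, elim conjE)
    fix M a :: nat
    assume M: "0 < M" and "\<forall>q. prime q \<and> q \<le> w \<longrightarrow> q dvd M" and cop: "coprime a M"
    then have wM: "q dvd M" if "prime q" "q \<le> w" for q using that by blast
    define \<phi> where "\<phi> = real (totient M)"
    have \<phi>1: "1 \<le> \<phi>" "\<phi> \<le> real M" using M by (simp_all add: \<phi>_def Suc_le_eq totient_le)
    obtain C where C: "\<And>N. 1 \<le> N \<Longrightarrow>
      \<bar>(\<Sum>n | n \<in> {1..N} \<and> [n = a] (mod M). mangoldt n / real n) - ln (real N) / real (totient M)\<bar> \<le> C"
      using dirichlet_mertens[OF M cop] by blast
    \<comment> \<open>The sum of all constants \<open>B\<close> for which
      \<open>B * (1 + ln y)\<^sup>2 \<le> (vlow y)\<^sup>2 * y\<close> will be used, so that one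
      condition on \<open>y\<close> serves them all.\<close>
    define A where "A = real M + 512 * 12 * (24 + 2 * real k ^ 2) * \<phi> ^ 2 * (4 * real s * real t) ^ 2 + 32 * \<phi>
       + (4 * real s * real t) ^ 2 + 8 * \<phi> * (real k + 1)\<^sup>2 * (1 + real k + 4 * real s * real t)"
    \<comment> \<open>These express \<open>\<tau>\<close> through \<open>ln y\<close> alone:
      \<open>n0\<close> equals \<open>c2 + c3 * ln y\<close> because \<open>ln x\<close> is
      \<open>4 * s * t * ln y\<close>.\<close>
    define c1 where "c1 = 8 * real k"
    define c2 where "c2 = real k ^ 2 * (log 2 (real k) + 1)"
    define c3 where "c3 = real k ^ 2 * (4 * real s * real t / ln 2)"
    have "0 < c1" "0 < c3" using k1 s t by (auto simp: c1_def c3_def)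
    moreover have "0 < c2"
    proof -
      have "0 \<le> log 2 (real k)" using k1 by simp
      then have "0 < log 2 (real k) + 1" by linarith
      then show ?thesis using k1 unfolding c2_def by (intro mult_pos_pos) auto
    qed
    ultimately have "((\<lambda>y::nat. exp (c1 * sqrt (c2 + c3 * ln (real y))) / sqrt (real y)) \<longlongrightarrow> 0) at_top"
      by (intro tau_tendsto)
    then have "eventually (\<lambda>y::nat. exp (c1 * sqrt (c2 + c3 * ln (real y))) / sqrt (real y) < c / (6 * st)) at_top"
      by (rule order_tendstoD) (use c0 st0 in simp)
    moreover have "eventually (\<lambda>y::nat. (2 * C + 1) * 16 * \<phi> \<le> ln (real y)) at_top"
      using filterlim_compose[OF ln_at_top filterlim_real_sequentially] by (simp add: filterlim_at_top)
    ultimately have "eventually (\<lambda>y::nat. exp (c1 * sqrt (c2 + c3 * ln (real y))) / sqrt (real y) < c / (6 * st) \<and>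
       (2 * C + 1) * 16 * \<phi> \<le> ln (real y) \<and> A * (1 + ln (real y)) ^ 2 \<le> vlow y ^ 2 * real y \<and> 3 \<le> y \<and> k \<le> y) at_top"
      using eventually_vlow[of A] eventually_ge_at_top[of 3] eventually_ge_at_top[of k] by eventually_elim simp
    then obtain y where y: "exp (c1 * sqrt (c2 + c3 * ln (real y))) / sqrt (real y) < c / (6 * st)"
       "(2 * C + 1) * 16 * \<phi> \<le> ln (real y)" "A * (1 + ln (real y)) ^ 2 \<le> vlow y ^ 2 * real y" "3 \<le> y" "k \<le> y"
      by (auto simp: eventually_at_top_linorder)
    define ly where "ly = ln (real y)"
    define v where "v = vlow y"
    have ly1: "1 \<le> ly"
    proof -
      have "exp 1 \<le> real y" using exp_le y(4) by linarith
      then show ?thesis using y(4) unfolding ly_def by (subst ln_ge_iff) auto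
    qed
    have v01: "0 < v" "v \<le> 1" using vlow_bounds[of y] y(4) by (auto simp: v_def)
    have y0: "0 < real y" "1 \<le> real y" using y(4) by auto
    have Ay: "B * (1 + ly) ^ 2 \<le> v ^ 2 * real y" if "B \<le> A" for B
      using mult_right_mono[OF that, of "(1 + ly) ^ 2"] y(3) by (simp add: v_def ly_def)
    have v2y: "v ^ 2 * real y \<le> v * real y" using v01 y0 by (simp add: power2_eq_square mult_left_le_one_le)
    have Apos: "0 \<le> 512 * 12 * (24 + 2 * real k ^ 2) * \<phi> ^ 2 * (4 * real s * real t) ^ 2" "0 \<le> 32 * \<phi>" "0 \<le> real M"
      "0 \<le> (4 * real s * real t) ^ 2" "0 \<le> 8 * \<phi> * (real k + 1)\<^sup>2 * (1 + real k + 4 * real s * real t)"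
      using \<phi>1 by auto
    have ge1: "1 \<le> (1 + ly) ^ 2" "ly \<le> (1 + ly) ^ 2" "ly ^ 2 \<le> (1 + ly) ^ 2" "1 + ly \<le> (1 + ly) ^ 2"
      using ly1 by (auto simp: power2_eq_square algebra_simps intro: order_trans[of _ "ly * ly"])
    define z where "z = (y ^ s)\<^sup>2"
    \<comment> \<open>A square root of \<open>x\<close>: half of \<open>ln x\<close> survives in the
      Dirichlet--Mertens difference.\<close>
    define N where "N = z ^ t"
    define x where "x = N\<^sup>2"
    have xy: "x = y ^ (4 * s * t)" by (simp add: x_def N_def z_def power_mult[symmetric] mult_ac)
    have VU: "v \<le> VV k M y" "v \<le> UU M y"
      unfolding v_def using sieve_product_ge[OF wB(2) k1 _ wM wB(3), of y] y(4) by auto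
    have sz: "real y ^ (16 * b + 25) * real M \<le> UU M y * real (y ^ s)"
    proof -
      have "real M \<le> real M * (1 + ly) ^ 2" using ge1(1) by (simp add: mult_le_cancel_left1)
      also have "\<dots> \<le> v ^ 2 * real y" by (rule Ay) (use Apos in \<open>simp add: A_def\<close>)
      also have "\<dots> \<le> v * real y" by (rule v2y)
      also have "\<dots> \<le> UU M y * (real y)\<^sup>2" using VU(2) v01 y0 by (intro mult_mono) (auto simp: power2_eq_square)
      finally have "real y ^ (16 * b + 25) * real M \<le> real y ^ (16 * b + 25) * (UU M y * (real y)\<^sup>2)"
        using y0 by (intro mult_left_mono) auto
      also have "\<dots> = UU M y * real (y ^ s)"
      proof -
        have s_eq: "s = (16 * b + 25) + 2" by (simp add: s_def)
        have "real (y ^ s) = real y ^ (16 * b + 25) * (real y)\<^sup>2"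
          unfolding s_eq by (simp add: power_add)
        then show ?thesis by simp
      qed
      finally show ?thesis .
    qed
    have ys1: "y \<le> y ^ s" using y(4) by (intro self_le_power) (auto simp: s_def)
    have zy: "y ^ s \<le> z" "y \<le> z" unfolding z_def using y(4) ys1 by (auto simp: power2_eq_square intro: order_trans[OF ys1])
    have Nz: "z \<le> N" unfolding N_def using zy y(4) by (intro self_le_power) (auto simp: t_def)
    have xN: "N \<le> x" unfolding x_def by (auto simp: power2_eq_square)
    interpret sieve_setup k M a y "y ^ s" N x b w
    proof
      show "1 \<le> k" "0 < M" "coprime a M" "3 \<le> y" "4 * k + 2 \<le> w" using k1 M cop y(4) wB(3) by auto
      show "q dvd M" if "prime q" "q \<le> w" for q using wM that by blast
      show "y \<le> (y ^ s)\<^sup>2" using zy(2) by (simp add: z_def)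
      show "2 * exp (60 * real (2 * k + 1)) \<le> 2 ^ b" using bK(2) by (simp add: K_def)
      show "1 \<le> N" "1 \<le> x" using Nz zy xN y(4) by auto
      show "real y ^ (16 * b + 25) * real M \<le> UU M y * real (y ^ s)" by (rule sz)
    qed
    have z0: "z0 = z" by (simp add: z0_def z_def)
    have Lly: "L = 4 * real s * real t * ly" unfolding L_def unfolding xy ly_def using y0 by (simp add: ln_realpow)
    have lnz: "ln (real z) = 2 * real s * ly" unfolding z_def ly_def using y0 by (simp add: ln_realpow)
    have lnN: "ln (real N) = L / 2" unfolding N_def using lnz Lly zy y(4) by (simp add: ln_realpow)
    have st1: "1 \<le> real s * real t" using s t mult_mono[of 1 "real s" 1 "real t"] by simp
    have L4: "4 \<le> L" "ly \<le> L"
      using Lly st1 ly1 mult_mono[of 1 "real s * real t" 1 ly] mult_right_mono[of 1 "4 * (real s * real t)" ly] by (auto simp: mult.assoc)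
    have H2: "H \<le> 2 * L" "L + 4 \<le> 2 * L" using L4 by (auto simp: H_def L_def)
    have V0: "0 < V" "V \<le> 1" by (rule VV_pos, rule VV_le1)
    have U0: "0 < U" "U \<le> 1" by (rule UU_pos, rule UU_le1)
    define u where "u = U / real M"
    have u: "0 < u" "u \<le> 1 / (\<phi> * ly)"
    proof -
      show "0 < u" using U0 M by (simp add: u_def)
      have "U / real M \<le> 1 / (real (totient M) * ln (real y))"
        using prod_primes_not_dvd_le[of y M] y(4) M by (simp add: UU_def sieve_primes_def)
      then show "u \<le> 1 / (\<phi> * ly)" by (simp add: u_def \<phi>_def ly_def)
    qed
    \<comment> \<open>Twice the expected main term. Four errors of \<open>D / 16\<close> each will
      be subtracted from \<open>D / 2\<close>, leaving \<open>D / 4\<close>.\<close>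
    define D where "D = V * L / \<phi>"
    have D0: "0 < D" unfolding D_def using V0 L4 \<phi>1 by (intro divide_pos_pos mult_pos_pos) auto
    have e_eq: "e = K / 2 ^ b" by (simp add: e_def K_def)
    have eta: "\<eta> * st \<le> c"
    proof -
      have "4 * e * st = 12 * real t ^ 3 * (K / 2 ^ b * (16 * real b + 27) ^ 3) / 3"
        by (simp add: e_eq st_def s(1))
      also have "\<dots> \<le> 12 * real t ^ 3 * (c / (12 * real t ^ 3)) / 3"
        by (intro divide_right_mono mult_left_mono bK(1)) auto
      also have "\<dots> = c / 3" using t(2) by simp
      finally have 1: "4 * e * st \<le> c / 3" .
      have tau: "\<tau> \<le> exp (c1 * sqrt (c2 + c3 * ly)) / sqrt (real y)"
      proof -
        have "log 2 (real k * real x) = log 2 (real k) + log 2 (real x)"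
          using k1 x1 by (subst log_mult_pos) auto
        also have "log 2 (real x) = 4 * real s * real t * ly / ln 2" using Lly by (simp add: log_def L_def)
        finally have "n0 = c2 + c3 * ly" unfolding n0_def c2_def c3_def by (simp add: algebra_simps)
        moreover have "sqrt (real y) \<le> sqrt (real (y ^ s))" using ys1 by (simp only: real_sqrt_le_iff of_nat_le_iff)
        ultimately show ?thesis unfolding \<tau>_def c1_def using y0 by (intro frac_le) auto
      qed
      then have "\<tau> \<le> c / (6 * st)" using y(1) by (simp add: ly_def)
      then have 2: "2 * \<tau> * st \<le> c / 3" using st0 by (simp add: field_simps)
      have 3: "2 * (exp (8 * real k ^ 3 / real w) - 1) * st \<le> c / 3"
        using mult_right_mono[OF less_imp_le[OF wB(1)], of "2 * st"] st0 by (simp add: mult_ac)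
      have "\<eta> * st = 2 * (exp (8 * real k ^ 3 / real w) - 1) * st + 2 * \<tau> * st + 4 * e * st"
        by (simp add: \<eta>_def algebra_simps)
      then show ?thesis using 1 2 3 by linarith
    qed
    have rho: "\<rho> \<le> (24 + 2 * real k ^ 2) * L ^ 2 / real y"
    proof -
      have Hp: "0 \<le> H" "0 \<le> L" using H1 L0 by auto
      have ez: "err / real z0 \<le> 1 / real y"
      proof -
        have "err * real y \<le> real (y ^ s) * real y"
          unfolding err_def using y0 by (simp add: s_def power_increasing)
        also have "\<dots> \<le> real (y ^ s) * real (y ^ s)" using ys1 by (intro mult_left_mono of_nat_mono) auto
        also have "\<dots> = real z0" by (simp add: z0 z_def power2_eq_square)
        finally show ?thesis using y0 r0pos by (simp add: field_simps z0 z_def)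
      qed
      have T0: "T0 \<le> 6 * L ^ 2"
      proof -
        have "U / real M \<le> 1" using U0 M by (simp add: divide_le_eq_1)
        then have "T0 \<le> L * (3 * H * 1)"
          unfolding T0_def times_divide_eq_right[symmetric] using Hp by (intro mult_left_mono) auto
        also have "\<dots> \<le> L * (3 * (2 * L))" using H2(1) Hp by (intro mult_left_mono) auto
        finally show ?thesis by (simp add: power2_eq_square)
      qed
      have "4 * err / real z0 * T0 \<le> 4 * (1 / real y) * (6 * L ^ 2)"
        using ez T0 T0_nonneg y0 by (intro mult_mono) auto
      moreover have "H * (real k ^ 2 * (L / real z0)) \<le> (2 * L) * (real k ^ 2 * (L / real y))"
        using H2(1) Hp zy y0 by (intro mult_mono mult_left_mono divide_left_mono) (auto simp: z0)
      ultimately show ?thesis unfolding \<rho>_def by (simp add: algebra_simps power2_eq_square add_divide_distrib)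
    qed
    have disp: "\<bar>B1 - V * B0\<bar> \<le> D / 16"
    proof (rule power2_le_imp_le)
      have Hp: "0 \<le> H" "0 \<le> L" using H1 L0 by auto
      \<comment> \<open>With \<open>H\<close> and \<open>L + 4\<close> at most \<open>2 * L\<close>
        and \<open>U / M\<close> at most \<open>1 / (\<phi> * ly)\<close>, the bound exceeds the
        square of the main term by \<open>(L / ly) ^ 3\<close>, that is \<open>64 * st\<close>; the
        smallness of \<eta> was arranged to absorb it.\<close>
      have first: "(3 * H * U * real (totient M) / real M) * ((L + 4) * (h * T0 * \<eta>)) \<le> D ^ 2 / 512"
      proof -
        have "(3 * H * U * real (totient M) / real M) * ((L + 4) * (h * T0 * \<eta>)) = 9 * (H ^ 3 * L * (L + 4) * (\<phi> * u ^ 3)) * (V ^ 2 * \<eta>)"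
          by (simp add: h_def T0_def u_def \<phi>_def power3_eq_cube power2_eq_square mult_ac)
        also have "\<dots> \<le> 9 * ((2 * L) ^ 3 * L * (2 * L) * (\<phi> * (1 / (\<phi> * ly)) ^ 3)) * (V ^ 2 * \<eta>)"
          using H2 Hp u \<phi>1 \<eta>_nonneg ly1
          by (intro mult_right_mono mult_left_mono mult_mono power_mono) auto
        also have "\<dots> = 144 * (L ^ 5 / ly ^ 3) * (V ^ 2 * \<eta>) / \<phi> ^ 2"
          using \<phi>1 by (simp add: field_simps power2_eq_square power3_eq_cube numeral_eq_Suc)
        also have "L ^ 5 / ly ^ 3 = 64 * st * L ^ 2"
        proof -
          have "L ^ 5 = L ^ 2 * (4 * real s * real t * ly) ^ 3" by (simp add: Lly[symmetric] power_add[symmetric])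
          then show ?thesis using ly1 by (simp add: st_def power_mult_distrib)
        qed
        also have "144 * (64 * st * L ^ 2) * (V ^ 2 * \<eta>) / \<phi> ^ 2 = 9216 * (\<eta> * st) * D ^ 2"
          by (simp add: D_def power_divide power_mult_distrib)
        also have "\<dots> \<le> 9216 * c * D ^ 2" using eta by (intro mult_right_mono mult_left_mono) auto
        also have "\<dots> = D ^ 2 / 512" by (simp add: c_def)
        finally show ?thesis .
      qed
      have second: "(3 * H * U * real (totient M) / real M) * ((L + 4) * \<rho>) \<le> D ^ 2 / 512"
      proof -
        have "U * (real (totient M) / real M) \<le> 1 * 1"
          using U0 \<phi>1 M by (intro mult_mono) (auto simp: \<phi>_def)
        then have "3 * H * (U * (real (totient M) / real M)) \<le> 3 * (2 * L) * 1"
          using H2(1) Hp U0 by (intro mult_mono) auto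
        then have a: "3 * H * U * real (totient M) / real M \<le> 6 * L" by (simp add: mult.assoc)
        have "(3 * H * U * real (totient M) / real M) * ((L + 4) * \<rho>)
          \<le> (6 * L) * ((2 * L) * ((24 + 2 * real k ^ 2) * L ^ 2 / real y))"
          by (intro mult_mono a H2(2) rho) (use Hp \<rho>_nonneg in auto)
        also have "\<dots> = (12 * (24 + 2 * real k ^ 2) * L ^ 2) * L ^ 2 / real y" by (simp add: power2_eq_square)
        also have "\<dots> \<le> (v ^ 2 * real y / (512 * \<phi> ^ 2)) * L ^ 2 / real y"
        proof (intro divide_right_mono mult_right_mono)
          have "512 * 12 * (24 + 2 * real k ^ 2) * \<phi> ^ 2 * L ^ 2 = (512 * 12 * (24 + 2 * real k ^ 2) * \<phi> ^ 2 * (4 * real s * real t) ^ 2) * ly ^ 2"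
            by (simp add: Lly power_mult_distrib)
          also have "\<dots> \<le> (512 * 12 * (24 + 2 * real k ^ 2) * \<phi> ^ 2 * (4 * real s * real t) ^ 2) * (1 + ly) ^ 2"
            using ge1(3) Apos(1) by (intro mult_left_mono)
          also have "\<dots> \<le> v ^ 2 * real y" by (rule Ay) (use Apos in \<open>simp add: A_def\<close>)
          finally have "12 * (24 + 2 * real k ^ 2) * L ^ 2 * (512 * \<phi> ^ 2) \<le> v ^ 2 * real y" by (simp only: mult_ac)
          then show "12 * (24 + 2 * real k ^ 2) * L ^ 2 \<le> v ^ 2 * real y / (512 * \<phi> ^ 2)"
            using \<phi>1 by (subst pos_le_divide_eq) auto
        qed auto
        also have "\<dots> = v ^ 2 * L ^ 2 / \<phi> ^ 2 / 512" using y0 by simp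
        also have "\<dots> \<le> V ^ 2 * L ^ 2 / \<phi> ^ 2 / 512"
          using VU(1) v01 by (intro divide_right_mono mult_right_mono power_mono) auto
        also have "\<dots> = D ^ 2 / 512" by (simp add: D_def power_divide power_mult_distrib)
        finally show ?thesis .
      qed
      have "\<bar>B1 - V * B0\<bar>\<^sup>2 \<le> (3 * H * U * real (totient M) / real M) * ((L + 4) * (h * T0 * \<eta> + \<rho>))"
        using dispersion_le by simp
      also have "\<dots> = (3 * H * U * real (totient M) / real M) * ((L + 4) * (h * T0 * \<eta>)) + (3 * H * U * real (totient M) / real M) * ((L + 4) * \<rho>)"
        by (simp only: distrib_left)
      also have "\<dots> \<le> D ^ 2 / 512 + D ^ 2 / 512" using first second by (rule add_mono)
      also have "\<dots> = (D / 16)\<^sup>2" by (simp add: power_divide)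
      finally show "\<bar>B1 - V * B0\<bar>\<^sup>2 \<le> (D / 16)\<^sup>2" .
      show "0 \<le> D / 16" using D0 by simp
    qed
    define e1 where "e1 = 2 * (exp (60 * real (2 * k + 1)) / 2 ^ b1)"
    define err1 where "err1 = ln (real N) / real N * real z0 ^ (16 * b1 + 25)"
    have eb1: "exp (60 * real (2 * k + 1)) \<le> 2 ^ b1"
      using b1(2) exp_ge_zero[of "60 * real (2 * k + 1)"] unfolding K_def by linarith
    have N3: "3 \<le> N" using Nz zy y(4) by simp
    have lower: "(\<Sum>n\<in>S1. mangoldt n / real n) \<ge> V * (\<Sum>n\<in>S0. mangoldt n / real n)
     - 2 * e1 * (L * H * UU M z0 / real M) * V - 2 * err1 - \<bar>B1 - V * B0\<bar>"
      unfolding e1_def err1_def by (rule prime_sum_lower) (use eb1 N3 in auto)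
    \<comment> \<open>As \<open>ln z\<close> is \<open>2 * s * ly\<close>, the ratio
      \<open>L / ln z\<close> equals \<open>2 * t\<close> and is free of \<open>s\<close>. This is
      what allows \<open>b1\<close> to be fixed before \<open>b\<close>.\<close>
    have lb1: "2 * e1 * (L * H * UU M z0 / real M) * V \<le> D / 16"
    proof -
      have e1t: "e1 * real t \<le> 1 / 128"
      proof -
        have "e1 * real t \<le> e1 * real t ^ 3" using t(2) by (intro mult_left_mono self_le_power) (auto simp: e1_def)
        also have "\<dots> = K / 2 ^ b1 * (16 * real b1 + 27) ^ 3" by (simp add: e1_def K_def t(1))
        finally show ?thesis using b1(1) by linarith
      qed
      have "UU M z / real M \<le> 1 / (real (totient M) * ln (real z))"
        using prod_primes_not_dvd_le[of z M] zy y(4) M by (simp add: UU_def sieve_primes_def)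
      then have uz: "UU M z / real M \<le> 1 / (\<phi> * (2 * real s * ly))" by (simp add: lnz \<phi>_def)
      have "L * H * UU M z0 / real M = L * H * (UU M z / real M)" by (simp add: z0)
      also have "\<dots> \<le> L * (2 * L) * (1 / (\<phi> * (2 * real s * ly)))"
        using uz H2(1) L4 H1 UU_pos[of z] by (intro mult_mono) auto
      also have "\<dots> = 4 * real t * L / \<phi>"
      proof -
        have "L * (2 * L) * (1 / (\<phi> * (2 * real s * ly))) = L * (2 * (4 * real s * real t * ly)) / (\<phi> * (2 * real s * ly))"
          by (simp add: Lly)
        then show ?thesis using s(2) ly1 \<phi>1 by (simp add: field_simps)
      qed
      finally have "2 * e1 * V * (L * H * UU M z0 / real M) \<le> 2 * e1 * V * (4 * real t * L / \<phi>)"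
        using V0 by (intro mult_left_mono) (auto simp: e1_def)
      also have "\<dots> = 8 * (e1 * real t) * D" by (simp add: D_def)
      also have "\<dots> \<le> 8 * (1 / 128) * D" using e1t D0 by (intro mult_right_mono mult_left_mono) auto
      finally show ?thesis by (simp add: mult_ac)
    qed
    have lb2: "2 * err1 \<le> D / 16"
    proof -
      have Np: "N = z ^ (16 * b1 + 25) * z ^ 2" unfolding N_def t_def power_add[symmetric] by (rule arg_cong[where f = "\<lambda>j. z ^ j"]) simp
      have zp: "0 < real z" using zy y(4) by simp
      have "err1 = ln (real N) / real (z ^ 2)" unfolding err1_def z0 Np using zp by simp
      also have "\<dots> \<le> L / real y"
      proof (rule frac_le)
        show "ln (real N) \<le> L" using lnN L4 by simp
        have "y \<le> z ^ 2" using zy(2) by (metis le_trans le_square power2_eq_square)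
        then show "real y \<le> real (z ^ 2)" by (rule of_nat_mono)
      qed (use L4 y0 in auto)
      finally have "2 * err1 \<le> 2 * L / real y" by simp
      also have "\<dots> \<le> D / 16"
      proof -
        have "32 * \<phi> \<le> 32 * \<phi> * (1 + ly) ^ 2" using ge1(1) \<phi>1 by (simp add: mult_le_cancel_left1)
        also have "\<dots> \<le> v ^ 2 * real y" by (rule Ay) (use Apos in \<open>simp add: A_def\<close>)
        also have "\<dots> \<le> v * real y" by (rule v2y)
        also have "\<dots> \<le> V * real y" using VU(1) y0 by (intro mult_right_mono) auto
        finally have "2 * L * (16 * \<phi>) \<le> V * L * real y" using mult_left_mono[of "32 * \<phi>" "V * real y" L] L4 by (simp add: mult_ac)
        then show ?thesis using y0 \<phi>1 unfolding D_def by (simp add: field_simps)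
      qed
      finally show ?thesis .
    qed
    have lb3: "V * (\<Sum>n\<in>S0. mangoldt n / real n) \<ge> D / 2 - D / 16"
    proof -
      define J where "J = 4 * s * t * y"
      have xJ: "x < 2 ^ J"
      proof -
        have "y ^ (4 * s * t) < (2 ^ y) ^ (4 * s * t)"
          by (rule power_strict_mono) (auto simp: s_def t_def)
        also have "\<dots> = 2 ^ J" by (simp add: J_def power_mult[symmetric] mult.commute)
        finally show ?thesis by (simp add: xy)
      qed
      have "(\<Sum>n\<in>S0. mangoldt n / real n) \<ge> (L - ln (real N)) / real (totient M) - 2 * C - real (z0 * J) * L / real N"
        by (rule prime_sum_S0_ge[OF C]) (use N3 xN xJ in auto)
      moreover have "(L - ln (real N)) / real (totient M) = L / \<phi> / 2" by (simp add: lnN \<phi>_def)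
      moreover have "real (z0 * J) * L / real N \<le> 1"
      proof -
        have "t = 16 * b1 + 24 + (1 + 2)" by (simp add: t_def)
        then have "N = z ^ (16 * b1 + 24) * (z * z ^ 2)" unfolding N_def by (simp only: power_add power_one_right)
        moreover have "1 \<le> z ^ (16 * b1 + 24)" using zy y(4) by (intro one_le_power) simp
        ultimately have "z * z ^ 2 \<le> N" by (metis mult_le_mono1 mult_1)
        moreover have "y ^ 2 \<le> z ^ 2" using zy(2) by (intro power_mono) auto
        ultimately have "z * y ^ 2 \<le> N" by (meson le_trans mult_le_mono2)
        then have 1: "real z * (real y) ^ 2 \<le> real N" by (metis of_nat_le_iff of_nat_mult of_nat_power)
        have "(4 * real s * real t) * L = (4 * real s * real t) ^ 2 * ly" by (simp add: Lly power2_eq_square)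
        also have "\<dots> \<le> (4 * real s * real t) ^ 2 * (1 + ly) ^ 2" using ge1(2) by (intro mult_left_mono) auto
        also have "\<dots> \<le> v ^ 2 * real y" by (rule Ay) (use Apos in \<open>simp add: A_def\<close>)
        also have "\<dots> \<le> 1 * real y" using v01 y0 by (intro mult_right_mono power_le_one) auto
        finally have "(4 * real s * real t) * L \<le> real y" by simp
        then have "real z * real y * ((4 * real s * real t) * L) \<le> real z * real y * real y"
          by (intro mult_left_mono) auto
        also have "\<dots> \<le> real N" using 1 by (simp add: power2_eq_square)
        finally have "real (z0 * J) * L \<le> real N" by (simp add: z0 J_def mult_ac)
        then show ?thesis using N3 by simp
      qed
      ultimately have "(\<Sum>n\<in>S0. mangoldt n / real n) \<ge> L / \<phi> / 2 - (2 * C + 1)" by linarith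
      moreover have "2 * C + 1 \<le> L / \<phi> / 16"
        using y(2) L4(2) \<phi>1 by (simp add: ly_def field_simps)
      ultimately have "L / \<phi> / 2 - L / \<phi> / 16 \<le> (\<Sum>n\<in>S0. mangoldt n / real n)" by (meson diff_left_mono order_trans)
      then have "V * (L / \<phi> / 2 - L / \<phi> / 16) \<le> V * (\<Sum>n\<in>S0. mangoldt n / real n)"
        using V0 by (intro mult_left_mono) auto
      then show ?thesis by (simp add: D_def algebra_simps)
    qed
    have "D / 4 \<le> (\<Sum>n\<in>S1. mangoldt n / real n)"
      using lower lb1 lb2 lb3 disp by linarith
    moreover have "L * ((real k + 1)\<^sup>2 * (1 + L + real k)) / real y < D / 4"
    proof -
      define E where "E = 8 * \<phi> * (real k + 1)\<^sup>2 * (1 + real k + 4 * real s * real t)"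
      have "1 + L + real k \<le> (1 + real k + 4 * real s * real t) * (1 + ly) ^ 2"
      proof -
        have "L \<le> 4 * real s * real t * (1 + ly) ^ 2" unfolding Lly using ge1(2) by (intro mult_left_mono) auto
        moreover have "(1 + real k) * 1 \<le> (1 + real k) * (1 + ly) ^ 2" using ge1(1) by (intro mult_left_mono) auto
        ultimately show ?thesis by (simp add: distrib_right)
      qed
      then have "8 * \<phi> * (real k + 1)\<^sup>2 * (1 + L + real k) \<le> 8 * \<phi> * (real k + 1)\<^sup>2 * ((1 + real k + 4 * real s * real t) * (1 + ly) ^ 2)"
        using \<phi>1 by (intro mult_left_mono) auto
      also have "\<dots> = E * (1 + ly) ^ 2" by (simp add: E_def)
      also have "\<dots> \<le> v ^ 2 * real y" by (rule Ay) (use Apos in \<open>simp add: A_def E_def\<close>)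
      also have "\<dots> \<le> v * real y" by (rule v2y)
      also have "\<dots> \<le> V * real y" using VU(1) y0 by (intro mult_right_mono) auto
      also have "\<dots> < 2 * (V * real y)" using V0 y0 by simp
      finally have "4 * \<phi> * ((real k + 1)\<^sup>2 * (1 + L + real k)) < V * real y" by (simp add: mult_ac)
      then have "L * (4 * \<phi> * ((real k + 1)\<^sup>2 * (1 + L + real k))) < L * (V * real y)"
        using L4 by (intro mult_strict_left_mono) auto
      then show ?thesis using y0 \<phi>1 unfolding D_def by (simp add: field_simps)
    qed
    ultimately have "L * ((real k + 1)\<^sup>2 * (1 + L + real k)) / real y < (\<Sum>n\<in>S1. mangoldt n / real n)" by linarith
    then obtain p where p: "prime p" "[p = a] (mod M)" "p \<le> x" "sifted k M y p"
      "\<And>i q. i \<in> {1..k} \<Longrightarrow> y < q \<Longrightarrow> \<not> q\<^sup>2 dvd p + i"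
      by (rule good_prime_exists) blast
    \<comment> \<open>Since \<open>p\<close> is sifted up to \<open>y\<close>, any prime factor of
      \<open>p + i\<close> outside \<open>M\<close> exceeds \<open>y\<close>.\<close>
    have big: "y < q" if "prime q" "\<not> q dvd M" "q dvd p + i" "i \<in> {1..k}" for q i
    proof (rule ccontr)
      assume "\<not> y < q"
      then have "q \<in> sieve_primes M y" using that by (simp add: sieve_primes_def)
      then show False using p(4) that unfolding sifted_def by blast
    qed
    have "card {q \<in> prime_factors (p + i). \<not> q dvd M} \<le> R" if i: "i \<in> {1..k}" for i
    proof -
      define T where "T = {q \<in> prime_factors (p + i). \<not> q dvd M}"
      have finT: "finite T" by (simp add: T_def)
      have T: "prime q \<and> q dvd p + i" "y \<le> q" if "q \<in> T" for q
      proof -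
        show pq: "prime q \<and> q dvd p + i" using that by (auto simp: T_def in_prime_factors_iff)
        have "y < q" using that pq i by (intro big[of q i]) (auto simp: T_def)
        then show "y \<le> q" by simp
      qed
      have "y ^ card T = (\<Prod>q\<in>T. y)" by simp
      also have "\<dots> \<le> \<Prod>T" by (intro prod_mono conjI T) auto
      also have "\<Prod>T \<le> p + i" using prod_primes_dvd[OF finT T(1)] i by (intro dvd_imp_le) auto
      also have "\<dots> \<le> x + y" using p(3) i y(5) by simp
      also have "\<dots> \<le> x * y"
      proof -
        have "y \<le> x" using zy Nz xN by simp
        then have "x + y \<le> x * 2" by simp
        also have "\<dots> \<le> x * y" using y(4) by simp
        finally show ?thesis .
      qed
      also have "\<dots> = y ^ R" by (simp add: xy R_eq)
      finally show ?thesis using y(4) unfolding T_def by (simp add: power_increasing_iff)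
    qed
    moreover have "\<not> q\<^sup>2 dvd p + i" if "i \<in> {1..k}" "prime q" "\<not> q dvd M" for i q
    proof
      assume sq: "q\<^sup>2 dvd p + i"
      then have "q dvd p + i" by (auto simp: power2_eq_square dest: dvd_mult_left)
      then have "y < q" using big that by blast
      then show False using p(5)[OF that(1)] sq by blast
    qed
    ultimately show "\<exists>p. prime p \<and> [p = a] (mod M) \<and> (\<forall>i\<in>{1..k}. card {q \<in> prime_factors (p + i). \<not> q dvd M} \<le> R \<and>
      (\<forall>q. prime q \<and> \<not> q dvd M \<longrightarrow> \<not> q\<^sup>2 dvd p + i))"
      using p(1,2) by blast
  qed
  then show ?thesis by blast
qed

section \<open>Prescribing the values at the shifts\<close>

lemma multiplicative_prod_primes:
  assumes "multiplicative_fun f" "finite T" "\<And>q. q \<in> T \<Longrightarrow> prime q"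
  shows "f (\<Prod>T) = (\<Prod>q\<in>T. f q)"
  using assms(2,3)
proof (induction T rule: finite_induct)
  case empty
  then show ?case using assms(1) by (simp add: multiplicative_fun_def)
next
  case (insert p T)
  have "coprime p (\<Prod>T)"
  proof (rule prod_coprime_right)
    fix q assume "q \<in> T"
    then show "coprime p q" using insert by (intro primes_coprime) auto
  qed
  then have "f (p * \<Prod>T) = f p * f (\<Prod>T)" using assms(1) by (simp add: multiplicative_fun_def)
  then show ?case using insert by simp
qed

text \<open>With \<open>F = (k + 1)!\<close>, the condition \<open>p = 1\<close> modulo
  \<open>F\<^sup>2\<close> makes \<open>(p + i) div (1 + i)\<close> free of primes up to
  \<open>k + 1\<close>. For \<open>q\<close> in \<open>S i\<close>, \<open>p = q - i\<close> modulo
  \<open>q\<^sup>2\<close> makes \<open>q\<close> divide \<open>p + i\<close> exactly once. Other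
  primes up to \<open>Y\<close> get \<open>p = 1\<close> and divide no \<open>p + i\<close>. What
  remains are at most \<open>R\<close> primes beyond \<open>Y\<close>.\<close>

lemma prime_near_prescribed:
  fixes f :: "nat \<Rightarrow> real" and S :: "nat \<Rightarrow> nat set"
  assumes k1: "1 \<le> k" and f: "multiplicative_fun f"
    and core: "almost_prime_shifts k w R"
    and \<eta>: "0 < \<eta>" "\<eta> < 1" and Y: "w \<le> Y" "k + 1 \<le> Y" "\<And>q. prime q \<Longrightarrow> Y < q \<Longrightarrow> \<bar>f q - 1\<bar> < \<eta>"
    and S: "\<And>i q. i \<in> {1..k} \<Longrightarrow> q \<in> S i \<Longrightarrow> prime q \<and> k + 1 < q \<and> q \<le> Y"
    and disj: "\<And>i j. i \<in> {1..k} \<Longrightarrow> j \<in> {1..k} \<Longrightarrow> i \<noteq> j \<Longrightarrow> S i \<inter> S j = {}"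
  shows "\<exists>p. prime p \<and> (\<forall>i\<in>{1..k}. \<exists>r. f (p + i) = f (1 + i) * (\<Prod>q\<in>S i. f q) * r \<and> (1 - \<eta>) ^ R \<le> r \<and> r \<le> (1 + \<eta>) ^ R)"
proof -
  define P where "P = {q. prime q \<and> k + 1 < q \<and> q \<le> Y}"
  have finP: "finite P" by (simp add: P_def)
  define F where "F = (fact (k + 1) :: nat)"
  \<comment> \<open>The index 0, not a prime, stands for the modulus built from \<open>F\<close>, so
    that a single family serves the Chinese remainder theorem.\<close>
  define m where "m q = (if q = 0 then F ^ 2 else q ^ 2)" for q :: nat
  define u where "u q = (if \<exists>i\<in>{1..k}. q \<in> S i then q - (THE i. i \<in> {1..k} \<and> q \<in> S i) else 1)" for q
  have uS: "u q = q - i" if "i \<in> {1..k}" "q \<in> S i" for i q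
  proof -
    have "(THE i. i \<in> {1..k} \<and> q \<in> S i) = i"
      by (rule the_equality) (use that disj in blast)+
    then show ?thesis using that by (auto simp: u_def)
  qed
  have u1: "u q = 1" if "\<And>i. i \<in> {1..k} \<Longrightarrow> q \<notin> S i" for q
    using that by (auto simp: u_def)
  have SP: "S i \<subseteq> P" if "i \<in> {1..k}" for i using S[OF that] by (auto simp: P_def)
  have P0: "q \<noteq> 0" "prime q" "k + 1 < q" if "q \<in> P" for q using that by (auto simp: P_def)
  have F0: "0 < F" by (simp add: F_def)
  have qF: "q dvd F \<longleftrightarrow> q \<le> k + 1" if "prime q" for q
    unfolding F_def by (rule prime_dvd_fact_iff[OF that])
  have copF: "coprime F q" if "q \<in> P" for q
    using prime_imp_coprime[OF P0(2)[OF that]] qF[OF P0(2)[OF that]] P0(3)[OF that] by (simp add: coprime_commute)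
  define A where "A = insert 0 P"
  have "\<exists>a. \<forall>q\<in>A. [a = (if q = 0 then 1 else u q)] (mod m q)"
  proof (rule chinese_remainder_nat)
    show "finite A" using finP by (simp add: A_def)
    show "\<forall>q\<in>A. \<forall>q'\<in>A. q \<noteq> q' \<longrightarrow> coprime (m q) (m q')"
    proof (intro ballI impI)
      fix q q' assume q: "q \<in> A" "q' \<in> A" "q \<noteq> q'"
      show "coprime (m q) (m q')"
        using q P0 primes_coprime[of q q'] by (auto simp: A_def m_def intro: copF coprime_commute[THEN iffD1, OF copF])
    qed
  qed
  then obtain a where a: "[a = 1] (mod F ^ 2)" "\<And>q. q \<in> P \<Longrightarrow> [a = u q] (mod q ^ 2)"
    using P0(1) by (fastforce simp: A_def m_def split: if_splits)
  define M where "M = F ^ 2 * (\<Prod>q\<in>P. q ^ 2)"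
  have M0: "0 < M" unfolding M_def using F0 P0(1) by (auto intro!: mult_pos_pos prod_pos)
  have copa: "coprime a M"
    unfolding M_def coprime_mult_right_iff
  proof
    show "coprime a (F ^ 2)" using cong_imp_coprime[OF cong_sym[OF a(1)]] by simp
    show "coprime a (\<Prod>q\<in>P. q ^ 2)"
    proof (rule prod_coprime_right)
      fix q assume q: "q \<in> P"
      have "\<not> q dvd u q"
      proof (cases "\<exists>i\<in>{1..k}. q \<in> S i")
        case True
        then obtain i where i: "i \<in> {1..k}" "q \<in> S i" by auto
        then have "u q = q - i" by (rule uS)
        then show ?thesis using i P0(3)[OF q] by (auto dest!: dvd_imp_le)
      next
        case False
        then have "u q = 1" using u1 by blast
        then show ?thesis using P0(2)[OF q] not_prime_unit by auto
      qed
      then have "coprime (u q) (q ^ 2)" using prime_imp_coprime[OF P0(2)[OF q], of "u q"] by (simp add: coprime_commute)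
      then show "coprime a (q ^ 2)" using cong_imp_coprime[OF cong_sym[OF a(2)[OF q]]] by simp
    qed
  qed
  have dvdM: "q dvd M \<longleftrightarrow> q \<le> Y" if q: "prime q" for q
  proof
    assume "q dvd M"
    then consider "q dvd F ^ 2" | "q dvd (\<Prod>q\<in>P. q ^ 2)" unfolding M_def using prime_dvd_mult_iff[OF q] by blast
    then show "q \<le> Y"
    proof cases
      case 1
      then show ?thesis using qF[OF q] prime_dvd_power[OF q] Y(2) by force
    next
      case 2
      then obtain q' where "q' \<in> P" "q dvd q' ^ 2" using prime_dvd_prod_iff[OF finP q, of "\<lambda>q. q ^ 2"] by auto
      then have "q dvd q'" "q' \<in> P" using prime_dvd_power[OF q] by auto
      then show ?thesis using primes_dvd_imp_eq[OF q] by (auto simp: P_def)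
    qed
  next
    assume "q \<le> Y"
    show "q dvd M"
    proof (cases "q \<le> k + 1")
      case True
      then show ?thesis unfolding M_def using qF[OF q] by (auto simp: power2_eq_square)
    next
      case False
      then have "q \<in> P" using q \<open>q \<le> Y\<close> by (simp add: P_def)
      then have "q ^ 2 dvd (\<Prod>q\<in>P. q ^ 2)" using finP by (intro dvd_prodI) auto
      then show ?thesis unfolding M_def by (auto simp: power2_eq_square intro: dvd_mult dvd_trans)
    qed
  qed
  have wM: "q dvd M" if "prime q" "q \<le> w" for q using dvdM[OF that(1)] that(2) Y(1) by simp
  have MP: "0 < M \<and> (\<forall>q. prime q \<and> q \<le> w \<longrightarrow> q dvd M) \<and> coprime a M" using M0 wM copa by blast
  obtain p where p: "prime p" "[p = a] (mod M)"
    "\<And>i. i \<in> {1..k} \<Longrightarrow> card {q \<in> prime_factors (p + i). \<not> q dvd M} \<le> R"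
    "\<And>i q. i \<in> {1..k} \<Longrightarrow> prime q \<Longrightarrow> \<not> q dvd M \<Longrightarrow> \<not> q\<^sup>2 dvd p + i"
    using core[unfolded almost_prime_shifts_def, THEN spec, THEN spec, THEN mp, OF MP] by blast
  have pF: "[p = 1] (mod F ^ 2)"
    using cong_modulus_mult_nat[of p a "F ^ 2" "\<Prod>q\<in>P. q ^ 2"] p(2) a(1) unfolding M_def by (metis cong_trans)
  have pq: "[p = u q] (mod q ^ 2)" if "q \<in> P" for q
  proof -
    have "q ^ 2 dvd M" unfolding M_def using finP that by (intro dvd_mult dvd_prodI) auto
    then have "[p = a] (mod q ^ 2)" using p(2) cong_dvd_modulus_nat by blast
    then show ?thesis using a(2)[OF that] by (rule cong_trans)
  qed
  have "\<exists>r. f (p + i) = f (1 + i) * (\<Prod>q\<in>S i. f q) * r \<and> (1 - \<eta>) ^ R \<le> r \<and> r \<le> (1 + \<eta>) ^ R" if i: "i \<in> {1..k}" for i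
  proof -
    have iF: "1 + i dvd F" unfolding F_def using i by (intro dvd_fact) auto
    have cF: "[p + i = 1 + i] (mod F ^ 2)" using pF by (rule cong_add_rcancel_nat[THEN iffD2])
    have "[p + i = 1 + i] (mod 1 + i)"
      using cF iF by (meson cong_dvd_modulus_nat dvd_trans dvd_power zero_less_numeral)
    then have "1 + i dvd p + i" by (simp add: cong_def dvd_eq_mod_eq_0)
    then obtain c where c: "p + i = (1 + i) * c" by (elim dvdE)
    have c0: "0 < c" using c i by (intro Nat.gr0I) auto
    \<comment> \<open>A prime \<open>q \<le> k + 1\<close> dividing the cofactor \<open>c\<close>
      would make \<open>(1 + i) * q\<close>, a divisor of \<open>F\<^sup>2\<close>, divide
      \<open>p + i\<close> and hence \<open>1 + i\<close>.\<close>
    have small: "\<not> q dvd c" if q: "prime q" "q \<le> k + 1" for q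
    proof
      assume "q dvd c"
      then have 1: "(1 + i) * q dvd p + i" unfolding c by (rule mult_dvd_mono[OF dvd_refl])
      have "(1 + i) * q dvd F ^ 2" unfolding power2_eq_square using iF qF q by (intro mult_dvd_mono) auto
      then have "[p + i = 1 + i] (mod (1 + i) * q)" using cF cong_dvd_modulus_nat by blast
      then have "(1 + i) * q dvd 1 + i" using 1 by (simp only: cong_dvd_iff)
      then have "(1 + i) * q \<le> (1 + i) * 1" by (intro dvd_imp_le) auto
      then have "q \<le> 1" unfolding mult_le_cancel1 by simp
      then show False using prime_gt_1_nat[OF q(1)] by simp
    qed
    have mem: "q \<in> S i" if q: "q \<in> P" "q dvd p + i" for q
    proof (rule ccontr)
      assume nS: "q \<notin> S i"
      have "[p = u q] (mod q)" using pq[OF q(1)] cong_dvd_modulus_nat[of p "u q" "q ^ 2" q] by (simp add: power2_eq_square)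
      then have "[p + i = u q + i] (mod q)" by (simp add: cong_add_rcancel_nat)
      then have d: "q dvd u q + i" using q(2) cong_dvd_iff by blast
      show False
      proof (cases "\<exists>j\<in>{1..k}. q \<in> S j")
        case True
        then obtain j where j: "j \<in> {1..k}" "q \<in> S j" by auto
        then have "i \<noteq> j" using nS by auto
        have "u q = q - j" using uS j by blast
        then have e: "u q + i + j = q + i" using j P0(3)[OF q(1)] by simp
        have qk: "i < q" "j < q" using i j P0(3)[OF q(1)] by auto
        have "[u q + i = 0] (mod q)" using d by (simp add: cong_0_iff)
        then have "[u q + i + j = 0 + j] (mod q)" by (simp only: cong_add_rcancel_nat)
        then have "[i = j] (mod q)" unfolding e by (simp add: cong_def)
        then show False using qk \<open>i \<noteq> j\<close> by (simp add: cong_def)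
      next
        case False
        then have "u q = 1" using u1 by blast
        then have "q dvd 1 + i" using d by simp
        then have "q \<le> 1 + i" by (rule dvd_imp_le) simp
        then show False using P0(3)[OF q(1)] i by simp
      qed
    qed
    have SI: "q dvd p + i" "\<not> q ^ 2 dvd p + i" if q: "q \<in> S i" for q
    proof -
      have qP: "q \<in> P" using SP[OF i] q by auto
      have "[p + i = (q - i) + i] (mod q ^ 2)" using pq[OF qP] uS[OF i q] by (simp add: cong_add_rcancel_nat)
      then have e: "[p + i = q] (mod q ^ 2)" using P0(3)[OF qP] i by simp
      then have "[p + i = q] (mod q)" using cong_dvd_modulus_nat[of "p + i" q "q ^ 2" q] by (simp add: power2_eq_square)
      then show "q dvd p + i" by (simp add: cong_dvd_iff)
      show "\<not> q ^ 2 dvd p + i"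
      proof
        assume "q ^ 2 dvd p + i"
        then have "q ^ 2 dvd q" using cong_dvd_iff[OF e] by simp
        then have "q ^ 2 \<le> q" using P0(1)[OF qP] by (intro dvd_imp_le) auto
        then show False using prime_gt_1_nat[OF P0(2)[OF qP]] by (simp add: power2_eq_square)
      qed
    qed
    \<comment> \<open>The prime factors beyond \<open>Y\<close>: there \<open>f\<close> is within
      \<eta> of 1, and \<open>almost_prime_shifts\<close> bounds their number by
      \<open>R\<close>.\<close>
    define T where "T = {q \<in> prime_factors (p + i). \<not> q dvd M}"
    have ST: "S i \<inter> T = {}" using S[OF i] dvdM by (auto simp: T_def)
    have finS: "finite (S i)" using SP[OF i] finP by (rule finite_subset)
    have finT: "finite T" by (simp add: T_def)
    have dvdc: "q dvd c" if "prime q" "k + 1 < q" "q dvd p + i" for q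
    proof -
      have "\<not> q dvd 1 + i" using that(2) i by (auto dest!: dvd_imp_le)
      then show ?thesis using that(3) unfolding c using prime_dvd_mult_iff[OF that(1)] by blast
    qed
    have sq: "\<not> q ^ 2 dvd c" if q: "prime q" for q
    proof
      assume qc: "q ^ 2 dvd c"
      then have qc1: "q dvd c" by (auto simp: power2_eq_square dest: dvd_mult_left)
      have qp: "q ^ 2 dvd p + i" unfolding c using qc by (rule dvd_mult)
      then have qp1: "q dvd p + i" by (auto simp: power2_eq_square dest: dvd_mult_left)
      show False
      proof (cases "q \<le> Y")
        case True
        have "k + 1 < q" using small[OF q] qc1 by (meson not_le)
        then have "q \<in> P" using q True by (simp add: P_def)
        then have "q \<in> S i" using mem qp1 by blast
        then show False using SI(2) qp by blast
      next
        case False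
        then show False using p(4)[OF i q] dvdM[OF q] qp by blast
      qed
    qed
    have pf: "prime_factors c = S i \<union> T"
    proof (intro equalityI subsetI)
      fix q assume "q \<in> prime_factors c"
      then have q: "prime q" "q dvd c" by auto
      have qp1: "q dvd p + i" unfolding c using q(2) by (rule dvd_mult)
      have kq: "k + 1 < q" using small[OF q(1)] q(2) by (meson not_le)
      show "q \<in> S i \<union> T"
      proof (cases "q \<le> Y")
        case True
        then show ?thesis using mem[of q] qp1 q kq by (auto simp: P_def)
      next
        case False
        then show ?thesis using q qp1 dvdM[OF q(1)] i by (auto simp: T_def prime_factors_dvd)
      qed
    next
      fix q assume q: "q \<in> S i \<union> T"
      then have "prime q \<and> k + 1 < q \<and> q dvd p + i"
        using S[OF i] SI(1) dvdM[of q] Y(2) by (auto simp: T_def in_prime_factors_iff)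
      then show "q \<in> prime_factors c" using dvdc c0 by (auto simp: prime_factors_dvd)
    qed
    have "squarefree c" using squarefree_factorial_semiring[of c] c0 sq by auto
    then have "c = \<Prod>(S i \<union> T)" using squarefree_eq_prod_primes[of c] c0 pf by simp
    then have "f c = (\<Prod>q\<in>S i \<union> T. f q)"
      using multiplicative_prod_primes[OF f, of "S i \<union> T"] pf by (metis finite_set_mset in_prime_factors_imp_prime)
    also have "\<dots> = (\<Prod>q\<in>S i. f q) * (\<Prod>q\<in>T. f q)" using finS finT ST by (rule prod.union_disjoint)
    finally have fc: "f c = (\<Prod>q\<in>S i. f q) * (\<Prod>q\<in>T. f q)" .
    have "coprime (1 + i) c"
    proof (rule ccontr)
      assume "\<not> coprime (1 + i) c"
      then have "gcd (1 + i) c \<noteq> 1" by (simp only: coprime_iff_gcd_eq_1 not_False_eq_True)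
      then obtain q where "prime q" "q dvd gcd (1 + i) c" using prime_factor_nat by blast
      then have q: "prime q" "q dvd 1 + i" "q dvd c" by (simp_all only: gcd_greatest_iff)
      then have "q \<le> 1 + i" by (intro dvd_imp_le) auto
      then show False using small[of q] q i by auto
    qed
    then have "f (p + i) = f (1 + i) * f c" unfolding c using f unfolding multiplicative_fun_def by blast
    then have eq: "f (p + i) = f (1 + i) * (\<Prod>q\<in>S i. f q) * (\<Prod>q\<in>T. f q)" by (simp add: fc)
    have fT: "1 - \<eta> \<le> f q" "f q \<le> 1 + \<eta>" if "q \<in> T" for q
    proof -
      have "prime q" "Y < q" using that dvdM[of q] by (auto simp: T_def in_prime_factors_iff)
      then have "\<bar>f q - 1\<bar> < \<eta>" using Y(3) by blast
      then show "1 - \<eta> \<le> f q" "f q \<le> 1 + \<eta>" by auto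
    qed
    have cT: "card T \<le> R" using p(3)[OF i] by (simp add: T_def)
    have "(1 - \<eta>) ^ R \<le> (1 - \<eta>) ^ card T" using \<eta> cT by (intro power_decreasing) auto
    also have "\<dots> = (\<Prod>q\<in>T. 1 - \<eta>)" by simp
    also have "\<dots> \<le> (\<Prod>q\<in>T. f q)" using fT \<eta> by (intro prod_mono) auto
    finally have l: "(1 - \<eta>) ^ R \<le> (\<Prod>q\<in>T. f q)" .
    have "(\<Prod>q\<in>T. f q) \<le> (\<Prod>q\<in>T. 1 + \<eta>)"
    proof (intro prod_mono conjI)
      fix q assume q: "q \<in> T"
      show "0 \<le> f q" using fT(1)[OF q] \<eta> by linarith
      show "f q \<le> 1 + \<eta>" by (rule fT(2)[OF q])
    qed
    also have "\<dots> = (1 + \<eta>) ^ card T" by simp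
    also have "\<dots> \<le> (1 + \<eta>) ^ R" using \<eta> cT by (intro power_increasing) auto
    finally show ?thesis using eq l by blast
  qed
  then show ?thesis using p(1) by blast
qed

section \<open>Products of values over chosen primes\<close>

text \<open>If the product without \<open>q\<close> still reaches the target, \<open>q\<close> is
  dropped. Otherwise the whole product overshoots by at most the one factor
  \<open>u q\<close>.\<close>

lemma greedy_subproduct:
  fixes u :: "'a \<Rightarrow> real"
  assumes "finite F" "\<And>q. q \<in> F \<Longrightarrow> 1 \<le> u q \<and> u q \<le> 1 + \<eta>" "1 \<le> \<tau>" "\<tau> \<le> prod u F" "0 \<le> \<eta>"
  shows "\<exists>S\<subseteq>F. \<tau> \<le> prod u S \<and> prod u S \<le> \<tau> * (1 + \<eta>)"
  using assms(1,2,4)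
proof (induction F rule: finite_induct)
  case empty
  then have "prod u {} \<le> \<tau> * (1 + \<eta>)" using assms mult_mono[of 1 \<tau> 1 "1 + \<eta>"] by simp
  then show ?case using empty by blast
next
  case (insert q F)
  show ?case
  proof (cases "\<tau> \<le> prod u F")
    case True
    then obtain S where "S \<subseteq> F" "\<tau> \<le> prod u S \<and> prod u S \<le> \<tau> * (1 + \<eta>)" using insert by auto
    then show ?thesis by blast
  next
    case False
    have "0 \<le> prod u F" using insert.prems(1) by (intro prod_nonneg) (force intro: order_trans[of 0 1])
    then have "u q * prod u F \<le> (1 + \<eta>) * \<tau>" using insert.prems(1) False assms by (intro mult_mono) auto
    then show ?thesis using insert by (intro exI[of _ "insert q F"]) (simp add: mult.commute)
  qed
qed

text \<open>Discarding finitely many primes preserves divergence, and over primes with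
  \<open>u > 1\<close> a product dominates the sum of the excesses; so some finite product passes
  the target and can be thinned out greedily.\<close>

lemma divergent_subproduct:
  fixes u :: "nat \<Rightarrow> real"
  assumes div: "\<not> (\<lambda>p. max 0 (u p - 1)) summable_on {p. prime p}"
    and lim: "\<And>\<epsilon>. 0 < \<epsilon> \<Longrightarrow> \<exists>N. \<forall>p. prime p \<and> N \<le> p \<longrightarrow> u p \<le> 1 + \<epsilon>"
    and \<tau>: "1 \<le> \<tau>" and \<eta>: "0 < \<eta>"
  shows "\<exists>S. finite S \<and> (\<forall>q\<in>S. prime q \<and> Y < q) \<and> \<tau> \<le> prod u S \<and> prod u S \<le> \<tau> * (1 + \<eta>)"
proof -
  define g where "g p = max 0 (u p - 1)" for p
  obtain N where N: "\<And>p. prime p \<Longrightarrow> N \<le> p \<Longrightarrow> u p \<le> 1 + \<eta>" using lim[OF \<eta>] by blast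
  define A where "A = {p. prime p \<and> Y + N < p}"
  have "\<not> g summable_on A"
  proof
    assume "g summable_on A"
    moreover have "g summable_on {p. prime p \<and> p \<le> Y + N}" by (rule summable_on_finite) simp
    ultimately have "g summable_on (A \<union> {p. prime p \<and> p \<le> Y + N})"
      by (rule summable_on_Un_disjoint) (auto simp: A_def)
    moreover have "A \<union> {p. prime p \<and> p \<le> Y + N} = {p. prime p}" by (auto simp: A_def)
    ultimately show False using div by (simp add: g_def[abs_def])
  qed
  then have "\<not> bdd_above (sum g ` {F. F \<subseteq> A \<and> finite F})"
    using nonneg_bdd_above_summable_on[of A g] by (auto simp: g_def)
  then have "\<not> (\<forall>F. F \<subseteq> A \<and> finite F \<longrightarrow> sum g F \<le> \<tau>)"
    by (auto intro!: bdd_aboveI[of _ \<tau>])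
  then obtain F where F: "F \<subseteq> A" "finite F" "\<tau> < sum g F" by (auto simp: not_le)
  define F' where "F' = {q \<in> F. 1 < u q}"
  have "sum g F = sum g F'"
    unfolding F'_def using F(2) by (intro sum.mono_neutral_right) (auto simp: g_def)
  also have "\<dots> \<le> (\<Prod>q\<in>F'. 1 + g q)" by (rule sum_le_prod) (simp add: g_def)
  also have "\<dots> = prod u F'" by (rule prod.cong) (auto simp: g_def F'_def)
  finally have "\<tau> \<le> prod u F'" using F(3) by simp
  moreover have "1 \<le> u q \<and> u q \<le> 1 + \<eta>" if "q \<in> F'" for q
    using that F(1) N[of q] by (auto simp: F'_def A_def)
  moreover have "finite F'" using F(2) by (simp add: F'_def)
  ultimately obtain S where S: "S \<subseteq> F'" "\<tau> \<le> prod u S" "prod u S \<le> \<tau> * (1 + \<eta>)"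
    using greedy_subproduct[of F' u \<eta> \<tau>] \<tau> \<eta> by auto
  have "S \<subseteq> A" using S(1) F(1) by (auto simp: F'_def)
  moreover have "finite S" using S(1) \<open>finite F'\<close> by (rule finite_subset)
  ultimately show ?thesis using S(2,3) by (intro exI[of _ S]) (auto simp: A_def)
qed

definition prime_blocks :: "nat \<Rightarrow> nat \<Rightarrow> (nat \<Rightarrow> nat set) \<Rightarrow> bool" where
  "prime_blocks k Y S \<longleftrightarrow> (\<forall>i\<in>{1..k}. finite (S i) \<and> (\<forall>q\<in>S i. prime q \<and> Y < q)) \<and>
    (\<forall>i\<in>{1..k}. \<forall>j\<in>{1..k}. i \<noteq> j \<longrightarrow> S i \<inter> S j = {})"

text \<open>Each new set is taken beyond all primes used before, which makes the sets
  disjoint.\<close>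

lemma divergent_disjoint_subproducts:
  fixes u :: "nat \<Rightarrow> real"
  assumes div: "\<not> (\<lambda>p. max 0 (u p - 1)) summable_on {p. prime p}"
    and lim: "\<And>\<epsilon>. 0 < \<epsilon> \<Longrightarrow> \<exists>N. \<forall>p. prime p \<and> N \<le> p \<longrightarrow> u p \<le> 1 + \<epsilon>"
    and \<eta>: "0 < \<eta>" and \<tau>: "\<And>i. i \<in> {1..k} \<Longrightarrow> 1 \<le> \<tau> i"
  shows "\<exists>S. prime_blocks k Y S \<and> (\<forall>i\<in>{1..k}. \<tau> i \<le> prod u (S i) \<and> prod u (S i) \<le> \<tau> i * (1 + \<eta>))"
  using \<tau>
proof (induction k)
  case 0
  then show ?case by (simp add: prime_blocks_def)
next
  case (Suc k)
  then obtain S where S: "prime_blocks k Y S"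
    "\<And>i. i \<in> {1..k} \<Longrightarrow> \<tau> i \<le> prod u (S i) \<and> prod u (S i) \<le> \<tau> i * (1 + \<eta>)"
    by (auto simp: le_Suc_eq)
  have fin: "finite (\<Union>i\<in>{1..k}. S i)" using S(1) by (auto simp: prime_blocks_def)
  define Z where "Z = Max (insert Y (\<Union>i\<in>{1..k}. S i))"
  have Z: "Y \<le> Z" "\<And>i q. i \<in> {1..k} \<Longrightarrow> q \<in> S i \<Longrightarrow> q \<le> Z"
    unfolding Z_def using fin by (auto intro!: Max_ge)
  have "1 \<le> \<tau> (Suc k)" using Suc.prems by simp
  then obtain T where T: "finite T" "\<And>q. q \<in> T \<Longrightarrow> prime q \<and> Z < q" "\<tau> (Suc k) \<le> prod u T" "prod u T \<le> \<tau> (Suc k) * (1 + \<eta>)"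
    using divergent_subproduct[OF div lim _ \<eta>, of "\<tau> (Suc k)" Z] by blast
  have TS: "S i \<inter> T = {}" if "i \<in> {1..k}" for i using Z(2)[OF that] T(2) by (meson disjoint_iff not_le)
  define S' where "S' = S(Suc k := T)"
  have S': "S' i = (if i = Suc k then T else S i)" for i by (simp add: S'_def)
  have iS: "i \<in> {1..Suc k} \<longleftrightarrow> i = Suc k \<or> i \<in> {1..k}" for i by auto
  have T': "prime q \<and> Y < q" if "q \<in> T" for q using T(2)[OF that] Z(1) by simp
  have "prime_blocks (Suc k) Y S'"
    unfolding prime_blocks_def
  proof (intro conjI ballI impI)
    fix i j assume ij: "i \<in> {1..Suc k}" "j \<in> {1..Suc k}" "i \<noteq> j"
    show "S' i \<inter> S' j = {}"
    proof (cases "i = Suc k \<or> j = Suc k")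
      case True
      then show ?thesis using ij TS[of i] TS[of j] unfolding iS S' by auto
    next
      case False
      then have "i \<in> {1..k}" "j \<in> {1..k}" using ij unfolding iS by auto
      then show ?thesis using S(1) ij(3) False unfolding S' prime_blocks_def by simp
    qed
  next
    fix i assume "i \<in> {1..Suc k}"
    then show "finite (S' i)" using S(1) T(1) unfolding iS S' prime_blocks_def by auto
  next
    fix i q assume "i \<in> {1..Suc k}" "q \<in> S' i"
    then have "prime q \<and> Y < q" using S(1) T' unfolding iS S' prime_blocks_def by (auto split: if_splits)
    then show "prime q" "Y < q" by auto
  qed
  moreover have "\<forall>i\<in>{1..Suc k}. \<tau> i \<le> prod u (S' i) \<and> prod u (S' i) \<le> \<tau> i * (1 + \<eta>)"
    unfolding iS S' using S(2) T by auto
  ultimately show ?case by blast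
qed

text \<open>The two-sided form of \<open>blocks\<close> covers approximation from above and from
  below, so it serves both cases of the final theorem. Targets are positive because all errors are
  multiplicative.\<close>

lemma shifted_prime_approx:
  fixes f x :: "nat \<Rightarrow> real"
  assumes k1: "1 \<le> k" and f: "multiplicative_fun f"
    and lim: "\<forall>\<epsilon>>0. \<exists>N. \<forall>p. prime p \<and> p \<ge> N \<longrightarrow> \<bar>f p - 1\<bar> < \<epsilon>"
    and x: "\<And>i. i \<in> {1..k} \<Longrightarrow> 0 < x i" and \<epsilon>: "0 < \<epsilon>"
    and blocks: "\<And>\<eta> Y. 0 < \<eta> \<Longrightarrow> \<exists>S. prime_blocks k Y S \<and> (\<forall>i\<in>{1..k}.
      x i / (1 + \<eta>) \<le> f (1 + i) * prod f (S i) \<and> f (1 + i) * prod f (S i) \<le> x i * (1 + \<eta>))"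
  shows "\<exists>p. prime p \<and> (\<forall>i\<in>{1..k}. \<bar>f (p + i) - x i\<bar> < \<epsilon>)"
proof -
  obtain w R where core: "almost_prime_shifts k w R" using ex_almost_prime_shifts[OF k1] by blast
  \<comment> \<open>The exponent \<open>R + 1\<close> counts up to \<open>R\<close> large primes and
    one factor for the inaccuracy of the block product.\<close>
  have "eventually (\<lambda>\<eta>. x i * (1 + \<eta>) ^ (R + 1) < x i + \<epsilon> \<and> x i - \<epsilon> < x i * (1 - \<eta>) ^ (R + 1)) (at_right 0)" for i
  proof (rule eventually_conj)
    have "((\<lambda>\<eta>. x i * (1 + \<eta>) ^ (R + 1)) \<longlongrightarrow> x i * (1 + 0) ^ (R + 1)) (at_right 0)" by (intro tendsto_intros)
    then show "eventually (\<lambda>\<eta>. x i * (1 + \<eta>) ^ (R + 1) < x i + \<epsilon>) (at_right 0)"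
      by (rule order_tendstoD) (use \<epsilon> in simp)
    have "((\<lambda>\<eta>. x i * (1 - \<eta>) ^ (R + 1)) \<longlongrightarrow> x i * (1 - 0) ^ (R + 1)) (at_right 0)" by (intro tendsto_intros)
    then show "eventually (\<lambda>\<eta>. x i - \<epsilon> < x i * (1 - \<eta>) ^ (R + 1)) (at_right 0)"
      by (rule order_tendstoD) (use \<epsilon> in simp)
  qed
  then have "eventually (\<lambda>\<eta>. \<forall>i\<in>{1..k}. x i * (1 + \<eta>) ^ (R + 1) < x i + \<epsilon> \<and> x i - \<epsilon> < x i * (1 - \<eta>) ^ (R + 1)) (at_right 0)"
    by (intro eventually_ball_finite) auto
  moreover have "eventually (\<lambda>\<eta>::real. \<eta> \<in> {0<..<1}) (at_right 0)" by (rule eventually_at_right_real) simp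
  ultimately have "eventually (\<lambda>\<eta>. (\<forall>i\<in>{1..k}. x i * (1 + \<eta>) ^ (R + 1) < x i + \<epsilon> \<and> x i - \<epsilon> < x i * (1 - \<eta>) ^ (R + 1)) \<and> \<eta> \<in> {0<..<1}) (at_right 0)"
    by (rule eventually_conj)
  then have "\<exists>\<eta>. (\<forall>i\<in>{1..k}. x i * (1 + \<eta>) ^ (R + 1) < x i + \<epsilon> \<and> x i - \<epsilon> < x i * (1 - \<eta>) ^ (R + 1)) \<and> \<eta> \<in> {0<..<1}"
    by (rule eventually_happens'[OF trivial_limit_at_right_real])
  then obtain \<eta> where \<eta>: "0 < \<eta>" "\<eta> < 1"
    "\<And>i. i \<in> {1..k} \<Longrightarrow> x i * (1 + \<eta>) ^ (R + 1) < x i + \<epsilon> \<and> x i - \<epsilon> < x i * (1 - \<eta>) ^ (R + 1)"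
    by (metis greaterThanLessThan_iff)
  obtain N where N: "\<And>p. prime p \<Longrightarrow> N \<le> p \<Longrightarrow> \<bar>f p - 1\<bar> < \<eta>" using lim \<eta>(1) by blast
  obtain S where S: "prime_blocks k (k + 1) S" "\<And>i. i \<in> {1..k} \<Longrightarrow>
      x i / (1 + \<eta>) \<le> f (1 + i) * prod f (S i) \<and> f (1 + i) * prod f (S i) \<le> x i * (1 + \<eta>)"
    using blocks[OF \<eta>(1)] by blast
  define Y where "Y = Max (insert (w + N + k + 1) (\<Union>i\<in>{1..k}. S i))"
  have fin: "finite (\<Union>i\<in>{1..k}. S i)" using S(1) by (auto simp: prime_blocks_def)
  then have "w + N + k + 1 \<le> Y" unfolding Y_def by (intro Max_ge) auto
  then have Y: "w \<le> Y" "k + 1 \<le> Y" "N \<le> Y" by auto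
  have SY: "q \<le> Y" if "i \<in> {1..k}" "q \<in> S i" for i q unfolding Y_def using fin that by (intro Max_ge) auto
  have "\<exists>p. prime p \<and> (\<forall>i\<in>{1..k}. \<exists>r. f (p + i) = f (1 + i) * (\<Prod>q\<in>S i. f q) * r \<and> (1 - \<eta>) ^ R \<le> r \<and> r \<le> (1 + \<eta>) ^ R)"
  proof (rule prime_near_prescribed[OF k1 f core \<eta>(1,2) Y(1,2)])
    show "\<bar>f q - 1\<bar> < \<eta>" if "prime q" "Y < q" for q using N[of q] that Y(3) by simp
    show "prime q \<and> k + 1 < q \<and> q \<le> Y" if "i \<in> {1..k}" "q \<in> S i" for i q
      using SY[OF that] S(1) that unfolding prime_blocks_def by blast
    show "S i \<inter> S j = {}" if "i \<in> {1..k}" "j \<in> {1..k}" "i \<noteq> j" for i j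
      using S(1) that unfolding prime_blocks_def by blast
  qed
  then obtain p where p: "prime p" "\<And>i. i \<in> {1..k} \<Longrightarrow> \<exists>r. f (p + i) = f (1 + i) * prod f (S i) * r \<and> (1 - \<eta>) ^ R \<le> r \<and> r \<le> (1 + \<eta>) ^ R"
    by blast
  have "\<bar>f (p + i) - x i\<bar> < \<epsilon>" if i: "i \<in> {1..k}" for i
  proof -
    define v where "v = f (1 + i) * prod f (S i)"
    obtain r where r: "f (p + i) = v * r" "(1 - \<eta>) ^ R \<le> r" "r \<le> (1 + \<eta>) ^ R" using p(2)[OF i] by (auto simp: v_def)
    have r0: "0 \<le> r" using r(2) \<eta>(2) zero_le_power[of "1 - \<eta>" R] by linarith
    have "1 - \<eta> \<le> 1 / (1 + \<eta>)" using \<eta>(1) by (simp add: field_simps)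
    then have "x i * (1 - \<eta>) \<le> x i * (1 / (1 + \<eta>))" using x[OF i] by (intro mult_left_mono) auto
    also have "\<dots> \<le> v" using S(2)[OF i] by (simp add: v_def)
    finally have v: "x i * (1 - \<eta>) \<le> v" "v \<le> x i * (1 + \<eta>)" using S(2)[OF i] by (auto simp: v_def)
    have v0: "0 \<le> x i * (1 - \<eta>)" "0 \<le> x i * (1 + \<eta>)" using x[OF i] \<eta> by auto
    have "(x i * (1 - \<eta>)) * (1 - \<eta>) ^ R \<le> v * r" using v v0 r \<eta>(2) by (intro mult_mono) auto
    moreover have "v * r \<le> (x i * (1 + \<eta>)) * (1 + \<eta>) ^ R" using v v0 r r0 by (intro mult_mono) auto
    ultimately show ?thesis using \<eta>(3)[OF i] unfolding r(1) by (simp add: mult.assoc abs_less_iff)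
  qed
  then show ?thesis using p(1) by blast
qed

theorem theorem1p1:
  fixes f :: "nat \<Rightarrow> real" and k :: nat
  assumes "k \<ge> 1"
    and "\<And>n. n > 0 \<Longrightarrow> f n > 0"
    and "multiplicative_fun f"
    and "\<not> ((\<lambda>p. \<bar>f p - 1\<bar>) summable_on {p. prime p})"
    and "\<forall>\<epsilon>>0. \<exists>N. \<forall>p. prime p \<and> p \<ge> N \<longrightarrow> \<bar>f p - 1\<bar> < \<epsilon>"
  shows "\<exists>c>0. tuples_dense_in_cube k {(\<lambda>i. f (p + i)) | p. prime p} {0..c}
             \<or> tuples_dense_in_cube k {(\<lambda>i. f (p + i)) | p. prime p} {c..}"
proof -
  define B where "B = (\<lambda>i. f (1 + i)) ` {1..k}"
  have B: "finite B" "B \<noteq> {}" "\<And>b. b \<in> B \<Longrightarrow> 0 < b" using assms(1,2) by (auto simp: B_def)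
  have memB: "f (1 + i) \<in> B" if "i \<in> {1..k}" for i using that by (simp add: B_def)
  have "(\<lambda>p. \<bar>f p - 1\<bar>) = (\<lambda>p. max 0 (f p - 1) + max 0 (1 - f p))" by auto
  \<comment> \<open>Split \<open>f p - 1\<close> into positive and negative parts; if both series
    converged, so would the series of absolute values.\<close>
  then consider (up) "\<not> (\<lambda>p. max 0 (f p - 1)) summable_on {p. prime p}"
    | (down) "\<not> (\<lambda>p. max 0 (1 - f p)) summable_on {p. prime p}"
    using assms(4) summable_on_add[of "\<lambda>p. max 0 (f p - 1)" "{p. prime p}" "\<lambda>p. max 0 (1 - f p)"] by auto
  then show ?thesis
  proof cases
    case up
    \<comment> \<open>Products of values above 1 can only raise \<open>f (1 + i)\<close>, so all
      targets must lie above the largest of these starting values.\<close>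
    define c where "c = Max B"
    have c: "0 < c" "\<And>b. b \<in> B \<Longrightarrow> b \<le> c" using B by (auto simp: c_def Max_gr_iff)
    have lim: "\<exists>N. \<forall>p. prime p \<and> N \<le> p \<longrightarrow> f p \<le> 1 + \<epsilon>" if "0 < \<epsilon>" for \<epsilon>
      using assms(5) that by (smt (verit))
    have "tuples_dense_in_cube k {(\<lambda>i. f (p + i)) | p. prime p} {c..}"
      unfolding tuples_dense_in_cube_def
    proof (intro allI impI)
      fix x \<epsilon> assume x: "\<forall>i\<in>{1..k}. x i \<in> {c..}" and \<epsilon>: "(0::real) < \<epsilon>"
      have b: "0 < f (1 + i)" "f (1 + i) \<le> x i" if "i \<in> {1..k}" for i
        using that x c(2)[OF memB[OF that]] B(3)[OF memB[OF that]] by fastforce+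
      have "\<exists>p. prime p \<and> (\<forall>i\<in>{1..k}. \<bar>f (p + i) - x i\<bar> < \<epsilon>)"
      proof (rule shifted_prime_approx[OF assms(1,3,5) _ \<epsilon>])
        show "0 < x i" if "i \<in> {1..k}" for i using b[OF that] by linarith
        fix \<eta> :: real and Y assume \<eta>: "0 < \<eta>"
        have "\<exists>S. prime_blocks k Y S \<and> (\<forall>i\<in>{1..k}. x i / f (1 + i) \<le> prod f (S i) \<and> prod f (S i) \<le> x i / f (1 + i) * (1 + \<eta>))"
          by (rule divergent_disjoint_subproducts[OF up lim \<eta>]) (use b in simp_all)
        then obtain S where S: "prime_blocks k Y S"
          "\<And>i. i \<in> {1..k} \<Longrightarrow> x i / f (1 + i) \<le> prod f (S i) \<and> prod f (S i) \<le> x i / f (1 + i) * (1 + \<eta>)" by blast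
        have "x i / (1 + \<eta>) \<le> f (1 + i) * prod f (S i) \<and> f (1 + i) * prod f (S i) \<le> x i * (1 + \<eta>)" if i: "i \<in> {1..k}" for i
        proof
          have "x i / (1 + \<eta>) \<le> x i" using b[OF i] \<eta> by (simp add: divide_le_eq mult_le_cancel_left1)
          also have "x i \<le> f (1 + i) * prod f (S i)" using S(2)[OF i] b[OF i] by (simp add: field_simps)
          finally show "x i / (1 + \<eta>) \<le> f (1 + i) * prod f (S i)" .
          show "f (1 + i) * prod f (S i) \<le> x i * (1 + \<eta>)" using S(2)[OF i] b[OF i] by (simp add: field_simps)
        qed
        then show "\<exists>S. prime_blocks k Y S \<and> (\<forall>i\<in>{1..k}. x i / (1 + \<eta>) \<le> f (1 + i) * prod f (S i) \<and> f (1 + i) * prod f (S i) \<le> x i * (1 + \<eta>))"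
          using S(1) by blast
      qed
      then obtain p where p: "prime p" "\<forall>i\<in>{1..k}. \<bar>f (p + i) - x i\<bar> < \<epsilon>" by blast
      have "(\<lambda>i. f (p + i)) \<in> {(\<lambda>i. f (p + i)) | p. prime p}" using p(1) by blast
      then show "\<exists>t\<in>{(\<lambda>i. f (p + i)) | p. prime p}. \<forall>i\<in>{1..k}. \<bar>t i - x i\<bar> < \<epsilon>" 
        by (rule bexI[where x = "\<lambda>i. f (p + i)", rotated]) (use p(2) in simp)
    qed
    then show ?thesis using c(1) by blast
  next
    case down
    \<comment> \<open>Values below 1 only lower \<open>f (1 + i)\<close>; the smallest starting
      value bounds the reachable cube.\<close>
    define c where "c = Min B"
    have c: "0 < c" "\<And>b. b \<in> B \<Longrightarrow> c \<le> b" using B by (auto simp: c_def Min_gr_iff)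
    define u where "u p = 1 / f p" for p
    have fp: "0 < f p" if "prime p" for p using assms(2) that prime_gt_0_nat by blast
    have div: "\<not> (\<lambda>p. max 0 (u p - 1)) summable_on {p. prime p}"
    proof
      assume "(\<lambda>p. max 0 (u p - 1)) summable_on {p. prime p}"
      then have "(\<lambda>p. max 0 (1 - f p)) summable_on {p. prime p}"
      proof (rule summable_on_comparison_test)
        fix p :: nat assume "p \<in> {p. prime p}"
        then have p: "0 < f p" using fp by simp
        \<comment> \<open>This square gives \<open>2 - f p \<le> 1 / f p\<close>, so divergence
          passes from \<open>1 - f p\<close> to the excess of \<open>1 / f p\<close>.\<close>
        have "0 \<le> (f p - 1) ^ 2" by simp
        then have "1 - f p \<le> u p - 1" using p by (simp add: u_def field_simps power2_eq_square)
        then show "max 0 (1 - f p) \<le> max 0 (u p - 1)" by simp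
      qed simp
      then show False using down by blast
    qed
    have lim: "\<exists>N. \<forall>p. prime p \<and> N \<le> p \<longrightarrow> u p \<le> 1 + \<epsilon>" if \<epsilon>: "0 < \<epsilon>" for \<epsilon>
    proof -
      have "0 < \<epsilon> / (1 + \<epsilon>)" using \<epsilon> by simp
      then obtain N where N: "\<And>p. prime p \<Longrightarrow> N \<le> p \<Longrightarrow> \<bar>f p - 1\<bar> < \<epsilon> / (1 + \<epsilon>)" using assms(5) by blast
      have "u p \<le> 1 + \<epsilon>" if "prime p" "N \<le> p" for p
      proof -
        have "1 - \<epsilon> / (1 + \<epsilon>) \<le> f p" using N[OF that] by linarith
        moreover have "1 - \<epsilon> / (1 + \<epsilon>) = 1 / (1 + \<epsilon>)" using \<epsilon> by (simp add: field_simps)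
        ultimately show ?thesis using fp[OF that(1)] \<epsilon> by (simp add: u_def field_simps)
      qed
      then show ?thesis by blast
    qed
    have "tuples_dense_in_cube k {(\<lambda>i. f (p + i)) | p. prime p} {0..c}"
      unfolding tuples_dense_in_cube_def
    proof (intro allI impI)
      fix x0 \<epsilon> assume x0: "\<forall>i\<in>{1..k}. x0 i \<in> {0..c}" and \<epsilon>: "(0::real) < \<epsilon>"
      \<comment> \<open>Coordinates near 0 are moved up by at most \<open>\<epsilon> / 2\<close>,
        since a target 0 cannot be met with multiplicative accuracy; the minimum with
        \<open>c\<close> keeps them inside the cube.\<close>
      define x where "x i = max (x0 i) (min c (\<epsilon> / 2))" for i
      have b: "0 < x i" "x i \<le> f (1 + i)" "\<bar>x i - x0 i\<bar> \<le> \<epsilon> / 2" if "i \<in> {1..k}" for i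
      proof -
        have "0 \<le> x0 i" "x0 i \<le> c" "c \<le> f (1 + i)" using that x0 c(2)[OF memB[OF that]] by auto
        then show "0 < x i" "x i \<le> f (1 + i)" "\<bar>x i - x0 i\<bar> \<le> \<epsilon> / 2"
          using c(1) \<epsilon> unfolding x_def by linarith+
      qed
      have "\<exists>p. prime p \<and> (\<forall>i\<in>{1..k}. \<bar>f (p + i) - x i\<bar> < \<epsilon> / 2)"
      proof (rule shifted_prime_approx[OF assms(1,3,5)])
        show "0 < \<epsilon> / 2" using \<epsilon> by simp
        show "0 < x i" if "i \<in> {1..k}" for i using b[OF that] by linarith
        fix \<eta> :: real and Y assume \<eta>: "0 < \<eta>"
        have "\<exists>S. prime_blocks k Y S \<and> (\<forall>i\<in>{1..k}. f (1 + i) / x i \<le> prod u (S i) \<and> prod u (S i) \<le> f (1 + i) / x i * (1 + \<eta>))"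
          by (rule divergent_disjoint_subproducts[OF div lim \<eta>]) (use b in simp_all)
        then obtain S where S: "prime_blocks k Y S"
          "\<And>i. i \<in> {1..k} \<Longrightarrow> f (1 + i) / x i \<le> prod u (S i) \<and> prod u (S i) \<le> f (1 + i) / x i * (1 + \<eta>)" by blast
        have "x i / (1 + \<eta>) \<le> f (1 + i) * prod f (S i) \<and> f (1 + i) * prod f (S i) \<le> x i * (1 + \<eta>)" if i: "i \<in> {1..k}" for i
        proof
          define P where "P = prod f (S i)"
          have P: "0 < P" unfolding P_def using S(1) i fp by (intro prod_pos) (auto simp: prime_blocks_def)
          have uP: "prod u (S i) = 1 / P" by (simp add: u_def P_def prod_dividef)
          show "x i / (1 + \<eta>) \<le> f (1 + i) * prod f (S i)"
            using S(2)[OF i] b[OF i] P \<eta> unfolding uP P_def[symmetric] by (simp add: field_simps)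
          have "f (1 + i) * P \<le> x i" using S(2)[OF i] b[OF i] P unfolding uP by (simp add: field_simps)
          also have "x i \<le> x i * (1 + \<eta>)" using b[OF i] \<eta> by (simp add: mult_le_cancel_left1)
          finally show "f (1 + i) * prod f (S i) \<le> x i * (1 + \<eta>)" by (simp add: P_def)
        qed
        then show "\<exists>S. prime_blocks k Y S \<and> (\<forall>i\<in>{1..k}. x i / (1 + \<eta>) \<le> f (1 + i) * prod f (S i) \<and> f (1 + i) * prod f (S i) \<le> x i * (1 + \<eta>))"
          using S(1) by blast
      qed
      then obtain p where p: "prime p" "\<And>i. i \<in> {1..k} \<Longrightarrow> \<bar>f (p + i) - x i\<bar> < \<epsilon> / 2" by blast
      have "\<bar>f (p + i) - x0 i\<bar> < \<epsilon>" if "i \<in> {1..k}" for i using p(2)[OF that] b(3)[OF that] by linarith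
      then have close: "\<forall>i\<in>{1..k}. \<bar>f (p + i) - x0 i\<bar> < \<epsilon>" by blast
      have "(\<lambda>i. f (p + i)) \<in> {(\<lambda>i. f (p + i)) | p. prime p}" using p(1) by blast
      then show "\<exists>t\<in>{(\<lambda>i. f (p + i)) | p. prime p}. \<forall>i\<in>{1..k}. \<bar>t i - x0 i\<bar> < \<epsilon>" 
        by (rule bexI[where x = "\<lambda>i. f (p + i)", rotated]) (use close in simp)
    qed
    then show ?thesis using c(1) by blast
  qed
qed

end
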